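(* Let $n\ge1$, $L>0$ and $L_1,\dots,L_n>0$. Let $\mathcal Z_{N+3,n}(L;L_1,\dots,L_n)$ be the volume of planar Strebel graphs with $N+3+n$ labelled faces, of which $N+3$ have perimeter $L$ and $n$ have perimeters $L_1,\dots,L_n$ (defined in the context), and let $$\hat{\mathcal Z}_n(\mu,L;L_1,\dots,L_n)=\sum_{N\ge0}\frac{\mu^{N+3}}{(N+3)!}\,\mathcal Z_{N+3,n}(L;L_1,\dots,L_n).$$ Let $u=u(\mu L^2)$ be the solution of $\mu L^2=u^2/I_0(u)$ vanishing at $\mu=0$. Then, as formal power series in $\mu$, $$\hat{\mathcal Z}_n(\mu,L;L_1,\dots,L_n)=\partial_\mu^{\,n-3}\left(\mu^nL^{2n}\left[\frac{1}{u^{2n}}\,\frac{I_0(u)^4}{2I_0(u)-u\,I_1(u)}\prod_{i=1}^nI_0\!\left(\frac{uL_i}{L}\right)\right]_+\right),$$ where $[\,\cdot\,]_+$ means keeping only the nonnegative powers of $\mu L^2$ in the Laurent expansion in $\mu L^2$.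
   Context: For $k\ge 3$ let $\overline{\mathcal M}_{0,k}$ be the (compactified) moduli space of genus $0$ curves with $k$ labelled marked points and $\psi_i$ the first Chern class of the cotangent line bundle at the $i$-th marked point. For $M\ge0$ and perimeters $P_1,\dots,P_{M+3}$ set $$\mathcal Z_{M+3}(P_1,\dots,P_{M+3})=\frac{1}{M!\,2^{2M+1}}\int_{\overline{\mathcal M}_{0,M+3}}\Big(\sum_{i=1}^{M+3}P_i^2\psi_i\Big)^M$$ (by a theorem of Kontsevich this is the volume, for the Lebesgue measure on edge lengths constrained by the perimeters, of planar trivalent metric ribbon graphs with $M+3$ labelled faces of perimeters $P_i$). Then $$\mathcal Z_{N+3,n}(L;L_1,\dots,L_n)=\mathcal Z_{N+3+n}(\underbrace{L,\dots,L}_{N+3},L_1,\dots,L_n).$$ $I_k(z)=\sum_{j\ge0}\frac{(z/2)^{2j+k}}{j!\,(j+k)!}$ is the modified Bessel function of the first kind. The quantity $u$ is defined by: $w=u^2$ is the unique formal power series in $s=\mu L^2$ with zero constant term satisfying $w=s\,I_0(\sqrt w)$; all expressions considered are even in $u$, hence Laurent series in $\mu$. For $n<3$, $\partial_\mu^{\,n-3}$ denotes the $(3-n)$-fold formal antiderivative in $\mu$ with zero integration constants, i.e. $\partial_\mu^{-k}\mu^m=\frac{m!}{(m+k)!}\mu^{m+k}$. *)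

theory Defs
  imports
    "HOL-Analysis.Analysis"
    "HOL-Combinatorics.Orbits"
    "HOL-Computational_Algebra.Formal_Laurent_Series"
begin

section \<open>Planar trivalent ribbon graphs with labelled faces\<close>

text \<open>
  A ribbon graph is a finite set \<open>D\<close> of darts (oriented half-edges) with a permutation \<open>\<sigma>\<close> turning
  to the next dart around its vertex and a permutation \<open>\<alpha>\<close> swapping the two darts of an edge.
  Vertices, edges and faces are the cycles of \<open>\<sigma>\<close>, \<open>\<alpha>\<close> and \<open>\<sigma> \<circ> \<alpha>\<close>.
\<close>

definition cycles_of :: "'a set \<Rightarrow> ('a \<Rightarrow> 'a) \<Rightarrow> 'a set set" where
  "cycles_of D p = orbit p ` D"

definition planar_trivalent_map :: "'a set \<Rightarrow> ('a \<Rightarrow> 'a) \<Rightarrow> ('a \<Rightarrow> 'a) \<Rightarrow> bool" where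
  "planar_trivalent_map D \<sigma> \<alpha> \<longleftrightarrow>
     finite D \<and> \<sigma> permutes D \<and> \<alpha> permutes D \<and>
     (\<forall>v \<in> cycles_of D \<sigma>. card v = 3) \<and>
     (\<forall>e \<in> cycles_of D \<alpha>. card e = 2) \<and>
     (\<forall>d \<in> D. \<forall>d' \<in> D. (d, d') \<in> (range (\<lambda>x. (x, \<sigma> x)) \<union> range (\<lambda>x. (x, \<alpha> x)))\<^sup>*) \<and>
     int (card (cycles_of D \<sigma>)) - int (card (cycles_of D \<alpha>))
       + int (card (cycles_of D (\<sigma> \<circ> \<alpha>))) = 2"

definition face_labelling ::
    "'a set \<Rightarrow> ('a \<Rightarrow> 'a) \<Rightarrow> ('a \<Rightarrow> 'a) \<Rightarrow> nat \<Rightarrow> ('a \<Rightarrow> nat) \<Rightarrow> bool" where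
  "face_labelling D \<sigma> \<alpha> k lab \<longleftrightarrow>
     lab \<in> D \<rightarrow>\<^sub>E {1..k} \<and> lab ` D = {1..k} \<and>
     (\<forall>d \<in> D. \<forall>d' \<in> D. lab d = lab d' \<longleftrightarrow> d' \<in> orbit (\<sigma> \<circ> \<alpha>) d)"

text \<open>
  By Euler's formula a planar trivalent graph with \<open>M + 3\<close> faces has \<open>3 * M + 3\<close> edges,
  hence \<open>6 * M + 6\<close> darts.
\<close>

definition strebel_graphs :: "nat \<Rightarrow> ((nat \<Rightarrow> nat) \<times> (nat \<Rightarrow> nat) \<times> (nat \<Rightarrow> nat)) set" where
  "strebel_graphs M = {(\<sigma>, \<alpha>, lab).
     planar_trivalent_map {..<6 * M + 6} \<sigma> \<alpha> \<and>
     face_labelling {..<6 * M + 6} \<sigma> \<alpha> (M + 3) lab}"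

section \<open>The volume with prescribed perimeters\<close>

text \<open>An edge both of whose darts lie on the same face contributes twice to its perimeter.\<close>

definition perimeter ::
    "'a set \<Rightarrow> ('a \<Rightarrow> 'a) \<Rightarrow> ('a \<Rightarrow> nat) \<Rightarrow> ('a set \<Rightarrow> real) \<Rightarrow> nat \<Rightarrow> real" where
  "perimeter D \<alpha> lab len i = (\<Sum>d \<in> {d \<in> D. lab d = i}. len (orbit \<alpha> d))"

definition window_volume ::
    "'a set \<Rightarrow> ('a \<Rightarrow> 'a) \<Rightarrow> ('a \<Rightarrow> nat) \<Rightarrow> nat \<Rightarrow> (nat \<Rightarrow> real) \<Rightarrow> real \<Rightarrow> real" where
  "window_volume D \<alpha> lab k P \<epsilon> =
     (let Leb = Pi\<^sub>M (cycles_of D \<alpha>) (\<lambda>_. lborel)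
      in measure Leb {len \<in> space Leb. (\<forall>e \<in> cycles_of D \<alpha>. len e > 0) \<and>
           (\<forall>i \<in> {1..k}. \<bar>perimeter D \<alpha> lab len i - P i\<bar> < \<epsilon>)})"

text \<open>
  The volume \<open>\<Z>(P\<^sub>1, \<dots>, P\<^bsub>M+3\<^esub>)\<close>: the sum over graphs up to isomorphism, weighted by
  \<open>1 / |Aut|\<close>, of the integral of \<open>\<Prod>\<^sub>e d len\<^sub>e \<Prod>\<^sub>i \<delta>(perimeter\<^sub>i - P\<^sub>i)\<close>, with each delta
  function read as the limit of normalised indicators of \<open>(-\<epsilon>, \<epsilon>)\<close>.  An isomorphism class has
  \<open>(6 * M + 6)! / |Aut|\<close> representatives on the dart set \<open>{..<6 * M + 6}\<close>, whence the factorial.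

  With this normalisation Kontsevich's theorem says that the volume is
  \<open>1 / (M! * 2 ^ (2 * M + 1))\<close> times the integral of \<open>(\<Sum>\<^sub>i P\<^sub>i\<^sup>2 \<psi>\<^sub>i) ^ M\<close> over the compactified
  moduli space of genus 0 curves with \<open>M + 3\<close> marked points.  Taking the limit of the sum over
  all graphs makes this hold for all positive perimeters, also on walls where individual graphs
  have discontinuous volume.
\<close>

definition strebel_volume :: "nat \<Rightarrow> (nat \<Rightarrow> real) \<Rightarrow> real" where
  "strebel_volume M P =
     Lim (at_right 0) (\<lambda>\<epsilon>.
       (\<Sum>(\<sigma>, \<alpha>, lab) \<in> strebel_graphs M. window_volume {..<6 * M + 6} \<alpha> lab (M + 3) P \<epsilon>)
         / fact (6 * M + 6) / (2 * \<epsilon>) ^ (M + 3))"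

definition strebel_Z :: "nat \<Rightarrow> nat \<Rightarrow> real \<Rightarrow> (nat \<Rightarrow> real) \<Rightarrow> real" where
  "strebel_Z N n L Ls =
     strebel_volume (N + n) (\<lambda>i. if i \<le> N + 3 then L else Ls (i - (N + 3)))"

definition strebel_Z_hat :: "nat \<Rightarrow> real \<Rightarrow> (nat \<Rightarrow> real) \<Rightarrow> real fps" where
  "strebel_Z_hat n L Ls =
     Abs_fps (\<lambda>m. if m < 3 then 0 else strebel_Z (m - 3) n L Ls / fact m)"

section \<open>Bessel series and formal calculus\<close>

definition bessel_I :: "nat \<Rightarrow> real fps" where
  "bessel_I k = Abs_fps (\<lambda>m. if k \<le> m \<and> even (m - k)
     then (1 / 2) ^ m / (fact ((m - k) div 2) * fact ((m - k) div 2 + k)) else 0)"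

text \<open>For an even series \<open>F(u)\<close>, the series \<open>F(\<surd>w)\<close> in \<open>w\<close>.\<close>

definition fps_at_sqrt :: "real fps \<Rightarrow> real fps" where
  "fps_at_sqrt F = Abs_fps (\<lambda>j. F $ (2 * j))"

text \<open>The series \<open>w = u\<^sup>2\<close> in the variable \<open>s = \<mu> L\<^sup>2\<close>.\<close>

definition u_squared :: "real fps" where
  "u_squared = (THE w. w $ 0 = 0 \<and> w = fps_X * (fps_at_sqrt (bessel_I 0) oo w))"

lemma u_squared_unique:
  "\<exists>!w :: real fps. w $ 0 = 0 \<and> w = fps_X * (fps_at_sqrt (bessel_I 0) oo w)"
proof -
  let ?I = "fps_at_sqrt (bessel_I 0)"
  let ?g = "fps_X * inverse ?I"
  have I0: "?I $ 0 = 1"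
    by (simp add: fps_at_sqrt_def bessel_I_def)
  have eq: "w = fps_X * (?I oo w) \<longleftrightarrow> ?g oo w = fps_X" if w: "w $ 0 = 0" for w :: "real fps"
  proof -
    have nz: "(?I oo w) $ 0 \<noteq> 0" using I0 w by simp
    have "?g oo w = w * inverse (?I oo w)"
      using w I0 by (simp add: fps_compose_mult_distrib fps_inverse_compose)
    moreover have one: "inverse (?I oo w) * (?I oo w) = 1"
      using nz by (rule inverse_mult_eq_1)
    moreover have "w * inverse (?I oo w) = fps_X \<longleftrightarrow> w = fps_X * (?I oo w)"
    proof
      assume "w * inverse (?I oo w) = fps_X"
      then have "fps_X * (?I oo w) = w * (inverse (?I oo w) * (?I oo w))"
        by (simp only: mult.assoc [symmetric])
      then show "w = fps_X * (?I oo w)" unfolding one by simp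
    next
      assume "w = fps_X * (?I oo w)"
      then have "w * inverse (?I oo w) = fps_X * (?I oo w) * inverse (?I oo w)"
        by (rule arg_cong)
      also have "\<dots> = fps_X * (inverse (?I oo w) * (?I oo w))"
        by (simp only: mult.assoc mult.commute [of "?I oo w"])
      finally show "w * inverse (?I oo w) = fps_X" unfolding one by simp
    qed
    ultimately show ?thesis by metis
  qed
  have g0: "?g $ 0 = 0" by simp
  have g1: "?g $ 1 \<noteq> 0" using I0 by simp
  show ?thesis
  proof (rule ex1I[of _ "fps_inv ?g"])
    have 0: "fps_inv ?g $ 0 = 0" by (simp add: fps_inv_def)
    show "fps_inv ?g $ 0 = 0 \<and> fps_inv ?g = fps_X * (?I oo fps_inv ?g)"
      using eq[OF 0] fps_inv_right[OF g0 g1] 0 by blast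
  next
    fix w :: "real fps"
    assume w: "w $ 0 = 0 \<and> w = fps_X * (?I oo w)"
    then have "?g oo w = fps_X" using eq by blast
    then have "fps_inv ?g oo (?g oo w) = fps_inv ?g" by simp
    moreover have "fps_inv ?g oo (?g oo w) = (fps_inv ?g oo ?g) oo w"
      using w g0 by (simp add: fps_compose_assoc)
    ultimately show "w = fps_inv ?g"
      using fps_inv[OF g0 g1] w by simp
  qed
qed

text \<open>The series in \<open>u\<close> inside the bracket, without its factor \<open>1 / u ^ (2 * n)\<close>.\<close>

definition bracket_numerator :: "nat \<Rightarrow> real \<Rightarrow> (nat \<Rightarrow> real) \<Rightarrow> real fps" where
  "bracket_numerator n L Ls =
     bessel_I 0 ^ 4 / (2 * bessel_I 0 - fps_X * bessel_I 1)
       * (\<Prod>i = 1..n. bessel_I 0 oo (fps_const (Ls i / L) * fps_X))"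

lemma bracket_numerator_even:
  assumes "odd m"
  shows "bracket_numerator n L Ls $ m = 0"
proof -
  define ev :: "real fps \<Rightarrow> bool" where "ev F \<longleftrightarrow> F oo (- fps_X) = F" for F
  have evI: "ev F" if "\<And>m. odd m \<Longrightarrow> F $ m = 0" for F :: "real fps"
    unfolding ev_def fps_eq_iff using that by (auto simp: fps_compose_uminus' minus_one_power_iff)
  have evD: "F $ m = 0" if "ev F" "odd m" for F :: "real fps" and m
  proof -
    have "(F oo (- fps_X)) $ m = F $ m" using that(1) by (simp add: ev_def)
    then show ?thesis using that(2) by (simp add: fps_compose_uminus')
  qed
  have mult: "ev (F * G)" if "ev F" "ev G" for F G
    using that by (simp add: ev_def fps_compose_mult_distrib)
  have inv: "ev (inverse F)" if "ev F" "F $ 0 \<noteq> 0" for F :: "real fps"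
    using that by (simp add: ev_def fps_inverse_compose)
  have B: "ev (bessel_I 0)" by (rule evI) (simp add: bessel_I_def)
  have B4: "ev (bessel_I 0 ^ 4)"
    using mult[OF mult[OF B B] mult[OF B B]] by (simp add: power4_eq_xxxx mult.assoc)
  have Dn: "ev (2 * bessel_I 0 - fps_X * bessel_I 1)"
    by (rule evI) (auto simp: bessel_I_def numeral_fps_const)
  have D0: "(2 * bessel_I 0 - fps_X * bessel_I 1) $ 0 \<noteq> 0"
    by (simp add: bessel_I_def numeral_fps_const)
  have P: "ev (\<Prod>i\<in>A. bessel_I 0 oo (fps_const (Ls i / L) * fps_X))" if "finite A" for A
    using that
  proof (induction A rule: finite_induct)
    case empty
    show ?case by (simp add: ev_def)
  next
    case (insert a A)
    have "ev (bessel_I 0 oo (fps_const (Ls a / L) * fps_X))"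
      by (rule evI) (simp add: bessel_I_def fps_compose_linear)
    with insert show ?case by (simp add: mult)
  qed
  have "ev (bracket_numerator n L Ls)"
    unfolding bracket_numerator_def fps_divide_unit[OF D0]
    by (intro mult inv B4 Dn D0 P) simp
  from evD[OF this assms] show ?thesis .
qed

definition bracket :: "nat \<Rightarrow> real \<Rightarrow> (nat \<Rightarrow> real) \<Rightarrow> real fls" where
  "bracket n L Ls =
     fps_to_fls (fps_at_sqrt (bracket_numerator n L Ls) oo u_squared) / fps_to_fls u_squared ^ n"

text \<open>Derivative of integer order; for negative orders, iterated antiderivatives without constants.\<close>

definition fps_deriv_int :: "int \<Rightarrow> real fps \<Rightarrow> real fps" where
  "fps_deriv_int k f =
     (if k \<ge> 0 then (fps_deriv ^^ nat k) f else ((\<lambda>g. fps_integral0 g) ^^ nat (- k)) f)"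

end

theory Submission
  imports Defs "HOL-Probability.Distributions"
begin

text \<open>
  The Laplace transform in the perimeters turns the volume of a ribbon graph into the product over its
  edges of \<open>1 / (\<lambda>\<^sub>i + \<lambda>\<^sub>j)\<close>, where \<open>i\<close> and \<open>j\<close> are the faces along the edge, so that one has to
  evaluate sums over planar trivalent maps with these edge weights.  Differentiating in \<open>\<lambda>\<^sub>x\<close> marks
  an edge of the face \<open>x\<close> or, equivalently, attaches a leaf there.  Removing the leaf together with its
  root vertex either disconnects the map or merges two faces; in the second case the sum over the
  possible positions telescopes along the root face.  This gives a loop equation, by which the sums are
  \<open>\<Prod>\<^sub>i 1 / \<lambda>\<^sub>i\<close> times homogeneous polynomials in the \<open>1 / \<lambda>\<^sub>i\<^sup>2\<close> of degree smaller than the number of faces.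
  Such a polynomial is determined by its restrictions to the coordinate hyperplanes, which are
  evaluated by the string equation.  Inverting the Laplace transform (a moment problem on a cube in
  the variables \<open>exp (- P\<^sub>i)\<close>) expresses the volume through a coefficient of a product of Bessel series,
  and Lagrange inversion identifies these coefficients with those of the bracket.
\<close>

section \<open>Trivalent maps with leaves\<close>

text \<open>The volume of a single graph is only piecewise polynomial in the perimeters, and its
  Laplace transform has poles along \<open>lam i + lam j = 0\<close>. These cancel only in the sum
  over all graphs, so the recursion has to act on the whole sum. Darts are named, so that a sum over
  maps divided by the factorial of the number of darts weights every isomorphism class by
  \<open>1 / |Aut|\<close>, and cutting a map becomes choosing a subset of darts or a list of
  removed darts. A leaf is a root without symmetries, and cutting at its vertex gives maps that are
  again rooted by leaves. Planarity is not carried through the surgery as Euler's equation. The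
  number of darts is fixed at its planar value for the given faces, and the inequality for maps with
  one leaf then forces every piece to be planar, because deficits could only add up. The loop
  equation also contains the map with two faces, which is not of the polynomial form; its pole is
  absorbed by the divided differences, and that is how even powers of \<open>1 / lam i\<close>
  arise.\<close>

text \<open>The fixed points \<open>U\<close> of \<open>\<sigma>\<close> are leaves, all other vertices are trivalent.\<close>

definition cubic :: "'a set \<Rightarrow> 'a set \<Rightarrow> ('a \<Rightarrow> 'a) \<Rightarrow> ('a \<Rightarrow> 'a) \<Rightarrow> bool" where
  "cubic D U \<sigma> \<alpha> \<longleftrightarrow> finite D \<and> U \<subseteq> D \<and>
     (\<forall>d. \<alpha> (\<alpha> d) = d) \<and> (\<forall>d. \<alpha> d \<noteq> d \<longleftrightarrow> d \<in> D) \<and>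
     (\<forall>d. \<sigma> (\<sigma> (\<sigma> d)) = d) \<and> (\<forall>d. \<sigma> d \<noteq> d \<longleftrightarrow> d \<in> D - U)"

definition map_closed :: "('a \<Rightarrow> 'a) \<Rightarrow> ('a \<Rightarrow> 'a) \<Rightarrow> 'a set \<Rightarrow> bool" where
  "map_closed \<sigma> \<alpha> A \<longleftrightarrow> (\<forall>d\<in>A. \<sigma> d \<in> A \<and> \<alpha> d \<in> A)"

text \<open>Connectedness is stated by closed sets instead of paths: both permutations have finite
  order, so closed sets are unions of components, and under surgery they are easier to follow than
  paths.\<close>

definition cubic_map :: "'a set \<Rightarrow> 'a set \<Rightarrow> ('a \<Rightarrow> 'a) \<Rightarrow> ('a \<Rightarrow> 'a) \<Rightarrow> bool" where
  "cubic_map D U \<sigma> \<alpha> \<longleftrightarrow> cubic D U \<sigma> \<alpha> \<and>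
     (\<forall>A. A \<subseteq> D \<and> A \<noteq> {} \<and> map_closed \<sigma> \<alpha> A \<longrightarrow> A = D)"

lemma cubicI:
  assumes "finite D" "U \<subseteq> D" "\<And>d. \<alpha> (\<alpha> d) = d" "\<And>d. \<alpha> d \<noteq> d \<longleftrightarrow> d \<in> D"
    "\<And>d. \<sigma> (\<sigma> (\<sigma> d)) = d" "\<And>d. \<sigma> d \<noteq> d \<longleftrightarrow> d \<in> D - U"
  shows "cubic D U \<sigma> \<alpha>"
  using assms by (simp add: cubic_def)

lemma cubicD:
  assumes "cubic D U \<sigma> \<alpha>"
  shows "finite D" "U \<subseteq> D" "\<alpha> (\<alpha> d) = d" "\<alpha> d \<noteq> d \<longleftrightarrow> d \<in> D"
    "\<sigma> (\<sigma> (\<sigma> d)) = d" "\<sigma> d \<noteq> d \<longleftrightarrow> d \<in> D - U"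
  using assms [unfolded cubic_def] by simp_all

lemma cubic_mapI:
  assumes "finite D" "U \<subseteq> D" "\<And>d. \<alpha> (\<alpha> d) = d" "\<And>d. \<alpha> d \<noteq> d \<longleftrightarrow> d \<in> D"
    "\<And>d. \<sigma> (\<sigma> (\<sigma> d)) = d" "\<And>d. \<sigma> d \<noteq> d \<longleftrightarrow> d \<in> D - U"
    "\<And>A. A \<subseteq> D \<Longrightarrow> A \<noteq> {} \<Longrightarrow> (\<And>d. d \<in> A \<Longrightarrow> \<sigma> d \<in> A \<and> \<alpha> d \<in> A) \<Longrightarrow> A = D"
  shows "cubic_map D U \<sigma> \<alpha>"
  unfolding cubic_map_def map_closed_def using assms by (intro conjI allI impI cubicI) blast+

lemma cubic_mapD:
  assumes "cubic_map D U \<sigma> \<alpha>"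
  shows "finite D" "U \<subseteq> D" "\<alpha> (\<alpha> d) = d" "\<alpha> d \<noteq> d \<longleftrightarrow> d \<in> D"
    "\<sigma> (\<sigma> (\<sigma> d)) = d" "\<sigma> d \<noteq> d \<longleftrightarrow> d \<in> D - U"
    "A \<subseteq> D \<Longrightarrow> A \<noteq> {} \<Longrightarrow> (\<And>d. d \<in> A \<Longrightarrow> \<sigma> d \<in> A \<and> \<alpha> d \<in> A) \<Longrightarrow> A = D"
proof -
  note M = assms [unfolded cubic_map_def cubic_def map_closed_def]
  show "finite D" "U \<subseteq> D" using M by simp_all
  show "\<alpha> (\<alpha> d) = d" "\<alpha> d \<noteq> d \<longleftrightarrow> d \<in> D" "\<sigma> (\<sigma> (\<sigma> d)) = d" "\<sigma> d \<noteq> d \<longleftrightarrow> d \<in> D - U"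
    using M by simp_all
  have "\<forall>A. A \<subseteq> D \<and> A \<noteq> {} \<and> (\<forall>d\<in>A. \<sigma> d \<in> A \<and> \<alpha> d \<in> A) \<longrightarrow> A = D" using M by simp
  then show "A \<subseteq> D \<Longrightarrow> A \<noteq> {} \<Longrightarrow> (\<And>d. d \<in> A \<Longrightarrow> \<sigma> d \<in> A \<and> \<alpha> d \<in> A) \<Longrightarrow> A = D" by blast
qed

lemma cubic_in:
  assumes "cubic D U \<sigma> \<alpha>"
  shows "\<alpha> d \<in> D \<longleftrightarrow> d \<in> D" "\<sigma> d \<in> D \<longleftrightarrow> d \<in> D" "\<alpha> d = \<alpha> d' \<longleftrightarrow> d = d'" "\<sigma> d = \<sigma> d' \<longleftrightarrow> d = d'"
    "d \<in> U \<Longrightarrow> \<sigma> d = d" "d \<notin> D \<Longrightarrow> \<sigma> d = d" "d \<notin> D \<Longrightarrow> \<alpha> d = d" "\<sigma> d \<in> U \<longleftrightarrow> d \<in> U"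
    "\<alpha> d = d' \<longleftrightarrow> d = \<alpha> d'"
proof -
  note D = cubicD[OF assms]
  show a: "\<alpha> d \<in> D \<longleftrightarrow> d \<in> D" and b: "\<alpha> d = \<alpha> d' \<longleftrightarrow> d = d'" and "\<alpha> d = d' \<longleftrightarrow> d = \<alpha> d'"
    and "d \<notin> D \<Longrightarrow> \<alpha> d = d"
    by (metis D(3,4))+
  show c: "d \<in> U \<Longrightarrow> \<sigma> d = d" "d \<notin> D \<Longrightarrow> \<sigma> d = d" for d using D(6) by auto
  show "\<sigma> d = \<sigma> d' \<longleftrightarrow> d = d'" by (metis D(5))
  show "\<sigma> d \<in> U \<longleftrightarrow> d \<in> U" by (metis D(5) c(1))
  show "\<sigma> d \<in> D \<longleftrightarrow> d \<in> D" by (metis D(5) c(2))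
qed

lemma cubic_map_cubic: "cubic_map D U \<sigma> \<alpha> \<Longrightarrow> cubic D U \<sigma> \<alpha>"
  by (simp add: cubic_map_def)

lemmas cubic_map_in = cubic_in [OF cubic_map_cubic]

text \<open>A leg: a new vertex with darts \<open>p\<close>, \<open>q\<close>, \<open>s\<close> subdivides the edge of \<open>k\<close> and carries an edge to
  the new leaf \<open>\<rho>\<close>.\<close>

definition leg_\<sigma> :: "('a \<Rightarrow> 'a) \<Rightarrow> 'a \<Rightarrow> 'a \<Rightarrow> 'a \<Rightarrow> 'a \<Rightarrow> 'a" where
  "leg_\<sigma> \<sigma> p q s = \<sigma>(p := s, s := q, q := p)"

definition leg_\<alpha> :: "('a \<Rightarrow> 'a) \<Rightarrow> 'a \<Rightarrow> 'a \<Rightarrow> 'a \<Rightarrow> 'a \<Rightarrow> 'a \<Rightarrow> 'a \<Rightarrow> 'a" where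
  "leg_\<alpha> \<alpha> k p q s \<rho> = \<alpha>(k := p, p := k, \<alpha> k := q, q := \<alpha> k, s := \<rho>, \<rho> := s)"

definition unleg_\<sigma> :: "('a \<Rightarrow> 'a) \<Rightarrow> 'a \<Rightarrow> 'a \<Rightarrow> 'a \<Rightarrow> 'a \<Rightarrow> 'a" where
  "unleg_\<sigma> \<sigma> p q s = \<sigma>(p := p, s := s, q := q)"

definition unleg_\<alpha> :: "('a \<Rightarrow> 'a) \<Rightarrow> 'a \<Rightarrow> 'a \<Rightarrow> 'a \<Rightarrow> 'a \<Rightarrow> 'a \<Rightarrow> 'a" where
  "unleg_\<alpha> \<alpha> p q s \<rho> = \<alpha>(\<alpha> p := \<alpha> q, \<alpha> q := \<alpha> p, p := p, q := q, s := s, \<rho> := \<rho>)"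

text \<open>Connectedness survives because the four new darts are linked with each other and with
  \<open>k\<close>. A nonempty closed set therefore meets \<open>D\<close>, and its trace on
  \<open>D\<close> is closed for the old permutations, the subdivided edge being bridged by
  \<open>p\<close> and \<open>q\<close>.\<close>

lemma cubic_map_leg:
  assumes M: "cubic_map D U \<sigma> \<alpha>" and k: "k \<in> D" and dist: "distinct [p, q, s, \<rho>]"
    and new: "{p, q, s, \<rho>} \<inter> D = {}"
  shows "cubic_map (D \<union> {p, q, s, \<rho>}) (insert \<rho> U) (leg_\<sigma> \<sigma> p q s) (leg_\<alpha> \<alpha> k p q s \<rho>)"
proof -
  note D = cubic_mapD[OF M] and I = cubic_map_in[OF M]
  have kk: "\<alpha> k \<noteq> k" "\<alpha> k \<in> D" using k D(4) I(1) by auto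
  have ne: "p \<noteq> q" "p \<noteq> s" "p \<noteq> \<rho>" "q \<noteq> s" "q \<noteq> \<rho>" "s \<noteq> \<rho>" "p \<notin> D" "q \<notin> D" "s \<notin> D" "\<rho> \<notin> D"
    using dist new by auto
  note ne' = ne ne(1-6)[symmetric]
  have ns: "d \<in> D \<Longrightarrow> d \<noteq> p \<and> d \<noteq> q \<and> d \<noteq> s \<and> d \<noteq> \<rho>" for d using ne by auto
  have nk: "k \<noteq> p" "k \<noteq> q" "k \<noteq> s" "k \<noteq> \<rho>" "\<alpha> k \<noteq> p" "\<alpha> k \<noteq> q" "\<alpha> k \<noteq> s" "\<alpha> k \<noteq> \<rho>"
    using ns[OF k] ns[OF kk(2)] by auto
  note nk' = nk nk[symmetric]
  show ?thesis
  proof (rule cubic_mapI)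
    show "finite (D \<union> {p, q, s, \<rho>})" using D(1) by simp
    show "insert \<rho> U \<subseteq> D \<union> {p, q, s, \<rho>}" using D(2) by auto
    show "leg_\<alpha> \<alpha> k p q s \<rho> (leg_\<alpha> \<alpha> k p q s \<rho> d) = d" for d
    proof (cases "d \<in> {k, \<alpha> k, p, q, s, \<rho>}")
      case True
      then show ?thesis using kk ne nk by (auto simp: leg_\<alpha>_def)
    next
      case False
      have "\<alpha> d \<noteq> k" "\<alpha> d \<noteq> \<alpha> k" using False I(9) D(3) by auto
      moreover have "\<alpha> d \<notin> {p, q, s, \<rho>}" using False I(1,7) ne by (metis insertCI insertE singletonD)
      ultimately show ?thesis using False D(3) by (auto simp: leg_\<alpha>_def)
    qed
    show "leg_\<alpha> \<alpha> k p q s \<rho> d \<noteq> d \<longleftrightarrow> d \<in> D \<union> {p, q, s, \<rho>}" for d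
      using kk k ne nk' D(4) by (auto simp: leg_\<alpha>_def)
    show "leg_\<sigma> \<sigma> p q s (leg_\<sigma> \<sigma> p q s (leg_\<sigma> \<sigma> p q s d)) = d" for d
    proof (cases "d \<in> {p, q, s}")
      case True
      then show ?thesis using ne by (auto simp: leg_\<sigma>_def)
    next
      case False
      have "\<sigma> d \<notin> {p, q, s} \<and> \<sigma> (\<sigma> d) \<notin> {p, q, s}" using False I(2,6) ne
        by (metis insertCI insertE singletonD)
      then show ?thesis using False D(5) by (auto simp: leg_\<sigma>_def)
    qed
    show "leg_\<sigma> \<sigma> p q s d \<noteq> d \<longleftrightarrow> d \<in> D \<union> {p, q, s, \<rho>} - insert \<rho> U" for d
      using ne D(2) D(6) by (auto simp: leg_\<sigma>_def)
    fix A assume A: "A \<subseteq> D \<union> {p, q, s, \<rho>}" "A \<noteq> {}"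
      "\<And>d. d \<in> A \<Longrightarrow> leg_\<sigma> \<sigma> p q s d \<in> A \<and> leg_\<alpha> \<alpha> k p q s \<rho> d \<in> A"
    have v: "leg_\<sigma> \<sigma> p q s p = s" "leg_\<sigma> \<sigma> p q s s = q" "leg_\<sigma> \<sigma> p q s q = p"
      "leg_\<alpha> \<alpha> k p q s \<rho> \<rho> = s" "leg_\<alpha> \<alpha> k p q s \<rho> s = \<rho>" "leg_\<alpha> \<alpha> k p q s \<rho> p = k"
      "leg_\<alpha> \<alpha> k p q s \<rho> k = p" "leg_\<alpha> \<alpha> k p q s \<rho> q = \<alpha> k" "leg_\<alpha> \<alpha> k p q s \<rho> (\<alpha> k) = q"
      using ne ne(1-6)[symmetric] nk nk[symmetric] kk(1) by (simp_all add: leg_\<alpha>_def leg_\<sigma>_def)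
    have a: "p \<in> A \<Longrightarrow> s \<in> A" "s \<in> A \<Longrightarrow> q \<in> A" "q \<in> A \<Longrightarrow> p \<in> A" "\<rho> \<in> A \<Longrightarrow> s \<in> A"
      "s \<in> A \<Longrightarrow> \<rho> \<in> A" "p \<in> A \<Longrightarrow> k \<in> A" "k \<in> A \<Longrightarrow> p \<in> A" "q \<in> A \<Longrightarrow> \<alpha> k \<in> A" "\<alpha> k \<in> A \<Longrightarrow> q \<in> A"
      using A(3) v by metis+
    have "A \<inter> D = D"
    proof (rule D(7))
      show "A \<inter> D \<subseteq> D" by simp
      obtain x where x: "x \<in> A" using A(2) by blast
      show "A \<inter> D \<noteq> {}"
      proof (cases "x \<in> D")
        case False
        then have "x \<in> {p, q, s, \<rho>}" using x A(1) by blast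
        then have "k \<in> A" using x a by blast
        then show ?thesis using k by blast
      qed (use x in blast)
      fix d assume d: "d \<in> A \<inter> D"
      have "\<sigma> d \<in> A" using A(3)[of d] d ns[of d] by (auto simp: leg_\<sigma>_def)
      moreover have "\<alpha> d \<in> A"
      proof (cases "d = k \<or> d = \<alpha> k")
        case True then show ?thesis using a d D(3) by (metis IntD1)
      next
        case False then show ?thesis using A(3)[of d] d ns[of d] by (auto simp: leg_\<alpha>_def)
      qed
      ultimately show "\<sigma> d \<in> A \<inter> D \<and> \<alpha> d \<in> A \<inter> D" using d I(1,2) by auto
    qed
    then have "k \<in> A" "D \<subseteq> A" using k by auto
    moreover from \<open>k \<in> A\<close> have "{p, q, s, \<rho>} \<subseteq> A" using a by blast
    ultimately show "A = D \<union> {p, q, s, \<rho>}" using A(1) by auto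
  qed
qed

text \<open>The hypotheses exclude the two shapes in which no edge is left to be healed: a leaf
  joined directly to a leaf, and a vertex whose other two darts form a loop.\<close>

lemma cubic_map_unleg:
  assumes M: "cubic_map D U \<sigma> \<alpha>" and \<rho>: "\<rho> \<in> U" and s: "s = \<alpha> \<rho>" "s \<notin> U"
    and q: "q = \<sigma> s" and p: "p = \<sigma> q" and pq: "\<alpha> p \<noteq> q"
  shows "distinct [p, q, s, \<rho>]" "{p, q, s, \<rho>} \<subseteq> D" "\<alpha> p \<in> D - {p, q, s, \<rho>}" "\<alpha> q \<in> D - {p, q, s, \<rho>}"
    and "cubic_map (D - {p, q, s, \<rho>}) (U - {\<rho>}) (unleg_\<sigma> \<sigma> p q s) (unleg_\<alpha> \<alpha> p q s \<rho>)"
    and "leg_\<sigma> (unleg_\<sigma> \<sigma> p q s) p q s = \<sigma>"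
    and "leg_\<alpha> (unleg_\<alpha> \<alpha> p q s \<rho>) (\<alpha> p) p q s \<rho> = \<alpha>"
    and "unleg_\<alpha> \<alpha> p q s \<rho> (\<alpha> p) = \<alpha> q"
proof -
  note D = cubic_mapD[OF M] and I = cubic_map_in[OF M]
  have \<rho>D: "\<rho> \<in> D" using \<rho> D(2) by auto
  have sD: "s \<in> D - U" using s \<rho>D I(1) by auto
  have qD: "q \<in> D - U" "p \<in> D - U" using sD q p I(2,8) by auto
  have sp: "\<sigma> p = s" using p q D(5) by simp
  have n1: "q \<noteq> s" "p \<noteq> q" "p \<noteq> s" using D(6)[of s] D(6)[of q] D(6)[of p] sD qD q p sp by auto
  have n2: "p \<noteq> \<rho>" "q \<noteq> \<rho>" "s \<noteq> \<rho>" using \<rho> sD qD by auto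
  show dist: "distinct [p, q, s, \<rho>]" using n1 n2 by auto
  show "{p, q, s, \<rho>} \<subseteq> D" using sD qD \<rho>D by auto
  have as: "\<alpha> s = \<rho>" "\<alpha> \<rho> = s" using s D(3) by auto
  have ap: "\<alpha> p \<in> D" "\<alpha> p \<noteq> p" "\<alpha> p \<noteq> q" "\<alpha> p \<noteq> s" "\<alpha> p \<noteq> \<rho>"
    using qD I(1) D(4)[of p] pq as n1 n2 I(9) by auto
  have aq: "\<alpha> q \<in> D" "\<alpha> q \<noteq> p" "\<alpha> q \<noteq> q" "\<alpha> q \<noteq> s" "\<alpha> q \<noteq> \<rho>"
    using qD I(1) D(4)[of q] pq as n1 n2 I(9) by auto
  show "\<alpha> p \<in> D - {p, q, s, \<rho>}" "\<alpha> q \<in> D - {p, q, s, \<rho>}" using ap aq by auto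
  have apq: "\<alpha> p \<noteq> \<alpha> q" using n1 I(3) by auto
  note ne = n1 n2 n1[symmetric] n2[symmetric] ap aq ap(2-5)[symmetric] aq(2-5)[symmetric] apq apq[symmetric]
  show "leg_\<sigma> (unleg_\<sigma> \<sigma> p q s) p q s = \<sigma>"
    using ne p q sp by (auto simp: fun_eq_iff leg_\<sigma>_def unleg_\<sigma>_def)
  show un: "unleg_\<alpha> \<alpha> p q s \<rho> (\<alpha> p) = \<alpha> q"
    using ne by (auto simp: unleg_\<alpha>_def)
  show "leg_\<alpha> (unleg_\<alpha> \<alpha> p q s \<rho>) (\<alpha> p) p q s \<rho> = \<alpha>"
    unfolding leg_\<alpha>_def un using ne as D(3) by (auto simp: fun_eq_iff unleg_\<alpha>_def)
  show "cubic_map (D - {p, q, s, \<rho>}) (U - {\<rho>}) (unleg_\<sigma> \<sigma> p q s) (unleg_\<alpha> \<alpha> p q s \<rho>)"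
  proof (rule cubic_mapI)
    show "finite (D - {p, q, s, \<rho>})" using D(1) by simp
    show "U - {\<rho>} \<subseteq> D - {p, q, s, \<rho>}" using D(2) qD sD by auto
    show "unleg_\<alpha> \<alpha> p q s \<rho> (unleg_\<alpha> \<alpha> p q s \<rho> d) = d" for d
    proof (cases "d \<in> {p, q, s, \<rho>, \<alpha> p, \<alpha> q}")
      case True then show ?thesis using ne as D(3) by (auto simp: unleg_\<alpha>_def)
    next
      case False
      then have "\<alpha> d \<notin> {p, q, s, \<rho>, \<alpha> p, \<alpha> q}" using as I(9) D(3) by auto
      then show ?thesis using False D(3) by (auto simp: unleg_\<alpha>_def)
    qed
    show "unleg_\<alpha> \<alpha> p q s \<rho> d \<noteq> d \<longleftrightarrow> d \<in> D - {p, q, s, \<rho>}" for d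
      using ne D(4) by (auto simp: unleg_\<alpha>_def)
    show "unleg_\<sigma> \<sigma> p q s (unleg_\<sigma> \<sigma> p q s (unleg_\<sigma> \<sigma> p q s d)) = d" for d
    proof (cases "d \<in> {p, q, s}")
      case True then show ?thesis by (auto simp: unleg_\<sigma>_def)
    next
      case False
      then have "\<sigma> d \<notin> {p, q, s}" "\<sigma> (\<sigma> d) \<notin> {p, q, s}" using p q sp I(4) by auto
      then show ?thesis using False D(5) by (auto simp: unleg_\<sigma>_def)
    qed
    show "unleg_\<sigma> \<sigma> p q s d \<noteq> d \<longleftrightarrow> d \<in> D - {p, q, s, \<rho>} - (U - {\<rho>})" for d
      using ne D(6) \<rho> by (auto simp: unleg_\<sigma>_def)
    fix A assume A: "A \<subseteq> D - {p, q, s, \<rho>}" "A \<noteq> {}"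
      "\<And>d. d \<in> A \<Longrightarrow> unleg_\<sigma> \<sigma> p q s d \<in> A \<and> unleg_\<alpha> \<alpha> p q s \<rho> d \<in> A"
    have aa: "\<alpha> p \<in> A \<longleftrightarrow> \<alpha> q \<in> A"
      using A(3)[of "\<alpha> p"] A(3)[of "\<alpha> q"] ne by (auto simp: unleg_\<alpha>_def)
    \<comment> \<open>A closed set of the reduced map becomes closed in the original one after
      adding the four removed darts, which is done exactly when it contains the healed edge.\<close>
    define B where "B = (if \<alpha> p \<in> A then A \<union> {p, q, s, \<rho>} else A)"
    have "B = D"
    proof (rule D(7))
      show "B \<subseteq> D" using A(1) qD sD \<rho>D by (auto simp: B_def)
      show "B \<noteq> {}" using A(2) by (auto simp: B_def)
      fix d assume d: "d \<in> B"
      show "\<sigma> d \<in> B \<and> \<alpha> d \<in> B"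
      proof (cases "d \<in> {p, q, s, \<rho>}")
        case True
        then have "\<alpha> p \<in> A" using d A(1) by (auto simp: B_def split: if_splits)
        then show ?thesis using True aa p q sp as I(5)[OF \<rho>] by (auto simp: B_def)
      next
        case False
        then have dA: "d \<in> A" using d by (auto simp: B_def split: if_splits)
        have "\<sigma> d \<in> A" using A(3)[OF dA] False by (auto simp: unleg_\<sigma>_def)
        moreover have "\<alpha> d \<in> B"
          using A(3)[OF dA] False dA aa D(3) by (auto simp: unleg_\<alpha>_def B_def split: if_splits)
        ultimately show ?thesis by (auto simp: B_def)
      qed
    qed
    moreover have "\<alpha> p \<in> D" using ap by auto
    ultimately show "A = D - {p, q, s, \<rho>}" using A(1) qD by (auto simp: B_def split: if_splits)
  qed
qed

lemma unleg_leg: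
  assumes M: "cubic_map D U \<sigma> \<alpha>" and k: "k \<in> D" and dist: "distinct [p, q, s, \<rho>]"
    and new: "{p, q, s, \<rho>} \<inter> D = {}"
  defines "\<sigma>' \<equiv> leg_\<sigma> \<sigma> p q s" and "\<alpha>' \<equiv> leg_\<alpha> \<alpha> k p q s \<rho>"
  shows "unleg_\<sigma> \<sigma>' p q s = \<sigma>" "unleg_\<alpha> \<alpha>' p q s \<rho> = \<alpha>" "\<alpha>' \<rho> = s" "\<sigma>' s = q" "\<sigma>' q = p" "\<alpha>' p = k"
    "\<alpha>' p \<noteq> q" "\<sigma>' p = s" "\<alpha>' q = \<alpha> k" "\<alpha>' s = \<rho>"
proof -
  note D = cubic_mapD[OF M] and I = cubic_map_in[OF M]
  have kk: "\<alpha> k \<noteq> k" "\<alpha> k \<in> D" using k D(4) I(1) by auto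
  have ne: "p \<noteq> q" "p \<noteq> s" "p \<noteq> \<rho>" "q \<noteq> s" "q \<noteq> \<rho>" "s \<noteq> \<rho>" "p \<notin> D" "q \<notin> D" "s \<notin> D" "\<rho> \<notin> D"
    using dist new by auto
  have nk: "k \<noteq> p" "k \<noteq> q" "k \<noteq> s" "k \<noteq> \<rho>" "\<alpha> k \<noteq> p" "\<alpha> k \<noteq> q" "\<alpha> k \<noteq> s" "\<alpha> k \<noteq> \<rho>"
    using ne k kk by auto
  have fx: "\<sigma> p = p" "\<sigma> q = q" "\<sigma> s = s" "\<alpha> p = p" "\<alpha> q = q" "\<alpha> s = s" "\<alpha> \<rho> = \<rho>"
    using ne I(6,7) by auto
  note n = ne ne(1-6)[symmetric] nk nk[symmetric] kk
  show ap: "\<alpha>' p = k" "\<alpha>' \<rho> = s" "\<sigma>' s = q" "\<sigma>' q = p" "\<alpha>' p \<noteq> q" "\<sigma>' p = s" and aq: "\<alpha>' q = \<alpha> k"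
    and "\<alpha>' s = \<rho>"
    using n by (auto simp: \<alpha>'_def \<sigma>'_def leg_\<alpha>_def leg_\<sigma>_def)
  show "unleg_\<sigma> \<sigma>' p q s = \<sigma>"
    using fx by (auto simp: \<sigma>'_def unleg_\<sigma>_def leg_\<sigma>_def fun_eq_iff)
  show "unleg_\<alpha> \<alpha>' p q s \<rho> = \<alpha>"
    unfolding unleg_\<alpha>_def ap aq using fx n D(3) by (auto simp: \<alpha>'_def leg_\<alpha>_def fun_eq_iff)
qed


text \<open>The leaves \<open>r1\<close> and \<open>r2\<close> are joined to a new vertex, whose third dart \<open>r\<close> leads to the new leaf \<open>\<rho>\<close>.\<close>

definition join_\<sigma> :: "('a \<Rightarrow> 'a) \<Rightarrow> 'a \<Rightarrow> 'a \<Rightarrow> 'a \<Rightarrow> 'a \<Rightarrow> 'a" where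
  "join_\<sigma> \<sigma> r r1 r2 = \<sigma>(r := r1, r1 := r2, r2 := r)"

definition join_\<alpha> :: "('a \<Rightarrow> 'a) \<Rightarrow> 'a \<Rightarrow> 'a \<Rightarrow> 'a \<Rightarrow> 'a" where
  "join_\<alpha> \<alpha> r \<rho> = \<alpha>(r := \<rho>, \<rho> := r)"

definition unjoin_\<sigma> :: "('a \<Rightarrow> 'a) \<Rightarrow> 'a \<Rightarrow> 'a \<Rightarrow> 'a \<Rightarrow> 'a \<Rightarrow> 'a" where
  "unjoin_\<sigma> \<sigma> r r1 r2 = \<sigma>(r := r, r1 := r1, r2 := r2)"

definition unjoin_\<alpha> :: "('a \<Rightarrow> 'a) \<Rightarrow> 'a \<Rightarrow> 'a \<Rightarrow> 'a \<Rightarrow> 'a" where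
  "unjoin_\<alpha> \<alpha> r \<rho> = \<alpha>(r := r, \<rho> := \<rho>)"

text \<open>Before the join there may be two components. The assumption \<open>conn\<close> only
  says that each of them carries \<open>r1\<close> or \<open>r2\<close>; the new vertex then links
  them.\<close>

lemma cubic_map_join:
  assumes C: "cubic D {r1, r2} \<sigma> \<alpha>" and r12: "r1 \<noteq> r2" and new: "r \<noteq> \<rho>" "r \<notin> D" "\<rho> \<notin> D"
    and conn: "\<And>A. A \<subseteq> D \<Longrightarrow> A \<noteq> {} \<Longrightarrow> map_closed \<sigma> \<alpha> A \<Longrightarrow> r1 \<in> A \<or> r2 \<in> A"
  shows "cubic_map (D \<union> {r, \<rho>}) {\<rho>} (join_\<sigma> \<sigma> r r1 r2) (join_\<alpha> \<alpha> r \<rho>)"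
    and "unjoin_\<sigma> (join_\<sigma> \<sigma> r r1 r2) r r1 r2 = \<sigma>" "unjoin_\<alpha> (join_\<alpha> \<alpha> r \<rho>) r \<rho> = \<alpha>"
proof -
  note D = cubicD[OF C] and I = cubic_in[OF C]
  have r: "r1 \<in> D" "r2 \<in> D" using D(2) by auto
  then have n: "r1 \<noteq> r" "r1 \<noteq> \<rho>" "r2 \<noteq> r" "r2 \<noteq> \<rho>" using new by auto
  have fx: "\<sigma> r1 = r1" "\<sigma> r2 = r2" "\<sigma> r = r" "\<sigma> \<rho> = \<rho>" "\<alpha> r = r" "\<alpha> \<rho> = \<rho>"
    using new I(5,6,7) by auto
  note ne = n n[symmetric] new(1) new(1)[symmetric] r12 r12[symmetric]
  show "unjoin_\<sigma> (join_\<sigma> \<sigma> r r1 r2) r r1 r2 = \<sigma>" "unjoin_\<alpha> (join_\<alpha> \<alpha> r \<rho>) r \<rho> = \<alpha>"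
    using fx by (auto simp: fun_eq_iff unjoin_\<sigma>_def unjoin_\<alpha>_def join_\<sigma>_def join_\<alpha>_def)
  show "cubic_map (D \<union> {r, \<rho>}) {\<rho>} (join_\<sigma> \<sigma> r r1 r2) (join_\<alpha> \<alpha> r \<rho>)"
  proof (rule cubic_mapI)
    show "finite (D \<union> {r, \<rho>})" "{\<rho>} \<subseteq> D \<union> {r, \<rho>}" using D(1) by auto
    show "join_\<alpha> \<alpha> r \<rho> (join_\<alpha> \<alpha> r \<rho> d) = d" for d
      using D(3) ne new fx I(9) by (auto simp: join_\<alpha>_def)
    show "(join_\<alpha> \<alpha> r \<rho> d \<noteq> d) = (d \<in> D \<union> {r, \<rho>})" for d
      using D(4) ne new by (auto simp: join_\<alpha>_def)
    show "join_\<sigma> \<sigma> r r1 r2 (join_\<sigma> \<sigma> r r1 r2 (join_\<sigma> \<sigma> r r1 r2 d)) = d" for d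
    proof (cases "d \<in> {r, r1, r2}")
      case True then show ?thesis using ne by (auto simp: join_\<sigma>_def)
    next
      case False
      then have "\<sigma> d \<notin> {r, r1, r2}" "\<sigma> (\<sigma> d) \<notin> {r, r1, r2}" using fx I(4) by (metis insert_iff empty_iff)+
      then show ?thesis using False D(5) by (simp add: join_\<sigma>_def)
    qed
    show "(join_\<sigma> \<sigma> r r1 r2 d \<noteq> d) = (d \<in> D \<union> {r, \<rho>} - {\<rho>})" for d
      using D(6)[of d] ne new r by (auto simp: join_\<sigma>_def)
    fix A assume A: "A \<subseteq> D \<union> {r, \<rho>}" "A \<noteq> {}"
      "\<And>d. d \<in> A \<Longrightarrow> join_\<sigma> \<sigma> r r1 r2 d \<in> A \<and> join_\<alpha> \<alpha> r \<rho> d \<in> A"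
    have v: "join_\<sigma> \<sigma> r r1 r2 r = r1" "join_\<sigma> \<sigma> r r1 r2 r1 = r2" "join_\<sigma> \<sigma> r r1 r2 r2 = r"
      "join_\<alpha> \<alpha> r \<rho> r = \<rho>" "join_\<alpha> \<alpha> r \<rho> \<rho> = r" using ne by (auto simp: join_\<sigma>_def join_\<alpha>_def)
    have a: "r \<in> A \<Longrightarrow> r1 \<in> A" "r1 \<in> A \<Longrightarrow> r2 \<in> A" "r2 \<in> A \<Longrightarrow> r \<in> A" "r \<in> A \<Longrightarrow> \<rho> \<in> A" "\<rho> \<in> A \<Longrightarrow> r \<in> A"
      using A(3) v by metis+
    have cl: "map_closed \<sigma> \<alpha> (A \<inter> D)" unfolding map_closed_def
    proof
      fix d assume d: "d \<in> A \<inter> D"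
      then have nd: "d \<noteq> r" "d \<noteq> \<rho>" using new by auto
      have "\<alpha> d \<in> A" using A(3)[of d] d nd by (auto simp: join_\<alpha>_def)
      moreover have "\<sigma> d \<in> A"
        using A(3)[of d] d nd fx by (auto simp: join_\<sigma>_def split: if_splits)
      ultimately show "\<sigma> d \<in> A \<inter> D \<and> \<alpha> d \<in> A \<inter> D" using I(1,2) d by auto
    qed
    have "A \<inter> D \<noteq> {}"
    proof -
      obtain x where x: "x \<in> A" using A(2) by blast
      show ?thesis
      proof (cases "x \<in> D")
        case False
        then have "r1 \<in> A" using x A(1) a by blast
        then show ?thesis using r by blast
      qed (use x in blast)
    qed
    then have all: "r \<in> A" "r1 \<in> A" "r2 \<in> A" "\<rho> \<in> A" using conn[OF _ _ cl] a by blast+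
    \<comment> \<open>Complements of closed sets are closed, so a nonempty rest of \<open>D\<close>
      would contain \<open>r1\<close> or \<open>r2\<close>, but both already lie in
      \<open>A\<close>.\<close>
    have "map_closed \<sigma> \<alpha> (D - A)" unfolding map_closed_def
    proof
      fix d assume d: "d \<in> D - A"
      have "\<sigma> d \<notin> A" "\<alpha> d \<notin> A"
        using cl d D(3,5) I(1,2) unfolding map_closed_def by (metis DiffE IntE IntI)+
      then show "\<sigma> d \<in> D - A \<and> \<alpha> d \<in> D - A" using I(1,2) d by auto
    qed
    then have "D - A = {}" using conn[of "D - A"] all by blast
    then show "A = D \<union> {r, \<rho>}" using A(1) all by auto
  qed
qed

text \<open>A component that avoids both new leaves is not touched by the removal, so it would be
  closed in the original connected map.\<close>

lemma cubic_unjoin: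
  assumes M: "cubic_map D {\<rho>} \<sigma> \<alpha>" and r: "r = \<alpha> \<rho>" "\<sigma> r \<noteq> r" "r1 = \<sigma> r" "r2 = \<sigma> r1"
  shows "distinct [\<rho>, r, r1, r2]" "{\<rho>, r, r1, r2} \<subseteq> D" "\<sigma> r2 = r"
    and "cubic (D - {r, \<rho>}) {r1, r2} (unjoin_\<sigma> \<sigma> r r1 r2) (unjoin_\<alpha> \<alpha> r \<rho>)"
    and "A \<subseteq> D - {r, \<rho>} \<Longrightarrow> A \<noteq> {} \<Longrightarrow> map_closed (unjoin_\<sigma> \<sigma> r r1 r2) (unjoin_\<alpha> \<alpha> r \<rho>) A
       \<Longrightarrow> r1 \<in> A \<or> r2 \<in> A"
    and "join_\<sigma> (unjoin_\<sigma> \<sigma> r r1 r2) r r1 r2 = \<sigma>" "join_\<alpha> (unjoin_\<alpha> \<alpha> r \<rho>) r \<rho> = \<alpha>"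
proof -
  note D = cubic_mapD[OF M] and I = cubic_map_in[OF M]
  have rD: "\<rho> \<in> D" "r \<in> D" using D(2) I(1) r(1) by auto
  have rr: "\<alpha> r = \<rho>" "\<rho> \<noteq> r" using D(3,4) r(1) rD by metis+
  have s: "\<sigma> \<rho> = \<rho>" using I(5) by auto
  show r2: "\<sigma> r2 = r" using r D(5) by simp
  show dist: "distinct [\<rho>, r, r1, r2]" using r rr s r2 I(4) D(5) by (auto; metis)
  show sub: "{\<rho>, r, r1, r2} \<subseteq> D" using rD r(3,4) I(2) by auto
  show "join_\<sigma> (unjoin_\<sigma> \<sigma> r r1 r2) r r1 r2 = \<sigma>" "join_\<alpha> (unjoin_\<alpha> \<alpha> r \<rho>) r \<rho> = \<alpha>"
    using r r2 rr by (auto simp: fun_eq_iff unjoin_\<sigma>_def unjoin_\<alpha>_def join_\<sigma>_def join_\<alpha>_def)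
  show "cubic (D - {r, \<rho>}) {r1, r2} (unjoin_\<sigma> \<sigma> r r1 r2) (unjoin_\<alpha> \<alpha> r \<rho>)"
  proof (rule cubicI)
    show "finite (D - {r, \<rho>})" "{r1, r2} \<subseteq> D - {r, \<rho>}" using D(1) sub dist by auto
    show "unjoin_\<alpha> \<alpha> r \<rho> (unjoin_\<alpha> \<alpha> r \<rho> d) = d" for d
      using D(3) rr r(1) I(3) by (auto simp: unjoin_\<alpha>_def)
    show "(unjoin_\<alpha> \<alpha> r \<rho> d \<noteq> d) = (d \<in> D - {r, \<rho>})" for d
      using D(4) by (auto simp: unjoin_\<alpha>_def)
    show "unjoin_\<sigma> \<sigma> r r1 r2 (unjoin_\<sigma> \<sigma> r r1 r2 (unjoin_\<sigma> \<sigma> r r1 r2 d)) = d" for d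
    proof (cases "d \<in> {r, r1, r2}")
      case True then show ?thesis by (auto simp: unjoin_\<sigma>_def)
    next
      case False
      then have "\<sigma> d \<notin> {r, r1, r2}" "\<sigma> (\<sigma> d) \<notin> {r, r1, r2}"
        using r(3,4) r2 I(4) by (metis insert_iff empty_iff)+
      then show ?thesis using False D(5) by (simp add: unjoin_\<sigma>_def)
    qed
    show "(unjoin_\<sigma> \<sigma> r r1 r2 d \<noteq> d) = (d \<in> D - {r, \<rho>} - {r1, r2})" for d
      using D(6)[of d] by (auto simp: unjoin_\<sigma>_def)
  qed
  assume A: "A \<subseteq> D - {r, \<rho>}" "A \<noteq> {}" "map_closed (unjoin_\<sigma> \<sigma> r r1 r2) (unjoin_\<alpha> \<alpha> r \<rho>) A"
  show "r1 \<in> A \<or> r2 \<in> A"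
  proof (rule ccontr)
    assume n: "\<not> (r1 \<in> A \<or> r2 \<in> A)"
    have "\<sigma> d \<in> A \<and> \<alpha> d \<in> A" if d: "d \<in> A" for d
    proof -
      have "d \<noteq> r" "d \<noteq> \<rho>" "d \<noteq> r1" "d \<noteq> r2" using A(1) n d by auto
      then show ?thesis using A(3) d unfolding map_closed_def unjoin_\<alpha>_def unjoin_\<sigma>_def by force
    qed
    then have "A = D" using D(7)[of A] A(1,2) by blast
    then show False using A(1) rD by auto
  qed
qed

text \<open>The face of \<open>k\<close> makes the detour \<open>s\<close>, \<open>\<rho>\<close>,
  \<open>q\<close> around the new leaf, while the face on the other side only gains
  \<open>p\<close>. This dictates the labels of the new darts.\<close>

lemma leg_face:
  assumes M: "cubic D U \<sigma> \<alpha>" and k: "k \<in> D" and dist: "distinct [p, q, s, \<rho>]"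
    and new: "{p, q, s, \<rho>} \<inter> D = {}"
  defines "\<phi> \<equiv> \<lambda>d. leg_\<sigma> \<sigma> p q s (leg_\<alpha> \<alpha> k p q s \<rho> d)"
  shows "\<phi> k = s" "\<phi> s = \<rho>" "\<phi> \<rho> = q" "\<phi> q = \<sigma> (\<alpha> k)" "\<phi> (\<alpha> k) = p" "\<phi> p = \<sigma> k"
    "d \<in> D \<Longrightarrow> d \<noteq> k \<Longrightarrow> d \<noteq> \<alpha> k \<Longrightarrow> \<phi> d = \<sigma> (\<alpha> d)"
proof -
  note D = cubicD[OF M] and I = cubic_in[OF M]
  have kk: "\<alpha> k \<noteq> k" "\<alpha> k \<in> D" using k D(4) I(1) by auto
  have ne: "p \<noteq> q" "p \<noteq> s" "p \<noteq> \<rho>" "q \<noteq> s" "q \<noteq> \<rho>" "s \<noteq> \<rho>" "p \<notin> D" "q \<notin> D" "s \<notin> D" "\<rho> \<notin> D"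
    using dist new by auto
  have nk: "k \<noteq> p" "k \<noteq> q" "k \<noteq> s" "k \<noteq> \<rho>" "\<alpha> k \<noteq> p" "\<alpha> k \<noteq> q" "\<alpha> k \<noteq> s" "\<alpha> k \<noteq> \<rho>"
    using ne k kk by auto
  have fx: "\<sigma> \<rho> = \<rho>" using ne I(6) by auto
  note n = ne(1-6) ne(1-6)[symmetric] nk nk[symmetric] kk(1) kk(1)[symmetric] fx
  show "\<phi> k = s" "\<phi> s = \<rho>" "\<phi> \<rho> = q" "\<phi> q = \<sigma> (\<alpha> k)" "\<phi> (\<alpha> k) = p" "\<phi> p = \<sigma> k"
    unfolding \<phi>_def leg_\<alpha>_def leg_\<sigma>_def using n by simp_all
  show "\<phi> d = \<sigma> (\<alpha> d)" if "d \<in> D" "d \<noteq> k" "d \<noteq> \<alpha> k"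
  proof -
    have "d \<notin> {p, q, s, \<rho>}" "\<alpha> d \<notin> {p, q, s, \<rho>}" using that new I(1) by auto
    then show ?thesis unfolding \<phi>_def leg_\<alpha>_def leg_\<sigma>_def using that by simp
  qed
qed

text \<open>With two separate leaves the walk passes from \<open>\<alpha> r1\<close> to
  \<open>r1\<close> and from \<open>\<alpha> r2\<close> to \<open>r2\<close>. The new vertex crosses
  these two passages, with \<open>r\<close> and \<open>\<rho>\<close> inserted into one of them;
  hence a join either merges two faces or splits one.\<close>

lemma join_face:
  assumes C: "cubic D {r1, r2} \<sigma> \<alpha>" and r12: "r1 \<noteq> r2" and new: "r \<noteq> \<rho>" "r \<notin> D" "\<rho> \<notin> D"
  defines "\<phi> \<equiv> \<lambda>d. join_\<sigma> \<sigma> r r1 r2 (join_\<alpha> \<alpha> r \<rho> d)"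
  shows "\<phi> r = \<rho>" "\<phi> \<rho> = r1" "\<phi> (\<alpha> r1) = r2" "\<phi> (\<alpha> r2) = r"
    "d \<in> D \<Longrightarrow> d \<noteq> \<alpha> r1 \<Longrightarrow> d \<noteq> \<alpha> r2 \<Longrightarrow> \<phi> d = \<sigma> (\<alpha> d)"
proof -
  note D = cubicD[OF C] and I = cubic_in[OF C]
  have r: "r1 \<in> D" "r2 \<in> D" "\<alpha> r1 \<in> D" "\<alpha> r2 \<in> D" using D(2) I(1) by auto
  have n: "r1 \<noteq> r" "r1 \<noteq> \<rho>" "r2 \<noteq> r" "r2 \<noteq> \<rho>" "\<alpha> r1 \<noteq> r" "\<alpha> r1 \<noteq> \<rho>" "\<alpha> r2 \<noteq> r" "\<alpha> r2 \<noteq> \<rho>" using new r by auto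
  have fx: "\<sigma> \<rho> = \<rho>" using new I(6) by auto
  note n' = n n[symmetric] new(1) new(1)[symmetric] r12 r12[symmetric] fx D(3)
  show "\<phi> r = \<rho>" "\<phi> \<rho> = r1" "\<phi> (\<alpha> r1) = r2" "\<phi> (\<alpha> r2) = r"
    unfolding \<phi>_def join_\<alpha>_def join_\<sigma>_def using n' by simp_all
  show "\<phi> d = \<sigma> (\<alpha> d)" if "d \<in> D" "d \<noteq> \<alpha> r1" "d \<noteq> \<alpha> r2"
  proof -
    have "d \<noteq> r" "d \<noteq> \<rho>" "\<alpha> d \<notin> {r, \<rho>, r1, r2}" using that new I(1,9) D(3) by auto
    then show ?thesis unfolding \<phi>_def join_\<alpha>_def join_\<sigma>_def by simp
  qed
qed

section \<open>Components after the root vertex has been cut out\<close>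

lemma map_closed_Diff:
  assumes "cubic D U \<sigma> \<alpha>" "map_closed \<sigma> \<alpha> A"
  shows "map_closed \<sigma> \<alpha> (D - A)"
  unfolding map_closed_def
proof
  fix d assume d: "d \<in> D - A"
  have "\<sigma> d \<notin> A" "\<alpha> d \<notin> A"
    using assms(2) d cubicD(3,5)[OF assms(1)] unfolding map_closed_def by (metis DiffE)+
  then show "\<sigma> d \<in> D - A \<and> \<alpha> d \<in> D - A" using cubic_in(1,2)[OF assms(1)] d by auto
qed

lemma cubic_restrict:
  assumes "cubic D U \<sigma> \<alpha>" "A \<subseteq> D" "map_closed \<sigma> \<alpha> A"
  shows "cubic A (U \<inter> A) (perm_restrict \<sigma> A) (perm_restrict \<alpha> A)"
proof -
  note D = cubicD[OF assms(1)]
  have cl: "d \<in> A \<Longrightarrow> \<sigma> d \<in> A \<and> \<alpha> d \<in> A" for d using assms(3) by (auto simp: map_closed_def)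
  show ?thesis
    using D cl assms(2) finite_subset[OF assms(2)] unfolding cubic_def perm_restrict_def by auto
qed

lemma map_closed_restrict:
  "B \<subseteq> A \<Longrightarrow> map_closed (perm_restrict \<sigma> A) (perm_restrict \<alpha> A) B \<longleftrightarrow> map_closed \<sigma> \<alpha> B"
  unfolding map_closed_def perm_restrict_def by (meson subset_iff)

text \<open>A proper closed part of \<open>A\<close> and its complement in \<open>A\<close> would
  both have to contain \<open>r1\<close>, as \<open>r2\<close> is outside.\<close>

lemma cubic_separate:
  assumes C: "cubic D {r1, r2} \<sigma> \<alpha>"
    and conn: "\<And>A. A \<subseteq> D \<Longrightarrow> A \<noteq> {} \<Longrightarrow> map_closed \<sigma> \<alpha> A \<Longrightarrow> r1 \<in> A \<or> r2 \<in> A"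
    and A: "A \<subseteq> D" "map_closed \<sigma> \<alpha> A" "r1 \<in> A" "r2 \<notin> A"
  shows "cubic_map A {r1} (perm_restrict \<sigma> A) (perm_restrict \<alpha> A)"
proof -
  have *: "{r1, r2} \<inter> A = {r1}" using A by auto
  show ?thesis unfolding cubic_map_def
  proof (intro conjI allI impI)
    show "cubic A {r1} (perm_restrict \<sigma> A) (perm_restrict \<alpha> A)"
      using cubic_restrict[OF C A(1,2)] * by simp
    fix B assume B: "B \<subseteq> A \<and> B \<noteq> {} \<and> map_closed (perm_restrict \<sigma> A) (perm_restrict \<alpha> A) B"
    then have B': "map_closed \<sigma> \<alpha> B" using map_closed_restrict by blast
    have r1: "r1 \<in> B" using conn[of B] B B' A by blast
    have "map_closed \<sigma> \<alpha> (A - B)"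
      using map_closed_Diff[OF C B'] A(2) unfolding map_closed_def by (metis A(1) Diff_iff subset_iff)
    then have "A - B = {}" using conn[of "A - B"] A r1 by blast
    then show "B = A" using B by auto
  qed
qed

lemma unjoin_cases:
  assumes C: "cubic D {r1, r2} \<sigma> \<alpha>"
    and conn: "\<And>A. A \<subseteq> D \<Longrightarrow> A \<noteq> {} \<Longrightarrow> map_closed \<sigma> \<alpha> A \<Longrightarrow> r1 \<in> A \<or> r2 \<in> A"
  obtains (connected) "cubic_map D {r1, r2} \<sigma> \<alpha>"
    | (separated) A where "A \<subseteq> D" "map_closed \<sigma> \<alpha> A" "r1 \<in> A" "r2 \<in> D - A"
        "cubic_map A {r1} (perm_restrict \<sigma> A) (perm_restrict \<alpha> A)"
        "cubic_map (D - A) {r2} (perm_restrict \<sigma> (D - A)) (perm_restrict \<alpha> (D - A))"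
proof (cases "\<exists>A\<subseteq>D. map_closed \<sigma> \<alpha> A \<and> r1 \<in> A \<and> r2 \<notin> A")
  case True
  then obtain A where A: "A \<subseteq> D" "map_closed \<sigma> \<alpha> A" "r1 \<in> A" "r2 \<notin> A" by blast
  have r2: "r2 \<in> D" using cubicD(2)[OF C] by auto
  have C': "cubic D {r2, r1} \<sigma> \<alpha>" using C by (simp add: insert_commute)
  show ?thesis
  proof (rule separated[of A])
    show "cubic_map A {r1} (perm_restrict \<sigma> A) (perm_restrict \<alpha> A)"
      by (rule cubic_separate[OF C conn A])
    show "cubic_map (D - A) {r2} (perm_restrict \<sigma> (D - A)) (perm_restrict \<alpha> (D - A))"
      by (rule cubic_separate[OF C' _ _ map_closed_Diff[OF C A(2)]]) (use conn A r2 in auto)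
  qed (use A r2 in auto)
next
  case False
  have "cubic_map D {r1, r2} \<sigma> \<alpha>" unfolding cubic_map_def
  proof (intro conjI allI impI)
    fix B assume B: "B \<subseteq> D \<and> B \<noteq> {} \<and> map_closed \<sigma> \<alpha> B"
    have r: "r1 \<in> D" "r2 \<in> D" using cubicD(2)[OF C] by auto
    have cB: "map_closed \<sigma> \<alpha> (D - B)" using map_closed_Diff[OF C] B by blast
    have "r1 \<in> B \<or> r2 \<in> B" using conn B by blast
    moreover have "r1 \<in> B \<Longrightarrow> r2 \<in> B" using False B by blast
    moreover have "r2 \<in> B \<Longrightarrow> r1 \<in> B" using False cB r by (metis Diff_iff Diff_subset)
    ultimately have "D - B = {}" using conn[OF _ _ cB] by blast
    then show "B = D" using B by auto
  qed (rule C)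
  then show ?thesis by (rule connected)
qed

text \<open>In the excluded case the leaf \<open>r2\<close>, its neighbour and the loop there form a
  closed set, hence the whole map, and no room is left for \<open>r1\<close>.\<close>

lemma leaf_not_loop:
  assumes M: "cubic_map D {r1, r2} \<sigma> \<alpha>" and r12: "r1 \<noteq> r2" and a: "\<alpha> r2 \<noteq> r1"
  shows "\<alpha> r2 \<notin> {r1, r2}" "\<alpha> (\<sigma> (\<sigma> (\<alpha> r2))) \<noteq> \<sigma> (\<alpha> r2)"
proof -
  note D = cubic_mapD[OF M] and I = cubic_map_in[OF M]
  show s: "\<alpha> r2 \<notin> {r1, r2}" using a D(4)[of r2] D(2) by auto
  show "\<alpha> (\<sigma> (\<sigma> (\<alpha> r2))) \<noteq> \<sigma> (\<alpha> r2)"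
  proof
    assume e: "\<alpha> (\<sigma> (\<sigma> (\<alpha> r2))) = \<sigma> (\<alpha> r2)"
    let ?B = "{r2, \<alpha> r2, \<sigma> (\<alpha> r2), \<sigma> (\<sigma> (\<alpha> r2))}"
    have r2: "r2 \<in> D" "r1 \<in> D" using D(2) by auto
    have e2: "\<alpha> (\<sigma> (\<alpha> r2)) = \<sigma> (\<sigma> (\<alpha> r2))" using e D(3) by metis
    have sr: "\<sigma> r2 = r2" using I(5) by auto
    have "?B = D"
      by (rule D(7)) (use r2 I(1,2) D(3,5) e e2 sr in auto)
    then have "r1 \<in> ?B" using r2 by auto
    moreover have "\<sigma> (\<alpha> r2) \<notin> {r1, r2}" "\<sigma> (\<sigma> (\<alpha> r2)) \<notin> {r1, r2}" using s I(8) by auto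
    ultimately show False using s r12 by auto
  qed
qed

text \<open>A leaf costs four darts and no face: each removed dart shares its label with a dart that
  stays. Here \<open>lab\<close> is any function constant on faces, so that it can also be applied
  to labels that have been identified.\<close>

lemma two_leaf_reduce:
  assumes M: "cubic_map D {r1, r2} \<sigma> \<alpha>" and r12: "r1 \<noteq> r2" and a: "\<alpha> r2 \<noteq> r1"
    and inv: "\<And>d. d \<in> D \<Longrightarrow> lab (\<sigma> (\<alpha> d)) = lab d"
  obtains D' \<sigma>' \<alpha>' where "cubic_map D' {r1} \<sigma>' \<alpha>'" "card D = card D' + 4"
    "\<And>d. d \<in> D' \<Longrightarrow> lab (\<sigma>' (\<alpha>' d)) = lab d" "lab ` D = lab ` D'"
proof -
  define s q p where "s = \<alpha> r2" "q = \<sigma> s" "p = \<sigma> q"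
  note nl = leaf_not_loop[OF M r12 a, folded s_q_p_def]
  note ul = cubic_map_unleg[OF M _ s_q_p_def(1) nl(1) s_q_p_def(2,3) nl(2)]
  have ul': "distinct [p, q, s, r2]" "{p, q, s, r2} \<subseteq> D" "\<alpha> p \<in> D - {p, q, s, r2}"
    "cubic_map (D - {p, q, s, r2}) ({r1, r2} - {r2}) (unleg_\<sigma> \<sigma> p q s) (unleg_\<alpha> \<alpha> p q s r2)"
    "leg_\<sigma> (unleg_\<sigma> \<sigma> p q s) p q s = \<sigma>"
    "leg_\<alpha> (unleg_\<alpha> \<alpha> p q s r2) (\<alpha> p) p q s r2 = \<alpha>"
    by (rule ul; simp)+
  define D2 where "D2 = D - {p, q, s, r2}"
  define k where "k = \<alpha> p"
  define \<sigma>2 where "\<sigma>2 = unleg_\<sigma> \<sigma> p q s"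
  define \<alpha>2 where "\<alpha>2 = unleg_\<alpha> \<alpha> p q s r2"
  have M2: "cubic_map D2 {r1} \<sigma>2 \<alpha>2"
    using ul'(4) r12 unfolding D2_def \<sigma>2_def \<alpha>2_def by (simp add: insert_Diff_if)
  have kD: "k \<in> D2" using ul'(3) by (simp add: k_def D2_def)
  have nw: "{p, q, s, r2} \<inter> D2 = {}" by (auto simp: D2_def)
  note lf = leg_face[OF cubic_map_cubic[OF M2] kD ul'(1) nw,
      unfolded \<sigma>2_def \<alpha>2_def k_def ul'(5,6), folded \<sigma>2_def \<alpha>2_def k_def]
  have D2: "D = D2 \<union> {p, q, s, r2}" using ul'(2) by (auto simp: D2_def)
  have cD2: "card D = card D2 + 4"
    using ul'(1) nw cubic_mapD(1)[OF M2] unfolding D2 by (subst card_Un_disjoint) auto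
  have k2: "\<alpha>2 k \<in> D2" "\<alpha>2 (\<alpha>2 k) = k" using kD cubic_map_in(1)[OF M2] cubic_mapD(3)[OF M2] by auto
  have lk: "lab s = lab k" "lab r2 = lab k" "lab q = lab k" "lab p = lab (\<alpha>2 k)"
     "lab (\<sigma>2 (\<alpha>2 k)) = lab q" "lab (\<sigma>2 k) = lab p"
    using inv[of k] inv[of s] inv[of r2] inv[of "\<alpha>2 k"] inv[of q] inv[of p, folded k_def] lf(1-6) kD k2 D2 by auto
  have "lab (\<sigma>2 (\<alpha>2 d)) = lab d" if "d \<in> D2" for d
    using lf(7)[OF that] inv[of d] lk that D2 k2 by (cases "d = k \<or> d = \<alpha>2 k") auto
  moreover have "lab ` D = lab ` D2" using D2 lk kD k2 by auto
  ultimately show ?thesis using that M2 cD2 by blast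
qed

text \<open>This is \<open>V - E + F \<le> 2\<close> for a map with one leaf, in terms of the number of darts.\<close>

theorem genus_bound:
  assumes "cubic_map D {\<rho>} \<sigma> \<alpha>" "\<And>d. d \<in> D \<Longrightarrow> lab (\<sigma> (\<alpha> d)) = lab d"
  shows "6 * card (lab ` D) \<le> card D + 8"
  using assms
proof (induction "card D" arbitrary: D \<rho> \<sigma> \<alpha> lab rule: less_induct)
  case less
  note M = less.prems(1) and inv = less.prems(2)
  note D = cubic_mapD[OF M] and I = cubic_map_in[OF M]
  define r where "r = \<alpha> \<rho>"
  define r1 where "r1 = \<sigma> r"
  define r2 where "r2 = \<sigma> r1"
  have \<rho>D: "\<rho> \<in> D" using D(2) by auto
  have rne: "\<sigma> r \<noteq> r" using D(4)[of \<rho>] D(6)[of r] \<rho>D I(1) r_def by auto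
  note uj = cubic_unjoin[OF M r_def rne r1_def r2_def]
  define \<sigma>' where "\<sigma>' = unjoin_\<sigma> \<sigma> r r1 r2"
  define \<alpha>' where "\<alpha>' = unjoin_\<alpha> \<alpha> r \<rho>"
  define D' where "D' = D - {r, \<rho>}"
  note uj' = uj(4-5)[folded \<sigma>'_def \<alpha>'_def D'_def]
  have DD: "D = D' \<union> {r, \<rho>}" "r \<notin> D'" "\<rho> \<notin> D'" using uj(2) by (auto simp: D'_def)
  have r12: "r1 \<noteq> r2" "r \<noteq> \<rho>" using uj(1) by auto
  have fD': "finite D'" using D(1) by (simp add: D'_def)
  have cD: "card D = card D' + 2" using fD' DD(2,3) r12 by (subst DD(1)) (simp add: card_insert_if)
  have sj: "\<sigma> = join_\<sigma> \<sigma>' r r1 r2" "\<alpha> = join_\<alpha> \<alpha>' r \<rho>" using uj(6,7) by (simp_all add: \<sigma>'_def \<alpha>'_def)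
  note jf = join_face[OF uj'(1) r12(1) r12(2) DD(2,3), folded sj]
  have c': "cubic D' {r1, r2} \<sigma>' \<alpha>'" by (rule uj'(1))
  note E' = cubicD[OF c'] and I' = cubic_in[OF c']
  have rD': "r1 \<in> D'" "r2 \<in> D'" using E'(2) by auto
  have aD': "\<alpha>' r1 \<in> D'" "\<alpha>' r2 \<in> D'" using rD' I'(1) by auto
  have l\<rho>: "lab r = lab r1" "lab \<rho> = lab r1"
    using inv[of r] inv[of \<rho>] jf(1,2) DD(1) by auto
  have la: "lab (\<alpha>' r1) = lab r2" "lab (\<alpha>' r2) = lab r1"
    using inv[of "\<alpha>' r1"] inv[of "\<alpha>' r2"] jf(3,4) aD' DD(1) l\<rho> by auto
  have inv': "lab (\<sigma>' (\<alpha>' d)) = lab d" if "d \<in> D'" "d \<noteq> \<alpha>' r1" "d \<noteq> \<alpha>' r2" for d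
    using inv[of d] jf(5)[OF that] that(1) DD(1) by auto
  have fr: "\<sigma>' r1 = r1" "\<sigma>' r2 = r2" using I'(5) by auto
  have LD: "lab ` D = lab ` D'" using DD(1) l\<rho> rD' by auto
  show ?case
  proof (rule unjoin_cases[OF c' uj'(2)])
    assume M': "cubic_map D' {r1, r2} \<sigma>' \<alpha>'"
    show ?thesis
    proof (cases "\<alpha>' r2 = r1")
      case True
      \<comment> \<open>The map is a single loop at the root vertex; with four darts and two faces
        the bound is attained.\<close>
      have "{r1, r2} = D'"
        by (rule cubic_mapD(7)[OF M']) (use rD' True E'(3) I'(9) fr in auto)
      then have "lab ` D = {lab r1, lab r2}" "card D' = 2" using LD r12 by auto
      then show ?thesis using cD by (simp add: card_insert_if)
    next
      case False
      \<comment> \<open>Without the root vertex, the faces of \<open>r1\<close> and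
        \<open>r2\<close> may have become one. Identifying their labels loses at most one face,
        against the six darts removed in total.\<close>
      define f where "f = (\<lambda>l. if l = lab r2 then lab r1 else l)"
      define lab2 where "lab2 = f \<circ> lab"
      have inv2: "lab2 (\<sigma>' (\<alpha>' d)) = lab2 d" if "d \<in> D'" for d
        using inv'[OF that] la E'(3) fr by (cases "d = \<alpha>' r1 \<or> d = \<alpha>' r2") (auto simp: lab2_def f_def)
      obtain D2 \<sigma>2 \<alpha>2 where M2: "cubic_map D2 {r1} \<sigma>2 \<alpha>2" and cD2: "card D' = card D2 + 4"
        and i2: "\<And>d. d \<in> D2 \<Longrightarrow> lab2 (\<sigma>2 (\<alpha>2 d)) = lab2 d" and im: "lab2 ` D' = lab2 ` D2"
        by (rule two_leaf_reduce[where lab = lab2, OF M' r12(1) False inv2]) auto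
      have IH: "6 * card (lab2 ` D2) \<le> card D2 + 8"
        by (intro less.hyps[OF _ M2]) (use cD cD2 i2 in auto)
      note im
      then have "lab ` D \<subseteq> insert (lab r2) (lab2 ` D2)"
        unfolding LD by (auto simp: lab2_def f_def image_iff split: if_splits)
      then have "card (lab ` D) \<le> card (insert (lab r2) (lab2 ` D2))"
        by (rule card_mono[rotated]) (use cubic_mapD(1)[OF M2] in auto)
      also have "\<dots> \<le> card (lab2 ` D2) + 1" using cubic_mapD(1)[OF M2] by (simp add: card_insert_if)
      finally show ?thesis using IH cD cD2 by simp
    qed
  next
    fix A assume A: "A \<subseteq> D'" "map_closed \<sigma>' \<alpha>' A" "r1 \<in> A" "r2 \<in> D' - A"
      and M1: "cubic_map A {r1} (perm_restrict \<sigma>' A) (perm_restrict \<alpha>' A)"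
      and M2: "cubic_map (D' - A) {r2} (perm_restrict \<sigma>' (D' - A)) (perm_restrict \<alpha>' (D' - A))"
    have cl: "d \<in> A \<Longrightarrow> \<sigma>' d \<in> A \<and> \<alpha>' d \<in> A" for d using A(2) by (auto simp: map_closed_def)
    have cl2: "d \<in> D' - A \<Longrightarrow> \<sigma>' d \<in> D' - A \<and> \<alpha>' d \<in> D' - A" for d
      using map_closed_Diff[OF c' A(2)] by (auto simp: map_closed_def)
    have l12: "lab r1 = lab r2"
    proof (rule ccontr)
      assume n: "lab r1 \<noteq> lab r2"
      \<comment> \<open>The only dart followed by \<open>r1\<close> in the face walk after the cut
        is \<open>\<alpha>' r1\<close>, whose label is that of \<open>r2\<close>. If the two labels
        differ, the walk injects the finite set \<open>B\<close> into itself without reaching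
        \<open>r1\<close>.\<close>
      define B where "B = {d \<in> A. lab d = lab r1}"
      have fB: "finite B" using fD' A(1) by (auto simp: B_def intro: finite_subset)
      have "\<sigma>' (\<alpha>' d) \<in> B - {r1}" if d: "d \<in> B" for d
      proof -
        have "d \<noteq> \<alpha>' r1" "d \<noteq> \<alpha>' r2" using d n la cl2[OF A(4)] by (auto simp: B_def)
        moreover from this have "\<sigma>' (\<alpha>' d) \<noteq> r1" using fr I'(4,9) by metis
        ultimately show ?thesis using d inv'[of d] cl A(1) by (auto simp: B_def)
      qed
      then have "(\<lambda>d. \<sigma>' (\<alpha>' d)) ` B \<subseteq> B - {r1}" by auto
      moreover have "inj_on (\<lambda>d. \<sigma>' (\<alpha>' d)) B" using I'(3,4) by (auto simp: inj_on_def)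
      ultimately have "card B \<le> card (B - {r1})" using fB card_inj_on_le[of _ B "B - {r1}"] by blast
      moreover have "r1 \<in> B" using A(3) by (simp add: B_def)
      ultimately show False using fB by (metis card_Diff1_less not_le)
    qed
    have inv2: "lab (\<sigma>' (\<alpha>' d)) = lab d" if "d \<in> D'" for d
      using inv'[OF that] la E'(3) fr l12 by (cases "d = \<alpha>' r1 \<or> d = \<alpha>' r2") auto
    have cA: "card D' = card A + card (D' - A)"
      using fD' A(1) by (simp add: card_Diff_subset card_mono finite_subset)
    have "A \<noteq> {}" "D' - A \<noteq> {}" using A by auto
    then have "card A > 0" "card (D' - A) > 0" using fD' A(1) by (auto simp: card_gt_0_iff intro: finite_subset)
    have IH1: "6 * card (lab ` A) \<le> card A + 8"
      by (rule less.hyps[OF _ M1]) (use cA cD inv2 A(1) cl in \<open>auto simp: perm_restrict_def\<close>)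
    have IH2: "6 * card (lab ` (D' - A)) \<le> card (D' - A) + 8"
      by (rule less.hyps[OF _ M2]) (use cA cD inv2 A(1) cl2 \<open>card A > 0\<close> in \<open>auto simp: perm_restrict_def\<close>)
    have fin: "finite (lab ` A)" "finite (lab ` (D' - A))" using fD' A(1) by (auto intro: finite_subset)
    \<comment> \<open>The root face is counted on both sides, so with \<open>F\<close> faces
      altogether \<open>6 * (F + 1)\<close> is at most \<open>(card D - 2) + 8 + 8\<close>, which is
      exactly the bound.\<close>
    have "lab r1 \<in> lab ` A \<inter> lab ` (D' - A)" using A(3,4) l12 by (auto intro: rev_image_eqI)
    then have "card (lab ` A \<inter> lab ` (D' - A)) \<ge> 1"
      using fin card_gt_0_iff[of "lab ` A \<inter> lab ` (D' - A)"] by (metis One_nat_def Suc_leI empty_iff finite_Int)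
    moreover have "lab ` D = lab ` A \<union> lab ` (D' - A)" using LD A(1) by auto
    ultimately have "card (lab ` D) + 1 \<le> card (lab ` A) + card (lab ` (D' - A))"
      using card_Un_Int[OF fin] by simp
    then show ?thesis using IH1 IH2 cA cD by simp
  qed
qed


text \<open>The second leaf accounts for four darts, so the slack drops from 8 to 4. This rules out
  that a root vertex lying on a single face could be removed from a planar map without disconnecting
  it.\<close>

lemma two_leaf_bound:
  assumes M: "cubic_map D {r1, r2} \<sigma> \<alpha>" and r12: "r1 \<noteq> r2"
    and inv: "\<And>d. d \<in> D \<Longrightarrow> lab (\<sigma> (\<alpha> d)) = lab d"
  shows "6 * card (lab ` D) \<le> card D + 4"
proof (cases "\<alpha> r2 = r1")
  case True
  note D = cubic_mapD[OF M] and I = cubic_map_in[OF M]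
  have r: "r1 \<in> D" "r2 \<in> D" "\<sigma> r1 = r1" "\<sigma> r2 = r2" "\<alpha> r1 = r2" using D(2,3) I(5) True by auto
  have "{r1, r2} = D" by (rule D(7)) (use r True in auto)
  moreover have "lab r1 = lab r2" using inv[OF r(1)] r by simp
  ultimately have "lab ` D = {lab r1}" "card D = 2" using r12 by auto
  then show ?thesis by simp
next
  case False
  show ?thesis
  proof (rule two_leaf_reduce[where lab = lab, OF M r12 False inv])
    fix D' \<sigma>' \<alpha>' assume "cubic_map D' {r1} \<sigma>' \<alpha>'" and c: "card D = card D' + 4"
      and "\<And>d. d \<in> D' \<Longrightarrow> lab (\<sigma>' (\<alpha>' d)) = lab d" and im: "lab ` D = lab ` D'"
    then have "6 * card (lab ` D') \<le> card D' + 8" by (intro genus_bound)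
    then show ?thesis using c im by simp
  qed
qed

section \<open>Face labellings and edge weights\<close>

text \<open>The last clause says that each label occurs on a single cycle of \<open>\<phi>\<close>: every \<open>\<phi>\<close>-closed set contains
  all darts whose label it meets.\<close>

definition face_lab :: "'a set \<Rightarrow> ('a \<Rightarrow> 'a) \<Rightarrow> 'b set \<Rightarrow> ('a \<Rightarrow> 'b) \<Rightarrow> bool" where
  "face_lab D \<phi> K lab \<longleftrightarrow> lab \<in> D \<rightarrow>\<^sub>E K \<and> lab ` D = K \<and> (\<forall>d\<in>D. lab (\<phi> d) = lab d) \<and>
     (\<forall>A d d'. A \<subseteq> D \<and> (\<forall>x\<in>A. \<phi> x \<in> A) \<and> d \<in> A \<and> d' \<in> D \<and> lab d' = lab d \<longrightarrow> d' \<in> A)"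

lemma face_labI:
  assumes ext: "lab \<in> extensional D" and im: "lab ` D = K" and inv: "\<And>d. d \<in> D \<Longrightarrow> lab (\<phi> d) = lab d"
    and min: "\<And>A d d'. A \<subseteq> D \<Longrightarrow> (\<And>x. x \<in> A \<Longrightarrow> \<phi> x \<in> A) \<Longrightarrow> d \<in> A \<Longrightarrow> d' \<in> D \<Longrightarrow> lab d' = lab d \<Longrightarrow> d' \<in> A"
  shows "face_lab D \<phi> K lab"
proof -
  have 1: "lab \<in> D \<rightarrow>\<^sub>E K" using ext imageI[of _ D lab] unfolding im PiE_iff by simp
  have 2: "\<forall>A d d'. A \<subseteq> D \<and> (\<forall>x\<in>A. \<phi> x \<in> A) \<and> d \<in> A \<and> d' \<in> D \<and> lab d' = lab d \<longrightarrow> d' \<in> A"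
  proof (intro allI impI, elim conjE)
    fix A d d' assume *: "A \<subseteq> D" "\<forall>x\<in>A. \<phi> x \<in> A" "d \<in> A" "d' \<in> D" "lab d' = lab d"
    show "d' \<in> A" by (rule min[OF *(1) bspec[OF *(2)] *(3-5)])
  qed
  have 3: "\<forall>d\<in>D. lab (\<phi> d) = lab d" by (rule ballI) (rule inv)
  show ?thesis unfolding face_lab_def by (intro conjI 1 2 3 im)
qed

lemma face_labD:
  assumes "face_lab D \<phi> K lab"
  shows "lab \<in> D \<rightarrow>\<^sub>E K" "lab \<in> extensional D" "lab ` D = K" "d \<in> D \<Longrightarrow> lab (\<phi> d) = lab d"
    and "A \<subseteq> D \<Longrightarrow> (\<And>x. x \<in> A \<Longrightarrow> \<phi> x \<in> A) \<Longrightarrow> d \<in> A \<Longrightarrow> d' \<in> D \<Longrightarrow> lab d' = lab d \<Longrightarrow> d' \<in> A"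
proof -
  note L = assms [unfolded face_lab_def]
  note L2 = conjunct2 [OF L] and L3 = conjunct2 [OF conjunct2 [OF L]]
  show "lab \<in> D \<rightarrow>\<^sub>E K" "lab ` D = K" by (rule conjunct1 [OF L], rule conjunct1 [OF L2])
  then show "lab \<in> extensional D" by (simp add: PiE_def)
  show "d \<in> D \<Longrightarrow> lab (\<phi> d) = lab d" by (rule bspec [OF conjunct1 [OF L3]])
  assume "A \<subseteq> D" "\<And>x. x \<in> A \<Longrightarrow> \<phi> x \<in> A" "d \<in> A" "d' \<in> D" "lab d' = lab d"
  then have "A \<subseteq> D \<and> (\<forall>x\<in>A. \<phi> x \<in> A) \<and> d \<in> A \<and> d' \<in> D \<and> lab d' = lab d" by (intro conjI ballI)
  moreover have "\<forall>A d d'. A \<subseteq> D \<and> (\<forall>x\<in>A. \<phi> x \<in> A) \<and> d \<in> A \<and> d' \<in> D \<and> lab d' = lab d \<longrightarrow> d' \<in> A"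
    by (rule conjunct2 [OF L3])
  ultimately show "d' \<in> A" by blast
qed

lemma cubic_permutes:
  assumes "cubic D U \<sigma> \<alpha>" shows "\<sigma> permutes D" "\<alpha> permutes D"
  using cubicD[OF assms] cubic_in[OF assms] unfolding permutes_def by metis+

lemma face_lab_leg:
  assumes M: "cubic D U \<sigma> \<alpha>" and k: "k \<in> D" and dist: "distinct [p, q, s, \<rho>]"
    and new: "{p, q, s, \<rho>} \<inter> D = {}" and L: "face_lab D (\<sigma> \<circ> \<alpha>) K lab"
  shows "face_lab (D \<union> {p, q, s, \<rho>}) (leg_\<sigma> \<sigma> p q s \<circ> leg_\<alpha> \<alpha> k p q s \<rho>) K
           (lab(p := lab (\<alpha> k), q := lab k, s := lab k, \<rho> := lab k))" (is "face_lab ?D ?\<phi> K ?lab")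
proof -
  note D = cubicD[OF M] and I = cubic_in[OF M] and Lb = face_labD[OF L, unfolded comp_def]
  note lf = leg_face[OF M k dist new]
  have kD: "\<alpha> k \<in> D" "\<sigma> k \<in> D" "\<sigma> (\<alpha> k) \<in> D" using k I(1,2) by auto
  have ne: "p \<noteq> q" "p \<noteq> s" "p \<noteq> \<rho>" "q \<noteq> s" "q \<noteq> \<rho>" "s \<noteq> \<rho>" using dist by auto
  define l where "l = ?lab"
  have lD: "l d = lab d" if "d \<in> D" for d using that new by (auto simp: l_def)
  have lp: "l p = lab (\<alpha> k)" "l q = lab k" "l s = lab k" "l \<rho> = lab k" using ne by (auto simp: l_def)
  have le: "l \<in> extensional ?D" using Lb(2) by (auto simp: l_def extensional_def)
  have fk: "lab (\<sigma> (\<alpha> k)) = lab k" "lab (\<sigma> k) = lab (\<alpha> k)" using Lb(4)[OF k] Lb(4)[OF kD(1)] D(3) by auto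
  show ?thesis unfolding l_def[symmetric]
  proof (rule face_labI)
    show "l \<in> extensional ?D" by (rule le)
    have "l ` D = lab ` D" using lD by (rule image_cong[OF refl])
    then show "l ` ?D = K" using k kD Lb(3) lp unfolding image_Un by auto
    show "l (?\<phi> d) = l d" if d: "d \<in> ?D" for d
    proof (cases "d \<in> {p, q, s, \<rho>, k, \<alpha> k}")
      case True
      then show ?thesis using lf(1-6) lp lD k kD fk D(3) unfolding comp_def
        by (elim insertE emptyE) (simp_all only:)
    next
      case False
      then have dD: "d \<in> D" using d by auto
      then have "?\<phi> d = \<sigma> (\<alpha> d)" using lf(7) False by simp
      moreover have "\<sigma> (\<alpha> d) \<in> D" using dD I(1,2) by auto
      ultimately show ?thesis using lD dD Lb(4)[OF dD] by metis
    qed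
    fix A d d' assume A: "A \<subseteq> ?D" "\<And>x. x \<in> A \<Longrightarrow> ?\<phi> x \<in> A" "d \<in> A" "d' \<in> ?D" "l d' = l d"
    have c: "k \<in> A \<Longrightarrow> s \<in> A" "s \<in> A \<Longrightarrow> \<rho> \<in> A" "\<rho> \<in> A \<Longrightarrow> q \<in> A" "q \<in> A \<Longrightarrow> \<sigma> (\<alpha> k) \<in> A"
      "\<alpha> k \<in> A \<Longrightarrow> p \<in> A" "p \<in> A \<Longrightarrow> \<sigma> k \<in> A"
      using A(2) lf(1-6) unfolding comp_def by metis+
    have cl: "\<sigma> (\<alpha> x) \<in> A \<inter> D" if x: "x \<in> A \<inter> D" for x
    proof -
      have "\<sigma> (\<alpha> x) \<in> A"
      proof (cases "x = k \<or> x = \<alpha> k")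
        case True then show ?thesis using c x D(3) by (metis IntD1)
      next
        case False then show ?thesis using A(2)[of x] lf(7)[of x] x by simp
      qed
      then show ?thesis using x I(1,2) by auto
    qed
    \<comment> \<open>A new dart is followed, at the end of its detour, by an old dart with the same
      label.\<close>
    have "\<exists>e\<in>A \<inter> D. lab e = l d"
    proof (cases "d \<in> D")
      case True then show ?thesis using A(3) lD by auto
    next
      case False
      then consider "d = p" | "d \<in> {q, s, \<rho>}" using A(1,3) by auto
      then show ?thesis
      proof cases
        case 1 then show ?thesis using c(6) A(3) kD lp fk by (intro bexI[of _ "\<sigma> k"]) auto
      next
        case 2
        then have "\<sigma> (\<alpha> k) \<in> A" using c A(3) by auto
        then show ?thesis using 2 kD lp fk by (intro bexI[of _ "\<sigma> (\<alpha> k)"]) auto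
      qed
    qed
    then obtain e where e: "e \<in> A \<inter> D" "lab e = l d'" using A(5) by metis
    have key: "y \<in> A" if "y \<in> D" "lab y = lab e" for y
      using Lb(5)[of "A \<inter> D" e y] cl e(1) that by auto
    show "d' \<in> A"
    proof (cases "d' \<in> D")
      case True then show ?thesis using key lD e by metis
    next
      case False
      then consider "d' = p" | "d' \<in> {q, s, \<rho>}" using A(4) by auto
      then show ?thesis
      proof cases
        case 1 then show ?thesis using key[of "\<alpha> k"] kD e lp c by simp
      next
        case 2
        then have "lab e = lab k" using e lp by auto
        then have "k \<in> A" using key[of k] k by simp
        then show ?thesis using 2 c by auto
      qed
    qed
  qed
qed

lemma face_lab_unleg:
  assumes M: "cubic D U \<sigma> \<alpha>" and k: "k \<in> D" and dist: "distinct [p, q, s, \<rho>]"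
    and new: "{p, q, s, \<rho>} \<inter> D = {}"
    and L: "face_lab (D \<union> {p, q, s, \<rho>}) (leg_\<sigma> \<sigma> p q s \<circ> leg_\<alpha> \<alpha> k p q s \<rho>) K lab" (is "face_lab ?D ?\<phi> K lab")
  shows "face_lab D (\<sigma> \<circ> \<alpha>) K (restrict lab D)"
    and "lab p = lab (\<alpha> k)" "lab q = lab k" "lab s = lab k" "lab \<rho> = lab k"
proof -
  note D = cubicD[OF M] and I = cubic_in[OF M] and Lb = face_labD[OF L, unfolded comp_def]
  note lf = leg_face[OF M k dist new]
  have kD: "\<alpha> k \<in> D" "\<sigma> k \<in> D" "\<sigma> (\<alpha> k) \<in> D" using k I(1,2) by auto
  show lp: "lab p = lab (\<alpha> k)" "lab q = lab k" "lab s = lab k" "lab \<rho> = lab k"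
    using Lb(4)[of k] Lb(4)[of s] Lb(4)[of \<rho>] Lb(4)[of "\<alpha> k"] lf(1-3,5) k kD by auto
  have fk: "lab (\<sigma> (\<alpha> k)) = lab k" "lab (\<sigma> k) = lab (\<alpha> k)"
    using Lb(4)[of q] Lb(4)[of p] lf(4,6) lp by auto
  have fD: "lab (\<sigma> (\<alpha> d)) = lab d" if "d \<in> D" for d
    using that fk Lb(4)[of d] lf(7)[OF that] D(3) by (cases "d = k \<or> d = \<alpha> k") auto
  show "face_lab D (\<sigma> \<circ> \<alpha>) K (restrict lab D)"
  proof (rule face_labI)
    show "restrict lab D \<in> extensional D" by simp
    show "restrict lab D ` D = K" using Lb(3) lp k kD by (auto simp: image_Un)
    show "restrict lab D ((\<sigma> \<circ> \<alpha>) d) = restrict lab D d" if "d \<in> D" for d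
      using fD[OF that] that I(1,2) by auto
    fix A d d' assume A: "A \<subseteq> D" "\<And>x. x \<in> A \<Longrightarrow> (\<sigma> \<circ> \<alpha>) x \<in> A" "d \<in> A" "d' \<in> D"
      "restrict lab D d' = restrict lab D d"
    \<comment> \<open>The walk in the map with the leg makes detours after \<open>k\<close> and
      after \<open>\<alpha> k\<close>; a set closed for the old walk is completed by the darts of
      these detours.\<close>
    define B where "B = A \<union> {x. k \<in> A \<and> x \<in> {s, \<rho>, q}} \<union> {x. \<alpha> k \<in> A \<and> x = p}"
    have nA: "p \<notin> A" "q \<notin> A" "s \<notin> A" "\<rho> \<notin> A" using A(1) new by auto
    have "d' \<in> B"
    proof (rule Lb(5))
      show "B \<subseteq> ?D" using A(1) by (auto simp: B_def)
      show "d \<in> B" "d' \<in> ?D" "lab d' = lab d" using A by (auto simp: B_def)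
      fix x assume x: "x \<in> B"
      consider "x \<in> A" "x = k" | "x \<in> A" "x = \<alpha> k" | "x \<in> A" "x \<noteq> k" "x \<noteq> \<alpha> k" | "k \<in> A" "x = s"
         | "k \<in> A" "x = \<rho>" | "k \<in> A" "x = q" | "\<alpha> k \<in> A" "x = p"
        using x unfolding B_def by blast
      then show "leg_\<sigma> \<sigma> p q s (leg_\<alpha> \<alpha> k p q s \<rho> x) \<in> B"
      proof cases
        case 3
        then show ?thesis using lf(7)[of x] A(1) A(2)[of x] by (auto simp: B_def)
      next
        case 6 then show ?thesis using lf(4) A(2)[of k] by (auto simp: B_def)
      next
        case 7 then show ?thesis using lf(6) A(2)[of "\<alpha> k"] D(3) by (auto simp: B_def)
      qed (simp_all add: lf(1-3,5) B_def)
    qed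
    then show "d' \<in> A" using A(4) new by (auto simp: B_def)
  qed
qed

text \<open>The Laplace transform of a map in the perimeters: an edge of length \<open>l\<close>
  adds \<open>l\<close> to the perimeter on either side, and \<open>1 / (a + b)\<close> is the
  integral of \<open>exp (- (a + b) * l)\<close> over positive \<open>l\<close>.\<close>

definition edge_wt :: "'a set \<Rightarrow> ('a \<Rightarrow> 'a) \<Rightarrow> ('a \<Rightarrow> real) \<Rightarrow> real" where
  "edge_wt D \<alpha> v = (\<Prod>e \<in> (\<lambda>d. {d, \<alpha> d}) ` D. 1 / (\<Sum>d\<in>e. v d))"

lemma edge_wt_cong: "(\<And>d. d \<in> D \<Longrightarrow> v d = v' d) \<Longrightarrow> (\<And>d. d \<in> D \<Longrightarrow> \<alpha> d \<in> D) \<Longrightarrow> edge_wt D \<alpha> v = edge_wt D \<alpha> v'"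
  unfolding edge_wt_def by (intro prod.cong refl arg_cong[of _ _ "\<lambda>x. 1 / x"] sum.cong) auto

lemma edge_wt_split:
  assumes M: "cubic D U \<sigma> \<alpha>" and k: "k \<in> D"
  shows "edge_wt D \<alpha> v = 1 / (v k + v (\<alpha> k)) * edge_wt (D - {k, \<alpha> k}) \<alpha> v"
proof -
  note D = cubicD[OF M] and I = cubic_in[OF M]
  have kk: "k \<noteq> \<alpha> k" "\<alpha> k \<in> D" using k D(4)[of k] I(1) by auto
  have "(\<lambda>d. {d, \<alpha> d}) ` D = insert {k, \<alpha> k} ((\<lambda>d. {d, \<alpha> d}) ` (D - {k, \<alpha> k}))"
    using k kk D(3) by auto
  moreover have "{k, \<alpha> k} \<notin> (\<lambda>d. {d, \<alpha> d}) ` (D - {k, \<alpha> k})" by auto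
  ultimately show ?thesis using D(1) kk unfolding edge_wt_def by simp
qed

text \<open>For weights that come from faces, \<open>v p = v (\<alpha> k)\<close> and
  \<open>v q = v k\<close>. Then the factor of the subdivided edge appears twice, the second copy
  being the term of \<open>k\<close> in the logarithmic derivative.\<close>

lemma edge_wt_leg:
  assumes M: "cubic D U \<sigma> \<alpha>" and k: "k \<in> D" and dist: "distinct [p, q, s, \<rho>]"
    and new: "{p, q, s, \<rho>} \<inter> D = {}"
  shows "edge_wt (D \<union> {p, q, s, \<rho>}) (leg_\<alpha> \<alpha> k p q s \<rho>) v =
    edge_wt (D - {k, \<alpha> k}) \<alpha> v / ((v k + v p) * (v (\<alpha> k) + v q) * (v s + v \<rho>))"
proof -
  note D = cubicD[OF M] and I = cubic_in[OF M]
  have kk: "k \<noteq> \<alpha> k" "\<alpha> k \<in> D" using k D(4)[of k] I(1) by auto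
  have ne: "p \<noteq> q" "p \<noteq> s" "p \<noteq> \<rho>" "q \<noteq> s" "q \<noteq> \<rho>" "s \<noteq> \<rho>" "p \<notin> D" "q \<notin> D" "s \<notin> D" "\<rho> \<notin> D"
    using dist new by auto
  have nk: "k \<noteq> p" "k \<noteq> q" "k \<noteq> s" "k \<noteq> \<rho>" "\<alpha> k \<noteq> p" "\<alpha> k \<noteq> q" "\<alpha> k \<noteq> s" "\<alpha> k \<noteq> \<rho>"
    using ne k kk by auto
  let ?a = "leg_\<alpha> \<alpha> k p q s \<rho>"
  note n = ne(1-6) ne(1-6)[symmetric] nk nk[symmetric] kk(1) kk(1)[symmetric]
  have v: "?a k = p" "?a p = k" "?a (\<alpha> k) = q" "?a q = \<alpha> k" "?a s = \<rho>" "?a \<rho> = s"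
    unfolding leg_\<alpha>_def using n by simp_all
  have E: "(\<lambda>d. {d, ?a d}) ` (D - {k, \<alpha> k}) = (\<lambda>d. {d, \<alpha> d}) ` (D - {k, \<alpha> k})"
    by (rule image_cong) (use ne in \<open>auto simp: leg_\<alpha>_def\<close>)
  have "D \<union> {p, q, s, \<rho>} = (D - {k, \<alpha> k}) \<union> {k, p} \<union> {\<alpha> k, q} \<union> {s, \<rho>}" using k kk by auto
  note Deq = this
  have *: "(\<lambda>d. {d, ?a d}) ` (D \<union> {p, q, s, \<rho>}) =
     insert {k, p} (insert {\<alpha> k, q} (insert {s, \<rho>} ((\<lambda>d. {d, \<alpha> d}) ` (D - {k, \<alpha> k}))))"
    unfolding Deq image_Un E by (simp add: v insert_commute)
  have sub: "e \<subseteq> D" if "e \<in> (\<lambda>d. {d, \<alpha> d}) ` (D - {k, \<alpha> k})" for e using that I(1) by auto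
  have "{k, p} \<notin> (\<lambda>d. {d, \<alpha> d}) ` (D - {k, \<alpha> k})" "{\<alpha> k, q} \<notin> (\<lambda>d. {d, \<alpha> d}) ` (D - {k, \<alpha> k})"
     "{s, \<rho>} \<notin> (\<lambda>d. {d, \<alpha> d}) ` (D - {k, \<alpha> k})" using sub ne by blast+
  moreover have "{k, p} \<noteq> {\<alpha> k, q}" "{k, p} \<noteq> {s, \<rho>}" "{\<alpha> k, q} \<noteq> {s, \<rho>}" using n by (auto simp: doubleton_eq_iff)
  ultimately show ?thesis using D(1) n unfolding edge_wt_def * by (simp add: field_simps)
qed

section \<open>Weighted sums over maps\<close>

definition rooted_maps :: "'a set \<Rightarrow> 'b set \<Rightarrow> 'b \<Rightarrow> ('a \<times> ('a \<Rightarrow> 'a) \<times> ('a \<Rightarrow> 'a) \<times> ('a \<Rightarrow> 'b)) set" where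
  "rooted_maps D K x = {(\<rho>, \<sigma>, \<alpha>, lab).
     cubic_map D {\<rho>} \<sigma> \<alpha> \<and> face_lab D (\<sigma> \<circ> \<alpha>) K lab \<and> lab \<rho> = x}"

definition closed_maps :: "'a set \<Rightarrow> 'b set \<Rightarrow> (('a \<Rightarrow> 'a) \<times> ('a \<Rightarrow> 'a) \<times> ('a \<Rightarrow> 'b)) set" where
  "closed_maps D K = {(\<sigma>, \<alpha>, lab). cubic_map D {} \<sigma> \<alpha> \<and> face_lab D (\<sigma> \<circ> \<alpha>) K lab}"

lemma finite_closed_maps:
  assumes "finite D" "finite K"
  shows "finite (closed_maps D K)"
proof (rule finite_subset)
  show "closed_maps D K \<subseteq> {p. p permutes D} \<times> {p. p permutes D} \<times> (D \<rightarrow>\<^sub>E K)"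
    unfolding closed_maps_def using cubic_permutes[OF cubic_map_cubic] face_labD(1) by fast
  show "finite ({p. p permutes D} \<times> {p. p permutes D} \<times> (D \<rightarrow>\<^sub>E K))"
    using assms by (intro finite_cartesian_product finite_permutations finite_PiE) auto
qed

lemma finite_rooted_maps:
  assumes "finite D" "finite K"
  shows "finite (rooted_maps D K x)"
proof (rule finite_subset)
  show "rooted_maps D K x \<subseteq> D \<times> {p. p permutes D} \<times> {p. p permutes D} \<times> (D \<rightarrow>\<^sub>E K)"
    unfolding rooted_maps_def
    using cubic_permutes[OF cubic_map_cubic] face_labD(1) cubic_mapD(2) by fast
  show "finite (D \<times> {p. p permutes D} \<times> {p. p permutes D} \<times> (D \<rightarrow>\<^sub>E K))"
    using assms by (intro finite_cartesian_product finite_permutations finite_PiE) auto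
qed

section \<open>Renaming darts\<close>

lemma ex_involution_image:
  assumes "finite D" "finite D'" "card D = card D'"
  obtains f :: "'a \<Rightarrow> 'a" where "\<And>d. f (f d) = d" "f ` D = D'"
proof -
  have "card (D - D') = card (D' - D)"
    using assms by (metis card_le_sym_Diff card_Diff_subset_Int finite_Int inf_commute)
  then obtain g where g: "bij_betw g (D - D') (D' - D)"
    using assms by (metis finite_Diff finite_same_card_bij)
  define h where "h = the_inv_into (D - D') g"
  have h: "bij_betw h (D' - D) (D - D')" unfolding h_def by (rule bij_betw_the_inv_into[OF g])
  have gh: "h (g d) = d" if "d \<in> D - D'" for d
    unfolding h_def using g that by (meson bij_betw_def the_inv_into_f_f)
  have hg: "g (h d) = d" if "d \<in> D' - D" for d
    unfolding h_def using g that by (metis f_the_inv_into_f bij_betw_def)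
  define f where "f d = (if d \<in> D - D' then g d else if d \<in> D' - D then h d else d)" for d
  have gm: "d \<in> D - D' \<Longrightarrow> g d \<in> D' - D" and hm: "d \<in> D' - D \<Longrightarrow> h d \<in> D - D'" for d
    using g h by (auto simp: bij_betw_def)
  have ff: "f (f d) = d" for d
    using gm[of d] hm[of d] gh[of d] hg[of d] by (auto simp: f_def)
  moreover have "f ` D = D'"
  proof
    show "f ` D \<subseteq> D'" using gm by (auto simp: f_def)
    show "D' \<subseteq> f ` D"
    proof
      fix d assume "d \<in> D'"
      then have "f d \<in> D" using hm by (auto simp: f_def)
      then show "d \<in> f ` D" using ff by (metis imageI)
    qed
  qed
  ultimately show ?thesis using that by blast
qed

context
  fixes f :: "'a \<Rightarrow> 'a"
  assumes ff: "\<And>d. f (f d) = d"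
begin

lemma involution_mem: "d \<in> f ` A \<longleftrightarrow> f d \<in> A"
  using ff by (metis imageE imageI)

lemma cubic_map_conj:
  assumes "cubic_map D U \<sigma> \<alpha>"
  shows "cubic_map (f ` D) (f ` U) (f \<circ> \<sigma> \<circ> f) (f \<circ> \<alpha> \<circ> f)"
proof -
  note D = cubic_mapD[OF assms]
  show ?thesis
  proof (rule cubic_mapI)
    show "finite (f ` D)" "f ` U \<subseteq> f ` D" using D(1,2) by auto
    show "(f \<circ> \<alpha> \<circ> f) ((f \<circ> \<alpha> \<circ> f) d) = d" for d using D(3) ff by simp
    show "(f \<circ> \<sigma> \<circ> f) ((f \<circ> \<sigma> \<circ> f) ((f \<circ> \<sigma> \<circ> f) d)) = d" for d using D(5) ff by simp
    show "(f \<circ> \<alpha> \<circ> f) d \<noteq> d \<longleftrightarrow> d \<in> f ` D" for d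
      using D(4)[of "f d"] ff unfolding involution_mem comp_def by metis
    show "(f \<circ> \<sigma> \<circ> f) d \<noteq> d \<longleftrightarrow> d \<in> f ` D - f ` U" for d
      using D(6)[of "f d"] ff unfolding involution_mem comp_def Diff_iff by metis
    fix A assume A: "A \<subseteq> f ` D" "A \<noteq> {}" "\<And>d. d \<in> A \<Longrightarrow> (f \<circ> \<sigma> \<circ> f) d \<in> A \<and> (f \<circ> \<alpha> \<circ> f) d \<in> A"
    have "f ` A = D"
    proof (rule D(7))
      show "f ` A \<subseteq> D" using A(1) ff by force
      show "f ` A \<noteq> {}" using A(2) by simp
      fix d assume "d \<in> f ` A"
      then show "\<sigma> d \<in> f ` A \<and> \<alpha> d \<in> f ` A" using A(3)[of "f d"] ff unfolding involution_mem by simp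
    qed
    then show "A = f ` D" using ff by (auto simp: image_image)
  qed
qed

lemma face_lab_conj:
  assumes "face_lab D \<phi> K lab"
  shows "face_lab (f ` D) (f \<circ> \<phi> \<circ> f) K (lab \<circ> f)"
proof -
  note L = face_labD[OF assms]
  show ?thesis
  proof (rule face_labI)
    show "lab \<circ> f \<in> extensional (f ` D)"
      using L(2) unfolding extensional_def involution_mem by simp
    show "(lab \<circ> f) ` f ` D = K" using L(3) ff by (simp add: image_image)
    show "(lab \<circ> f) ((f \<circ> \<phi> \<circ> f) d) = (lab \<circ> f) d" if "d \<in> f ` D" for d
      using L(4) that ff unfolding involution_mem by simp
    fix A d d' assume A: "A \<subseteq> f ` D" "\<And>x. x \<in> A \<Longrightarrow> (f \<circ> \<phi> \<circ> f) x \<in> A" "d \<in> A" "d' \<in> f ` D"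
      "(lab \<circ> f) d' = (lab \<circ> f) d"
    have "f d' \<in> f ` A"
    proof (rule L(5))
      show "f ` A \<subseteq> D" using A(1) ff by force
      show "f d \<in> f ` A" using A(3) by simp
      show "f d' \<in> D" "lab (f d') = lab (f d)" using A(4,5) unfolding involution_mem by auto
      show "\<phi> x \<in> f ` A" if "x \<in> f ` A" for x
        using A(2)[of "f x"] that ff unfolding involution_mem by simp
    qed
    then show "d' \<in> A" using ff unfolding involution_mem by simp
  qed
qed

lemma edge_wt_conj: "edge_wt (f ` D) (f \<circ> \<alpha> \<circ> f) (v \<circ> f) = edge_wt D \<alpha> v"
proof -
  have inj: "inj f" using ff by (metis injI)
  have "(\<lambda>d. {d, (f \<circ> \<alpha> \<circ> f) d}) ` f ` D = (\<lambda>e. f ` e) ` (\<lambda>d. {d, \<alpha> d}) ` D"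
    using ff by (simp add: image_image)
  moreover have "inj_on (\<lambda>e. f ` e) ((\<lambda>d. {d, \<alpha> d}) ` D)" using inj by (meson inj_image_eq_iff inj_onI)
  moreover have "sum (v \<circ> f) (f ` e) = sum v e" for e
    using inj ff by (subst sum.reindex) (auto intro: inj_on_subset)
  ultimately show ?thesis unfolding edge_wt_def by (simp add: prod.reindex)
qed

end

text \<open>The dart sets are exchanged by an involution, so the transport of maps is its own
  inverse and one hypothesis about \<open>T\<close> serves both directions of the
  reindexing.\<close>

lemma sum_conj_eq:
  fixes F :: "'a set \<Rightarrow> 'c \<Rightarrow> real" and T :: "('a \<Rightarrow> 'a) \<Rightarrow> 'c \<Rightarrow> 'c"
  assumes "finite D" "finite D'" "card D = card D'"
    and T: "\<And>f D m. (\<And>d. f (f d) = d) \<Longrightarrow> m \<in> S D \<Longrightarrow> T f m \<in> S (f ` D) \<and> F (f ` D) (T f m) = F D m \<and> T f (T f m) = m"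
  shows "(\<Sum>m\<in>S D. F D m) = (\<Sum>m\<in>S D'. F D' m)"
proof -
  obtain f where f: "\<And>d. f (f d) = d" "f ` D = D'" using ex_involution_image[OF assms(1-3)] by blast
  have f': "f ` D' = D" using f by (auto simp: image_image)
  show ?thesis
    by (rule sum.reindex_bij_witness[of _ "T f" "T f"]) (use T[OF f(1)] f(2) f' in metis)+
qed

definition rooted_sum :: "'a set \<Rightarrow> 'b set \<Rightarrow> 'b \<Rightarrow> ('b \<Rightarrow> real) \<Rightarrow> real" where
  "rooted_sum D K x lam = (\<Sum>(\<rho>, \<sigma>, \<alpha>, lab)\<in>rooted_maps D K x. edge_wt D \<alpha> (\<lambda>d. lam (lab d)))"

definition closed_sum :: "'a set \<Rightarrow> 'b set \<Rightarrow> ('b \<Rightarrow> real) \<Rightarrow> real" where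
  "closed_sum D K lam = (\<Sum>(\<sigma>, \<alpha>, lab)\<in>closed_maps D K. edge_wt D \<alpha> (\<lambda>d. lam (lab d)))"

text \<open>The inner sum is minus the logarithmic derivative of the edge weight in \<open>lam x\<close>.\<close>

definition marked_sum :: "'a set \<Rightarrow> 'b set \<Rightarrow> 'b \<Rightarrow> ('b \<Rightarrow> real) \<Rightarrow> real" where
  "marked_sum D K x lam = (\<Sum>(\<sigma>, \<alpha>, lab)\<in>closed_maps D K. edge_wt D \<alpha> (\<lambda>d. lam (lab d)) *
     (\<Sum>k\<in>{k\<in>D. lab k = x}. 1 / (lam x + lam (lab (\<alpha> k)))))"

lemma rooted_sum_card:
  fixes D D' :: "'a set"
  assumes "finite D" "finite D'" "card D = card D'"
  shows "rooted_sum D K x lam = rooted_sum D' K x lam"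
  unfolding rooted_sum_def
proof (rule sum_conj_eq[OF assms, where T = "\<lambda>f (\<rho>, \<sigma>, \<alpha>, lab). (f \<rho>, f \<circ> \<sigma> \<circ> f, f \<circ> \<alpha> \<circ> f, lab \<circ> f)"])
  fix f :: "'a \<Rightarrow> 'a" and D :: "'a set" and m :: "'a \<times> ('a \<Rightarrow> 'a) \<times> ('a \<Rightarrow> 'a) \<times> ('a \<Rightarrow> 'b)"
  assume ff: "\<And>d. f (f d) = d" and m: "m \<in> rooted_maps D K x"
  obtain \<rho> \<sigma> \<alpha> lab where mm: "m = (\<rho>, \<sigma>, \<alpha>, lab)" by (cases m)
  have M: "cubic_map D {\<rho>} \<sigma> \<alpha>" "face_lab D (\<sigma> \<circ> \<alpha>) K lab" "lab \<rho> = x" using m by (auto simp: mm rooted_maps_def)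
  have e: "(f \<circ> \<sigma> \<circ> f) \<circ> (f \<circ> \<alpha> \<circ> f) = f \<circ> (\<sigma> \<circ> \<alpha>) \<circ> f" using ff by auto
  have "face_lab (f ` D) ((f \<circ> \<sigma> \<circ> f) \<circ> (f \<circ> \<alpha> \<circ> f)) K (lab \<circ> f)"
    unfolding e by (rule face_lab_conj[OF ff M(2)])
  moreover have "cubic_map (f ` D) {f \<rho>} (f \<circ> \<sigma> \<circ> f) (f \<circ> \<alpha> \<circ> f)"
    using cubic_map_conj[OF ff M(1)] by simp
  moreover have "edge_wt (f ` D) (f \<circ> \<alpha> \<circ> f) (\<lambda>d. lam ((lab \<circ> f) d)) = edge_wt D \<alpha> (\<lambda>d. lam (lab d))"
    using edge_wt_conj[OF ff, where v = "\<lambda>d. lam (lab d)"] by (simp add: comp_def)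
  moreover have "f \<circ> (f \<circ> g \<circ> f) \<circ> f = g" "lab \<circ> f \<circ> f = lab" for g using ff by (auto simp: fun_eq_iff)
  ultimately show "(case m of (\<rho>, \<sigma>, \<alpha>, lab) \<Rightarrow> (f \<rho>, f \<circ> \<sigma> \<circ> f, f \<circ> \<alpha> \<circ> f, lab \<circ> f)) \<in> rooted_maps (f ` D) K x \<and>
     (case (case m of (\<rho>, \<sigma>, \<alpha>, lab) \<Rightarrow> (f \<rho>, f \<circ> \<sigma> \<circ> f, f \<circ> \<alpha> \<circ> f, lab \<circ> f)) of (\<rho>, \<sigma>, \<alpha>, lab) \<Rightarrow>
        edge_wt (f ` D) \<alpha> (\<lambda>d. lam (lab d))) = (case m of (\<rho>, \<sigma>, \<alpha>, lab) \<Rightarrow> edge_wt D \<alpha> (\<lambda>d. lam (lab d))) \<and>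
     (case (case m of (\<rho>, \<sigma>, \<alpha>, lab) \<Rightarrow> (f \<rho>, f \<circ> \<sigma> \<circ> f, f \<circ> \<alpha> \<circ> f, lab \<circ> f)) of (\<rho>, \<sigma>, \<alpha>, lab) \<Rightarrow>
        (f \<rho>, f \<circ> \<sigma> \<circ> f, f \<circ> \<alpha> \<circ> f, lab \<circ> f)) = m"
    unfolding mm using M(3) ff by (simp add: rooted_maps_def)
qed

lemma marked_sum_card:
  fixes D D' :: "'a set"
  assumes "finite D" "finite D'" "card D = card D'"
  shows "marked_sum D K x lam = marked_sum D' K x lam"
  unfolding marked_sum_def
proof (rule sum_conj_eq[OF assms, where T = "\<lambda>f (\<sigma>, \<alpha>, lab). (f \<circ> \<sigma> \<circ> f, f \<circ> \<alpha> \<circ> f, lab \<circ> f)"])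
  fix f :: "'a \<Rightarrow> 'a" and D :: "'a set" and m :: "('a \<Rightarrow> 'a) \<times> ('a \<Rightarrow> 'a) \<times> ('a \<Rightarrow> 'b)"
  assume ff: "\<And>d. f (f d) = d" and m: "m \<in> closed_maps D K"
  obtain \<sigma> \<alpha> lab where mm: "m = (\<sigma>, \<alpha>, lab)" by (cases m)
  have M: "cubic_map D {} \<sigma> \<alpha>" "face_lab D (\<sigma> \<circ> \<alpha>) K lab" using m by (auto simp: mm closed_maps_def)
  have e: "(f \<circ> \<sigma> \<circ> f) \<circ> (f \<circ> \<alpha> \<circ> f) = f \<circ> (\<sigma> \<circ> \<alpha>) \<circ> f" using ff by auto
  have "face_lab (f ` D) ((f \<circ> \<sigma> \<circ> f) \<circ> (f \<circ> \<alpha> \<circ> f)) K (lab \<circ> f)"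
    unfolding e by (rule face_lab_conj[OF ff M(2)])
  moreover have "cubic_map (f ` D) {} (f \<circ> \<sigma> \<circ> f) (f \<circ> \<alpha> \<circ> f)"
    using cubic_map_conj[OF ff M(1)] by simp
  moreover have "edge_wt (f ` D) (f \<circ> \<alpha> \<circ> f) (\<lambda>d. lam ((lab \<circ> f) d)) = edge_wt D \<alpha> (\<lambda>d. lam (lab d))"
    using edge_wt_conj[OF ff, where v = "\<lambda>d. lam (lab d)"] by (simp add: comp_def)
  moreover have "f \<circ> (f \<circ> g \<circ> f) \<circ> f = g" "lab \<circ> f \<circ> f = lab" for g using ff by (auto simp: fun_eq_iff)
  moreover have "(\<Sum>k\<in>{k\<in>f ` D. (lab \<circ> f) k = x}. 1 / (lam x + lam ((lab \<circ> f) ((f \<circ> \<alpha> \<circ> f) k)))) =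
     (\<Sum>k\<in>{k\<in>D. lab k = x}. 1 / (lam x + lam (lab (\<alpha> k))))"
    by (rule sum.reindex_bij_witness[of _ f f]) (auto simp: ff)
  ultimately show "(case m of (\<sigma>, \<alpha>, lab) \<Rightarrow> (f \<circ> \<sigma> \<circ> f, f \<circ> \<alpha> \<circ> f, lab \<circ> f)) \<in> closed_maps (f ` D) K \<and>
     (case (case m of (\<sigma>, \<alpha>, lab) \<Rightarrow> (f \<circ> \<sigma> \<circ> f, f \<circ> \<alpha> \<circ> f, lab \<circ> f)) of (\<sigma>, \<alpha>, lab) \<Rightarrow>
        edge_wt (f ` D) \<alpha> (\<lambda>d. lam (lab d)) * (\<Sum>k\<in>{k\<in>f ` D. lab k = x}. 1 / (lam x + lam (lab (\<alpha> k))))) =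
     (case m of (\<sigma>, \<alpha>, lab) \<Rightarrow> edge_wt D \<alpha> (\<lambda>d. lam (lab d)) * (\<Sum>k\<in>{k\<in>D. lab k = x}. 1 / (lam x + lam (lab (\<alpha> k))))) \<and>
     (case (case m of (\<sigma>, \<alpha>, lab) \<Rightarrow> (f \<circ> \<sigma> \<circ> f, f \<circ> \<alpha> \<circ> f, lab \<circ> f)) of (\<sigma>, \<alpha>, lab) \<Rightarrow>
        (f \<circ> \<sigma> \<circ> f, f \<circ> \<alpha> \<circ> f, lab \<circ> f)) = m"
    unfolding mm by (simp add: closed_maps_def)
qed

text \<open>Choosing the \<open>n\<close> removed darts in order turns the normalisation by the
  factorial for the large map into the one for the small map.\<close>

lemma sum_distinct_lists_const:
  assumes "finite D" "\<And>xs. length xs = n \<Longrightarrow> distinct xs \<Longrightarrow> set xs \<subseteq> D \<Longrightarrow> g xs = c" "n \<le> card D"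
  shows "(\<Sum>xs\<in>{xs. length xs = n \<and> distinct xs \<and> set xs \<subseteq> D}. g xs) / fact (card D) = (c::real) / fact (card D - n)"
proof -
  have "(\<Sum>xs\<in>{xs. length xs = n \<and> distinct xs \<and> set xs \<subseteq> D}. g xs) =
    (\<Sum>xs\<in>{xs. length xs = n \<and> distinct xs \<and> set xs \<subseteq> D}. c)"
    by (rule sum.cong) (use assms(2) in auto)
  also have "\<dots> = real (\<Prod>{card D - n + 1..card D}) * c"
    using card_lists_distinct_length_eq[OF assms(1,3)] by simp
  also have "real (\<Prod>{card D - n + 1..card D}) = fact (card D) / fact (card D - n)"
  proof -
    have "fact (card D) = fact (card D - n) * \<Prod>{card D - n + 1..card D}"
      using assms(3) by (metis fact_eq_fact_times diff_le_self Suc_eq_plus1)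
    then have "real (fact (card D)) = real (fact (card D - n)) * real (\<Prod>{card D - n + 1..card D})"
      by (metis of_nat_mult)
    then show ?thesis by simp
  qed
  finally show ?thesis by simp
qed

lemma finite_distinct_lists: "finite D \<Longrightarrow> finite {xs. length xs = n \<and> distinct xs \<and> set xs \<subseteq> D}"
  by (rule finite_subset[OF _ finite_lists_length_eq[of D n]]) auto

lemma length_4E:
  assumes "length xs = 4" obtains a b c d where "xs = [a, b, c, d]"
  using assms by (auto simp: numeral_eq_Suc length_Suc_conv)

lemma root_vertex:
  assumes M: "cubic_map D {\<rho>} \<sigma> \<alpha>"
  shows "\<alpha> \<rho> \<in> D - {\<rho>}" "\<sigma> (\<alpha> \<rho>) \<noteq> \<alpha> \<rho>"
  using cubic_mapD[OF M] cubic_map_in(1)[OF M] by auto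

text \<open>A loop at the root vertex would, together with the edge of the leaf, make up the whole
  map on only four darts; the bound on \<open>card D\<close> excludes it.\<close>

lemma rooted_unleg:
  assumes M: "cubic_map D {\<rho>} \<sigma> \<alpha>" and L: "face_lab D (\<sigma> \<circ> \<alpha>) K lab" and cD: "card D > 4"
    and s: "s = \<alpha> \<rho>" and q: "q = \<sigma> s" and p: "p = \<sigma> q"
  shows "distinct [p, q, s, \<rho>]" "{p, q, s, \<rho>} \<subseteq> D" "\<alpha> p \<in> D - {p, q, s, \<rho>}"
    and "cubic_map (D - {p, q, s, \<rho>}) {} (unleg_\<sigma> \<sigma> p q s) (unleg_\<alpha> \<alpha> p q s \<rho>)"
    and "face_lab (D - {p, q, s, \<rho>}) (unleg_\<sigma> \<sigma> p q s \<circ> unleg_\<alpha> \<alpha> p q s \<rho>) K (restrict lab (D - {p, q, s, \<rho>}))"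
    and "leg_\<sigma> (unleg_\<sigma> \<sigma> p q s) p q s = \<sigma>"
    and "leg_\<alpha> (unleg_\<alpha> \<alpha> p q s \<rho>) (\<alpha> p) p q s \<rho> = \<alpha>"
    and "lab \<rho> = lab (\<alpha> p)"
    and "lab = (restrict lab (D - {p, q, s, \<rho>}))(p := lab (\<alpha> q), q := lab (\<alpha> p), s := lab (\<alpha> p), \<rho> := lab (\<alpha> p))"
    and "unleg_\<alpha> \<alpha> p q s \<rho> (\<alpha> p) = \<alpha> q" "\<alpha> q \<in> D - {p, q, s, \<rho>}"
proof -
  note D = cubic_mapD[OF M] and I = cubic_map_in[OF M]
  have \<rho>: "\<rho> \<in> D" using D(2) by auto
  have sU: "s \<notin> {\<rho>}" using root_vertex(1)[OF M] s by auto
  have pq: "\<alpha> p \<noteq> q"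
  proof
    assume e: "\<alpha> p = q"
    then have e2: "\<alpha> q = p" using D(3) by auto
    have "{p, q, s, \<rho>} = D"
      by (rule D(7)) (use \<rho> s q p I(1,2,5) D(3,5) e e2 in auto)
    moreover have "card {p, q, s, \<rho>} \<le> 4" by (simp add: card_insert_if)
    ultimately show False using cD by simp
  qed
  note ul = cubic_map_unleg[OF M _ s sU q p pq]
  have ul': "distinct [p, q, s, \<rho>]" "{p, q, s, \<rho>} \<subseteq> D" "\<alpha> p \<in> D - {p, q, s, \<rho>}" "\<alpha> q \<in> D - {p, q, s, \<rho>}"
    "cubic_map (D - {p, q, s, \<rho>}) ({\<rho>} - {\<rho>}) (unleg_\<sigma> \<sigma> p q s) (unleg_\<alpha> \<alpha> p q s \<rho>)"
    "leg_\<sigma> (unleg_\<sigma> \<sigma> p q s) p q s = \<sigma>" "leg_\<alpha> (unleg_\<alpha> \<alpha> p q s \<rho>) (\<alpha> p) p q s \<rho> = \<alpha>"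
    "unleg_\<alpha> \<alpha> p q s \<rho> (\<alpha> p) = \<alpha> q"
    by (rule ul; simp)+
  show "distinct [p, q, s, \<rho>]" "{p, q, s, \<rho>} \<subseteq> D" "\<alpha> p \<in> D - {p, q, s, \<rho>}" "\<alpha> q \<in> D - {p, q, s, \<rho>}"
    "leg_\<sigma> (unleg_\<sigma> \<sigma> p q s) p q s = \<sigma>" "leg_\<alpha> (unleg_\<alpha> \<alpha> p q s \<rho>) (\<alpha> p) p q s \<rho> = \<alpha>"
    "unleg_\<alpha> \<alpha> p q s \<rho> (\<alpha> p) = \<alpha> q" by (fact ul')+
  show M2: "cubic_map (D - {p, q, s, \<rho>}) {} (unleg_\<sigma> \<sigma> p q s) (unleg_\<alpha> \<alpha> p q s \<rho>)" using ul'(5) by simp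
  have D2: "D - {p, q, s, \<rho>} \<union> {p, q, s, \<rho>} = D" using ul'(2) by auto
  have nw: "{p, q, s, \<rho>} \<inter> (D - {p, q, s, \<rho>}) = {}" by auto
  have "face_lab (D - {p, q, s, \<rho>} \<union> {p, q, s, \<rho>}) (leg_\<sigma> (unleg_\<sigma> \<sigma> p q s) p q s \<circ> leg_\<alpha> (unleg_\<alpha> \<alpha> p q s \<rho>) (\<alpha> p) p q s \<rho>) K lab"
    unfolding D2 ul'(6,7) by (rule L)
  note fl = face_lab_unleg[OF cubic_map_cubic[OF M2] ul'(3,1) nw this]
  show "face_lab (D - {p, q, s, \<rho>}) (unleg_\<sigma> \<sigma> p q s \<circ> unleg_\<alpha> \<alpha> p q s \<rho>) K (restrict lab (D - {p, q, s, \<rho>}))"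
    by (rule fl(1))
  show "lab \<rho> = lab (\<alpha> p)" by (rule fl(5))
  show "lab = (restrict lab (D - {p, q, s, \<rho>}))(p := lab (\<alpha> q), q := lab (\<alpha> p), s := lab (\<alpha> p), \<rho> := lab (\<alpha> p))"
    using fl(2-5) ul'(8) face_labD(2)[OF L] by (auto simp: fun_eq_iff extensional_def)
qed

lemma sum_Sigma2:
  assumes "finite A" "\<And>x. x \<in> A \<Longrightarrow> finite (B x)" "\<And>x y. x \<in> A \<Longrightarrow> y \<in> B x \<Longrightarrow> finite (C x y)"
  shows "(\<Sum>b\<in>(SIGMA x:A. SIGMA y:B x. C x y). h b) = (\<Sum>x\<in>A. \<Sum>y\<in>B x. \<Sum>z\<in>C x y. h (x, y, z))"
proof -
  have "(\<Sum>x\<in>A. \<Sum>y\<in>B x. \<Sum>z\<in>C x y. h (x, y, z)) = (\<Sum>x\<in>A. \<Sum>(y, z)\<in>Sigma (B x) (C x). h (x, y, z))"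
    using assms by (intro sum.cong refl sum.Sigma) auto
  also have "\<dots> = (\<Sum>(x, (y, z))\<in>(SIGMA x:A. Sigma (B x) (C x)). h (x, y, z))"
    using assms by (intro sum.Sigma) auto
  finally show ?thesis by (simp add: case_prod_unfold)
qed

text \<open>A map with a leaf on the face \<open>x\<close> amounts to a map without leaves, a dart
  \<open>k\<close> of \<open>x\<close> where the leg is attached, and names for the four new darts.
  The repeated factor of the subdivided edge is the summand of \<open>marked_sum\<close>, and the
  edge to the leaf has \<open>x\<close> on both sides, whence
  \<open>1 / (2 * lam x)\<close>.\<close>

theorem rooted_sum_eq_marked_sum:
  fixes D :: "'a set" and K :: "'b set"
  assumes fD: "finite D" and card: "card D > 4" and fK: "finite K" and x: "x \<in> K"
    and pos: "\<And>i. i \<in> K \<Longrightarrow> lam i > 0"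
  shows "rooted_sum D K x lam =
    (\<Sum>xs\<in>{xs. length xs = 4 \<and> distinct xs \<and> set xs \<subseteq> D}. marked_sum (D - set xs) K x lam / (2 * lam x))"
proof -
  define T where "T = (SIGMA xs : {xs. length xs = 4 \<and> distinct xs \<and> set xs \<subseteq> D}.
     SIGMA m : closed_maps (D - set xs) K. {k \<in> D - set xs. snd (snd m) k = x})"
  define h where "h = (\<lambda>(xs, (\<sigma> :: 'a \<Rightarrow> 'a, \<alpha>, lab), k). edge_wt (D - set xs) \<alpha> (\<lambda>d. lam (lab d)) *
      (1 / (lam x + lam (lab (\<alpha> k)))) / (2 * lam x))"
  define j where "j = (\<lambda>(\<rho> :: 'a, \<sigma> :: 'a \<Rightarrow> 'a, \<alpha> :: 'a \<Rightarrow> 'a, lab :: 'a \<Rightarrow> 'b). let s = \<alpha> \<rho>; q = \<sigma> s; p = \<sigma> q in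
     ([p, q, s, \<rho>], (unleg_\<sigma> \<sigma> p q s, unleg_\<alpha> \<alpha> p q s \<rho>, restrict lab (D - {p, q, s, \<rho>})), \<alpha> p))"
  define i where "i = (\<lambda>(xs :: 'a list, (\<sigma> :: 'a \<Rightarrow> 'a, \<alpha> :: 'a \<Rightarrow> 'a, lab :: 'a \<Rightarrow> 'b), k :: 'a). case xs of [p, q, s, \<rho>] \<Rightarrow>
     (\<rho>, leg_\<sigma> \<sigma> p q s, leg_\<alpha> \<alpha> k p q s \<rho>, lab(p := lab (\<alpha> k), q := lab k, s := lab k, \<rho> := lab k)))"
  have "rooted_sum D K x lam = (\<Sum>b\<in>T. h b)"
    unfolding rooted_sum_def
  proof (rule sum.reindex_bij_witness[of _ i j])
    fix a assume "a \<in> rooted_maps D K x"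
    then obtain \<rho> \<sigma> \<alpha> lab where a: "a = (\<rho>, \<sigma>, \<alpha>, lab)" and M: "cubic_map D {\<rho>} \<sigma> \<alpha>"
      and L: "face_lab D (\<sigma> \<circ> \<alpha>) K lab" and x: "lab \<rho> = x" by (auto simp: rooted_maps_def)
    define s q p where "s = \<alpha> \<rho>" "q = \<sigma> s" "p = \<sigma> q"
    note R = rooted_unleg[OF M L card s_q_p_def]
    have ja: "j a = ([p, q, s, \<rho>], (unleg_\<sigma> \<sigma> p q s, unleg_\<alpha> \<alpha> p q s \<rho>, restrict lab (D - {p, q, s, \<rho>})), \<alpha> p)"
      unfolding a j_def Let_def s_q_p_def by simp
    show "i (j a) = a"
    proof -
      have v: "restrict lab (D - {p, q, s, \<rho>}) (\<alpha> p) = lab (\<alpha> p)"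
        "restrict lab (D - {p, q, s, \<rho>}) (\<alpha> q) = lab (\<alpha> q)" using R(3,11) by auto
      show ?thesis
        unfolding ja unfolding i_def a prod.case list.case
        by (simp only: v R(6,7,10) R(9)[symmetric])
    qed
    show "j a \<in> T"
      unfolding ja T_def closed_maps_def using R(1-5,8) x by simp
    define D2 \<alpha>2 lab2 where "D2 = D - {p, q, s, \<rho>}" and "\<alpha>2 = unleg_\<alpha> \<alpha> p q s \<rho>" and "lab2 = restrict lab D2"
    have kD: "\<alpha> p \<in> D2" "\<alpha> q \<in> D2" "\<alpha>2 (\<alpha> p) = \<alpha> q" using R(3,10,11) by (auto simp: D2_def \<alpha>2_def)
    note M2 = R(4)[folded D2_def \<alpha>2_def]
    have lx: "lab (\<alpha> p) = x" "lab s = x" "lab q = x" "lab p = lab (\<alpha> q)"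
      using R(8) x fun_cong[OF R(9), of s] fun_cong[OF R(9), of q] fun_cong[OF R(9), of p] R(1) by auto
    have "edge_wt D \<alpha> (\<lambda>d. lam (lab d)) = edge_wt (D2 \<union> {p, q, s, \<rho>}) (leg_\<alpha> \<alpha>2 (\<alpha> p) p q s \<rho>) (\<lambda>d. lam (lab d))"
      using R(2,7) by (auto simp: D2_def \<alpha>2_def intro!: arg_cong[of _ _ "\<lambda>D. edge_wt D \<alpha> _"])
    also have "\<dots> = edge_wt (D2 - {\<alpha> p, \<alpha>2 (\<alpha> p)}) \<alpha>2 (\<lambda>d. lam (lab d)) /
        ((lam (lab (\<alpha> p)) + lam (lab p)) * (lam (lab (\<alpha> q)) + lam (lab q)) * (lam (lab s) + lam (lab \<rho>)))"
      using edge_wt_leg[OF cubic_map_cubic[OF M2] kD(1) R(1), of "\<lambda>d. lam (lab d)"] kD(3) by (simp add: D2_def)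
    also have "edge_wt (D2 - {\<alpha> p, \<alpha>2 (\<alpha> p)}) \<alpha>2 (\<lambda>d. lam (lab d)) = edge_wt (D2 - {\<alpha> p, \<alpha>2 (\<alpha> p)}) \<alpha>2 (\<lambda>d. lam (lab2 d))"
      by (rule edge_wt_cong) (use cubic_map_in(1,9)[OF M2] cubic_mapD(3)[OF M2] in \<open>auto simp: lab2_def\<close>)
    finally have w1: "edge_wt D \<alpha> (\<lambda>d. lam (lab d)) = edge_wt (D2 - {\<alpha> p, \<alpha>2 (\<alpha> p)}) \<alpha>2 (\<lambda>d. lam (lab2 d)) /
        ((lam x + lam (lab (\<alpha> q))) * (lam (lab (\<alpha> q)) + lam x) * (lam x + lam x))" using x by (simp add: lx)
    have "edge_wt D2 \<alpha>2 (\<lambda>d. lam (lab2 d)) = 1 / (lam x + lam (lab (\<alpha> q))) * edge_wt (D2 - {\<alpha> p, \<alpha>2 (\<alpha> p)}) \<alpha>2 (\<lambda>d. lam (lab2 d))"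
      using edge_wt_split[OF cubic_map_cubic[OF M2] kD(1), of "\<lambda>d. lam (lab2 d)"] kD lx by (simp add: lab2_def)
    then have "h (j a) = edge_wt D \<alpha> (\<lambda>d. lam (lab d))"
      unfolding ja h_def w1 using kD by (simp add: D2_def[symmetric] \<alpha>2_def[symmetric] lab2_def[symmetric]) (simp add: lab2_def add.commute)
    then show "h (j a) = (case a of (\<rho>, \<sigma>, \<alpha>, lab) \<Rightarrow> edge_wt D \<alpha> (\<lambda>d. lam (lab d)))" by (simp add: a)
  next
    fix b assume b: "b \<in> T"
    obtain xs \<sigma> \<alpha> lab k where b': "b = (xs, (\<sigma>, \<alpha>, lab), k)" by (metis prod.collapse)
    obtain p q s \<rho> where xs: "xs = [p, q, s, \<rho>]" using b b' by (auto simp: T_def elim: length_4E)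
    define D2 where "D2 = D - {p, q, s, \<rho>}"
    have dist: "distinct [p, q, s, \<rho>]" "{p, q, s, \<rho>} \<subseteq> D" and M: "cubic_map D2 {} \<sigma> \<alpha>"
      and L: "face_lab D2 (\<sigma> \<circ> \<alpha>) K lab" and k: "k \<in> D2" "lab k = x"
      using b unfolding b' xs T_def closed_maps_def D2_def by auto
    have D: "D = D2 \<union> {p, q, s, \<rho>}" using dist(2) by (auto simp: D2_def)
    have nw: "{p, q, s, \<rho>} \<inter> D2 = {}" by (auto simp: D2_def)
    note u = unleg_leg[OF M k(1) dist(1) nw]
    have kk: "\<alpha> k \<in> D2" using k cubic_map_in(1)[OF M] by simp
    define l where "l = lab(p := lab (\<alpha> k), q := lab k, s := lab k, \<rho> := lab k)"
    have ib: "i b = (\<rho>, leg_\<sigma> \<sigma> p q s, leg_\<alpha> \<alpha> k p q s \<rho>, l)"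
      unfolding b' xs i_def l_def by simp
    have rl: "restrict l D2 = lab"
      using nw face_labD(2)[OF L] by (auto simp: l_def fun_eq_iff extensional_def)
    show "j (i b) = b"
      unfolding ib unfolding j_def b' xs using u rl by (simp add: Let_def D2_def)
    have "l \<rho> = x" using k by (simp add: l_def)
    then show "i b \<in> rooted_maps D K x"
      unfolding ib rooted_maps_def using cubic_map_leg[OF M k(1) dist(1) nw]
        face_lab_leg[OF cubic_map_cubic[OF M] k(1) dist(1) nw L] by (simp add: D l_def)
  qed
  also have "\<dots> = (\<Sum>xs\<in>{xs. length xs = 4 \<and> distinct xs \<and> set xs \<subseteq> D}. \<Sum>m\<in>closed_maps (D - set xs) K.
     \<Sum>k\<in>{k \<in> D - set xs. snd (snd m) k = x}. h (xs, m, k))"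
    unfolding T_def using fD fK finite_distinct_lists[OF fD, of 4]
    by (intro sum_Sigma2) (auto simp: finite_closed_maps)
  also have "\<dots> = (\<Sum>xs\<in>{xs. length xs = 4 \<and> distinct xs \<and> set xs \<subseteq> D}. marked_sum (D - set xs) K x lam / (2 * lam x))"
    unfolding marked_sum_def sum_divide_distrib h_def
    by (intro sum.cong refl) (auto simp: sum_distrib_left sum_divide_distrib intro!: sum.cong)
  finally show ?thesis .
qed

section \<open>Separating root vertices\<close>

text \<open>The face walk when the leaves \<open>r1\<close> and \<open>r2\<close> are fused to a
  vertex of degree two: \<open>\<sigma>\<close> fixes both, so composing with the transposition
  creates the cycle. These are the faces of the joined map with the edge to the leaf
  \<open>\<rho>\<close> erased.\<close>

abbreviation bivalent :: "'a \<Rightarrow> 'a \<Rightarrow> ('a \<Rightarrow> 'a) \<Rightarrow> ('a \<Rightarrow> 'a) \<Rightarrow> 'a \<Rightarrow> 'a" where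
  "bivalent r1 r2 \<sigma> \<alpha> \<equiv> (\<lambda>d. Transposition.transpose r1 r2 (\<sigma> (\<alpha> d)))"

lemma bivalent_face:
  assumes C: "cubic D {r1, r2} \<sigma> \<alpha>" and r12: "r1 \<noteq> r2"
  defines "\<psi> \<equiv> bivalent r1 r2 \<sigma> \<alpha>"
  shows "\<psi> (\<alpha> r1) = r2" "\<psi> (\<alpha> r2) = r1" "d \<noteq> \<alpha> r1 \<Longrightarrow> d \<noteq> \<alpha> r2 \<Longrightarrow> \<psi> d = \<sigma> (\<alpha> d)"
    "\<psi> d \<in> D \<longleftrightarrow> d \<in> D" "\<psi> d = \<psi> d' \<longleftrightarrow> d = d'"
proof -
  note D = cubicD[OF C] and I = cubic_in[OF C]
  have r: "\<sigma> r1 = r1" "\<sigma> r2 = r2" "r1 \<in> D" "r2 \<in> D" using I(5) D(2) by auto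
  show "\<psi> (\<alpha> r1) = r2" "\<psi> (\<alpha> r2) = r1" using r D(3) by (simp_all add: \<psi>_def)
  show "\<psi> d = \<sigma> (\<alpha> d)" if "d \<noteq> \<alpha> r1" "d \<noteq> \<alpha> r2"
  proof -
    have *: "d = \<alpha> t" if "\<sigma> (\<alpha> d) = t" "\<sigma> t = t" for t
    proof -
      have "\<sigma> (\<alpha> d) = \<sigma> t" using that by simp
      then show ?thesis by (rule iffD1[OF I(9), OF iffD1[OF I(4)]])
    qed
    have "\<sigma> (\<alpha> d) \<noteq> r1" "\<sigma> (\<alpha> d) \<noteq> r2" using *[of r1] *[of r2] r(1,2) that by blast+
    then show ?thesis by (simp add: \<psi>_def)
  qed
  show "\<psi> d \<in> D \<longleftrightarrow> d \<in> D"
  proof -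
    have "Transposition.transpose r1 r2 e \<in> D \<longleftrightarrow> e \<in> D" for e
      using r(3,4) by (cases "e = r1"; cases "e = r2") simp_all
    then show ?thesis using I(1,2) by (simp add: \<psi>_def)
  qed
  show "\<psi> d = \<psi> d' \<longleftrightarrow> d = d'"
    unfolding \<psi>_def by (metis I(3,4) transpose_involutory)
qed

text \<open>Compared with the walk through the bivalent vertex, the joined map only has the detour
  from \<open>\<alpha> r2\<close> through \<open>r\<close> and \<open>\<rho>\<close> to
  \<open>r1\<close>, so the faces are the same.\<close>

lemma face_lab_join:
  assumes C: "cubic D {r1, r2} \<sigma> \<alpha>" and r12: "r1 \<noteq> r2" and new: "r \<noteq> \<rho>" "r \<notin> D" "\<rho> \<notin> D"
    and L: "face_lab D (bivalent r1 r2 \<sigma> \<alpha>) K lab"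
  shows "face_lab (D \<union> {r, \<rho>}) (join_\<sigma> \<sigma> r r1 r2 \<circ> join_\<alpha> \<alpha> r \<rho>) K (lab(r := lab r1, \<rho> := lab r1))"
    (is "face_lab ?D ?\<phi> K ?lab")
proof -
  note D = cubicD[OF C] and I = cubic_in[OF C] and Lb = face_labD[OF L]
  note b = bivalent_face[OF C r12]
  note jf = join_face[OF C r12 new]
  have r: "r1 \<in> D" "r2 \<in> D" "\<alpha> r1 \<in> D" "\<alpha> r2 \<in> D" using D(2) I(1) by auto
  define l where "l = ?lab"
  have lD: "l d = lab d" if "d \<in> D" for d using that new by (auto simp: l_def)
  have lr: "l r = lab r1" "l \<rho> = lab r1" using new by (auto simp: l_def)
  have le: "l \<in> extensional ?D" using Lb(2) by (auto simp: l_def extensional_def)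
  have step: "?\<phi> d = bivalent r1 r2 \<sigma> \<alpha> d" if "d \<in> D" "d \<noteq> \<alpha> r2" for d
    using that jf(3,5) b(1,3) unfolding comp_def by metis
  show ?thesis unfolding l_def[symmetric]
  proof (rule face_labI)
    show "l \<in> extensional ?D" by (rule le)
    have "l ` D = lab ` D" using lD by (rule image_cong[OF refl])
    then show "l ` ?D = K" using r Lb(3) lr unfolding image_Un by auto
    show "l (?\<phi> d) = l d" if d: "d \<in> ?D" for d
    proof -
      consider "d = r" | "d = \<rho>" | "d = \<alpha> r2" | "d \<in> D" "d \<noteq> \<alpha> r2" using d by blast
      then show ?thesis
      proof cases
        case 3
        have "lab (\<alpha> r2) = lab r1" using Lb(4)[OF r(4)] b(2) by simp
        then show ?thesis using 3 jf(4) lr lD r by simp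
      next
        case 4
        then have "bivalent r1 r2 \<sigma> \<alpha> d \<in> D" using b(4) by blast
        then show ?thesis using step[OF 4] Lb(4)[OF 4(1)] lD 4(1) by metis
      qed (use jf lr lD r in auto)
    qed
    fix A d d' assume A: "A \<subseteq> ?D" "\<And>x. x \<in> A \<Longrightarrow> ?\<phi> x \<in> A" "d \<in> A" "d' \<in> ?D" "l d' = l d"
    have c: "r \<in> A \<Longrightarrow> \<rho> \<in> A" "\<rho> \<in> A \<Longrightarrow> r1 \<in> A" "\<alpha> r2 \<in> A \<Longrightarrow> r \<in> A"
      using A(2) jf(1,2,4) unfolding comp_def by metis+
    have cl: "bivalent r1 r2 \<sigma> \<alpha> x \<in> A \<inter> D" if x: "x \<in> A \<inter> D" for x
    proof (cases "x = \<alpha> r2")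
      case True then show ?thesis using c x b(2) r by auto
    next
      case False then show ?thesis using A(2)[of x] step[of x] b(4)[of x] x by auto
    qed
    obtain e where e: "e \<in> A \<inter> D" "lab e = l d"
    proof (cases "d \<in> D")
      case True then show ?thesis using that[of d] A(3) lD by auto
    next
      case False
      then have "d = r \<or> d = \<rho>" using A(1,3) by auto
      then show ?thesis using that[of r1] c A(3) lr r by auto
    qed
    have key: "y \<in> A" if "y \<in> D" "lab y = lab e" for y
      using Lb(5)[of "A \<inter> D" e y] cl e(1) that by auto
    show "d' \<in> A"
    proof (cases "d' \<in> D")
      case True then show ?thesis using key lD e A(5) by metis
    next
      case False
      then have d': "d' = r \<or> d' = \<rho>" using A(4) by auto
      have "lab (\<alpha> r2) = lab r1" using Lb(4)[OF r(4)] b(2) by simp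
      then have "\<alpha> r2 \<in> A" using key r(4) d' lr e A(5) by auto
      then show ?thesis using c d' by auto
    qed
  qed
qed

lemma face_lab_unjoin:
  assumes C: "cubic D {r1, r2} \<sigma> \<alpha>" and r12: "r1 \<noteq> r2" and new: "r \<noteq> \<rho>" "r \<notin> D" "\<rho> \<notin> D"
    and L: "face_lab (D \<union> {r, \<rho>}) (join_\<sigma> \<sigma> r r1 r2 \<circ> join_\<alpha> \<alpha> r \<rho>) K lab"
  shows "face_lab D (bivalent r1 r2 \<sigma> \<alpha>) K (restrict lab D)" "lab r = lab r1" "lab \<rho> = lab r1"
proof -
  note D = cubicD[OF C] and I = cubic_in[OF C] and Lb = face_labD[OF L, unfolded comp_def]
  note b = bivalent_face[OF C r12]
  note jf = join_face[OF C r12 new]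
  have r: "r1 \<in> D" "r2 \<in> D" "\<alpha> r1 \<in> D" "\<alpha> r2 \<in> D" using D(2) I(1) by auto
  show lr: "lab r = lab r1" "lab \<rho> = lab r1"
    using Lb(4)[of r] Lb(4)[of \<rho>] jf(1,2) by auto
  have step: "join_\<sigma> \<sigma> r r1 r2 (join_\<alpha> \<alpha> r \<rho> d) = bivalent r1 r2 \<sigma> \<alpha> d" if "d \<in> D" "d \<noteq> \<alpha> r2" for d
    using that jf(3,5) b(1,3) by metis
  have inv: "lab (bivalent r1 r2 \<sigma> \<alpha> d) = lab d" if d: "d \<in> D" for d
  proof (cases "d = \<alpha> r2")
    case True
    then show ?thesis using Lb(4)[of d] d jf(4) b(2) lr by simp
  next
    case False
    then show ?thesis using Lb(4)[of d] d step[OF d] by simp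
  qed
  show "face_lab D (bivalent r1 r2 \<sigma> \<alpha>) K (restrict lab D)"
  proof (rule face_labI)
    show "restrict lab D \<in> extensional D" by simp
    show "restrict lab D ` D = K" using Lb(3) lr r by (auto simp: image_Un)
    show "restrict lab D (bivalent r1 r2 \<sigma> \<alpha> d) = restrict lab D d" if "d \<in> D" for d
      using inv that b(4)[of d] by simp
    fix A d d' assume A: "A \<subseteq> D" "\<And>x. x \<in> A \<Longrightarrow> bivalent r1 r2 \<sigma> \<alpha> x \<in> A" "d \<in> A" "d' \<in> D"
      "restrict lab D d' = restrict lab D d"
    define B where "B = A \<union> {x. \<alpha> r2 \<in> A \<and> x \<in> {r, \<rho>}}"
    have "d' \<in> B"
    proof (rule Lb(5))
      show "B \<subseteq> D \<union> {r, \<rho>}" using A(1) by (auto simp: B_def)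
      show "d \<in> B" "d' \<in> D \<union> {r, \<rho>}" "lab d' = lab d" using A by (auto simp: B_def)
      fix x assume x: "x \<in> B"
      consider "x \<in> A" "x = \<alpha> r2" | "x \<in> A" "x \<noteq> \<alpha> r2" | "\<alpha> r2 \<in> A" "x = r" | "\<alpha> r2 \<in> A" "x = \<rho>"
        using x unfolding B_def by blast
      then show "join_\<sigma> \<sigma> r r1 r2 (join_\<alpha> \<alpha> r \<rho> x) \<in> B"
      proof cases
        case 2 then show ?thesis using step[of x] A(1) A(2)[of x] by (auto simp: B_def)
      next
        case 4 then show ?thesis using jf(2) A(2)[of "\<alpha> r2"] b(2) by (auto simp: B_def)
      qed (simp_all add: jf(1,4) B_def)
    qed
    then show "d' \<in> A" using A(4) new by (auto simp: B_def)
  qed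
qed

lemma edge_wt_join:
  assumes C: "cubic D U \<sigma> \<alpha>" and new: "r \<noteq> \<rho>" "r \<notin> D" "\<rho> \<notin> D"
  shows "edge_wt (D \<union> {r, \<rho>}) (join_\<alpha> \<alpha> r \<rho>) v = edge_wt D \<alpha> v / (v r + v \<rho>)"
proof -
  have E: "(\<lambda>d. {d, join_\<alpha> \<alpha> r \<rho> d}) ` D = (\<lambda>d. {d, \<alpha> d}) ` D"
    by (rule image_cong) (use new in \<open>auto simp: join_\<alpha>_def\<close>)
  have "(\<lambda>d. {d, join_\<alpha> \<alpha> r \<rho> d}) ` (D \<union> {r, \<rho>}) = insert {r, \<rho>} ((\<lambda>d. {d, \<alpha> d}) ` D)"
    unfolding image_Un E using new by (auto simp: join_\<alpha>_def)
  moreover have "{r, \<rho>} \<notin> (\<lambda>d. {d, \<alpha> d}) ` D" using new by auto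
  ultimately show ?thesis unfolding edge_wt_def using cubicD(1)[OF C] new by simp
qed

context
  fixes D A :: "'a set" and r1 r2 \<sigma> \<alpha>
  assumes C: "cubic D {r1, r2} \<sigma> \<alpha>" and A: "A \<subseteq> D" "map_closed \<sigma> \<alpha> A" "r1 \<in> A" "r2 \<in> D - A"
begin

lemma separated_dart:
  "d \<in> A \<Longrightarrow> \<sigma> d \<in> A" "d \<in> A \<Longrightarrow> \<alpha> d \<in> A" "d \<in> D - A \<Longrightarrow> \<sigma> d \<in> D - A" "d \<in> D - A \<Longrightarrow> \<alpha> d \<in> D - A"
  using A(2) map_closed_Diff[OF C A(2)] unfolding map_closed_def by auto

text \<open>The only passages between \<open>A\<close> and the rest lead from
  \<open>\<alpha> r1\<close> to \<open>r2\<close> and from \<open>\<alpha> r2\<close> to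
  \<open>r1\<close>. A face that uses one of them has to come back through the other, so exactly one
  face is shared.\<close>

lemma face_lab_separate:
  assumes L: "face_lab D (bivalent r1 r2 \<sigma> \<alpha>) K lab"
  shows "face_lab A (perm_restrict \<sigma> A \<circ> perm_restrict \<alpha> A) (lab ` A) (restrict lab A)"
    "lab ` A \<inter> lab ` (D - A) = {lab r1}" "lab r2 = lab r1"
proof -
  have r12: "r1 \<noteq> r2" using A by auto
  note D = cubicD[OF C] and I = cubic_in[OF C] and Lb = face_labD[OF L]
  note b = bivalent_face[OF C r12] and cl = separated_dart
  have a: "\<alpha> r1 \<in> A" "\<alpha> r2 \<in> D - A" "\<alpha> r1 \<in> D" "r1 \<in> D" "r2 \<in> D" "\<alpha> r2 \<in> D" using cl A by auto
  have la: "lab (\<alpha> r1) = lab r2" "lab (\<alpha> r2) = lab r1" using Lb(4)[of "\<alpha> r1"] Lb(4)[of "\<alpha> r2"] b(1,2) a by auto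
  have fr: "\<sigma> r1 = r1" "\<sigma> r2 = r2" using I(5) by auto
  have stA: "bivalent r1 r2 \<sigma> \<alpha> d \<in> A" "bivalent r1 r2 \<sigma> \<alpha> d = \<sigma> (\<alpha> d)" if "d \<in> A" "d \<noteq> \<alpha> r1" for d
  proof -
    have "d \<noteq> \<alpha> r2" using that a by blast
    then show "bivalent r1 r2 \<sigma> \<alpha> d = \<sigma> (\<alpha> d)" using b(3)[of d] that by blast
    then show "bivalent r1 r2 \<sigma> \<alpha> d \<in> A" using cl(1)[OF cl(2)[OF that(1)]] by simp
  qed
  have stB: "bivalent r1 r2 \<sigma> \<alpha> d \<in> D - A" if "d \<in> D - A" "d \<noteq> \<alpha> r2" for d
  proof -
    have "d \<noteq> \<alpha> r1" using that a by auto
    then show ?thesis using that b(3)[of d] cl(3)[OF cl(4)[of d]] by simp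
  qed
  text \<open>A face that does not pass through \<open>r1\<close> or \<open>r2\<close> stays on one side.\<close>
  have sideA: "lab d = lab r2" if "d \<in> A" "e \<in> D - A" "lab e = lab d" for d e
  proof (rule ccontr)
    assume n: "lab d \<noteq> lab r2"
    have "e \<in> {y \<in> A. lab y = lab d}"
    proof (rule Lb(5))
      show "{y \<in> A. lab y = lab d} \<subseteq> D" using A(1) by auto
      fix y assume y: "y \<in> {y \<in> A. lab y = lab d}"
      then have "y \<noteq> \<alpha> r1" using n la by auto
      then show "bivalent r1 r2 \<sigma> \<alpha> y \<in> {y \<in> A. lab y = lab d}" using stA y Lb(4)[of y] A(1) by auto
    qed (use that A in auto)
    then show False using that by auto
  qed
  have sideB: "lab e = lab r1" if "d \<in> A" "e \<in> D - A" "lab e = lab d" for d e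
  proof (rule ccontr)
    assume n: "lab e \<noteq> lab r1"
    have "d \<in> {y \<in> D - A. lab y = lab e}"
    proof (rule Lb(5)[of _ e d])
      fix y assume y: "y \<in> {y \<in> D - A. lab y = lab e}"
      then have "y \<noteq> \<alpha> r2" using n la by auto
      then show "bivalent r1 r2 \<sigma> \<alpha> y \<in> {y \<in> D - A. lab y = lab e}" using stB y Lb(4)[of y] by auto
    qed (use that A in auto)
    then show False using that by auto
  qed
  have "lab (\<alpha> r1) = lab r2" by (rule la)
  then have "lab r2 = lab r1" using sideB[of "\<alpha> r1" r2] a A by auto
  then show l12: "lab r2 = lab r1" .
  show "lab ` A \<inter> lab ` (D - A) = {lab r1}"
  proof
    show "lab ` A \<inter> lab ` (D - A) \<subseteq> {lab r1}" using sideB by fastforce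
    show "{lab r1} \<subseteq> lab ` A \<inter> lab ` (D - A)" using A(3,4) l12 by (auto intro: rev_image_eqI)
  qed
  show "face_lab A (perm_restrict \<sigma> A \<circ> perm_restrict \<alpha> A) (lab ` A) (restrict lab A)"
  proof (rule face_labI)
    have ev: "(perm_restrict \<sigma> A \<circ> perm_restrict \<alpha> A) d = \<sigma> (\<alpha> d)" if "d \<in> A" for d
      using that cl by (simp add: perm_restrict_def)
    show "restrict lab A \<in> extensional A" "restrict lab A ` A = lab ` A" by auto
    have inv: "lab (\<sigma> (\<alpha> d)) = lab d" if "d \<in> A" for d
    proof (cases "d = \<alpha> r1")
      case True then show ?thesis using la l12 D(3) fr by simp
    next
      case False then show ?thesis using stA[OF that False] Lb(4)[of d] that A(1) by auto
    qed
    show "restrict lab A ((perm_restrict \<sigma> A \<circ> perm_restrict \<alpha> A) d) = restrict lab A d" if "d \<in> A" for d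
      unfolding ev[OF that] using that inv cl by auto
    fix B d d' assume B: "B \<subseteq> A" "\<And>x. x \<in> B \<Longrightarrow> (perm_restrict \<sigma> A \<circ> perm_restrict \<alpha> A) x \<in> B" "d \<in> B" "d' \<in> A"
      "restrict lab A d' = restrict lab A d"
    have clB: "\<sigma> (\<alpha> x) \<in> B" if "x \<in> B" for x
      using B(2)[OF that] ev[of x] B(1) that by (simp add: subset_iff)
    have ld: "lab d' = lab d" using B by auto
    \<comment> \<open>If the walk on \<open>A\<close> runs through the leaf \<open>r1\<close>, the
      walk of the whole map makes an excursion to the other side at this place; adding that part of
      the root face keeps the set closed.\<close>
    define E where "E = (if \<alpha> r1 \<in> B then {y \<in> D - A. lab y = lab r1} else {})"
    have "d' \<in> B \<union> E"
    proof (rule Lb(5))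
      show "B \<union> E \<subseteq> D" using B(1) A(1) by (auto simp: E_def)
      show "d \<in> B \<union> E" "d' \<in> D" "lab d' = lab d" using B ld A(1) by auto
      fix y assume "y \<in> B \<union> E"
      then consider "y \<in> B" "y = \<alpha> r1" | "y \<in> B" "y \<noteq> \<alpha> r1" | "y = \<alpha> r2" "\<alpha> r1 \<in> B"
        | "y \<in> D - A" "y \<noteq> \<alpha> r2" "lab y = lab r1" "\<alpha> r1 \<in> B" by (auto simp: E_def split: if_splits)
      then show "bivalent r1 r2 \<sigma> \<alpha> y \<in> B \<union> E"
      proof cases
        case 1 then show ?thesis using b(1) A(4) l12 by (auto simp: E_def)
      next
        case 2 then show ?thesis using stA(2)[of y] clB[of y] B(1) by auto
      next
        case 3 then show ?thesis using b(2) clB[of "\<alpha> r1"] D(3) fr by auto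
      next
        case 4 then show ?thesis using stB[of y] Lb(4)[of y] by (auto simp: E_def)
      qed
    qed
    then show "d' \<in> B" using B(4) by (auto simp: E_def split: if_splits)
  qed
qed

text \<open>The bivalent vertex merges the face of \<open>r1\<close> with the face of
  \<open>r2\<close>. Both are labelled \<open>x\<close>, and by \<open>K1 \<inter> K2 = {x}\<close>
  no other label occurs on both sides, so labels still distinguish faces.\<close>

lemma face_lab_glue:
  assumes L1: "face_lab A (perm_restrict \<sigma> A \<circ> perm_restrict \<alpha> A) K1 (restrict lab A)"
    and L2: "face_lab (D - A) (perm_restrict \<sigma> (D - A) \<circ> perm_restrict \<alpha> (D - A)) K2 (restrict lab (D - A))"
    and K: "K1 \<inter> K2 = {x}" and x: "lab r1 = x" "lab r2 = x" and ext: "lab \<in> extensional D"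
  shows "face_lab D (bivalent r1 r2 \<sigma> \<alpha>) (K1 \<union> K2) lab"
proof -
  have r12: "r1 \<noteq> r2" using A by auto
  note D = cubicD[OF C] and I = cubic_in[OF C] and Lb = face_labD[OF L1] face_labD[OF L2]
  note b = bivalent_face[OF C r12] and cl = separated_dart
  have a: "\<alpha> r1 \<in> A" "\<alpha> r2 \<in> D - A" "\<alpha> r1 \<in> D" "r1 \<in> D" "r2 \<in> D" "\<alpha> r2 \<in> D" using cl A by auto
  have ev: "(perm_restrict \<sigma> A \<circ> perm_restrict \<alpha> A) d = \<sigma> (\<alpha> d)" if "d \<in> A" for d
    using that cl by (simp add: perm_restrict_def)
  have ev2: "(perm_restrict \<sigma> (D - A) \<circ> perm_restrict \<alpha> (D - A)) d = \<sigma> (\<alpha> d)" if "d \<in> D - A" for d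
    using that cl(3,4)[of d] cl(3,4)[of "\<alpha> d"] by (simp add: perm_restrict_def)
  have inv: "lab (\<sigma> (\<alpha> d)) = lab d" if "d \<in> D" for d
  proof (cases "d \<in> A")
    case True
    then show ?thesis using Lb(4)[OF True] ev[OF True] cl by simp
  next
    case False
    then have d: "d \<in> D - A" using that by simp
    show ?thesis using Lb(9)[OF d] ev2[OF d] cl(3)[OF cl(4)[OF d]] d by simp
  qed
  have im: "lab ` A = K1" "lab ` (D - A) = K2" using Lb(3,8) by auto
  have fr: "\<sigma> r1 = r1" "\<sigma> r2 = r2" using I(5) by auto
  have la: "lab (\<alpha> r1) = x" "lab (\<alpha> r2) = x" using inv[of "\<alpha> r1"] inv[of "\<alpha> r2"] a D(3) fr x by auto
  show ?thesis
  proof (rule face_labI)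
    show "lab \<in> extensional D" by (rule ext)
    show "lab ` D = K1 \<union> K2" using im A(1) by auto
    show "lab (bivalent r1 r2 \<sigma> \<alpha> d) = lab d" if "d \<in> D" for d
      using b inv[OF that] la x by (cases "d = \<alpha> r1 \<or> d = \<alpha> r2") auto
    fix B d d' assume B: "B \<subseteq> D" "\<And>y. y \<in> B \<Longrightarrow> bivalent r1 r2 \<sigma> \<alpha> y \<in> B" "d \<in> B" "d' \<in> D" "lab d' = lab d"
    have c: "\<alpha> r1 \<in> B \<Longrightarrow> r2 \<in> B" "\<alpha> r2 \<in> B \<Longrightarrow> r1 \<in> B" using B(2) b(1,2) by metis+
    have st: "\<sigma> (\<alpha> y) \<in> B" if "y \<in> B" "y \<noteq> \<alpha> r1" "y \<noteq> \<alpha> r2" for y using B(2) b(3) that by metis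
    \<comment> \<open>Within one side a closed set contains every face that it meets, unless it
      leaves through \<open>\<alpha> r1\<close> and does not come back at \<open>r1\<close>.\<close>
    have keyA: "z \<in> B" if "y \<in> A \<inter> B" "z \<in> A" "lab z = lab y" "lab y \<noteq> x \<or> \<alpha> r1 \<notin> B \<or> r1 \<in> B" for y z
    proof -
      define E where "E = {w \<in> A \<inter> B. lab w = lab y}"
      have "z \<in> E"
      proof (rule Lb(5))
        show "E \<subseteq> A" "y \<in> E" "z \<in> A" using that by (auto simp: E_def)
        show "restrict lab A z = restrict lab A y" using that by auto
        fix w assume w: "w \<in> E"
        then have wA: "w \<in> A" "w \<in> B" "w \<in> D" using A(1) by (auto simp: E_def)
        have "\<sigma> (\<alpha> w) \<in> B"
        proof (cases "w = \<alpha> r1")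
          case True
          then have "lab y = x" using w la by (auto simp: E_def)
          then have "r1 \<in> B" using that(4) True wA by auto
          then show ?thesis using True D(3) fr by simp
        next
          case False
          then show ?thesis using st wA a by blast
        qed
        then show "(perm_restrict \<sigma> A \<circ> perm_restrict \<alpha> A) w \<in> E"
          unfolding ev[OF wA(1)] using w inv[OF wA(3)] cl wA by (auto simp: E_def)
      qed
      then show ?thesis by (simp add: E_def)
    qed
    have keyB: "z \<in> B" if "y \<in> (D - A) \<inter> B" "z \<in> D - A" "lab z = lab y" "lab y \<noteq> x \<or> \<alpha> r2 \<notin> B \<or> r2 \<in> B" for y z
    proof -
      define E where "E = {w \<in> (D - A) \<inter> B. lab w = lab y}"
      have "z \<in> E"
      proof (rule Lb(10))
        show "E \<subseteq> D - A" "y \<in> E" "z \<in> D - A" using that by (auto simp: E_def)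
        show "restrict lab (D - A) z = restrict lab (D - A) y" using that by auto
        fix w assume w: "w \<in> E"
        then have wA: "w \<in> D - A" "w \<in> B" "w \<in> D" by (auto simp: E_def)
        have "\<sigma> (\<alpha> w) \<in> B"
        proof (cases "w = \<alpha> r2")
          case True
          then have "lab y = x" using w la by (auto simp: E_def)
          then have "r2 \<in> B" using that(4) True wA by auto
          then show ?thesis using True D(3) fr by simp
        next
          case False
          then show ?thesis using st wA a by blast
        qed
        then show "(perm_restrict \<sigma> (D - A) \<circ> perm_restrict \<alpha> (D - A)) w \<in> E"
          unfolding ev2[OF wA(1)] using w inv[OF wA(3)] cl(3)[OF cl(4)[OF wA(1)]] by (auto simp: E_def)
      qed
      then show ?thesis by (simp add: E_def)
    qed
    \<comment> \<open>On the merged face each side ends in its own exit, and each exit leads to the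
      entrance of the other side; so a closed set that meets this face passes both exits.\<close>
    have all: "\<alpha> r1 \<in> B \<and> \<alpha> r2 \<in> B" if y: "y \<in> B" "lab y = x" for y
    proof (cases "y \<in> A")
      case True
      have 1: "\<alpha> r1 \<in> B" using keyA[of y "\<alpha> r1"] True y la a by auto
      then have "\<alpha> r2 \<in> B" using keyB[of r2 "\<alpha> r2"] c x la a A(4) by auto
      then show ?thesis using 1 by simp
    next
      case False
      then have y': "y \<in> (D - A) \<inter> B" using y B(1) by auto
      have 1: "\<alpha> r2 \<in> B" using keyB[of y "\<alpha> r2"] y' y la a by auto
      then have "\<alpha> r1 \<in> B" using keyA[of r1 "\<alpha> r1"] c x la a A(3) by auto
      then show ?thesis using 1 by simp
    qed
    show "d' \<in> B"
    proof (cases "lab d = x")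
      case True
      then have "r1 \<in> B" "r2 \<in> B" using all[OF B(3)] c by auto
      then show ?thesis using keyA[of r1 d'] keyB[of r2 d'] A(3,4) x True B(4,5) by auto
    next
      case False
      have "d \<in> A \<longleftrightarrow> d' \<in> A"
        using False im K B(1,3,4,5) by (metis DiffI IntI imageI singletonD subset_iff)
      then show ?thesis using keyA[of d d'] keyB[of d d'] False B by auto
    qed
  qed
qed

end

lemma edge_wt_Un:
  assumes "finite A" "finite B" "A \<inter> B = {}" "\<And>d. d \<in> A \<Longrightarrow> \<alpha> d \<in> A" "\<And>d. d \<in> B \<Longrightarrow> \<alpha> d \<in> B"
  shows "edge_wt (A \<union> B) \<alpha> v = edge_wt A \<alpha> v * edge_wt B \<alpha> v"
  unfolding edge_wt_def image_Un
proof (rule prod.union_disjoint)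
  show "(\<lambda>d. {d, \<alpha> d}) ` A \<inter> (\<lambda>d. {d, \<alpha> d}) ` B = {}"
  proof (rule ccontr)
    assume "(\<lambda>d. {d, \<alpha> d}) ` A \<inter> (\<lambda>d. {d, \<alpha> d}) ` B \<noteq> {}"
    then obtain a b where ab: "a \<in> A" "b \<in> B" "{a, \<alpha> a} = {b, \<alpha> b}" by blast
    then have "a \<in> B" using assms(5)[OF ab(2)] by (auto simp: doubleton_eq_iff)
    then show False using ab(1) assms(3) by auto
  qed
qed (use assms in auto)

lemma edge_wt_cong2:
  "D = D' \<Longrightarrow> (\<And>d. d \<in> D \<Longrightarrow> \<alpha> d = \<alpha>' d) \<Longrightarrow> (\<And>d. d \<in> D \<Longrightarrow> v d = v' d) \<Longrightarrow> (\<And>d. d \<in> D \<Longrightarrow> \<alpha> d \<in> D)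
    \<Longrightarrow> edge_wt D \<alpha> v = edge_wt D' \<alpha>' v'"
  unfolding edge_wt_def
  by (intro prod.cong image_cong arg_cong[of _ _ "\<lambda>x. 1 / x"] sum.cong refl) auto

text \<open>Each permutation fixes the darts of the other piece, so composing them superposes the
  two maps.\<close>

lemma cubic_glue:
  assumes M1: "cubic_map D1 {r1} \<sigma>1 \<alpha>1" and M2: "cubic_map D2 {r2} \<sigma>2 \<alpha>2" and disj: "D1 \<inter> D2 = {}"
  defines "\<sigma> \<equiv> \<sigma>1 \<circ> \<sigma>2" and "\<alpha> \<equiv> \<alpha>1 \<circ> \<alpha>2" and "D \<equiv> D1 \<union> D2"
  shows "cubic D {r1, r2} \<sigma> \<alpha>" "map_closed \<sigma> \<alpha> D1"
    and "perm_restrict \<sigma> D1 = \<sigma>1" "perm_restrict \<alpha> D1 = \<alpha>1" "perm_restrict \<sigma> D2 = \<sigma>2" "perm_restrict \<alpha> D2 = \<alpha>2"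
    and "A \<subseteq> D \<Longrightarrow> A \<noteq> {} \<Longrightarrow> map_closed \<sigma> \<alpha> A \<Longrightarrow> r1 \<in> A \<or> r2 \<in> A"
    and "map_closed \<sigma> \<alpha> A \<Longrightarrow> r1 \<in> A \<Longrightarrow> A \<subseteq> D \<Longrightarrow> D1 \<subseteq> A"
proof -
  note X = cubic_mapD[OF M1] and I = cubic_map_in[OF M1]
  note Y = cubic_mapD[OF M2] and J = cubic_map_in[OF M2]
  have r: "r1 \<in> D1" "r2 \<in> D2" using X(2) Y(2) by auto
  have v1: "\<sigma> d = \<sigma>1 d" "\<alpha> d = \<alpha>1 d" "\<sigma>1 d \<in> D1" "\<alpha>1 d \<in> D1" if "d \<in> D1" for d
    using that disj I(1,2) J(6,7) by (auto simp: \<sigma>_def \<alpha>_def disjoint_iff)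
  have v2: "\<sigma> d = \<sigma>2 d" "\<alpha> d = \<alpha>2 d" "\<sigma>2 d \<in> D2" "\<alpha>2 d \<in> D2" if "d \<in> D2" for d
  proof -
    have "\<sigma>2 d \<in> D2" "\<alpha>2 d \<in> D2" using that J(1,2) by auto
    moreover from this have "\<sigma>2 d \<notin> D1" "\<alpha>2 d \<notin> D1" using disj by auto
    ultimately show "\<sigma> d = \<sigma>2 d" "\<alpha> d = \<alpha>2 d" "\<sigma>2 d \<in> D2" "\<alpha>2 d \<in> D2"
      using I(6,7) by (simp_all add: \<sigma>_def \<alpha>_def)
  qed
  have v3: "\<sigma> d = d" "\<alpha> d = d" "d \<notin> D1" "d \<notin> D2" if "d \<notin> D" for d
    using that I(6,7) J(6,7) by (auto simp: \<sigma>_def \<alpha>_def D_def)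
  have cases: "(d \<in> D1 \<Longrightarrow> d \<notin> D2 \<Longrightarrow> P) \<Longrightarrow> (d \<in> D2 \<Longrightarrow> d \<notin> D1 \<Longrightarrow> P) \<Longrightarrow> (d \<notin> D \<Longrightarrow> P) \<Longrightarrow> P" for d P
    using disj by (auto simp: D_def)
  show "cubic D {r1, r2} \<sigma> \<alpha>"
  proof (rule cubicI)
    show "finite D" "{r1, r2} \<subseteq> D" using X(1) Y(1) r by (auto simp: D_def)
    show "\<alpha> (\<alpha> d) = d" for d by (rule cases[of d]) (simp_all add: v1 v2 v3 X(3) Y(3))
    show "\<sigma> (\<sigma> (\<sigma> d)) = d" for d by (rule cases[of d]) (simp_all add: v1 v2 v3 X(5) Y(5))
    have DI: "d \<in> D1 \<Longrightarrow> d \<in> D" "d \<in> D2 \<Longrightarrow> d \<in> D" for d by (simp_all add: D_def)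
    show "\<alpha> d \<noteq> d \<longleftrightarrow> d \<in> D" for d
      by (rule cases[of d]) (simp_all add: v1 v2 v3(1,2) X(4) Y(4) DI)
    have r': "d \<in> D1 \<Longrightarrow> d \<noteq> r2" "d \<in> D2 \<Longrightarrow> d \<noteq> r1" for d using r disj by auto
    show "\<sigma> d \<noteq> d \<longleftrightarrow> d \<in> D - {r1, r2}" for d
      by (rule cases[of d]) (simp_all add: v1 v2 v3(1,2) X(6) Y(6) DI r')
  qed
  show "map_closed \<sigma> \<alpha> D1" unfolding map_closed_def using v1 by simp
  show "perm_restrict \<sigma> D1 = \<sigma>1" "perm_restrict \<alpha> D1 = \<alpha>1" "perm_restrict \<sigma> D2 = \<sigma>2" "perm_restrict \<alpha> D2 = \<alpha>2"
    using v1 v2 I(6,7) J(6,7) by (auto simp: perm_restrict_def fun_eq_iff)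
  have s1: "D1 \<subseteq> A" if A: "A \<inter> D1 \<noteq> {}" "map_closed \<sigma> \<alpha> A" for A
  proof -
    have "A \<inter> D1 = D1"
      by (rule X(7)) (use A v1 in \<open>auto simp: map_closed_def\<close>)
    then show ?thesis by auto
  qed
  have s2: "D2 \<subseteq> A" if A: "A \<inter> D2 \<noteq> {}" "map_closed \<sigma> \<alpha> A" for A
  proof -
    have "A \<inter> D2 = D2"
      by (rule Y(7)) (use A v2 in \<open>auto simp: map_closed_def\<close>)
    then show ?thesis by auto
  qed
  show "r1 \<in> A \<or> r2 \<in> A" if "A \<subseteq> D" "A \<noteq> {}" "map_closed \<sigma> \<alpha> A"
    using s1[OF _ that(3)] s2[OF _ that(3)] r that(1,2) unfolding D_def by blast
  show "D1 \<subseteq> A" if "map_closed \<sigma> \<alpha> A" "r1 \<in> A" "A \<subseteq> D" using s1[of A] that r by blast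
qed

text \<open>The component of \<open>r1\<close>, written as a function of the map because the cutting
  below must be the explicit inverse of gluing.\<close>

definition root_comp :: "'a set \<Rightarrow> 'a \<Rightarrow> ('a \<Rightarrow> 'a) \<Rightarrow> ('a \<Rightarrow> 'a) \<Rightarrow> 'a set" where
  "root_comp D r1 \<sigma> \<alpha> = \<Inter> {A. A \<subseteq> D \<and> map_closed \<sigma> \<alpha> A \<and> r1 \<in> A}"

lemma root_comp_eq:
  assumes "A \<subseteq> D" "map_closed \<sigma> \<alpha> A" "r1 \<in> A" "\<And>B. B \<subseteq> D \<Longrightarrow> map_closed \<sigma> \<alpha> B \<Longrightarrow> r1 \<in> B \<Longrightarrow> A \<subseteq> B"
  shows "root_comp D r1 \<sigma> \<alpha> = A"
  unfolding root_comp_def using assms by blast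

text \<open>In a planar map, a root vertex with the same face on all sides separates the map:
  otherwise removing it would leave a connected map with too many faces.\<close>

lemma root_separates:
  assumes M: "cubic_map D {\<rho>} \<sigma> \<alpha>" and L: "face_lab D (\<sigma> \<circ> \<alpha>) K lab" and card: "card D + 8 = 6 * card K"
    and r: "r = \<alpha> \<rho>" "r1 = \<sigma> r" "r2 = \<sigma> r1" and same: "lab r2 = lab \<rho>"
  defines "D' \<equiv> D - {r, \<rho>}" and "\<sigma>' \<equiv> unjoin_\<sigma> \<sigma> r r1 r2" and "\<alpha>' \<equiv> unjoin_\<alpha> \<alpha> r \<rho>"
  defines "A \<equiv> root_comp D' r1 \<sigma>' \<alpha>'"
  shows "A \<subseteq> D'" "map_closed \<sigma>' \<alpha>' A" "r1 \<in> A" "r2 \<in> D' - A"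
    and "cubic_map A {r1} (perm_restrict \<sigma>' A) (perm_restrict \<alpha>' A)"
    and "cubic_map (D' - A) {r2} (perm_restrict \<sigma>' (D' - A)) (perm_restrict \<alpha>' (D' - A))"
    and "face_lab A (perm_restrict \<sigma>' A \<circ> perm_restrict \<alpha>' A) (lab ` A) (restrict lab A)"
    and "face_lab (D' - A) (perm_restrict \<sigma>' (D' - A) \<circ> perm_restrict \<alpha>' (D' - A)) (lab ` (D' - A)) (restrict lab (D' - A))"
    and "lab ` A \<inter> lab ` (D' - A) = {lab \<rho>}" "lab ` A \<union> lab ` (D' - A) = K" "lab r1 = lab \<rho>" "lab r = lab \<rho>"
proof -
  have rne: "\<sigma> r \<noteq> r" using root_vertex(2)[OF M] r(1) by simp
  note uj = cubic_unjoin[OF M r(1) rne r(2,3)]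
  have C: "cubic D' {r1, r2} \<sigma>' \<alpha>'" using uj(4) by (simp add: D'_def \<sigma>'_def \<alpha>'_def)
  have conn: "B \<subseteq> D' \<Longrightarrow> B \<noteq> {} \<Longrightarrow> map_closed \<sigma>' \<alpha>' B \<Longrightarrow> r1 \<in> B \<or> r2 \<in> B" for B
    unfolding D'_def \<sigma>'_def \<alpha>'_def by (rule uj(5))
  have DD: "D = D' \<union> {r, \<rho>}" "r \<notin> D'" "\<rho> \<notin> D'" using uj(2) by (auto simp: D'_def)
  have r12: "r1 \<noteq> r2" "r \<noteq> \<rho>" using uj(1) by auto
  have cD: "card D = card D' + 2"
    using cubicD(1)[OF C] DD(2,3) r12 by (subst DD(1)) (simp add: card_insert_if)
  have sj: "\<sigma> = join_\<sigma> \<sigma>' r r1 r2" "\<alpha> = join_\<alpha> \<alpha>' r \<rho>" using uj(6,7) by (simp_all add: \<sigma>'_def \<alpha>'_def)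
  have "face_lab (D' \<union> {r, \<rho>}) (join_\<sigma> \<sigma>' r r1 r2 \<circ> join_\<alpha> \<alpha>' r \<rho>) K lab"
    using L unfolding DD(1)[symmetric] sj[symmetric] .
  note fu = face_lab_unjoin[OF C r12 DD(2,3) this]
  show l1: "lab r1 = lab \<rho>" "lab r = lab \<rho>" using fu(2,3) by auto
  note b = bivalent_face[OF C r12(1)] and Lb = face_labD[OF fu(1)]
  have rD: "r1 \<in> D'" "r2 \<in> D'" "\<alpha>' r1 \<in> D'" "\<alpha>' r2 \<in> D'" using cubicD(2)[OF C] cubic_in(1)[OF C] by auto
  have la: "lab (\<alpha>' r1) = lab \<rho>" "lab (\<alpha>' r2) = lab \<rho>"
    using Lb(4)[OF rD(3)] Lb(4)[OF rD(4)] b(1,2) rD l1 same by auto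
  have inv: "lab (\<sigma>' (\<alpha>' d)) = lab d" if d: "d \<in> D'" for d
  proof -
    consider "d = \<alpha>' r1" | "d = \<alpha>' r2" | "d \<noteq> \<alpha>' r1" "d \<noteq> \<alpha>' r2" by blast
    then show ?thesis
    proof cases
      case 3
      have "bivalent r1 r2 \<sigma>' \<alpha>' d \<in> D'" using b(4) d by blast
      then show ?thesis using Lb(4)[OF d] d b(3)[OF 3] by simp
    qed (use la l1 same cubicD(3)[OF C] cubic_in(5)[OF C] in auto)
  qed
  have imK: "lab ` D' = K" using Lb(3) by auto
  obtain B where B: "B \<subseteq> D'" "map_closed \<sigma>' \<alpha>' B" "r1 \<in> B" "r2 \<in> D' - B"
    and M1: "cubic_map B {r1} (perm_restrict \<sigma>' B) (perm_restrict \<alpha>' B)"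
    and M2: "cubic_map (D' - B) {r2} (perm_restrict \<sigma>' (D' - B)) (perm_restrict \<alpha>' (D' - B))"
  proof (rule unjoin_cases[OF C conn])
    \<comment> \<open>With equal labels at \<open>r1\<close> and \<open>r2\<close>,
      \<open>lab\<close> is constant on the faces of the cut map. If that map were connected, then
      \<open>6 * card K\<close> would be at most \<open>card D' + 4 = card D + 2\<close>, but it
      equals \<open>card D + 8\<close>.\<close>
    assume "cubic_map D' {r1, r2} \<sigma>' \<alpha>'"
    then have "6 * card (lab ` D') \<le> card D' + 4" using r12(1) inv by (rule two_leaf_bound)
    then show ?thesis using imK cD card by simp
  qed
  have AB: "A = B" unfolding A_def
  proof (rule root_comp_eq[OF B(1-3)])
    fix E assume E: "E \<subseteq> D'" "map_closed \<sigma>' \<alpha>' E" "r1 \<in> E"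
    have "map_closed (perm_restrict \<sigma>' B) (perm_restrict \<alpha>' B) (E \<inter> B)"
      unfolding map_closed_restrict[OF Int_lower2] using E(2) B(2) by (auto simp: map_closed_def)
    then have "E \<inter> B = B" using M1 E B(3) unfolding cubic_map_def by blast
    then show "B \<subseteq> E" by auto
  qed
  show "A \<subseteq> D'" "map_closed \<sigma>' \<alpha>' A" "r1 \<in> A" "r2 \<in> D' - A"
    "cubic_map A {r1} (perm_restrict \<sigma>' A) (perm_restrict \<alpha>' A)"
    "cubic_map (D' - A) {r2} (perm_restrict \<sigma>' (D' - A)) (perm_restrict \<alpha>' (D' - A))"
    unfolding AB by (fact B M1 M2)+
  note fs = face_lab_separate[OF C B fu(1)]
  have C': "cubic D' {r2, r1} \<sigma>' \<alpha>'" using C by (simp add: insert_commute)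
  have B': "D' - B \<subseteq> D'" "map_closed \<sigma>' \<alpha>' (D' - B)" "r2 \<in> D' - B" "r1 \<in> D' - (D' - B)"
    using B map_closed_Diff[OF C B(2)] by auto
  have "face_lab D' (bivalent r2 r1 \<sigma>' \<alpha>') K (restrict lab D')" using fu(1) by (simp add: transpose_commute)
  note fs' = face_lab_separate(1)[OF C' B' this]
  have e: "restrict (restrict lab D') B = restrict lab B" "restrict lab D' ` B = lab ` B"
    "restrict (restrict lab D') (D' - B) = restrict lab (D' - B)" "restrict lab D' ` (D' - B) = lab ` (D' - B)"
    using B(1) by (auto simp: restrict_def fun_eq_iff image_iff subset_iff intro!: bexI)
  show "face_lab A (perm_restrict \<sigma>' A \<circ> perm_restrict \<alpha>' A) (lab ` A) (restrict lab A)"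
    using fs(1) unfolding AB e .
  show "face_lab (D' - A) (perm_restrict \<sigma>' (D' - A) \<circ> perm_restrict \<alpha>' (D' - A)) (lab ` (D' - A)) (restrict lab (D' - A))"
    using fs' unfolding AB e .
  show "lab ` A \<inter> lab ` (D' - A) = {lab \<rho>}" using fs(2) rD(1) l1 unfolding AB e by simp
  show "lab ` A \<union> lab ` (D' - A) = K" using imK B(1) unfolding AB by auto
qed

lemma length_2E:
  assumes "length xs = 2" obtains a b where "xs = [a, b]"
  using assms by (auto simp: numeral_eq_Suc length_Suc_conv)

lemma sum_Sigma3:
  assumes "finite A" "\<And>x. x \<in> A \<Longrightarrow> finite (B x)" "\<And>x y. x \<in> A \<Longrightarrow> y \<in> B x \<Longrightarrow> finite (C x y)"
    "\<And>x y z. x \<in> A \<Longrightarrow> y \<in> B x \<Longrightarrow> z \<in> C x y \<Longrightarrow> finite (E x y z)"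
  shows "(\<Sum>b\<in>(SIGMA x:A. SIGMA y:B x. SIGMA z:C x y. E x y z). h b) =
    (\<Sum>x\<in>A. \<Sum>y\<in>B x. \<Sum>z\<in>C x y. \<Sum>w\<in>E x y z. h (x, y, z, w))"
proof -
  have "(\<Sum>x\<in>A. \<Sum>y\<in>B x. \<Sum>z\<in>C x y. \<Sum>w\<in>E x y z. h (x, y, z, w)) =
    (\<Sum>x\<in>A. \<Sum>b\<in>(SIGMA y:B x. SIGMA z:C x y. E x y z). h (x, b))"
    using assms by (intro sum.cong refl sum_Sigma2[symmetric]) auto
  also have "\<dots> = (\<Sum>(x, b)\<in>(SIGMA x:A. SIGMA y:B x. SIGMA z:C x y. E x y z). h (x, b))"
    using assms by (intro sum.Sigma) auto
  finally show ?thesis by (simp add: case_prod_unfold)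
qed

text \<open>The root vertex has darts \<open>r\<close>, \<open>r1\<close>, \<open>r2\<close>, and
  the first two always carry the label of the root face. The label of \<open>r2\<close> thus decides
  whether the vertex lies on one face or on two.\<close>

definition third_label :: "('a \<times> ('a \<Rightarrow> 'a) \<times> ('a \<Rightarrow> 'a) \<times> ('a \<Rightarrow> 'b)) \<Rightarrow> 'b" where
  "third_label = (\<lambda>(\<rho>, \<sigma>, \<alpha>, lab). lab (\<sigma> (\<sigma> (\<alpha> \<rho>))))"

theorem rooted_sum_separating:
  fixes D :: "'a set" and K :: "'b set"
  assumes fD: "finite D" and card: "card D + 8 = 6 * card K" and fK: "finite K" and x: "x \<in> K"
    and pos: "\<And>i. i \<in> K \<Longrightarrow> lam i > 0"
  shows "(\<Sum>(\<rho>, \<sigma>, \<alpha>, lab)\<in>{m \<in> rooted_maps D K x. third_label m = x}. edge_wt D \<alpha> (\<lambda>d. lam (lab d))) =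
    (\<Sum>xs\<in>{xs. length xs = 2 \<and> distinct xs \<and> set xs \<subseteq> D}. \<Sum>D1\<in>Pow (D - set xs).
       \<Sum>K1\<in>{K1. K1 \<subseteq> K \<and> x \<in> K1}.
         rooted_sum D1 K1 x lam * rooted_sum (D - set xs - D1) (insert x (K - K1)) x lam / (2 * lam x))"
proof -
  define T where "T = (SIGMA xs : {xs. length xs = 2 \<and> distinct xs \<and> set xs \<subseteq> D}.
     SIGMA D1 : Pow (D - set xs). SIGMA K1 : {K1. K1 \<subseteq> K \<and> x \<in> K1}.
       rooted_maps D1 K1 x \<times> rooted_maps (D - set xs - D1) (insert x (K - K1)) x)"
  define h where "h = (\<lambda>(xs, D1, K1 :: 'b set, (r1 :: 'a, \<sigma>1 :: 'a \<Rightarrow> 'a, \<alpha>1, lab1), (r2 :: 'a, \<sigma>2 :: 'a \<Rightarrow> 'a, \<alpha>2, lab2)).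
     edge_wt D1 \<alpha>1 (\<lambda>d. lam (lab1 d)) * edge_wt (D - set xs - D1) \<alpha>2 (\<lambda>d. lam (lab2 d)) / (2 * lam x))"
  define j where "j = (\<lambda>(\<rho> :: 'a, \<sigma> :: 'a \<Rightarrow> 'a, \<alpha> :: 'a \<Rightarrow> 'a, lab :: 'a \<Rightarrow> 'b).
     let r = \<alpha> \<rho>; r1 = \<sigma> r; r2 = \<sigma> r1; \<sigma>' = unjoin_\<sigma> \<sigma> r r1 r2; \<alpha>' = unjoin_\<alpha> \<alpha> r \<rho>; D' = D - {r, \<rho>};
       A = root_comp D' r1 \<sigma>' \<alpha>'
     in ([r, \<rho>], A, lab ` A, (r1, perm_restrict \<sigma>' A, perm_restrict \<alpha>' A, restrict lab A),
         (r2, perm_restrict \<sigma>' (D' - A), perm_restrict \<alpha>' (D' - A), restrict lab (D' - A))))"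
  define i where "i = (\<lambda>(xs :: 'a list, D1 :: 'a set, K1 :: 'b set,
      (r1 :: 'a, \<sigma>1 :: 'a \<Rightarrow> 'a, \<alpha>1 :: 'a \<Rightarrow> 'a, lab1 :: 'a \<Rightarrow> 'b), (r2 :: 'a, \<sigma>2 :: 'a \<Rightarrow> 'a, \<alpha>2 :: 'a \<Rightarrow> 'a, lab2 :: 'a \<Rightarrow> 'b)).
     case xs of [r, \<rho>] \<Rightarrow> (\<rho>, join_\<sigma> (\<sigma>1 \<circ> \<sigma>2) r r1 r2, join_\<alpha> (\<alpha>1 \<circ> \<alpha>2) r \<rho>,
        (\<lambda>d. if d \<in> D1 then lab1 d else lab2 d)(r := lab1 r1, \<rho> := lab1 r1)))"
  have "(\<Sum>(\<rho>, \<sigma>, \<alpha>, lab)\<in>{m \<in> rooted_maps D K x. third_label m = x}. edge_wt D \<alpha> (\<lambda>d. lam (lab d))) = (\<Sum>b\<in>T. h b)"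
  proof (rule sum.reindex_bij_witness[of _ i j])
    fix a assume "a \<in> {m \<in> rooted_maps D K x. third_label m = x}"
    then obtain \<rho> \<sigma> \<alpha> lab where a: "a = (\<rho>, \<sigma>, \<alpha>, lab)" and M: "cubic_map D {\<rho>} \<sigma> \<alpha>"
      and L: "face_lab D (\<sigma> \<circ> \<alpha>) K lab" and lx: "lab \<rho> = x" "lab (\<sigma> (\<sigma> (\<alpha> \<rho>))) = x"
      by (auto simp: rooted_maps_def third_label_def)
    define r r1 r2 where r: "r = \<alpha> \<rho>" "r1 = \<sigma> r" "r2 = \<sigma> r1"
    define \<sigma>' where "\<sigma>' = unjoin_\<sigma> \<sigma> r r1 r2"
    define \<alpha>' where "\<alpha>' = unjoin_\<alpha> \<alpha> r \<rho>"
    define D' where "D' = D - {r, \<rho>}"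
    define A where "A = root_comp D' r1 \<sigma>' \<alpha>'"
    have l2: "lab r2 = lab \<rho>" using lx by (simp add: r)
    note R = root_separates[OF M L card r l2, folded \<sigma>'_def \<alpha>'_def D'_def, folded A_def]
    have rne: "\<sigma> r \<noteq> r" using root_vertex(2)[OF M] r(1) by simp
    note uj = cubic_unjoin[OF M r(1) rne r(2,3), folded \<sigma>'_def \<alpha>'_def D'_def]
    have ja: "j a = ([r, \<rho>], A, lab ` A, (r1, perm_restrict \<sigma>' A, perm_restrict \<alpha>' A, restrict lab A),
         (r2, perm_restrict \<sigma>' (D' - A), perm_restrict \<alpha>' (D' - A), restrict lab (D' - A)))"
      unfolding a j_def Let_def \<sigma>'_def \<alpha>'_def D'_def A_def r by simp
    note I = cubic_in[OF uj(4)]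
    have cl: "d \<in> A \<Longrightarrow> \<sigma>' d \<in> A \<and> \<alpha>' d \<in> A" for d using R(2) by (auto simp: map_closed_def)
    have cl2: "d \<in> D' - A \<Longrightarrow> \<sigma>' d \<in> D' - A \<and> \<alpha>' d \<in> D' - A" for d
      using map_closed_Diff[OF uj(4) R(2)] by (auto simp: map_closed_def)
    have comp: "perm_restrict \<sigma>' A \<circ> perm_restrict \<sigma>' (D' - A) = \<sigma>'" "perm_restrict \<alpha>' A \<circ> perm_restrict \<alpha>' (D' - A) = \<alpha>'"
      using cl2 R(1) I(6,7) by (auto simp: fun_eq_iff perm_restrict_def)
    have rr: "r \<noteq> \<rho>" "r \<in> D" "\<rho> \<in> D" "r \<notin> D'" "\<rho> \<notin> D'" using uj(1,2) by (auto simp: D'_def)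
    have lab: "(\<lambda>d. if d \<in> A then restrict lab A d else restrict lab (D' - A) d)(r := restrict lab A r1, \<rho> := restrict lab A r1) = lab"
      using R(1,3,11,12) face_labD(2)[OF L] by (auto simp: fun_eq_iff extensional_def D'_def)
    show "i (j a) = a"
      unfolding ja unfolding i_def a prod.case list.case comp lab uj(6,7) ..
    have K2: "lab ` (D' - A) = insert x (K - lab ` A)" using R(9,10) lx(1) by auto
    have K1: "lab ` A \<subseteq> K" "x \<in> lab ` A" using R(9,10) lx(1) by auto
    show "j a \<in> T"
      unfolding ja T_def rooted_maps_def using R(1,3-8,11) K1 rr lx l2
      by (simp add: D'_def[symmetric] K2[symmetric])
    have fin: "finite A" "finite (D' - A)" using cubicD(1)[OF uj(4)] R(1) by (auto intro: finite_subset)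
    have "edge_wt D \<alpha> (\<lambda>d. lam (lab d)) = edge_wt (D' \<union> {r, \<rho>}) (join_\<alpha> \<alpha>' r \<rho>) (\<lambda>d. lam (lab d))"
      unfolding uj(7) using rr by (auto simp: D'_def intro!: arg_cong[of _ _ "\<lambda>D. edge_wt D \<alpha> _"])
    also have "\<dots> = edge_wt D' \<alpha>' (\<lambda>d. lam (lab d)) / (2 * lam x)"
      using edge_wt_join[OF uj(4) rr(1,4,5), of "\<lambda>d. lam (lab d)"] lx R(12) by simp
    also have "edge_wt D' \<alpha>' (\<lambda>d. lam (lab d)) = edge_wt (A \<union> (D' - A)) \<alpha>' (\<lambda>d. lam (lab d))"
      using R(1) by (simp add: Un_absorb1)
    also have "\<dots> = edge_wt A \<alpha>' (\<lambda>d. lam (lab d)) * edge_wt (D' - A) \<alpha>' (\<lambda>d. lam (lab d))"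
      by (rule edge_wt_Un) (use fin cl cl2 in auto)
    also have "edge_wt A \<alpha>' (\<lambda>d. lam (lab d)) = edge_wt A (perm_restrict \<alpha>' A) (\<lambda>d. lam (restrict lab A d))"
      by (rule edge_wt_cong2) (use cl in \<open>auto simp: perm_restrict_def\<close>)
    also have "edge_wt (D' - A) \<alpha>' (\<lambda>d. lam (lab d)) =
      edge_wt (D' - A) (perm_restrict \<alpha>' (D' - A)) (\<lambda>d. lam (restrict lab (D' - A) d))"
      by (rule edge_wt_cong2) (use cl2 in \<open>auto simp: perm_restrict_def\<close>)
    finally show "h (j a) = (case a of (\<rho>, \<sigma>, \<alpha>, lab) \<Rightarrow> edge_wt D \<alpha> (\<lambda>d. lam (lab d)))"
      unfolding ja unfolding h_def a by (simp add: D'_def)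
  next
    fix b assume b: "b \<in> T"
    obtain xs D1 K1 r1 \<sigma>1 \<alpha>1 lab1 r2 \<sigma>2 \<alpha>2 lab2
      where b': "b = (xs, D1, K1, (r1, \<sigma>1, \<alpha>1, lab1), (r2, \<sigma>2, \<alpha>2, lab2))" by (metis prod.collapse)
    obtain r \<rho> where xs: "xs = [r, \<rho>]" using b b' by (auto simp: T_def elim: length_2E)
    define D' where "D' = D - {r, \<rho>}"
    define D2 where "D2 = D' - D1"
    define K2 where "K2 = insert x (K - K1)"
    have rr: "r \<noteq> \<rho>" "r \<in> D" "\<rho> \<in> D" "r \<notin> D'" "\<rho> \<notin> D'" and D1: "D1 \<subseteq> D'" and K1: "K1 \<subseteq> K" "x \<in> K1"
      and M1: "cubic_map D1 {r1} \<sigma>1 \<alpha>1" and L1: "face_lab D1 (\<sigma>1 \<circ> \<alpha>1) K1 lab1" and x1: "lab1 r1 = x"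
      and M2: "cubic_map D2 {r2} \<sigma>2 \<alpha>2" and L2: "face_lab D2 (\<sigma>2 \<circ> \<alpha>2) K2 lab2" and x2: "lab2 r2 = x"
      using b unfolding b' xs T_def rooted_maps_def by (simp_all add: D'_def D2_def K2_def)
    have disj: "D1 \<inter> D2 = {}" and D12: "D1 \<union> D2 = D'" using D1 by (auto simp: D2_def)
    have DD: "D' \<union> {r, \<rho>} = D" using rr by (auto simp: D'_def)
    define \<sigma> where "\<sigma> = \<sigma>1 \<circ> \<sigma>2"
    define \<alpha> where "\<alpha> = \<alpha>1 \<circ> \<alpha>2"
    note G = cubic_glue[OF M1 M2 disj, folded \<sigma>_def \<alpha>_def, unfolded D12]
    have r12: "r1 \<in> D1" "r2 \<in> D' - D1" "r1 \<noteq> r2"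
      using cubic_mapD(2)[OF M1] cubic_mapD(2)[OF M2] by (auto simp: D2_def)
    define l where "l = (\<lambda>d. if d \<in> D1 then lab1 d else lab2 d)"
    have lr: "l r1 = x" "l r2 = x" using r12 x1 x2 by (auto simp: l_def)
    have rl: "restrict l D1 = lab1" "restrict l (D' - D1) = lab2"
      using face_labD(2)[OF L1] face_labD(2)[OF L2] disj by (auto simp: l_def fun_eq_iff extensional_def D2_def)
    have le: "l \<in> extensional D'"
      using face_labD(2)[OF L2] D1 by (auto simp: l_def extensional_def D2_def)
    have K12: "K1 \<inter> K2 = {x}" "K1 \<union> K2 = K" using K1 by (auto simp: K2_def)
    have F: "face_lab D' (bivalent r1 r2 \<sigma> \<alpha>) (K1 \<union> K2) l"
      by (rule face_lab_glue[OF G(1) D1 G(2) r12(1,2) _ _ K12(1) lr le])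
         (use L1 L2 in \<open>simp_all add: rl(1) rl(2)[folded D2_def] G(3-6) D2_def[symmetric]\<close>)
    have M: "cubic_map D {\<rho>} (join_\<sigma> \<sigma> r r1 r2) (join_\<alpha> \<alpha> r \<rho>)"
      using cubic_map_join(1)[OF G(1) r12(3) rr(1,4,5) G(7)] DD by simp
    have FL: "face_lab D (join_\<sigma> \<sigma> r r1 r2 \<circ> join_\<alpha> \<alpha> r \<rho>) K (l(r := x, \<rho> := x))"
      using face_lab_join[OF G(1) r12(3) rr(1,4,5) F] K12 DD lr by simp
    have ib: "i b = (\<rho>, join_\<sigma> \<sigma> r r1 r2, join_\<alpha> \<alpha> r \<rho>, l(r := x, \<rho> := x))"
      unfolding b' xs i_def \<sigma>_def \<alpha>_def l_def by (simp add: x1)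
    have r3: "r1 \<noteq> r" "r1 \<noteq> \<rho>" "r2 \<noteq> r" "r2 \<noteq> \<rho>" using r12 D1 rr by auto
    have jv: "join_\<alpha> \<alpha> r \<rho> \<rho> = r" "join_\<sigma> \<sigma> r r1 r2 r = r1" "join_\<sigma> \<sigma> r r1 r2 r1 = r2"
      using rr r3 r12 by (auto simp: join_\<alpha>_def join_\<sigma>_def)
    have uj: "unjoin_\<sigma> (join_\<sigma> \<sigma> r r1 r2) r r1 r2 = \<sigma>" "unjoin_\<alpha> (join_\<alpha> \<alpha> r \<rho>) r \<rho> = \<alpha>"
      using cubic_map_join(2,3)[OF G(1) r12(3) rr(1,4,5) G(7)] by auto
    have rc: "root_comp D' r1 \<sigma> \<alpha> = D1"
      by (rule root_comp_eq[OF D1 G(2) r12(1)]) (rule G(8))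
    have rl': "restrict (l(r := x, \<rho> := x)) D1 = lab1" "restrict (l(r := x, \<rho> := x)) (D' - D1) = lab2"
      "(l(r := x, \<rho> := x)) ` D1 = K1"
    proof -
      show "restrict (l(r := x, \<rho> := x)) D1 = lab1" "restrict (l(r := x, \<rho> := x)) (D' - D1) = lab2"
        unfolding rl[symmetric] using D1 rr by (auto simp: fun_eq_iff)
      have "(l(r := x, \<rho> := x)) ` D1 = lab1 ` D1"
        by (rule image_cong) (use D1 rr in \<open>auto simp: l_def\<close>)
      then show "(l(r := x, \<rho> := x)) ` D1 = K1" using face_labD(3)[OF L1] by simp
    qed
    show "j (i b) = b"
      unfolding ib unfolding j_def b' xs Let_def prod.case jv uj D'_def[symmetric] rc rl' G(3,4)
      using G(5,6) by (simp add: D2_def)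
    show "i b \<in> {m \<in> rooted_maps D K x. third_label m = x}"
      unfolding ib rooted_maps_def third_label_def using M FL jv lr r3 by simp
  qed
  also have "\<dots> = (\<Sum>xs\<in>{xs. length xs = 2 \<and> distinct xs \<and> set xs \<subseteq> D}. \<Sum>D1\<in>Pow (D - set xs).
       \<Sum>K1\<in>{K1. K1 \<subseteq> K \<and> x \<in> K1}. \<Sum>m\<in>rooted_maps D1 K1 x \<times> rooted_maps (D - set xs - D1) (insert x (K - K1)) x.
         h (xs, D1, K1, m))"
    unfolding T_def
    by (rule sum_Sigma3)
       (use fD fK finite_distinct_lists[OF fD, of 2] in
         \<open>auto intro!: finite_cartesian_product finite_rooted_maps intro: finite_subset\<close>)
  also have "\<dots> = (\<Sum>xs\<in>{xs. length xs = 2 \<and> distinct xs \<and> set xs \<subseteq> D}. \<Sum>D1\<in>Pow (D - set xs).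
       \<Sum>K1\<in>{K1. K1 \<subseteq> K \<and> x \<in> K1}.
         rooted_sum D1 K1 x lam * rooted_sum (D - set xs - D1) (insert x (K - K1)) x lam / (2 * lam x))"
    unfolding rooted_sum_def sum_product sum.cartesian_product sum_divide_distrib h_def case_prod_unfold
    by (intro sum.cong refl) simp
  finally show ?thesis .
qed

section \<open>Root vertices that touch two faces\<close>

text \<open>A set \<open>S\<close> of darts is an initial segment from \<open>a\<close> to \<open>k\<close> of the face \<open>F\<close> of \<open>a\<close>.\<close>

definition face_segment :: "('a \<Rightarrow> 'a) \<Rightarrow> 'a set \<Rightarrow> 'a \<Rightarrow> 'a \<Rightarrow> 'a set \<Rightarrow> bool" where
  "face_segment \<phi> F a k S \<longleftrightarrow> a \<in> S \<and> k \<in> S \<and> S \<subseteq> F \<and>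
     (\<forall>d\<in>S. d \<noteq> k \<longrightarrow> \<phi> d \<in> S \<and> \<phi> d \<noteq> a) \<and> (\<phi> k \<in> S \<longrightarrow> \<phi> k = a) \<and>
     (\<forall>d\<in>F - S. \<phi> d \<in> S \<longrightarrow> \<phi> d = a)"

lemma face_segmentD:
  assumes "face_segment \<phi> F a k S"
  shows "a \<in> S" "k \<in> S" "S \<subseteq> F" "d \<in> S \<Longrightarrow> d \<noteq> k \<Longrightarrow> \<phi> d \<in> S" "d \<in> S \<Longrightarrow> d \<noteq> k \<Longrightarrow> \<phi> d \<noteq> a"
    "\<phi> k \<in> S \<Longrightarrow> \<phi> k = a" "d \<in> F \<Longrightarrow> d \<notin> S \<Longrightarrow> \<phi> d \<in> S \<Longrightarrow> \<phi> d = a"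
  using assms unfolding face_segment_def by auto

text \<open>The removal of a root vertex that touches two faces, seen backwards: a map with one leaf
  \<open>r1\<close> receives a leg at \<open>k\<close> that ends in a second leaf \<open>r2\<close>,
  and then \<open>r1\<close> and \<open>r2\<close> are fused. If \<open>k\<close> lies on the face
  of \<open>r1\<close>, this splits the face into two.\<close>

locale marked_leg =
  fixes D :: "'a set" and r1 \<sigma> \<alpha> k p q s r2
  assumes C: "cubic D {r1} \<sigma> \<alpha>" and k: "k \<in> D" and dist: "distinct [p, q, s, r2]"
    and new: "{p, q, s, r2} \<inter> D = {}"
begin

definition "\<phi> d = \<sigma> (\<alpha> d)"
definition "\<psi> = bivalent r1 r2 (leg_\<sigma> \<sigma> p q s) (leg_\<alpha> \<alpha> k p q s r2)"
text \<open>Fusing the leaves diverts to \<open>r2\<close> whatever used to enter \<open>r1\<close>;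
  the new way into \<open>r1\<close> comes from \<open>s\<close>.\<close>

definition "\<tau> e = (if e = r1 then r2 else e)"

lemma r1: "r1 \<in> D" using cubicD(2)[OF C] by auto

lemma ne: "p \<noteq> q" "p \<noteq> s" "p \<noteq> r2" "q \<noteq> s" "q \<noteq> r2" "s \<noteq> r2" "p \<notin> D" "q \<notin> D" "s \<notin> D" "r2 \<notin> D" "r1 \<noteq> r2"
  using dist new r1 by auto

lemma ak: "\<alpha> k \<in> D" "\<alpha> k \<noteq> k" "\<alpha> (\<alpha> k) = k" using cubic_in(1)[OF C] cubicD(3,4)[OF C] k by auto

lemma \<phi>D: "\<phi> d \<in> D \<longleftrightarrow> d \<in> D" using cubic_in(1,2)[OF C] by (simp add: \<phi>_def)

lemma \<tau>D: "d \<in> D \<Longrightarrow> Transposition.transpose r1 r2 d = \<tau> d"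
  using ne(10) by (cases "d = r1"; cases "d = r2") (auto simp: \<tau>_def)

lemma \<psi>: "\<psi> k = s" "\<psi> s = r1" "\<psi> r2 = q" "\<psi> q = \<tau> (\<phi> k)" "\<psi> (\<alpha> k) = p" "\<psi> p = \<tau> (\<phi> (\<alpha> k))"
    "d \<in> D \<Longrightarrow> d \<noteq> k \<Longrightarrow> d \<noteq> \<alpha> k \<Longrightarrow> \<psi> d = \<tau> (\<phi> d)"
proof -
  note lf = leg_face[OF C k dist new]
  have t: "Transposition.transpose r1 r2 s = s" "Transposition.transpose r1 r2 p = p" "Transposition.transpose r1 r2 q = q"
    using ne r1 by (auto intro!: transpose_apply_other)
  have kD: "\<sigma> k \<in> D" "\<sigma> (\<alpha> k) \<in> D" using k ak cubic_in(2)[OF C] by auto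
  show "\<psi> k = s" "\<psi> s = r1" "\<psi> r2 = q" "\<psi> q = \<tau> (\<phi> k)" "\<psi> (\<alpha> k) = p" "\<psi> p = \<tau> (\<phi> (\<alpha> k))"
    unfolding \<psi>_def \<phi>_def lf(1-6) t ak(3) by (simp_all add: \<tau>D kD)
  show "\<psi> d = \<tau> (\<phi> d)" if "d \<in> D" "d \<noteq> k" "d \<noteq> \<alpha> k"
    unfolding \<psi>_def lf(7)[OF that] using \<phi>D[of d] that by (simp add: \<tau>D \<phi>_def)
qed

text \<open>Closedness under \<open>\<psi>\<close> with the dart \<open>p\<close> suppressed. As
  \<open>p\<close> merely subdivides the step that leaves \<open>\<alpha> k\<close>, it can be put
  in or left out afterwards.\<close>

definition "open_closed B \<longleftrightarrow> (\<forall>y\<in>B \<inter> D. y \<noteq> k \<longrightarrow> \<tau> (\<phi> y) \<in> B) \<and> (k \<in> B \<longrightarrow> s \<in> B) \<and> (s \<in> B \<longrightarrow> r1 \<in> B) \<and>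
  (r2 \<in> B \<longrightarrow> q \<in> B) \<and> (q \<in> B \<longrightarrow> \<tau> (\<phi> k) \<in> B)"

lemma \<psi>_closed:
  assumes "B \<subseteq> D \<union> {q, s, r2}" "open_closed B" "x \<in> B \<union> {y. y = p \<and> \<alpha> k \<in> B}"
  shows "\<psi> x \<in> B \<union> {y. y = p \<and> \<alpha> k \<in> B}"
proof -
  have B: "x \<in> B \<Longrightarrow> x \<in> D \<Longrightarrow> x \<noteq> k \<Longrightarrow> \<tau> (\<phi> x) \<in> B" "k \<in> B \<Longrightarrow> s \<in> B" "s \<in> B \<Longrightarrow> r1 \<in> B"
    "r2 \<in> B \<Longrightarrow> q \<in> B" "q \<in> B \<Longrightarrow> \<tau> (\<phi> k) \<in> B" "\<alpha> k \<in> B \<Longrightarrow> \<tau> (\<phi> (\<alpha> k)) \<in> B"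
    using assms(2) ak unfolding open_closed_def by auto
  consider "x = k" "x \<in> B" | "x = \<alpha> k" "x \<in> B" | "x = s" "x \<in> B" | "x = q" "x \<in> B" | "x = r2" "x \<in> B"
    | "x = p" "\<alpha> k \<in> B" | "x \<in> D" "x \<in> B" "x \<noteq> k" "x \<noteq> \<alpha> k" using assms(1,3) by blast
  then show ?thesis by cases (use B \<psi> in \<open>simp_all only:, simp_all\<close>)
qed

lemma open_closed_\<psi>:
  assumes "A \<subseteq> D \<union> {p, q, s, r2}" "\<And>x. x \<in> A \<Longrightarrow> \<psi> x \<in> A"
  shows "open_closed (A - {p})" "\<alpha> k \<in> A \<Longrightarrow> p \<in> A" "p \<in> A \<Longrightarrow> \<tau> (\<phi> (\<alpha> k)) \<in> A"
proof -
  show 1: "\<alpha> k \<in> A \<Longrightarrow> p \<in> A" and 2: "p \<in> A \<Longrightarrow> \<tau> (\<phi> (\<alpha> k)) \<in> A" using assms(2) \<psi>(5,6) by metis+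
  have np: "\<tau> (\<phi> y) \<noteq> p" if "y \<in> D" for y using that \<phi>D[of y] ne by (auto simp: \<tau>_def)
  have y: "\<tau> (\<phi> y) \<in> A" if "y \<in> A" "y \<in> D" "y \<noteq> k" for y
    using 1 2 assms(2)[OF that(1)] \<psi>(7)[OF that(2,3)] that by (cases "y = \<alpha> k") auto
  have "k \<in> A \<Longrightarrow> s \<in> A" "s \<in> A \<Longrightarrow> r1 \<in> A" "r2 \<in> A \<Longrightarrow> q \<in> A" "q \<in> A \<Longrightarrow> \<tau> (\<phi> k) \<in> A"
    using assms(2) \<psi>(1-4) by metis+
  then show "open_closed (A - {p})" unfolding open_closed_def using y np[OF k] np ne r1 by auto
qed

text \<open>From \<open>r1\<close> the walk follows the old face up to \<open>k\<close>, where
  \<open>s\<close> sends it back to \<open>r1\<close>: this is the segment \<open>S\<close>. The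
  remaining darts follow \<open>q\<close>, and where the old face returned to \<open>r1\<close> they
  reach \<open>r2\<close> and then \<open>q\<close> again: this is the new face
  \<open>j\<close>.\<close>

lemma face_lab_split:
  assumes L: "face_lab D \<phi> K lab" and S: "face_segment \<phi> {d \<in> D. lab d = x} r1 k S" and x: "lab r1 = x" and j: "j \<notin> K"
  defines "l \<equiv> (\<lambda>d. if lab d = x \<and> d \<in> D - S then j else lab d)"
  shows "face_lab (D \<union> {p, q, s, r2}) \<psi> (insert j K) (l(p := l (\<alpha> k), q := j, s := x, r2 := j))"
proof -
  define m where "m = l(p := l (\<alpha> k), q := j, s := x, r2 := j)"
  note Lb = face_labD[OF L] and Sg = face_segmentD[OF S]
  have lk: "lab k = x" "x \<in> K" using Sg(2,3) Lb(3) x r1 by auto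
  have xj: "x \<noteq> j" using lk j by auto
  have lK: "d \<in> D \<Longrightarrow> lab d \<noteq> j" for d using Lb(3) j by auto
  have mD: "m d = l d" if "d \<in> D" for d using that ne by (auto simp: m_def)
  have mv: "m p = l (\<alpha> k)" "m q = j" "m s = x" "m r2 = j" using ne by (auto simp: m_def)
  have lS: "d \<in> S \<Longrightarrow> l d = x" for d using Sg(3) by (auto simp: l_def)
  have lx: "d \<in> D \<Longrightarrow> l d = x \<Longrightarrow> d \<in> S" for d using xj by (auto simp: l_def split: if_splits)
  have lj: "d \<in> D \<Longrightarrow> l d = j \<longleftrightarrow> lab d = x \<and> d \<notin> S" for d using lK by (auto simp: l_def)
  have lo: "lab d \<noteq> x \<Longrightarrow> l d = lab d" for d by (auto simp: l_def)
  have SD: "S \<subseteq> D" using Sg(3) by auto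
  have fx: "lab (\<phi> d) = x \<longleftrightarrow> lab d = x" if "d \<in> D" for d using Lb(4)[OF that] by simp
  have stepl: "m (\<tau> (\<phi> d)) = l d" if d: "d \<in> D" "d \<noteq> k" for d
  proof (cases "lab d = x")
    case False
    then have "\<phi> d \<noteq> r1" using fx[OF d(1)] x by auto
    then show ?thesis using False d mD[of "\<phi> d"] \<phi>D[of d] Lb(4)[OF d(1)] by (simp add: \<tau>_def lo)
  next
    case True
    show ?thesis
    proof (cases "d \<in> S")
      case T: True
      then show ?thesis using Sg(4,5)[OF T d(2)] lS mD[of "\<phi> d"] SD by (auto simp: \<tau>_def)
    next
      case F: False
      have "l d = j" using lj[OF d(1)] True F by simp
      moreover have "\<phi> d = r1 \<or> \<phi> d \<notin> S" using Sg(7)[of d] True F d by auto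
      ultimately show ?thesis using mv mD[of "\<phi> d"] \<phi>D[of d] d lj[of "\<phi> d"] fx[OF d(1)] True by (auto simp: \<tau>_def)
    qed
  qed
  have stepk: "m (\<tau> (\<phi> k)) = j"
    using Sg(6) mv mD[of "\<phi> k"] \<phi>D[of k] k lj[of "\<phi> k"] fx[OF k] lk by (auto simp: \<tau>_def)
  show ?thesis unfolding m_def[symmetric]
  proof (rule face_labI)
    show "m \<in> extensional (D \<union> {p, q, s, r2})"
      using Lb(2) ne unfolding m_def l_def by (auto simp: extensional_def)
    have "m ` D \<subseteq> insert j K" using mD Lb(3) by (auto simp: l_def)
    moreover have "i \<in> m ` D" if i: "i \<in> K" for i
    proof (cases "i = x")
      case True
      then have "m r1 = i" using mD[OF r1] lS[OF Sg(1)] by simp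
      then show ?thesis using r1 by auto
    next
      case False
      obtain d where "d \<in> D" "lab d = i" using Lb(3) i by auto
      then show ?thesis using mD[of d] lo[of d] False by (auto intro!: image_eqI[of _ _ d])
    qed
    moreover have "l (\<alpha> k) \<in> insert j K" using ak Lb(3) by (auto simp: l_def)
    ultimately show "m ` (D \<union> {p, q, s, r2}) = insert j K"
      unfolding image_Un using mv lk by auto
    show "m (\<psi> d) = m d" if d: "d \<in> D \<union> {p, q, s, r2}" for d
    proof -
      consider "d = k" | "d = \<alpha> k" | "d = s" | "d = q" | "d = r2" | "d = p" | "d \<in> D" "d \<noteq> k" "d \<noteq> \<alpha> k"
        using d by blast
      then show ?thesis
      proof cases
        case 1 then show ?thesis using \<psi>(1) mv mD[OF k] lS[OF Sg(2)] by simp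
      next
        case 2 then show ?thesis using \<psi>(5) mv mD[OF ak(1)] by simp
      next
        case 3 then show ?thesis using \<psi>(2) mv mD[OF r1] lS[OF Sg(1)] by simp
      next
        case 4 then show ?thesis using \<psi>(4) mv stepk by simp
      next
        case 5 then show ?thesis using \<psi>(3) mv by simp
      next
        case 6 then show ?thesis using \<psi>(6) mv stepl[OF ak(1,2)] by simp
      next
        case 7 then show ?thesis using \<psi>(7) mD stepl by simp
      qed
    qed
    fix A d d' assume A: "A \<subseteq> D \<union> {p, q, s, r2}" "\<And>x. x \<in> A \<Longrightarrow> \<psi> x \<in> A" "d \<in> A" "d' \<in> D \<union> {p, q, s, r2}" "m d' = m d"
    note oc = open_closed_\<psi>[OF A(1,2)]
    have c: "k \<in> A \<Longrightarrow> s \<in> A" "s \<in> A \<Longrightarrow> r1 \<in> A" "r2 \<in> A \<Longrightarrow> q \<in> A" "q \<in> A \<Longrightarrow> \<tau> (\<phi> k) \<in> A"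
      "y \<in> A \<Longrightarrow> y \<in> D \<Longrightarrow> y \<noteq> k \<Longrightarrow> \<tau> (\<phi> y) \<in> A" for y
      using oc(1) ne r1 k unfolding open_closed_def by auto
    text \<open>\<open>A\<close> meets the original darts with the label of \<open>d\<close>, unless it contains \<open>r2\<close>.\<close>
    have "\<exists>e\<in>A. m e = m d \<and> (e \<in> D \<or> e = r2)"
    proof -
      have t: "\<exists>e\<in>A. m e = m (\<tau> (\<phi> y)) \<and> (e \<in> D \<or> e = r2)" if "\<tau> (\<phi> y) \<in> A" "y \<in> D" for y
        using that \<phi>D[of y] by (intro bexI[of _ "\<tau> (\<phi> y)"]) (auto simp: \<tau>_def)
      consider "d \<in> D \<or> d = r2" | "d = p" | "d = q" | "d = s" using A(1,3) by blast
      then show ?thesis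
      proof cases
        case 2
        then show ?thesis using t[OF _ ak(1)] oc(3) A(3) stepl[OF ak(1,2)] mv by simp
      next
        case 3
        then show ?thesis using t[OF _ k] c(4) A(3) stepk mv by simp
      next
        case 4
        then show ?thesis using c(2) A(3) mv mD[OF r1] lS[OF Sg(1)] r1 by (intro bexI[of _ r1]) auto
      qed (use A(3) in blast)
    qed
    then obtain e where e: "e \<in> A" "m e = m d" "e \<in> D \<or> e = r2" by blast
    have fin: "d' \<in> A" if "\<And>y. y \<in> D \<Longrightarrow> m y = m d \<Longrightarrow> y \<in> A" "m d = x \<Longrightarrow> k \<in> A" "m d = j \<Longrightarrow> r2 \<in> A"
    proof -
      consider "d' \<in> D" | "d' = p" | "d' = q" | "d' = s" | "d' = r2" using A(4) by blast
      then show ?thesis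
      proof cases
        case 2
        then have "\<alpha> k \<in> A" using that(1)[OF ak(1)] A(5) mv mD[OF ak(1)] by simp
        then show ?thesis using oc(2) 2 by simp
      next
        case 4 then show ?thesis using that(2) A(5) mv c(1) by simp
      qed (use that A(5) mv c in auto)
    qed
    show "d' \<in> A"
    proof (cases "m d = x")
      case T: True
      then have eS: "e \<in> A \<inter> S" using e mv xj mD[of e] lx[of e] by auto
      \<comment> \<open>Only \<open>k\<close> leaves the segment. A set that avoids \<open>k\<close>
        would therefore be closed for the old walk too, although it misses \<open>k\<close> on the
        face it meets.\<close>
      have kA: "k \<in> A"
      proof (rule ccontr)
        assume kn: "k \<notin> A"
        have "k \<in> A \<inter> S"
        proof (rule Lb(5)[of _ e])
          fix y assume y: "y \<in> A \<inter> S"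
          then have "y \<noteq> k" using kn by auto
          then show "\<phi> y \<in> A \<inter> S" using c(5)[of y] Sg(4,5)[of y] y SD by (auto simp: \<tau>_def)
        qed (use eS SD k lk Sg(3) in auto)
        then show False using kn by simp
      qed
      then have r1A: "r1 \<in> A" using c by blast
      have "y \<in> A" if "y \<in> S" for y
      proof -
        \<comment> \<open>Adding the part of the old face outside the segment gives a set closed for
          the old walk; it exhausts the face, and so \<open>A\<close> contains all of
          \<open>S\<close>.\<close>
        define E where "E = (A \<inter> S) \<union> {y \<in> D. lab y = x \<and> y \<notin> S}"
        have "y \<in> E"
        proof (rule Lb(5)[of _ r1])
          show "E \<subseteq> D" "r1 \<in> E" "y \<in> D" "lab y = lab r1" using SD r1A Sg(1,3) that x by (auto simp: E_def)
          fix z assume z: "z \<in> E"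
          then have zD: "z \<in> D" "lab z = x" using SD Sg(3) by (auto simp: E_def)
          have fz: "\<phi> z \<in> D" "lab (\<phi> z) = x" using \<phi>D zD fx by auto
          show "\<phi> z \<in> E"
          proof (cases "z \<in> S \<and> z \<noteq> k")
            case True
            then have "\<phi> z \<in> S" "\<phi> z \<noteq> r1" using Sg(4,5) by auto
            moreover have "\<tau> (\<phi> z) \<in> A" using c(5)[of z] z True zD by (auto simp: E_def)
            ultimately show ?thesis by (simp add: E_def \<tau>_def)
          next
            case False
            then have "\<phi> z \<in> S \<Longrightarrow> \<phi> z = r1" using Sg(6) Sg(7)[of z] zD by auto
            then show ?thesis using fz r1A Sg(1) by (auto simp: E_def)
          qed
        qed
        then show ?thesis using that by (auto simp: E_def)
      qed
      then show ?thesis using fin kA T xj mD lx by metis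
    next
      case F: False
      show ?thesis
      proof (cases "m d = j")
        case T: True
        \<comment> \<open>Outside the segment the walk must eventually return to the old entry
          \<open>r1\<close>, which is now diverted to \<open>r2\<close>.\<close>
        have r2A: "r2 \<in> A"
        proof (rule ccontr)
          assume rn: "r2 \<notin> A"
          define E where "E = {y \<in> A \<inter> D. lab y = x \<and> y \<notin> S}"
          have eE: "e \<in> E" using e rn T mD[of e] lj[of e] by (auto simp: E_def)
          have "r1 \<in> E"
          proof (rule Lb(5)[of _ e])
            fix y assume y: "y \<in> E"
            then have yk: "y \<noteq> k" "y \<in> D" "y \<in> A" using Sg(2) by (auto simp: E_def)
            have "\<tau> (\<phi> y) \<in> A" using c(5) yk by auto
            then have "\<phi> y \<noteq> r1" "\<phi> y \<in> A" using rn by (auto simp: \<tau>_def split: if_splits)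
            then show "\<phi> y \<in> E" using y Sg(7)[of y] \<phi>D[of y] fx[of y] by (auto simp: E_def)
          qed (use eE r1 x in \<open>auto simp: E_def\<close>)
          then show False using Sg(1) by (simp add: E_def)
        qed
        then have qA: "\<tau> (\<phi> k) \<in> A" using c by blast
        have "y \<in> A" if "y \<in> D" "lab y = x" "y \<notin> S" for y
        proof -
          \<comment> \<open>This time the segment is the padding, and what remains of the face must
            belong to \<open>A\<close>.\<close>
          define E where "E = S \<union> {y \<in> A \<inter> D. lab y = x \<and> y \<notin> S}"
          have "y \<in> E"
          proof (rule Lb(5)[of _ r1])
            show "E \<subseteq> D" "r1 \<in> E" "y \<in> D" "lab y = lab r1" using SD Sg(1) that x by (auto simp: E_def)
            fix z assume z: "z \<in> E"
            then have zD: "z \<in> D" "lab z = x" using SD Sg(3) by (auto simp: E_def)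
            have fz: "\<phi> z \<in> D" "lab (\<phi> z) = x" using \<phi>D zD fx by auto
            show "\<phi> z \<in> E"
            proof (cases "z \<in> S \<and> z \<noteq> k")
              case True
              then show ?thesis using Sg(4) by (auto simp: E_def)
            next
              case False
              have "\<tau> (\<phi> z) \<in> A"
              proof (cases "z = k")
                case True then show ?thesis using qA by simp
              next
                case F2: False
                then show ?thesis using c(5)[of z] z False zD by (auto simp: E_def)
              qed
              then show ?thesis using fz Sg(1) by (auto simp: E_def \<tau>_def split: if_splits)
            qed
          qed
          then show ?thesis using that by (auto simp: E_def)
        qed
        then show ?thesis using fin r2A T xj mD lj by metis
      next
        case F2: False
        have eD: "e \<in> D" "lab e = m d" "lab e \<noteq> x" using e F F2 mv mD[of e] by (auto simp: l_def split: if_splits)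
        have "y \<in> A" if y: "y \<in> D" "m y = m d" for y
        proof -
          have ly: "lab y = lab e" using y eD F F2 mD[of y] by (auto simp: l_def split: if_splits)
          have "y \<in> {z \<in> A \<inter> D. lab z = lab e}"
          proof (rule Lb(5)[of _ e])
            fix z assume z: "z \<in> {z \<in> A \<inter> D. lab z = lab e}"
            then have zk: "z \<noteq> k" "z \<in> D" "z \<in> A" using eD lk by auto
            have "\<phi> z \<noteq> r1" using fx[OF zk(2)] z eD x by auto
            then have "\<phi> z \<in> A" using c(5)[of z] zk by (simp add: \<tau>_def)
            then show "\<phi> z \<in> {z \<in> A \<inter> D. lab z = lab e}" using z \<phi>D[of z] Lb(4)[of z] by auto
          qed (use e eD y ly in auto)
          then show ?thesis by simp
        qed
        then show ?thesis using fin F F2 by blast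
      qed
    qed
  qed
qed

end

context marked_leg begin

text \<open>Undoing the split identifies the labels \<open>j\<close> and \<open>x\<close>. The
  information lost thereby is kept in \<open>k\<close>: the darts that had the label
  \<open>x\<close> are the segment from \<open>r1\<close> to \<open>k\<close>.\<close>

lemma face_lab_merge:
  assumes L: "face_lab (D \<union> {p, q, s, r2}) \<psi> K l" and x: "l r1 = x" and j: "l r2 = j" and xj: "x \<noteq> j"
  defines "lab \<equiv> restrict (\<lambda>d. if l d = j then x else l d) D"
  shows "face_lab D \<phi> (K - {j}) lab" "lab r1 = x"
    and "face_segment \<phi> {d \<in> D. lab d = x} r1 k {d \<in> D. l d = x}"
    and "l p = l (\<alpha> k)" "l q = j" "l s = x" "l k = x"
proof -
  note Lb = face_labD[OF L]
  have mem: "k \<in> D \<union> {p, q, s, r2}" "\<alpha> k \<in> D \<union> {p, q, s, r2}" "r1 \<in> D \<union> {p, q, s, r2}" using k ak r1 by auto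
  show lv: "l p = l (\<alpha> k)" "l q = j" "l s = x" "l k = x"
    using Lb(4)[OF mem(2)] Lb(4)[of r2] Lb(4)[of s] Lb(4)[OF mem(1)] \<psi>(1,2,3,5) x j by auto
  have stepl: "l (\<tau> (\<phi> d)) = l d" if d: "d \<in> D" "d \<noteq> k" for d
    using Lb(4)[of d] Lb(4)[of p] \<psi>(6) \<psi>(7)[of d] d lv by (cases "d = \<alpha> k") auto
  have stepk: "l (\<tau> (\<phi> k)) = j" using Lb(4)[of q] \<psi>(4) lv by auto
  have key: "e' \<in> B \<union> {y. y = p \<and> \<alpha> k \<in> B}"
    if B: "B \<subseteq> D \<union> {q, s, r2}" "open_closed B" "e \<in> B" "e' \<in> D \<union> {p, q, s, r2}" "l e' = l e" for B e e'
  proof (rule Lb(5)[of _ e])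
    show "B \<union> {y. y = p \<and> \<alpha> k \<in> B} \<subseteq> D \<union> {p, q, s, r2}" using B(1) by auto
    show "\<psi> y \<in> B \<union> {y. y = p \<and> \<alpha> k \<in> B}" if "y \<in> B \<union> {y. y = p \<and> \<alpha> k \<in> B}" for y
      by (rule \<psi>_closed[OF B(1,2) that])
  qed (use B in auto)
  have labD: "lab d = (if l d = j then x else l d)" if "d \<in> D" for d using that by (simp add: lab_def)
  show "lab r1 = x" using labD[OF r1] x by simp
  have lx: "lab d = x \<longleftrightarrow> l d = x \<or> l d = j" if "d \<in> D" for d using labD[OF that] by auto
  show "face_segment \<phi> {d \<in> D. lab d = x} r1 k {d \<in> D. l d = x}" (is "face_segment _ ?F _ _ ?S")
    unfolding face_segment_def
  proof (intro conjI ballI impI)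
    show "r1 \<in> ?S" "k \<in> ?S" using r1 k x lv by auto
    show "?S \<subseteq> ?F" using lx by auto
    fix d assume d: "d \<in> ?S" "d \<noteq> k"
    then have "l (\<tau> (\<phi> d)) = x" using stepl by auto
    then show "\<phi> d \<in> ?S" "\<phi> d \<noteq> r1" using \<phi>D[of d] d j xj by (auto simp: \<tau>_def split: if_splits)
  next
    assume "\<phi> k \<in> ?S"
    then show "\<phi> k = r1" using stepk xj by (auto simp: \<tau>_def split: if_splits)
  next
    fix d assume d: "d \<in> ?F - ?S" "\<phi> d \<in> ?S"
    then have "l d = j" "d \<noteq> k" using lx lv k by auto
    then have "l (\<tau> (\<phi> d)) = j" using stepl d by auto
    then show "\<phi> d = r1" using d xj by (auto simp: \<tau>_def split: if_splits)
  qed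
  show "face_lab D \<phi> (K - {j}) lab"
  proof (rule face_labI)
    show "lab \<in> extensional D" by (simp add: lab_def)
    have "lab ` D \<subseteq> K - {j}"
    proof -
      have "x \<in> K" using Lb(3) mem(3) x by auto
      then show ?thesis using labD Lb(3) xj by auto
    qed
    moreover have "i \<in> lab ` D" if i: "i \<in> K - {j}" for i
    proof -
      obtain d where d: "d \<in> D \<union> {p, q, s, r2}" "l d = i" using Lb(3) i by auto
      consider "d \<in> D" | "d = p" | "i = x" using d lv j i by auto
      then show ?thesis
      proof cases
        case 1 then show ?thesis using labD[OF 1] d i by (auto intro!: image_eqI[of _ _ d])
      next
        case 2 then show ?thesis using labD[OF ak(1)] ak(1) lv d i by (auto intro!: image_eqI[of _ _ "\<alpha> k"])
      next
        case 3 then show ?thesis using labD[OF r1] x r1 by (auto intro!: image_eqI[of _ _ r1])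
      qed
    qed
    ultimately show "lab ` D = K - {j}" by auto
    have t: "lab (\<phi> d) = (if l (\<tau> (\<phi> d)) = j then x else l (\<tau> (\<phi> d)))" if "d \<in> D" for d
      using labD[of "\<phi> d"] \<phi>D[of d] that x j xj by (auto simp: \<tau>_def)
    show inv: "lab (\<phi> d) = lab d" if d: "d \<in> D" for d
      using t[OF d] stepl[OF d] stepk labD[OF d] lv by (cases "d = k") auto
    fix A d d' assume A: "A \<subseteq> D" "\<And>y. y \<in> A \<Longrightarrow> \<phi> y \<in> A" "d \<in> A" "d' \<in> D" "lab d' = lab d"
    have nA: "q \<notin> A" "s \<notin> A" "r2 \<notin> A" using A(1) ne by auto
    show "d' \<in> A"
    proof (cases "lab d = x")
      case F: False
      then have ld: "l d = lab d" "l d \<noteq> x" "l d \<noteq> j" using labD[of d] A by (auto split: if_splits)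
      have "open_closed {y \<in> A. l y = l d}" unfolding open_closed_def
      proof (intro conjI ballI impI)
        fix y assume y: "y \<in> {y \<in> A. l y = l d} \<inter> D" "y \<noteq> k"
        then have "l (\<tau> (\<phi> y)) = l d" using stepl by auto
        moreover from this have "\<phi> y \<noteq> r1" using ld j by (auto simp: \<tau>_def)
        ultimately show "\<tau> (\<phi> y) \<in> {y \<in> A. l y = l d}" using A(2) y by (auto simp: \<tau>_def)
      qed (use ld lv nA in auto)
      then have "d' \<in> {y \<in> A. l y = l d} \<union> {y. y = p \<and> \<alpha> k \<in> {y \<in> A. l y = l d}}"
        by (rule key[rotated, of _ d]) (use A ld labD[of d'] in \<open>auto split: if_splits\<close>)
      then show ?thesis using A(4) ne by auto
    next
      case T: True
      \<comment> \<open>The way round the merged face: the first part ends in \<open>k\<close>, from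
        \<open>k\<close> one reaches \<open>r1\<close> or the second part, and the second part ends
        in \<open>r1\<close>. A set closed for the old walk that meets either part therefore
        contains both \<open>r1\<close> and \<open>k\<close>.\<close>
      have sx: "k \<in> A" if y: "y \<in> A" "l y = x" for y
      proof (rule ccontr)
        assume kn: "k \<notin> A"
        have "open_closed {y \<in> A. l y = x}" unfolding open_closed_def
        proof (intro conjI ballI impI)
          fix y assume y: "y \<in> {y \<in> A. l y = x} \<inter> D" "y \<noteq> k"
          then have "l (\<tau> (\<phi> y)) = x" using stepl by auto
          moreover from this have "\<phi> y \<noteq> r1" using j xj by (auto simp: \<tau>_def)
          ultimately show "\<tau> (\<phi> y) \<in> {y \<in> A. l y = x}" using A(2) y by (auto simp: \<tau>_def)
        qed (use kn nA in auto)
        then have "k \<in> {y \<in> A. l y = x} \<union> {z. z = p \<and> \<alpha> k \<in> {y \<in> A. l y = x}}"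
          by (rule key[rotated, of _ y]) (use A y k lv in auto)
        then show False using kn k ne by auto
      qed
      have jx: "r1 \<in> A" if y: "y \<in> A" "l y = j" for y
      proof (rule ccontr)
        assume rn: "r1 \<notin> A"
        have "open_closed {y \<in> A. l y = j}" unfolding open_closed_def
        proof (intro conjI ballI impI)
          fix y assume y: "y \<in> {y \<in> A. l y = j} \<inter> D" "y \<noteq> k"
          then have "l (\<tau> (\<phi> y)) = j" using stepl by auto
          moreover have "\<phi> y \<noteq> r1" using A(2)[of y] y rn by auto
          ultimately show "\<tau> (\<phi> y) \<in> {y \<in> A. l y = j}" using A(2) y by (auto simp: \<tau>_def)
        qed (use nA xj lv in auto)
        then have "r2 \<in> {y \<in> A. l y = j} \<union> {z. z = p \<and> \<alpha> k \<in> {y \<in> A. l y = j}}"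
          by (rule key[rotated, of _ y]) (use A y j in auto)
        then show False using nA ne by auto
      qed
      have kr: "r1 \<in> A" if "k \<in> A"
      proof (cases "\<phi> k = r1")
        case True then show ?thesis using A(2)[OF that] by simp
      next
        case False
        then have "l (\<phi> k) = j" using stepk by (simp add: \<tau>_def)
        then show ?thesis using jx A(2)[OF that] by blast
      qed
      have "l d = x \<or> l d = j" using lx T A by auto
      then have r1A: "r1 \<in> A" using jx kr sx A(3) by blast
      then have kA: "k \<in> A" using sx x by blast
      have "l d' = x \<or> l d' = j" using lx T A by auto
      then show ?thesis
      proof
        assume d': "l d' = x"
        have "open_closed (insert s {y \<in> A. l y = x})" unfolding open_closed_def
        proof (intro conjI ballI impI)
          fix y assume y: "y \<in> insert s {y \<in> A. l y = x} \<inter> D" "y \<noteq> k"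
          then have y': "y \<in> A" "l y = x" "y \<in> D" using ne by auto
          then have "l (\<tau> (\<phi> y)) = x" using stepl y by auto
          moreover from this have "\<phi> y \<noteq> r1" using j xj by (auto simp: \<tau>_def)
          ultimately show "\<tau> (\<phi> y) \<in> insert s {y \<in> A. l y = x}" using A(2) y' by (auto simp: \<tau>_def)
        qed (use r1A x nA ne in auto)
        then have "d' \<in> insert s {y \<in> A. l y = x} \<union> {z. z = p \<and> \<alpha> k \<in> insert s {y \<in> A. l y = x}}"
          by (rule key[rotated, of _ r1]) (use A r1A x d' in auto)
        then show ?thesis using A(4) ne by auto
      next
        assume d': "l d' = j"
        define B where "B = {r2, q} \<union> {y \<in> A. l y = j}"
        have "open_closed B" unfolding open_closed_def
        proof (intro conjI ballI impI)
          fix y assume y: "y \<in> B \<inter> D" "y \<noteq> k"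
          then have y': "y \<in> A" "l y = j" "y \<in> D" using ne by (auto simp: B_def)
          then have "l (\<tau> (\<phi> y)) = j" using stepl y by auto
          then show "\<tau> (\<phi> y) \<in> B" using A(2) y' by (auto simp: \<tau>_def B_def)
        next
          show "\<tau> (\<phi> k) \<in> B" using stepk A(2)[OF kA] by (auto simp: \<tau>_def B_def)
        qed (use nA ne lv xj k in \<open>auto simp: B_def\<close>)
        then have "d' \<in> B \<union> {z. z = p \<and> \<alpha> k \<in> B}"
          by (rule key[rotated, of _ r2]) (use A d' j in \<open>auto simp: B_def\<close>)
        then show ?thesis using A(4) ne by (auto simp: B_def)
      qed
    qed
  qed
qed

end

text \<open>The intersection of two segments, enlarged by the darts of the face outside the first,
  is closed and contains \<open>a\<close>; hence it is the whole face, and the first segment lies in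
  the second.\<close>

lemma face_segment_unique:
  assumes L: "face_lab D \<phi> K lab" and \<phi>D: "\<And>d. d \<in> D \<Longrightarrow> \<phi> d \<in> D" and a: "a \<in> D" "lab a = x"
    and S: "face_segment \<phi> {d \<in> D. lab d = x} a k S" and S': "face_segment \<phi> {d \<in> D. lab d = x} a k S'"
  shows "S = S'"
proof -
  have *: "S \<subseteq> S'" if S: "face_segment \<phi> {d \<in> D. lab d = x} a k S" and S': "face_segment \<phi> {d \<in> D. lab d = x} a k S'" for S S'
  proof
    note Lb = face_labD[OF L] and Sg = face_segmentD[OF S] and Sg' = face_segmentD[OF S']
    fix d assume d: "d \<in> S"
    define E where "E = (S \<inter> S') \<union> {y \<in> D. lab y = x \<and> y \<notin> S}"
    have "d \<in> E"
    proof (rule Lb(5)[of _ a])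
      show "E \<subseteq> D" "a \<in> E" "d \<in> D" "lab d = lab a" using Sg(1,3) Sg'(1) d a by (auto simp: E_def)
      fix y assume y: "y \<in> E"
      then have yD: "y \<in> D" "lab y = x" using Sg(3) by (auto simp: E_def)
      show "\<phi> y \<in> E"
      proof (cases "y \<in> S \<and> y \<noteq> k")
        case True
        then have "y \<in> S'" using y by (auto simp: E_def)
        then show ?thesis using True Sg(4) Sg'(4) by (auto simp: E_def)
      next
        case False
        then have 1: "\<phi> y \<in> S \<Longrightarrow> \<phi> y = a" using Sg(6) Sg(7)[of y] yD by auto
        show ?thesis
        proof (cases "\<phi> y \<in> S")
          case True
          then show ?thesis using 1 Sg(1) Sg'(1) by (auto simp: E_def)
        next
          case F: False
          have "\<phi> y \<in> D" using \<phi>D yD by simp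
          then show ?thesis using F Lb(4) yD by (auto simp: E_def)
        qed
      qed
    qed
    then show "d \<in> S'" using d by (auto simp: E_def)
  qed
  show ?thesis using *[OF S S'] *[OF S' S] by auto
qed

section \<open>Faces as cycles, and segments given by their last dart\<close>

lemma face_cycle:
  assumes L: "face_lab D \<phi> K lab" and p: "\<phi> permutes D" and fD: "finite D" and a: "a \<in> D"
  obtains m where "m > 0" "(\<phi> ^^ m) a = a" "inj_on (\<lambda>i. (\<phi> ^^ i) a) {..<m}"
    "{d \<in> D. lab d = lab a} = (\<lambda>i. (\<phi> ^^ i) a) ` {..<m}"
proof -
  note Lb = face_labD[OF L]
  have perm: "permutation \<phi>" using p fD by (auto simp: permutation_permutes)
  have ao: "a \<in> orbit \<phi> a" using perm by (rule permutation_self_in_orbit)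
  have sub: "orbit \<phi> a \<subseteq> D" using p a by (simp add: permutes_orbit_subset)
  have st: "\<phi> y \<in> orbit \<phi> a" if "y \<in> orbit \<phi> a" for y using that by (rule orbit.step)
  have lo: "lab y = lab a" if "y \<in> orbit \<phi> a" for y
    using that
  proof induction
    case base then show ?case using Lb(4)[OF a] by simp
  next
    case (step y) then show ?case using Lb(4)[of y] sub by auto
  qed
  have F: "{d \<in> D. lab d = lab a} = orbit \<phi> a"
  proof
    show "orbit \<phi> a \<subseteq> {d \<in> D. lab d = lab a}" using sub lo by auto
    show "{d \<in> D. lab d = lab a} \<subseteq> orbit \<phi> a"
      using Lb(5)[OF sub st ao] by auto
  qed
  show ?thesis
  proof (rule that[of "funpow_dist1 \<phi> a a"])
    show "(\<phi> ^^ funpow_dist1 \<phi> a a) a = a" by (rule funpow_dist1_prop[OF ao])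
    show "inj_on (\<lambda>i. (\<phi> ^^ i) a) {..<funpow_dist1 \<phi> a a}"
      using inj_on_funpow_dist1[OF ao] by (simp add: atLeast0LessThan)
    show "{d \<in> D. lab d = lab a} = (\<lambda>i. (\<phi> ^^ i) a) ` {..<funpow_dist1 \<phi> a a}"
      unfolding F using orbit_conv_funpow_dist1[OF ao] by (simp add: atLeast0LessThan)
  qed simp
qed

lemma face_segment_funpow:
  assumes m: "m > 0" "(\<phi> ^^ m) a = a" "inj_on (\<lambda>i. (\<phi> ^^ i) a) {..<m}" and F: "F = (\<lambda>i. (\<phi> ^^ i) a) ` {..<m}"
    and i: "i < m"
  shows "face_segment \<phi> F a ((\<phi> ^^ i) a) ((\<lambda>t. (\<phi> ^^ t) a) ` {..<Suc i})"
proof -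
  let ?g = "\<lambda>i. (\<phi> ^^ i) a"
  have inj: "?g t = ?g u \<longleftrightarrow> t = u" if "t < m" "u < m" for t u
    using m(3) that by (auto simp: inj_on_def)
  have g0: "?g t = a \<longleftrightarrow> t = 0" if "t < m" for t using inj[OF that m(1)] by simp
  have st: "\<phi> (?g t) = ?g (Suc t)" for t by simp
  show ?thesis unfolding face_segment_def
  proof (intro conjI ballI impI)
    show "a \<in> ?g ` {..<Suc i}" by (rule image_eqI[of _ _ 0]) auto
    show "?g i \<in> ?g ` {..<Suc i}" by auto
    show "?g ` {..<Suc i} \<subseteq> F" unfolding F using i by (intro image_mono) auto
    fix d assume "d \<in> ?g ` {..<Suc i}" "d \<noteq> ?g i"
    then obtain t where t: "d = ?g t" "t < i" by (auto simp: less_Suc_eq)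
    have "\<phi> d = ?g (Suc t)" using t st by simp
    then show "\<phi> d \<in> ?g ` {..<Suc i}" using t by (intro image_eqI[of _ _ "Suc t"]) auto
    show "\<phi> d \<noteq> a" using g0[of "Suc t"] t i \<open>\<phi> d = _\<close> by simp
  next
    assume "\<phi> (?g i) \<in> ?g ` {..<Suc i}"
    then obtain u where u: "?g (Suc i) = ?g u" "u < Suc i" unfolding st by auto
    show "\<phi> (?g i) = a"
    proof (cases "Suc i < m")
      case True then show ?thesis using inj[of "Suc i" u] u i by simp
    next
      case False then have "Suc i = m" using i by simp
      then show ?thesis using m(2) st by metis
    qed
  next
    fix d assume d: "d \<in> F - ?g ` {..<Suc i}" "\<phi> d \<in> ?g ` {..<Suc i}"
    obtain t where t: "d = ?g t" "t < m" using d F by auto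
    have "t \<notin> {..<Suc i}" using d(1) unfolding t(1) by blast
    then have ti: "t > i" by simp
    obtain u where u: "?g (Suc t) = ?g u" "u < Suc i" using d(2) unfolding t st by auto
    show "\<phi> d = a"
    proof (cases "Suc t < m")
      case True then show ?thesis using inj[of "Suc t" u] u ti i by simp
    next
      case False then have "Suc t = m" using t by simp
      then show ?thesis using m(2) st t by metis
    qed
  qed
qed

definition the_segment :: "('a \<Rightarrow> 'a) \<Rightarrow> 'a set \<Rightarrow> 'a \<Rightarrow> 'a \<Rightarrow> 'a set" where
  "the_segment \<phi> F a k = (THE S. face_segment \<phi> F a k S)"

lemma the_segment_eq:
  assumes "face_lab D \<phi> K lab" "\<phi> permutes D" "a \<in> D" "lab a = x" "face_segment \<phi> {d \<in> D. lab d = x} a k S"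
  shows "the_segment \<phi> {d \<in> D. lab d = x} a k = S"
  unfolding the_segment_def
proof (rule the_equality)
  show "face_segment \<phi> {d \<in> D. lab d = x} a k S" by fact
  fix S' assume "face_segment \<phi> {d \<in> D. lab d = x} a k S'"
  then show "S' = S"
    using face_segment_unique[OF assms(1) _ assms(3,4)] assms(2,5) by (metis permutes_in_image)
qed

lemma face_segment_the:
  assumes L: "face_lab D \<phi> K lab" and p: "\<phi> permutes D" and fD: "finite D" and a: "a \<in> D" "lab a = x"
    and k: "k \<in> D" "lab k = x"
  shows "face_segment \<phi> {d \<in> D. lab d = x} a k (the_segment \<phi> {d \<in> D. lab d = x} a k)"
proof (rule face_cycle[OF L p fD a(1), unfolded a(2)])
  fix m assume m: "m > 0" "(\<phi> ^^ m) a = a" "inj_on (\<lambda>i. (\<phi> ^^ i) a) {..<m}"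
    "{d \<in> D. lab d = x} = (\<lambda>i. (\<phi> ^^ i) a) ` {..<m}"
  obtain i where i: "i < m" "k = (\<phi> ^^ i) a" using m(4) k by auto
  have "face_segment \<phi> {d \<in> D. lab d = x} a k ((\<lambda>t. (\<phi> ^^ t) a) ` {..<Suc i})"
    using face_segment_funpow[OF m i(1)] i(2) by simp
  then show ?thesis using the_segment_eq[OF L p a] by metis
qed

definition split_lab :: "'a set \<Rightarrow> ('a \<Rightarrow> 'a) \<Rightarrow> ('a \<Rightarrow> 'b) \<Rightarrow> 'a \<Rightarrow> 'a \<Rightarrow> 'b \<Rightarrow> 'b \<Rightarrow> 'a \<Rightarrow> 'b" where
  "split_lab D \<phi> lab a k x j =
     (\<lambda>d. if lab d = x \<and> d \<in> D - the_segment \<phi> {d \<in> D. lab d = x} a k then j else lab d)"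

text \<open>The sum over the darts \<open>k\<close> of the root face telescopes: moving \<open>k\<close> one dart further changes
  the factor of a single edge.\<close>

lemma sum_root_face_telescope:
  fixes lam :: "'b \<Rightarrow> real"
  assumes C: "cubic D U \<sigma> \<alpha>" and L: "face_lab D (\<sigma> \<circ> \<alpha>) K lab" and a: "a \<in> D" "lab a = x"
    and pos: "\<And>i. i \<in> K \<Longrightarrow> lam i > 0" "lam j > 0" and j: "j \<notin> K" and ne: "lam j \<noteq> lam x"
  shows "(\<Sum>k\<in>{k \<in> D. lab k = x}. let l = split_lab D (\<sigma> \<circ> \<alpha>) lab a k x j in
       edge_wt (D - {k, \<alpha> k}) \<alpha> (\<lambda>d. lam (l d)) / ((lam x + lam (l (\<alpha> k))) * (lam j + lam (l (\<alpha> k))))) =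
    (edge_wt D \<alpha> (\<lambda>d. lam (lab d)) - edge_wt D \<alpha> (\<lambda>d. (lam(x := lam j)) (lab d))) / (lam j - lam x)"
proof -
  define \<phi> where "\<phi> = \<sigma> \<circ> \<alpha>"
  note D = cubicD[OF C] and I = cubic_in[OF C]
  note L = L[folded \<phi>_def]
  have p: "\<phi> permutes D" unfolding \<phi>_def using cubic_permutes[OF C] by (rule permutes_compose[rotated])
  show ?thesis unfolding \<phi>_def[symmetric]
  proof (rule face_cycle[OF L p D(1) a(1), unfolded a(2)])
    fix m assume m: "m > 0" "(\<phi> ^^ m) a = a" "inj_on (\<lambda>i. (\<phi> ^^ i) a) {..<m}"
      "{d \<in> D. lab d = x} = (\<lambda>i. (\<phi> ^^ i) a) ` {..<m}"
    define g where "g = (\<lambda>i. (\<phi> ^^ i) a)"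
    \<comment> \<open>The first \<open>i\<close> darts of the root face have the weight
      \<open>lam x\<close> and the others have \<open>lam j\<close>. Advancing \<open>k\<close>
      along the face raises \<open>i\<close>, from all \<open>lam j\<close> at \<open>0\<close> to
      all \<open>lam x\<close> at \<open>m\<close>.\<close>
    define v where "v = (\<lambda>i d. if d \<in> g ` {..<i} then lam x else if lab d = x then lam j else lam (lab d))"
    define W where "W = (\<lambda>i. edge_wt D \<alpha> (v i))"
    have gF: "g i \<in> D" "lab (g i) = x" if "i < m" for i
      using m(4) that unfolding g_def by auto
    have inj: "g t = g u \<longleftrightarrow> t = u" if "t < m" "u < m" for t u
      using m(3) that by (auto simp: inj_on_def g_def)
    have vK: "v i d > 0" if "d \<in> D" for i d
      using that pos face_labD(3)[OF L] a by (auto simp: v_def)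
    have step: "(let l = split_lab D \<phi> lab a (g i) x j in
       edge_wt (D - {g i, \<alpha> (g i)}) \<alpha> (\<lambda>d. lam (l d)) / ((lam x + lam (l (\<alpha> (g i)))) * (lam j + lam (l (\<alpha> (g i))))))
        = (W (Suc i) - W i) / (lam j - lam x)" if i: "i < m" for i
    proof -
      let ?k = "g i" and ?l = "split_lab D \<phi> lab a (g i) x j"
      have "the_segment \<phi> {d \<in> D. lab d = x} a ?k = g ` {..<Suc i}"
        unfolding g_def by (rule the_segment_eq[OF L p a face_segment_funpow[OF m i]])
      moreover have gx: "lab d = x" if "d \<in> g ` {..<Suc i}" for d using that gF i by auto
      ultimately have l: "lam (?l d) = v (Suc i) d" if "d \<in> D" for d
        using that by (auto simp: split_lab_def v_def)
      have ak: "\<alpha> ?k \<in> D" "\<alpha> ?k \<noteq> ?k" using gF(1)[OF i] I(1) D(4) by auto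
      have vv: "v i d = v (Suc i) d" if "d \<noteq> ?k" for d using that by (auto simp: v_def lessThan_Suc)
      have vk: "v (Suc i) ?k = lam x" "v i ?k = lam j" using gF[OF i] inj i by (auto simp: v_def)
      have E: "edge_wt (D - {?k, \<alpha> ?k}) \<alpha> (v i) = edge_wt (D - {?k, \<alpha> ?k}) \<alpha> (v (Suc i))"
        by (rule edge_wt_cong) (use vv I(1,9) D(3) in auto)
      have E': "edge_wt (D - {?k, \<alpha> ?k}) \<alpha> (\<lambda>d. lam (?l d)) = edge_wt (D - {?k, \<alpha> ?k}) \<alpha> (v (Suc i))"
        by (rule edge_wt_cong) (use l I(1,9) D(3) in auto)
      \<comment> \<open>The weight opposite to \<open>g i\<close> is the same before and after the
        move, even if that dart also lies on the root face, since only one dart changes at a time.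
        The two factors of the edge then combine by \<open>1 / (lam x + f) - 1 / (lam j + f) = (lam
        j - lam x) / ((lam x + f) * (lam j + f))\<close>.\<close>
      define f where "f = v (Suc i) (\<alpha> ?k)"
      have W: "W (Suc i) = 1 / (lam x + f) * edge_wt (D - {?k, \<alpha> ?k}) \<alpha> (v (Suc i))"
          "W i = 1 / (lam j + f) * edge_wt (D - {?k, \<alpha> ?k}) \<alpha> (v (Suc i))"
        unfolding W_def edge_wt_split[OF C gF(1)[OF i]] E vk f_def vv[OF ak(2)] by auto
      have f0: "lam x + f \<noteq> 0" "lam j + f \<noteq> 0"
        using vK[OF ak(1), of "Suc i"] vK[OF gF(1)[OF i], of "Suc i"] vK[OF gF(1)[OF i], of i] vk
        by (auto simp: f_def)
      show ?thesis unfolding Let_def E' l[OF ak(1)] f_def[symmetric] W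
        using f0 ne by (simp add: divide_simps) (simp add: algebra_simps)
    qed
    have "(\<Sum>k\<in>{k \<in> D. lab k = x}. let l = split_lab D \<phi> lab a k x j in
       edge_wt (D - {k, \<alpha> k}) \<alpha> (\<lambda>d. lam (l d)) / ((lam x + lam (l (\<alpha> k))) * (lam j + lam (l (\<alpha> k))))) =
       (\<Sum>i<m. (W (Suc i) - W i) / (lam j - lam x))"
      unfolding m(4) g_def[symmetric] using step m(3)[folded g_def] by (simp add: sum.reindex)
    also have "\<dots> = (W m - W 0) / (lam j - lam x)"
      by (simp add: sum_divide_distrib[symmetric] sum_lessThan_telescope)
    also have "W m = edge_wt D \<alpha> (\<lambda>d. lam (lab d))"
      unfolding W_def by (rule edge_wt_cong) (use m(4)[folded g_def] I(1) in \<open>auto simp: v_def\<close>)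
    also have "W 0 = edge_wt D \<alpha> (\<lambda>d. (lam(x := lam j)) (lab d))"
      unfolding W_def by (rule edge_wt_cong) (use I(1) in \<open>auto simp: v_def\<close>)
    finally show "(\<Sum>k\<in>{k \<in> D. lab k = x}. let l = split_lab D \<phi> lab a k x j in
       edge_wt (D - {k, \<alpha> k}) \<alpha> (\<lambda>d. lam (l d)) / ((lam x + lam (l (\<alpha> k))) * (lam j + lam (l (\<alpha> k))))) =
      (edge_wt D \<alpha> (\<lambda>d. lam (lab d)) - edge_wt D \<alpha> (\<lambda>d. (lam(x := lam j)) (lab d))) / (lam j - lam x)" .
  qed
qed

lemma length_6E:
  assumes "length xs = 6" obtains a b c d e f where "xs = [a, b, c, d, e, f]"
  using assms by (auto simp: numeral_eq_Suc length_Suc_conv)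

text \<open>If the root vertex touches two faces, removing it keeps the map connected, and then the
  second of the two new leaves can be removed as well.\<close>

lemma root_connects:
  assumes M: "cubic_map D {\<rho>} \<sigma> \<alpha>" and L: "face_lab D (\<sigma> \<circ> \<alpha>) K lab" and card: "card D > 4"
    and r: "r = \<alpha> \<rho>" "r1 = \<sigma> r" "r2 = \<sigma> r1" and x: "lab \<rho> = x" and j: "lab r2 = j" and xj: "x \<noteq> j"
  defines "D' \<equiv> D - {r, \<rho>}" and "\<sigma>' \<equiv> unjoin_\<sigma> \<sigma> r r1 r2" and "\<alpha>' \<equiv> unjoin_\<alpha> \<alpha> r \<rho>"
  assumes s: "s = \<alpha>' r2" "q = \<sigma>' s" "p = \<sigma>' q"
  defines "D2 \<equiv> D' - {p, q, s, r2}" and "\<sigma>2 \<equiv> unleg_\<sigma> \<sigma>' p q s" and "\<alpha>2 \<equiv> unleg_\<alpha> \<alpha>' p q s r2"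
  shows "distinct [\<rho>, r, r2, s, p, q]" "{\<rho>, r, r2, s, p, q} \<subseteq> D" "r1 \<in> D2"
    and "\<alpha>' p \<in> D2" "cubic_map D2 {r1} \<sigma>2 \<alpha>2" "leg_\<sigma> \<sigma>2 p q s = \<sigma>'" "leg_\<alpha> \<alpha>2 (\<alpha>' p) p q s r2 = \<alpha>'"
    and "D2 \<union> {p, q, s, r2} = D'" "{p, q, s, r2} \<inter> D2 = {}" "D' \<union> {r, \<rho>} = D" "r \<notin> D'" "\<rho> \<notin> D'"
    and "face_lab D' (bivalent r1 r2 \<sigma>' \<alpha>') K (restrict lab D')" "lab r1 = x" "lab r = x"
    and "join_\<sigma> \<sigma>' r r1 r2 = \<sigma>" "join_\<alpha> \<alpha>' r \<rho> = \<alpha>"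
    and "cubic D' {r1, r2} \<sigma>' \<alpha>'"
proof -
  have rne: "\<sigma> r \<noteq> r" using root_vertex(2)[OF M] r(1) by simp
  note uj = cubic_unjoin[OF M r(1) rne r(2,3)]
  show C: "cubic D' {r1, r2} \<sigma>' \<alpha>'" using uj(4) by (simp add: D'_def \<sigma>'_def \<alpha>'_def)
  have conn: "B \<subseteq> D' \<Longrightarrow> B \<noteq> {} \<Longrightarrow> map_closed \<sigma>' \<alpha>' B \<Longrightarrow> r1 \<in> B \<or> r2 \<in> B" for B
    unfolding D'_def \<sigma>'_def \<alpha>'_def by (rule uj(5))
  show DD: "D' \<union> {r, \<rho>} = D" "r \<notin> D'" "\<rho> \<notin> D'" using uj(2) by (auto simp: D'_def)
  have r12: "r1 \<noteq> r2" "r \<noteq> \<rho>" using uj(1) by auto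
  have cD: "card D = card D' + 2"
    using cubicD(1)[OF C] DD(2,3) r12 by (subst DD(1)[symmetric]) (simp add: card_insert_if)
  show sj: "join_\<sigma> \<sigma>' r r1 r2 = \<sigma>" "join_\<alpha> \<alpha>' r \<rho> = \<alpha>" using uj(6,7) by (simp_all add: \<sigma>'_def \<alpha>'_def)
  have "face_lab (D' \<union> {r, \<rho>}) (join_\<sigma> \<sigma>' r r1 r2 \<circ> join_\<alpha> \<alpha>' r \<rho>) K lab"
    using L unfolding DD(1) sj .
  note fu = face_lab_unjoin[OF C r12 DD(2,3) this]
  show "face_lab D' (bivalent r1 r2 \<sigma>' \<alpha>') K (restrict lab D')" by (rule fu(1))
  show l1: "lab r1 = x" "lab r = x" using fu(2,3) x by auto
  have rD: "r1 \<in> D'" "r2 \<in> D'" using cubicD(2)[OF C] by auto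
  \<comment> \<open>If the cut separated the map, both new leaves would lie on the root face,
    contrary to \<open>x \<noteq> j\<close>.\<close>
  have M': "cubic_map D' {r1, r2} \<sigma>' \<alpha>'"
  proof (rule unjoin_cases[OF C conn])
    fix A assume A: "A \<subseteq> D'" "map_closed \<sigma>' \<alpha>' A" "r1 \<in> A" "r2 \<in> D' - A"
    have "restrict lab D' r2 = restrict lab D' r1" by (rule face_lab_separate(3)[OF C A fu(1)])
    then show ?thesis using rD l1 j xj by simp
  qed
  have nloop: "\<alpha>' r2 \<noteq> r1"
  proof
    assume e: "\<alpha>' r2 = r1"
    have "{r1, r2} = D'"
      by (rule cubic_mapD(7)[OF M']) (use rD e cubicD(3)[OF C, of r2] cubic_in(5)[OF C] in auto)
    then have "card D' = 2" using r12 by auto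
    then show False using cD card by simp
  qed
  note nl = leaf_not_loop[OF M' r12(1) nloop, folded s]
  note ul = cubic_map_unleg[OF M' _ s(1) nl(1) s(2,3) nl(2)]
  have ul': "distinct [p, q, s, r2]" "{p, q, s, r2} \<subseteq> D'" "\<alpha>' p \<in> D' - {p, q, s, r2}"
    "cubic_map (D' - {p, q, s, r2}) ({r1, r2} - {r2}) (unleg_\<sigma> \<sigma>' p q s) (unleg_\<alpha> \<alpha>' p q s r2)"
    "leg_\<sigma> (unleg_\<sigma> \<sigma>' p q s) p q s = \<sigma>'" "leg_\<alpha> (unleg_\<alpha> \<alpha>' p q s r2) (\<alpha>' p) p q s r2 = \<alpha>'"
    by (rule ul; simp)+
  show "leg_\<sigma> \<sigma>2 p q s = \<sigma>'" "leg_\<alpha> \<alpha>2 (\<alpha>' p) p q s r2 = \<alpha>'" "\<alpha>' p \<in> D2"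
    using ul'(3,5,6) by (auto simp: \<sigma>2_def \<alpha>2_def D2_def)
  show M2: "cubic_map D2 {r1} \<sigma>2 \<alpha>2"
    using ul'(4) r12(1) unfolding D2_def \<sigma>2_def \<alpha>2_def by (simp add: insert_Diff_if)
  show "D2 \<union> {p, q, s, r2} = D'" "{p, q, s, r2} \<inter> D2 = {}" using ul'(2) by (auto simp: D2_def)
  show "r1 \<in> D2" using cubic_mapD(2)[OF M2] by auto
  have "{r, \<rho>} \<inter> {p, q, s, r2} = {}" using ul'(2) DD(2,3) by auto
  then show "distinct [\<rho>, r, r2, s, p, q]" using ul'(1) r12 by auto
  show "{\<rho>, r, r2, s, p, q} \<subseteq> D" using ul'(2) DD(1) by auto
qed

text \<open>Each such map arises from one without the face \<open>j\<close> by attaching a leg at a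
  dart \<open>k\<close> of the root face and fusing its leaf with the old one. Six darts are new.
  The edge between the two faces at the leg and the edge to the new leaf give
  \<open>1 / ((lam x + lam j) * (2 * lam x))\<close>, and the sum over \<open>k\<close>
  telescopes.\<close>

theorem rooted_sum_connecting:
  fixes D :: "'a set" and K :: "'b set"
  assumes fD: "finite D" and card: "card D > 4" and fK: "finite K" and xK: "x \<in> K" and jK: "j \<in> K" and xj: "x \<noteq> j"
    and pos: "\<And>i. i \<in> K \<Longrightarrow> lam i > 0" and ne: "lam j \<noteq> lam x"
  shows "(\<Sum>(\<rho>, \<sigma>, \<alpha>, lab)\<in>{m \<in> rooted_maps D K x. third_label m = j}. edge_wt D \<alpha> (\<lambda>d. lam (lab d))) =
    (\<Sum>xs\<in>{xs. length xs = 6 \<and> distinct xs \<and> set xs \<subseteq> D}.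
       (rooted_sum (D - set xs) (K - {j}) x lam - rooted_sum (D - set xs) (K - {j}) x (lam(x := lam j))) /
         ((lam j - lam x) * (lam x + lam j) * (2 * lam x)))"
proof -
  define T where "T = (SIGMA xs : {xs. length xs = 6 \<and> distinct xs \<and> set xs \<subseteq> D}.
     SIGMA m : rooted_maps (D - set xs) (K - {j}) x. {k \<in> D - set xs. snd (snd (snd m)) k = x})"
  define h where "h = (\<lambda>(xs :: 'a list, (r1 :: 'a, \<sigma> :: 'a \<Rightarrow> 'a, \<alpha> :: 'a \<Rightarrow> 'a, lab :: 'a \<Rightarrow> 'b), k :: 'a).
     (let l = split_lab (D - set xs) (\<sigma> \<circ> \<alpha>) lab r1 k x j in
       edge_wt (D - set xs - {k, \<alpha> k}) \<alpha> (\<lambda>d. lam (l d)) / ((lam x + lam (l (\<alpha> k))) * (lam j + lam (l (\<alpha> k)))))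
       / ((lam x + lam j) * (2 * lam x)))"
  define jj where "jj = (\<lambda>(\<rho> :: 'a, \<sigma> :: 'a \<Rightarrow> 'a, \<alpha> :: 'a \<Rightarrow> 'a, lab :: 'a \<Rightarrow> 'b).
     let r = \<alpha> \<rho>; r1 = \<sigma> r; r2 = \<sigma> r1; \<sigma>' = unjoin_\<sigma> \<sigma> r r1 r2; \<alpha>' = unjoin_\<alpha> \<alpha> r \<rho>;
       s = \<alpha>' r2; q = \<sigma>' s; p = \<sigma>' q
     in ([\<rho>, r, r2, s, p, q], (r1, unleg_\<sigma> \<sigma>' p q s, unleg_\<alpha> \<alpha>' p q s r2,
          restrict (\<lambda>d. if lab d = j then x else lab d) (D - {\<rho>, r, r2, s, p, q})), \<alpha>' p))"
  define i where "i = (\<lambda>(xs :: 'a list, (r1 :: 'a, \<sigma> :: 'a \<Rightarrow> 'a, \<alpha> :: 'a \<Rightarrow> 'a, lab :: 'a \<Rightarrow> 'b), k :: 'a).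
     case xs of [\<rho>, r, r2, s, p, q] \<Rightarrow>
      (let l = split_lab (D - set xs) (\<sigma> \<circ> \<alpha>) lab r1 k x j in
       (\<rho>, join_\<sigma> (leg_\<sigma> \<sigma> p q s) r r1 r2, join_\<alpha> (leg_\<alpha> \<alpha> k p q s r2) r \<rho>,
        l(p := l (\<alpha> k), q := j, s := x, r2 := j, r := x, \<rho> := x))))"
  have KK: "insert j (K - {j}) = K" "j \<notin> K - {j}" using jK by auto
  have "(\<Sum>(\<rho>, \<sigma>, \<alpha>, lab)\<in>{m \<in> rooted_maps D K x. third_label m = j}. edge_wt D \<alpha> (\<lambda>d. lam (lab d))) = (\<Sum>b\<in>T. h b)"
  proof (rule sum.reindex_bij_witness[of _ i jj])
    fix a assume "a \<in> {m \<in> rooted_maps D K x. third_label m = j}"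
    then obtain \<rho> \<sigma> \<alpha> lab where a: "a = (\<rho>, \<sigma>, \<alpha>, lab)" and M: "cubic_map D {\<rho>} \<sigma> \<alpha>"
      and L: "face_lab D (\<sigma> \<circ> \<alpha>) K lab" and lx: "lab \<rho> = x" "lab (\<sigma> (\<sigma> (\<alpha> \<rho>))) = j"
      by (auto simp: rooted_maps_def third_label_def)
    define r r1 r2 where r: "r = \<alpha> \<rho>" "r1 = \<sigma> r" "r2 = \<sigma> r1"
    define \<sigma>' where "\<sigma>' = unjoin_\<sigma> \<sigma> r r1 r2"
    define \<alpha>' where "\<alpha>' = unjoin_\<alpha> \<alpha> r \<rho>"
    define D' where "D' = D - {r, \<rho>}"
    define s q p where s: "s = \<alpha>' r2" "q = \<sigma>' s" "p = \<sigma>' q"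
    define D2 where "D2 = D' - {p, q, s, r2}"
    define \<sigma>2 where "\<sigma>2 = unleg_\<sigma> \<sigma>' p q s"
    define \<alpha>2 where "\<alpha>2 = unleg_\<alpha> \<alpha>' p q s r2"
    define k where "k = \<alpha>' p"
    have l2: "lab r2 = j" using lx by (simp add: r)
    note R = root_connects[OF M L card r lx(1) l2 xj, folded \<sigma>'_def \<alpha>'_def D'_def, OF s, folded D2_def \<sigma>2_def \<alpha>2_def, folded k_def]
    have D2: "D - {\<rho>, r, r2, s, p, q} = D2" by (auto simp: D2_def D'_def)
    have dist: "distinct [p, q, s, r2]" using R(1) by auto
    interpret ml: marked_leg D2 r1 \<sigma>2 \<alpha>2 k p q s r2
      by standard (fact cubic_map_cubic[OF R(5)] R(4) dist R(9))+
    have \<phi>: "ml.\<phi> = \<sigma>2 \<circ> \<alpha>2" by (simp add: ml.\<phi>_def fun_eq_iff)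
    have \<psi>: "ml.\<psi> = bivalent r1 r2 \<sigma>' \<alpha>'" unfolding ml.\<psi>_def R(6,7) ..
    define l where "l = restrict lab D'"
    have rD: "r1 \<in> D'" "r2 \<in> D'" using R(3,8) by auto
    have F: "face_lab (D2 \<union> {p, q, s, r2}) ml.\<psi> K l" unfolding \<psi> R(8) l_def by (rule R(13))
    have l12: "l r1 = x" "l r2 = j" using rD R(14) l2 by (auto simp: l_def)
    note G = ml.face_lab_merge[OF F l12 xj]
    define lab2 where "lab2 = restrict (\<lambda>d. if lab d = j then x else lab d) D2"
    have lab2: "restrict (\<lambda>d. if l d = j then x else l d) D2 = lab2"
      using R(8) by (auto simp: lab2_def l_def fun_eq_iff restrict_def)
    note G = G[unfolded lab2 \<phi>]
    have ja: "jj a = ([\<rho>, r, r2, s, p, q], (r1, \<sigma>2, \<alpha>2, lab2), k)"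
      unfolding a jj_def Let_def prod.case r[symmetric] \<sigma>'_def[symmetric] \<alpha>'_def[symmetric] s[symmetric]
        \<sigma>2_def[symmetric] \<alpha>2_def[symmetric] D2 lab2_def[symmetric] k_def[symmetric] ..
    have p2: "(\<sigma>2 \<circ> \<alpha>2) permutes D2"
      using cubic_permutes[OF ml.C] by (rule permutes_compose[rotated])
    \<comment> \<open>Identifying \<open>j\<close> with \<open>x\<close> is reversible because the
      old face \<open>x\<close> can be read off as the segment from \<open>r1\<close> to
      \<open>k\<close>.\<close>
    have S: "the_segment (\<sigma>2 \<circ> \<alpha>2) {d \<in> D2. lab2 d = x} r1 k = {d \<in> D2. l d = x}"
      by (rule the_segment_eq[OF G(1) p2 R(3) G(2,3)])
    define sl where "sl = split_lab D2 (\<sigma>2 \<circ> \<alpha>2) lab2 r1 k x j"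
    have lD: "l d = lab d" if "d \<in> D2" for d using that R(8) by (auto simp: l_def)
    have sl: "sl d = lab d" if "d \<in> D2" for d
      using that lD[OF that] xj unfolding sl_def split_lab_def S by (auto simp: lab2_def)
    have slo: "sl d = undefined" if "d \<notin> D2" for d using that by (auto simp: sl_def split_lab_def lab2_def)
    have ak: "\<alpha>2 k \<in> D2" by (rule ml.ak(1))
    have lv: "lab p = lab (\<alpha>2 k)" "lab q = j" "lab s = x" "lab k = x" "lab r2 = j"
      using G(4-7) lD[OF ak] lD[OF R(4)] R(8) l2 by (auto simp: l_def)
    have labeq: "sl(p := sl (\<alpha>2 k), q := j, s := x, r2 := j, r := x, \<rho> := x) = lab"
    proof
      fix d
      have "d \<in> D2 \<or> d \<in> {p, q, s, r2, r, \<rho>} \<or> d \<notin> D" using D2 by auto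
      moreover have "d \<notin> D \<Longrightarrow> lab d = undefined" using face_labD(2)[OF L] by (auto simp: extensional_def)
      moreover have "d \<in> D2 \<Longrightarrow> d \<notin> {p, q, s, r2, r, \<rho>}" using D2 by auto
      moreover have "d \<notin> D \<Longrightarrow> d \<notin> D2 \<and> d \<notin> {p, q, s, r2, r, \<rho>}" using D2 R(2) by auto
      ultimately show "(sl(p := sl (\<alpha>2 k), q := j, s := x, r2 := j, r := x, \<rho> := x)) d = lab d"
        using sl slo lv sl[OF ak] R(15) lx(1) R(1) by auto
    qed
    show "i (jj a) = a"
      unfolding ja unfolding i_def a prod.case list.case by (simp add: D2 Let_def R(6,7,16,17) sl_def[symmetric] labeq)
    have kk: "k \<in> D - {\<rho>, r, r2, s, p, q}" unfolding D2 by (rule R(4))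
    then have kk: "k \<in> D \<and> k \<noteq> \<rho> \<and> k \<noteq> r \<and> k \<noteq> r2 \<and> k \<noteq> s \<and> k \<noteq> p \<and> k \<noteq> q" by simp
    show "jj a \<in> T"
      unfolding ja T_def rooted_maps_def using kk R(1,2,4,5) G(1,2) lv by (simp add: D2) (simp add: lab2_def)
    have r\<rho>: "r \<noteq> \<rho>" using R(1) by auto
    have w1: "edge_wt D \<alpha> (\<lambda>d. lam (lab d)) = edge_wt D' \<alpha>' (\<lambda>d. lam (lab d)) / (2 * lam x)"
      using edge_wt_join[OF R(18) r\<rho> R(11,12), of "\<lambda>d. lam (lab d)"] R(10,15,17) lx(1) by simp
    have w2: "edge_wt D' \<alpha>' (\<lambda>d. lam (lab d)) = edge_wt (D2 - {k, \<alpha>2 k}) \<alpha>2 (\<lambda>d. lam (lab d)) /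
        ((lam x + lam (lab (\<alpha>2 k))) * (lam (lab (\<alpha>2 k)) + lam j) * (lam x + lam j))"
      using edge_wt_leg[OF ml.C R(4) dist R(9), of "\<lambda>d. lam (lab d)"] R(7,8) lv by simp
    have w3: "edge_wt (D2 - {k, \<alpha>2 k}) \<alpha>2 (\<lambda>d. lam (lab d)) = edge_wt (D2 - {k, \<alpha>2 k}) \<alpha>2 (\<lambda>d. lam (sl d))"
      by (rule edge_wt_cong) (use sl cubic_in(1,9)[OF ml.C] cubicD(3)[OF ml.C] in auto)
    have hj: "h (jj a) = edge_wt (D2 - {k, \<alpha>2 k}) \<alpha>2 (\<lambda>d. lam (sl d)) / ((lam x + lam (sl (\<alpha>2 k))) * (lam j + lam (sl (\<alpha>2 k))))
       / ((lam x + lam j) * (2 * lam x))"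
      unfolding ja h_def by (simp add: D2 Let_def sl_def[symmetric])
    have "h (jj a) = edge_wt D \<alpha> (\<lambda>d. lam (lab d))"
      unfolding hj w1 w2 w3 sl[OF ak] by (simp add: ac_simps)
    then show "h (jj a) = (case a of (\<rho>, \<sigma>, \<alpha>, lab) \<Rightarrow> edge_wt D \<alpha> (\<lambda>d. lam (lab d)))"
      by (simp add: a)
  next
    fix b assume b: "b \<in> T"
    obtain xs r1 \<sigma> \<alpha> lab k where b': "b = (xs, (r1, \<sigma>, \<alpha>, lab), k)" by (metis prod.collapse)
    obtain \<rho> r r2 s p q where xs: "xs = [\<rho>, r, r2, s, p, q]" using b b' by (auto simp: T_def elim: length_6E)
    define D2 where "D2 = D - {\<rho>, r, r2, s, p, q}"
    have dist6: "distinct [\<rho>, r, r2, s, p, q]" and sub: "{\<rho>, r, r2, s, p, q} \<subseteq> D"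
      and M: "cubic_map D2 {r1} \<sigma> \<alpha>" and L: "face_lab D2 (\<sigma> \<circ> \<alpha>) (K - {j}) lab" and x1: "lab r1 = x"
      and k: "k \<in> D2" "lab k = x"
      using b unfolding b' xs T_def rooted_maps_def by (simp_all add: D2_def)
    have dist: "distinct [p, q, s, r2]" using dist6 by auto
    have nw: "{p, q, s, r2} \<inter> D2 = {}" by (auto simp: D2_def)
    interpret ml: marked_leg D2 r1 \<sigma> \<alpha> k p q s r2
      by standard (fact cubic_map_cubic[OF M] k(1) dist nw)+
    have \<phi>: "ml.\<phi> = \<sigma> \<circ> \<alpha>" by (simp add: ml.\<phi>_def fun_eq_iff)
    have p2: "(\<sigma> \<circ> \<alpha>) permutes D2" using cubic_permutes[OF ml.C] by (rule permutes_compose[rotated])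
    define S where "S = the_segment (\<sigma> \<circ> \<alpha>) {d \<in> D2. lab d = x} r1 k"
    have S: "face_segment (\<sigma> \<circ> \<alpha>) {d \<in> D2. lab d = x} r1 k S"
      unfolding S_def by (rule face_segment_the[OF L p2 cubicD(1)[OF ml.C] ml.r1 x1 k])
    define sl where "sl = split_lab D2 (\<sigma> \<circ> \<alpha>) lab r1 k x j"
    have sl_eq: "sl = (\<lambda>d. if lab d = x \<and> d \<in> D2 - S then j else lab d)"
      by (simp add: sl_def split_lab_def S_def)
    define \<sigma>' where "\<sigma>' = leg_\<sigma> \<sigma> p q s"
    define \<alpha>' where "\<alpha>' = leg_\<alpha> \<alpha> k p q s r2"
    define D' where "D' = D2 \<union> {p, q, s, r2}"
    define l where "l = sl(p := sl (\<alpha> k), q := j, s := x, r2 := j)"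
    have slk: "(if lab (\<alpha> k) = x \<and> \<alpha> k \<in> D2 - S then j else lab (\<alpha> k)) = sl (\<alpha> k)"
      unfolding sl_eq ..
    have F: "face_lab D' (bivalent r1 r2 \<sigma>' \<alpha>') K l"
      using ml.face_lab_split[unfolded \<phi>, OF L S x1 KK(2)]
      unfolding ml.\<psi>_def sl_eq[symmetric] slk l_def[symmetric] KK D'_def \<sigma>'_def \<alpha>'_def .
    have "cubic_map D' (insert r2 {r1}) \<sigma>' \<alpha>'"
      unfolding D'_def \<sigma>'_def \<alpha>'_def by (rule cubic_map_leg[OF M k(1) dist nw])
    then have M': "cubic_map D' {r1, r2} \<sigma>' \<alpha>'" by (simp add: insert_commute)
    note C' = cubic_map_cubic[OF M']
    have new: "r \<noteq> \<rho>" "r \<notin> D'" "\<rho> \<notin> D'" using dist6 by (auto simp: D'_def D2_def)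
    have DD: "D' \<union> {r, \<rho>} = D" using sub by (auto simp: D'_def D2_def)
    have r12: "r1 \<noteq> r2" by (rule ml.ne)
    have conn: "A \<subseteq> D' \<Longrightarrow> A \<noteq> {} \<Longrightarrow> map_closed \<sigma>' \<alpha>' A \<Longrightarrow> r1 \<in> A \<or> r2 \<in> A" for A
      using M' cubicD(2)[OF C'] unfolding cubic_map_def by blast
    note J = cubic_map_join[OF C' r12 new conn]
    have J2: "unjoin_\<sigma> (join_\<sigma> \<sigma>' r r1 r2) r r1 r2 = \<sigma>'" "unjoin_\<alpha> (join_\<alpha> \<alpha>' r \<rho>) r \<rho> = \<alpha>'"
      using J(2,3) by auto
    have lr1: "l r1 = x"
    proof -
      have "r1 \<in> S" by (rule face_segmentD(1)[OF S])
      then show ?thesis using ml.r1 nw x1 unfolding l_def sl_eq by auto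
    qed
    have FL: "face_lab D (join_\<sigma> \<sigma>' r r1 r2 \<circ> join_\<alpha> \<alpha>' r \<rho>) K (l(r := x, \<rho> := x))"
      using face_lab_join[OF C' r12 new F] DD lr1 by simp
    have ib: "i b = (\<rho>, join_\<sigma> \<sigma>' r r1 r2, join_\<alpha> \<alpha>' r \<rho>, l(r := x, \<rho> := x))"
      unfolding b' xs i_def by (simp add: Let_def D2_def[symmetric] sl_def[symmetric] \<sigma>'_def \<alpha>'_def l_def)
    have n3: "r1 \<noteq> r" "r1 \<noteq> \<rho>" "r2 \<noteq> r" "r2 \<noteq> \<rho>" using new ml.r1 by (auto simp: D'_def)
    have jv: "join_\<alpha> \<alpha>' r \<rho> \<rho> = r" "join_\<sigma> \<sigma>' r r1 r2 r = r1" "join_\<sigma> \<sigma>' r r1 r2 r1 = r2"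
      using new n3 r12 by (auto simp: join_\<alpha>_def join_\<sigma>_def)
    note u = unleg_leg[OF M k(1) dist nw, folded \<sigma>'_def \<alpha>'_def]
    have labr: "restrict (\<lambda>d. if (l(r := x, \<rho> := x)) d = j then x else (l(r := x, \<rho> := x)) d) D2 = lab"
    proof
      fix d
      have Kd: "lab d \<noteq> j" if "d \<in> D2" using that face_labD(3)[OF L] by auto
      have "d \<in> D2 \<Longrightarrow> d \<notin> {\<rho>, r, r2, s, p, q}" by (auto simp: D2_def)
      then show "restrict (\<lambda>d. if (l(r := x, \<rho> := x)) d = j then x else (l(r := x, \<rho> := x)) d) D2 d = lab d"
        using Kd face_labD(2)[OF L] by (auto simp: l_def sl_eq extensional_def)
    qed
    show "jj (i b) = b"
      unfolding ib unfolding jj_def b' xs Let_def prod.case jv J2 u D2_def[symmetric] labr ..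
    show "i b \<in> {m \<in> rooted_maps D K x. third_label m = j}"
      unfolding ib rooted_maps_def third_label_def using J(1) FL jv n3 DD by (simp add: l_def)
  qed
  also have "\<dots> = (\<Sum>xs\<in>{xs. length xs = 6 \<and> distinct xs \<and> set xs \<subseteq> D}. \<Sum>m\<in>rooted_maps (D - set xs) (K - {j}) x.
     \<Sum>k\<in>{k \<in> D - set xs. snd (snd (snd m)) k = x}. h (xs, m, k))"
    unfolding T_def using fD fK finite_distinct_lists[OF fD, of 6]
    by (intro sum_Sigma2) (auto simp: finite_rooted_maps)
  also have "\<dots> = (\<Sum>xs\<in>{xs. length xs = 6 \<and> distinct xs \<and> set xs \<subseteq> D}.
       (rooted_sum (D - set xs) (K - {j}) x lam - rooted_sum (D - set xs) (K - {j}) x (lam(x := lam j))) /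
         ((lam j - lam x) * (lam x + lam j) * (2 * lam x)))"
  proof (rule sum.cong[OF refl])
    fix xs assume "xs \<in> {xs. length xs = 6 \<and> distinct xs \<and> set xs \<subseteq> D}"
    let ?c = "(lam j - lam x) * (lam x + lam j) * (2 * lam x)"
    define D2 where "D2 = D - set xs"
    have "(\<Sum>m\<in>rooted_maps D2 (K - {j}) x. \<Sum>k\<in>{k \<in> D2. snd (snd (snd m)) k = x}. h (xs, m, k)) =
      (\<Sum>(r1, \<sigma>, \<alpha>, lab)\<in>rooted_maps D2 (K - {j}) x.
         (edge_wt D2 \<alpha> (\<lambda>d. lam (lab d)) - edge_wt D2 \<alpha> (\<lambda>d. (lam(x := lam j)) (lab d))) / ?c)"
    proof (rule sum.cong[OF refl])
      fix m assume m: "m \<in> rooted_maps D2 (K - {j}) x"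
      obtain r1 \<sigma> \<alpha> lab where m': "m = (r1, \<sigma>, \<alpha>, lab)" by (cases m)
      have M: "cubic_map D2 {r1} \<sigma> \<alpha>" and L: "face_lab D2 (\<sigma> \<circ> \<alpha>) (K - {j}) lab" and x1: "lab r1 = x"
        using m unfolding m' rooted_maps_def by auto
      have r1: "r1 \<in> D2" using cubic_mapD(2)[OF M] by auto
      have "(\<Sum>k\<in>{k \<in> D2. lab k = x}. h (xs, m, k)) =
       (\<Sum>k\<in>{k \<in> D2. lab k = x}. let l = split_lab D2 (\<sigma> \<circ> \<alpha>) lab r1 k x j in
       edge_wt (D2 - {k, \<alpha> k}) \<alpha> (\<lambda>d. lam (l d)) / ((lam x + lam (l (\<alpha> k))) * (lam j + lam (l (\<alpha> k)))))
         / ((lam x + lam j) * (2 * lam x))"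
        unfolding h_def m' D2_def[symmetric] prod.case sum_divide_distrib[symmetric] ..
      also have "\<dots> = (edge_wt D2 \<alpha> (\<lambda>d. lam (lab d)) - edge_wt D2 \<alpha> (\<lambda>d. (lam(x := lam j)) (lab d))) / (lam j - lam x)
         / ((lam x + lam j) * (2 * lam x))"
        by (subst sum_root_face_telescope[OF cubic_map_cubic[OF M] L r1 x1 _ _ KK(2) ne])
           (use pos jK in auto)
      finally show "(\<Sum>k\<in>{k \<in> D2. snd (snd (snd m)) k = x}. h (xs, m, k)) =
         (case m of (r1, \<sigma>, \<alpha>, lab) \<Rightarrow> (edge_wt D2 \<alpha> (\<lambda>d. lam (lab d)) - edge_wt D2 \<alpha> (\<lambda>d. (lam(x := lam j)) (lab d))) / ?c)"
        by (simp add: m' mult.assoc)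
    qed
    then show "(\<Sum>m\<in>rooted_maps (D - set xs) (K - {j}) x. \<Sum>k\<in>{k \<in> D - set xs. snd (snd (snd m)) k = x}. h (xs, m, k)) =
      (rooted_sum (D - set xs) (K - {j}) x lam - rooted_sum (D - set xs) (K - {j}) x (lam(x := lam j))) / ?c"
      unfolding rooted_sum_def D2_def[symmetric]
      by (simp add: sum_subtractf[symmetric] sum_divide_distrib case_prod_unfold)
  qed
  finally show ?thesis .
qed

section \<open>The loop equation\<close>

lemma rooted_maps_genus_bound:
  assumes "rooted_maps D K x \<noteq> {}"
  shows "6 * card K \<le> card D + 8" "x \<in> K" "D \<noteq> {}"
proof -
  obtain \<rho> \<sigma> \<alpha> lab where M: "cubic_map D {\<rho>} \<sigma> \<alpha>" and L: "face_lab D (\<sigma> \<circ> \<alpha>) K lab" and x: "lab \<rho> = x"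
    using assms unfolding rooted_maps_def by auto
  have "6 * card (lab ` D) \<le> card D + 8"
    by (rule genus_bound[OF M]) (use face_labD(4)[OF L] in simp)
  then show "6 * card K \<le> card D + 8" using face_labD(3)[OF L] by simp
  show "x \<in> K" "D \<noteq> {}" using x face_labD(3)[OF L] cubic_mapD(2)[OF M] by auto
qed

text \<open>The number of darts is that of a planar map with one leaf (here) or none (below), by Euler's formula.\<close>

definition rooted_Z :: "'b set \<Rightarrow> 'b \<Rightarrow> ('b \<Rightarrow> real) \<Rightarrow> real" where
  "rooted_Z K x lam = rooted_sum {..<6 * card K - 8} K x lam / fact (6 * card K - 8)"

definition marked_Z :: "'b set \<Rightarrow> 'b \<Rightarrow> ('b \<Rightarrow> real) \<Rightarrow> real" where
  "marked_Z K x lam = marked_sum {..<6 * card K - 12} K x lam / fact (6 * card K - 12)"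

lemma rooted_Z_card:
  fixes D :: "nat set"
  assumes "finite D" "card D + 8 = 6 * card K"
  shows "rooted_sum D K x lam = fact (card D) * rooted_Z K x lam"
proof -
  have c: "card D = 6 * card K - 8" using assms(2) by simp
  have "rooted_sum D K x lam = rooted_sum {..<6 * card K - 8} K x lam"
    by (rule rooted_sum_card) (use assms c in auto)
  then show ?thesis by (simp add: rooted_Z_def c)
qed

lemma rooted_Z_marked_Z:
  assumes K: "card K \<ge> 3" "x \<in> K" and pos: "\<And>i. i \<in> K \<Longrightarrow> lam i > 0"
  shows "2 * lam x * rooted_Z K x lam = marked_Z K x lam"
proof -
  let ?n = "6 * card K - 8"
  define D where "D = {..<?n}"
  have fK: "finite K" using K by (metis card.infinite not_numeral_le_zero)
  have D: "finite D" "card D = ?n" "card D > 4" "4 \<le> card D" using K by (auto simp: D_def)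
  have e: "card D - 4 = 6 * card K - 12" using D K by simp
  have m: "marked_sum (D - set xs) K x lam / (2 * lam x) = marked_sum {..<6 * card K - 12} K x lam / (2 * lam x)"
    if "length xs = 4" "distinct xs" "set xs \<subseteq> D" for xs
  proof -
    have "card (D - set xs) = card D - 4" using that D(1) by (simp add: card_Diff_subset distinct_card)
    then show ?thesis using marked_sum_card[of "D - set xs" "{..<6 * card K - 12}" K x lam] e D(1) by simp
  qed
  have "rooted_Z K x lam = rooted_sum D K x lam / fact (card D)" by (simp add: rooted_Z_def D_def)
  also have "\<dots> = (\<Sum>xs\<in>{xs. length xs = 4 \<and> distinct xs \<and> set xs \<subseteq> D}. marked_sum (D - set xs) K x lam / (2 * lam x)) / fact (card D)"
    by (subst rooted_sum_eq_marked_sum[OF D(1,3) fK K(2)]) (use pos in auto)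
  also have "\<dots> = (marked_sum {..<6 * card K - 12} K x lam / (2 * lam x)) / fact (card D - 4)"
    by (rule sum_distinct_lists_const[OF D(1) m D(4)])
  also have "\<dots> = marked_Z K x lam / (2 * lam x)" unfolding e marked_Z_def by simp
  finally show ?thesis using pos[OF K(2)] by simp
qed

text \<open>By truncated subtraction the dart set is empty for a single face, and no map with a leaf
  lives on it. This is the right value: splitting off a piece without a further face contributes
  nothing.\<close>

lemma rooted_Z_singleton: "card K = 1 \<Longrightarrow> rooted_Z K x lam = 0"
proof -
  assume "card K = 1"
  then have "rooted_maps ({..<6 * card K - 8} :: nat set) K x = {}"
    using rooted_maps_genus_bound(3)[of "{..<6 * card K - 8}" K x] by auto
  then show ?thesis by (simp add: rooted_Z_def rooted_sum_def)
qed

text \<open>The darts available are exactly the sum of the planar dart numbers of the two pieces,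
  and so both pieces are planar. The number of subsets \<open>D1\<close> of the right size cancels
  the two factorials against that of \<open>D\<close>.\<close>

lemma sum_separated_pairs:
  fixes D :: "nat set"
  assumes fD: "finite D" and cD: "card D + 10 = 6 * card K" and fK: "finite K"
    and K1: "K1 \<subseteq> K" "x \<in> K1" and K2: "K2 = insert x (K - K1)"
  shows "(\<Sum>D1\<in>Pow D. rooted_sum D1 K1 x lam * rooted_sum (D - D1) K2 x lam) =
    fact (card D) * (rooted_Z K1 x lam * rooted_Z K2 x lam)"
proof -
  have fK12: "finite K1" "finite K2" using fK K1 K2 by (auto intro: finite_subset)
  have cK: "card K1 + card K2 = card K + 1"
  proof -
    have "card K2 = card (K - K1) + 1" using K2 K1 fK by simp
    moreover have "card (K - K1) = card K - card K1" using K1 fK12 by (simp add: card_Diff_subset)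
    moreover have "card K1 \<le> card K" using K1 fK by (simp add: card_mono)
    ultimately show ?thesis by simp
  qed
  have c12: "card K1 \<ge> 1" "card K2 \<ge> 1" using fK12 K1 K2 by (auto simp: Suc_le_eq card_gt_0_iff)
  have c: "rooted_sum D1 K1 x lam * rooted_sum (D - D1) K2 x lam =
     (if card D1 + 8 = 6 * card K1 then fact (card D1) * fact (card D - card D1) * (rooted_Z K1 x lam * rooted_Z K2 x lam) else 0)"
    if D1: "D1 \<subseteq> D" for D1
  proof -
    have cc: "card (D - D1) = card D - card D1" "card D1 \<le> card D" "finite D1"
      using D1 fD by (auto simp: card_Diff_subset finite_subset card_mono)
    show ?thesis
    proof (cases "card D1 + 8 = 6 * card K1")
      case True
      then have "card (D - D1) + 8 = 6 * card K2" using cD cK cc by simp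
      then show ?thesis using True rooted_Z_card[OF cc(3) True] rooted_Z_card[of "D - D1" K2] fD cc by simp
    next
      case False
      \<comment> \<open>Too few darts violate the genus bound on one side; too many leave too few
        for the other.\<close>
      have "rooted_maps D1 K1 x = {} \<or> rooted_maps (D - D1) K2 x = {}"
      proof (rule ccontr)
        assume "\<not> ?thesis"
        then have "6 * card K1 \<le> card D1 + 8" "6 * card K2 \<le> card (D - D1) + 8"
          using rooted_maps_genus_bound(1)[of D1 K1 x] rooted_maps_genus_bound(1)[of "D - D1" K2 x] by auto
        then show False using False cD cK cc by simp
      qed
      then show ?thesis using False by (auto simp: rooted_sum_def)
    qed
  qed
  show ?thesis
  proof (cases "card K1 = 1 \<or> card K2 = 1")
    case True
    then have 0: "rooted_Z K1 x lam * rooted_Z K2 x lam = 0" using rooted_Z_singleton[of K1 x lam] rooted_Z_singleton[of K2 x lam] by auto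
    have "(\<Sum>D1\<in>Pow D. rooted_sum D1 K1 x lam * rooted_sum (D - D1) K2 x lam) = 0"
      by (rule sum.neutral) (use c 0 in auto)
    then show ?thesis using 0 by simp
  next
    case False
    define n1 where "n1 = 6 * card K1 - 8"
    have n1: "card D1 + 8 = 6 * card K1 \<longleftrightarrow> card D1 = n1" for D1 :: "nat set"
      using False c12 by (auto simp: n1_def)
    have n1D: "n1 \<le> card D" using False c12 cK cD by (auto simp: n1_def)
    have "(\<Sum>D1\<in>Pow D. rooted_sum D1 K1 x lam * rooted_sum (D - D1) K2 x lam) =
      (\<Sum>D1\<in>Pow D. if card D1 = n1 then fact n1 * fact (card D - n1) * (rooted_Z K1 x lam * rooted_Z K2 x lam) else 0)"
      by (rule sum.cong) (auto simp: c n1)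
    also have "\<dots> = (\<Sum>D1\<in>{D1. D1 \<subseteq> D \<and> card D1 = n1}. fact n1 * fact (card D - n1) * (rooted_Z K1 x lam * rooted_Z K2 x lam))"
      using fD by (subst sum.inter_filter[symmetric]) (auto intro!: sum.cong)
    also have "\<dots> = real (card D choose n1) * (fact n1 * fact (card D - n1) * (rooted_Z K1 x lam * rooted_Z K2 x lam))"
      using n_subsets[OF fD, of n1] by simp
    also have "\<dots> = fact (card D) * (rooted_Z K1 x lam * rooted_Z K2 x lam)"
      using binomial_fact_lemma[OF n1D] by (metis (no_types, lifting) ab_semigroup_mult_class.mult_ac(1) mult.commute of_nat_fact of_nat_mult)
    finally show ?thesis .
  qed
qed

text \<open>A Tutte equation: the first sum collects the maps whose root vertex lies on the root
  face alone, the summand of \<open>j\<close> those whose root vertex also touches the face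
  \<open>j\<close>. The factor \<open>1 / (2 * lam x)\<close> of the edge to the leaf is common to
  both and has been moved to the left.\<close>

theorem loop_equation:
  assumes K: "card K \<ge> 3" "x \<in> K" and pos: "\<And>i. i \<in> K \<Longrightarrow> lam i > 0"
    and ne: "\<And>j. j \<in> K - {x} \<Longrightarrow> lam j \<noteq> lam x"
  shows "2 * lam x * rooted_Z K x lam =
    (\<Sum>K1\<in>{K1. K1 \<subseteq> K \<and> x \<in> K1}. rooted_Z K1 x lam * rooted_Z (insert x (K - K1)) x lam) +
    (\<Sum>j\<in>K - {x}. (rooted_Z (K - {j}) x lam - rooted_Z (K - {j}) x (lam(x := lam j))) / ((lam j)\<^sup>2 - (lam x)\<^sup>2))"
proof -
  let ?n = "6 * card K - 8"
  define D where "D = {..<?n}"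
  have fK: "finite K" using K by (metis card.infinite not_numeral_le_zero)
  have D: "finite D" "card D = ?n" "card D > 4" "card D + 8 = 6 * card K" "2 \<le> card D" "6 \<le> card D" using K by (auto simp: D_def)
  have lx: "lam x > 0" using pos K by auto
  define S where "S = (\<lambda>c. \<Sum>(\<rho>, \<sigma>, \<alpha>, lab)\<in>{m \<in> rooted_maps D K x. third_label m = c}. edge_wt D \<alpha> (\<lambda>d. lam (lab d)))"
  have tl: "third_label m \<in> K" if m: "m \<in> rooted_maps D K x" for m
  proof -
    obtain \<rho> \<sigma> \<alpha> lab where m': "m = (\<rho>, \<sigma>, \<alpha>, lab)" by (cases m)
    then have M: "cubic_map D {\<rho>} \<sigma> \<alpha>" and L: "face_lab D (\<sigma> \<circ> \<alpha>) K lab" using m by (auto simp: rooted_maps_def)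
    have "\<sigma> (\<sigma> (\<alpha> \<rho>)) \<in> D" using root_vertex(1)[OF M] cubic_map_in(2)[OF M] by auto
    then show ?thesis using face_labD(3)[OF L] by (auto simp: m' third_label_def)
  qed
  have "rooted_sum D K x lam = (\<Sum>c\<in>K. S c)"
    unfolding rooted_sum_def S_def
    by (rule sum.group[symmetric]) (use fK finite_rooted_maps[OF D(1) fK] tl in auto)
  also have "\<dots> = S x + (\<Sum>c\<in>K - {x}. S c)" using fK K by (simp add: sum.remove)
  finally have split: "rooted_Z K x lam = S x / fact (card D) + (\<Sum>c\<in>K - {x}. S c / fact (card D))"
    by (simp add: rooted_Z_def D_def add_divide_distrib sum_divide_distrib)
  have 1: "S x / fact (card D) = (\<Sum>K1\<in>{K1. K1 \<subseteq> K \<and> x \<in> K1}. rooted_Z K1 x lam * rooted_Z (insert x (K - K1)) x lam) / (2 * lam x)"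
  proof -
    define R where "R = (\<Sum>K1\<in>{K1. K1 \<subseteq> K \<and> x \<in> K1}. rooted_Z K1 x lam * rooted_Z (insert x (K - K1)) x lam)"
    have "S x = (\<Sum>xs\<in>{xs. length xs = 2 \<and> distinct xs \<and> set xs \<subseteq> D}. \<Sum>D1\<in>Pow (D - set xs).
       \<Sum>K1\<in>{K1. K1 \<subseteq> K \<and> x \<in> K1}.
         rooted_sum D1 K1 x lam * rooted_sum (D - set xs - D1) (insert x (K - K1)) x lam / (2 * lam x))"
      unfolding S_def by (rule rooted_sum_separating[OF D(1,4) fK K(2) pos])
    also have "\<dots> / fact (card D) = (fact (card D - 2) * R / (2 * lam x)) / fact (card D - 2)"
    proof (rule sum_distinct_lists_const[OF D(1) _ D(5)])
      fix xs :: "nat list" assume xs: "length xs = 2" "distinct xs" "set xs \<subseteq> D"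
      have cx: "card (D - set xs) = card D - 2" using xs D(1) by (simp add: card_Diff_subset distinct_card)
      have "(\<Sum>D1\<in>Pow (D - set xs). \<Sum>K1\<in>{K1. K1 \<subseteq> K \<and> x \<in> K1}.
         rooted_sum D1 K1 x lam * rooted_sum (D - set xs - D1) (insert x (K - K1)) x lam / (2 * lam x)) =
        (\<Sum>K1\<in>{K1. K1 \<subseteq> K \<and> x \<in> K1}. (\<Sum>D1\<in>Pow (D - set xs).
         rooted_sum D1 K1 x lam * rooted_sum (D - set xs - D1) (insert x (K - K1)) x lam) / (2 * lam x))"
        unfolding sum_divide_distrib by (rule sum.swap)
      also have "\<dots> = (\<Sum>K1\<in>{K1. K1 \<subseteq> K \<and> x \<in> K1}. fact (card D - 2) * (rooted_Z K1 x lam * rooted_Z (insert x (K - K1)) x lam) / (2 * lam x))"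
        by (intro sum.cong refl, subst sum_separated_pairs[OF _ _ fK _ _ refl]) (use D cx in auto)
      also have "\<dots> = fact (card D - 2) * R / (2 * lam x)"
        unfolding R_def by (simp add: sum_distrib_left sum_divide_distrib)
      finally show "(\<Sum>D1\<in>Pow (D - set xs). \<Sum>K1\<in>{K1. K1 \<subseteq> K \<and> x \<in> K1}.
         rooted_sum D1 K1 x lam * rooted_sum (D - set xs - D1) (insert x (K - K1)) x lam / (2 * lam x)) =
         fact (card D - 2) * R / (2 * lam x)" .
    qed
    finally show ?thesis unfolding R_def by simp
  qed
  have 2: "S j / fact (card D) = (rooted_Z (K - {j}) x lam - rooted_Z (K - {j}) x (lam(x := lam j))) / ((lam j)\<^sup>2 - (lam x)\<^sup>2) / (2 * lam x)"
    if j: "j \<in> K - {x}" for j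
  proof -
    let ?c = "(lam j - lam x) * (lam x + lam j) * (2 * lam x)"
    define R where "R = rooted_Z (K - {j}) x lam - rooted_Z (K - {j}) x (lam(x := lam j))"
    have "S j = (\<Sum>xs\<in>{xs. length xs = 6 \<and> distinct xs \<and> set xs \<subseteq> D}.
       (rooted_sum (D - set xs) (K - {j}) x lam - rooted_sum (D - set xs) (K - {j}) x (lam(x := lam j))) / ?c)"
      unfolding S_def by (rule rooted_sum_connecting[OF D(1,3) fK K(2)]) (use j pos ne in auto)
    also have "\<dots> / fact (card D) = (fact (card D - 6) * R / ?c) / fact (card D - 6)"
    proof (rule sum_distinct_lists_const[OF D(1) _ D(6)])
      fix xs :: "nat list" assume xs: "length xs = 6" "distinct xs" "set xs \<subseteq> D"
      have cx: "card (D - set xs) = card D - 6" using xs D(1) by (simp add: card_Diff_subset distinct_card)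
      have "card (D - set xs) + 8 = 6 * card (K - {j})" using cx D(2,4) fK j K by simp
      then show "(rooted_sum (D - set xs) (K - {j}) x lam - rooted_sum (D - set xs) (K - {j}) x (lam(x := lam j))) / ?c =
        fact (card D - 6) * R / ?c"
        using rooted_Z_card[of "D - set xs" "K - {j}"] D(1) cx unfolding R_def by (simp add: algebra_simps)
    qed
    also have "\<dots> = R / ?c" by simp
    also have "?c = ((lam j)\<^sup>2 - (lam x)\<^sup>2) * (2 * lam x)" by (simp add: power2_eq_square algebra_simps)
    finally show ?thesis unfolding R_def by simp
  qed
  have "2 * lam x * rooted_Z K x lam = 2 * lam x * (S x / fact (card D)) + (\<Sum>c\<in>K - {x}. 2 * lam x * (S c / fact (card D)))"
    unfolding split by (simp add: distrib_left sum_distrib_left)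
  also have "2 * lam x * (S x / fact (card D)) = (\<Sum>K1\<in>{K1. K1 \<subseteq> K \<and> x \<in> K1}. rooted_Z K1 x lam * rooted_Z (insert x (K - K1)) x lam)"
    unfolding 1 using lx by simp
  also have "(\<Sum>c\<in>K - {x}. 2 * lam x * (S c / fact (card D))) =
     (\<Sum>j\<in>K - {x}. (rooted_Z (K - {j}) x lam - rooted_Z (K - {j}) x (lam(x := lam j))) / ((lam j)\<^sup>2 - (lam x)\<^sup>2))"
    by (rule sum.cong[OF refl]) (use 2 lx in simp)
  finally show ?thesis .
qed

text \<open>The only map is a loop at the root vertex, with \<open>x\<close> on the side of the leaf
  and \<open>j\<close> on the other. Having no symmetry, it occurs once for each of the
  \<open>4!\<close> namings of its darts, which the normalisation cancels.\<close>

lemma rooted_Z_pair: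
  assumes K: "K = {x, j}" "x \<noteq> j" and pos: "lam x > 0" "lam j > 0"
  shows "rooted_Z K x lam = 1 / (2 * lam x * (lam x + lam j))"
proof -
  define D :: "nat set" where "D = {..<4}"
  have D: "finite D" "card D = 4" "4 \<le> card D" by (auto simp: D_def)
  define i where "i = (\<lambda>xs :: nat list. case xs of [\<rho>, r, r1, r2] \<Rightarrow>
    (\<rho>, join_\<sigma> id r r1 r2, join_\<alpha> (Transposition.transpose r1 r2) r \<rho>,
      (\<lambda>_. undefined)(r1 := x, r2 := j, r := x, \<rho> := x)))"
  define jj where "jj = (\<lambda>(\<rho> :: nat, \<sigma> :: nat \<Rightarrow> nat, \<alpha> :: nat \<Rightarrow> nat, lab :: nat \<Rightarrow> 'a). [\<rho>, \<alpha> \<rho>, \<sigma> (\<alpha> \<rho>), \<sigma> (\<sigma> (\<alpha> \<rho>))])"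
  have "rooted_sum D K x lam = (\<Sum>xs\<in>{xs. length xs = 4 \<and> distinct xs \<and> set xs \<subseteq> D}. 1 / (2 * lam x * (lam x + lam j)))"
    unfolding rooted_sum_def
  proof (rule sum.reindex_bij_witness[of _ i jj])
    fix a assume "a \<in> rooted_maps D K x"
    then obtain \<rho> \<sigma> \<alpha> lab where a: "a = (\<rho>, \<sigma>, \<alpha>, lab)" and M: "cubic_map D {\<rho>} \<sigma> \<alpha>"
      and L: "face_lab D (\<sigma> \<circ> \<alpha>) K lab" and lx: "lab \<rho> = x" by (auto simp: rooted_maps_def)
    define r r1 r2 where r: "r = \<alpha> \<rho>" "r1 = \<sigma> r" "r2 = \<sigma> r1"
    have rne: "\<sigma> r \<noteq> r" using root_vertex(2)[OF M] r(1) by simp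
    note uj = cubic_unjoin[OF M r(1) rne r(2,3)]
    define D' where "D' = D - {r, \<rho>}"
    define \<sigma>' where "\<sigma>' = unjoin_\<sigma> \<sigma> r r1 r2"
    define \<alpha>' where "\<alpha>' = unjoin_\<alpha> \<alpha> r \<rho>"
    have r12: "r1 \<noteq> r2" "r \<noteq> \<rho>" using uj(1) by auto
    have "card D' = 2" using uj(1,2) D by (auto simp: D'_def card_Diff_subset)
    moreover have "{r1, r2} \<subseteq> D'" using uj(1,2) by (auto simp: D'_def)
    ultimately have D': "D' = {r1, r2}" using r12 by (metis card_2_iff card_subset_eq finite.emptyI finite_insert card_gt_0_iff zero_less_numeral card_eq_0_iff)
    have C: "cubic D' {r1, r2} \<sigma>' \<alpha>'" using uj(4) by (simp add: D'_def \<sigma>'_def \<alpha>'_def)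
    have DD: "D' \<union> {r, \<rho>} = D" "r \<notin> D'" "\<rho> \<notin> D'" using uj(2) by (auto simp: D'_def)
    have s': "\<sigma>' = id" using cubicD(6)[OF C] D' by (auto simp: fun_eq_iff)
    have "\<alpha>' r1 = r2" "\<alpha>' r2 = r1" using cubicD(4)[OF C, of r1] cubicD(4)[OF C, of r2] cubic_in(1)[OF C, of r1] cubic_in(1)[OF C, of r2] D' by auto
    moreover have "\<alpha>' d = d" if "d \<notin> {r1, r2}" for d using cubicD(4)[OF C] D' that by auto
    ultimately have "\<alpha>' d = Transposition.transpose r1 r2 d" for d
      by (cases "d = r1"; cases "d = r2") auto
    then have a': "\<alpha>' = Transposition.transpose r1 r2" ..
    have sj: "join_\<sigma> \<sigma>' r r1 r2 = \<sigma>" "join_\<alpha> \<alpha>' r \<rho> = \<alpha>" using uj(6,7) by (simp_all add: \<sigma>'_def \<alpha>'_def)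
    have "face_lab (D' \<union> {r, \<rho>}) (join_\<sigma> \<sigma>' r r1 r2 \<circ> join_\<alpha> \<alpha>' r \<rho>) K lab"
      using L unfolding DD(1) sj .
    note fu = face_lab_unjoin[OF C r12 DD(2,3) this]
    have l1: "lab r1 = x" "lab r = x" using fu(2,3) lx by auto
    have "lab ` D = {x, lab r2}" using DD(1) D' l1 lx by auto
    then have l2: "lab r2 = j" using face_labD(3)[OF L] K by auto
    have le: "lab d = undefined" if "d \<notin> D" for d using face_labD(2)[OF L] that by (auto simp: extensional_def)
    have ja: "jj a = [\<rho>, r, r1, r2]" by (simp add: a jj_def r)
    have lab: "(\<lambda>_. undefined)(r1 := x, r2 := j, r := x, \<rho> := x) = lab"
      using l1 l2 lx le DD(1) D' by (auto simp: fun_eq_iff)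
    show "i (jj a) = a"
      unfolding ja unfolding i_def a list.case lab using sj s' a' by simp
    show "jj a \<in> {xs. length xs = 4 \<and> distinct xs \<and> set xs \<subseteq> D}" using uj(1,2) by (simp add: ja)
    have "edge_wt D \<alpha> (\<lambda>d. lam (lab d)) = edge_wt D' \<alpha>' (\<lambda>d. lam (lab d)) / (2 * lam x)"
      using edge_wt_join[OF C r12(2) DD(2,3), of "\<lambda>d. lam (lab d)"] DD(1) sj l1 lx by simp
    also have "edge_wt D' \<alpha>' (\<lambda>d. lam (lab d)) = 1 / (lam x + lam j)"
      using edge_wt_split[OF C, of r1 "\<lambda>d. lam (lab d)"] D' \<open>\<alpha>' r1 = r2\<close> l1 l2 by (simp add: edge_wt_def)
    finally show "1 / (2 * lam x * (lam x + lam j)) = (case a of (\<rho>, \<sigma>, \<alpha>, lab) \<Rightarrow> edge_wt D \<alpha> (\<lambda>d. lam (lab d)))"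
      by (simp add: a mult.commute)
  next
    fix b assume b: "b \<in> {xs :: nat list. length xs = 4 \<and> distinct xs \<and> set xs \<subseteq> D}"
    then obtain \<rho> r r1 r2 where xs: "b = [\<rho>, r, r1, r2]" by (auto elim: length_4E)
    have dist: "distinct [\<rho>, r, r1, r2]" and sub: "{\<rho>, r, r1, r2} \<subseteq> D" using b by (auto simp: xs)
    have DD: "{r1, r2} \<union> {r, \<rho>} = D"
      using card_subset_eq[OF D(1) sub] dist D by auto
    let ?t = "Transposition.transpose r1 r2"
    have C: "cubic {r1, r2} {r1, r2} id ?t"
    proof (rule cubicI)
      show "(?t d \<noteq> d) = (d \<in> {r1, r2})" for d
        using dist by (cases "d = r1"; cases "d = r2") auto
    qed auto
    have r12: "r1 \<noteq> r2" and new: "r \<noteq> \<rho>" "r \<notin> {r1, r2}" "\<rho> \<notin> {r1, r2}" using dist by auto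
    have conn: "r1 \<in> A \<or> r2 \<in> A" if "A \<subseteq> {r1, r2}" "A \<noteq> {}" for A using that by auto
    have F: "face_lab {r1, r2} (bivalent r1 r2 id ?t) K ((\<lambda>_. undefined)(r1 := x, r2 := j))"
    proof (rule face_labI)
      show "((\<lambda>_. undefined)(r1 := x, r2 := j)) \<in> extensional {r1, r2}" by (auto simp: extensional_def)
      show "((\<lambda>_. undefined)(r1 := x, r2 := j)) ` {r1, r2} = K" using r12 K by auto
    qed (use r12 K in \<open>auto split: if_splits\<close>)
    have M: "cubic_map D {\<rho>} (join_\<sigma> id r r1 r2) (join_\<alpha> ?t r \<rho>)"
      using cubic_map_join(1)[OF C r12 new conn] DD by auto
    have FL: "face_lab D (join_\<sigma> id r r1 r2 \<circ> join_\<alpha> ?t r \<rho>) K ((\<lambda>_. undefined)(r1 := x, r2 := j, r := x, \<rho> := x))"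
    proof -
      have lr: "((\<lambda>_. undefined)(r1 := x, r2 := j)) r1 = x" using r12 by simp
      show ?thesis using face_lab_join[OF C r12 new F] unfolding DD lr .
    qed
    have jv: "join_\<alpha> ?t r \<rho> \<rho> = r" "join_\<sigma> id r r1 r2 r = r1" "join_\<sigma> id r r1 r2 r1 = r2"
      using dist by (auto simp: join_\<alpha>_def join_\<sigma>_def)
    show "jj (i b) = b" unfolding xs i_def jj_def by (simp add: jv)
    show "i b \<in> rooted_maps D K x" unfolding xs i_def rooted_maps_def using M FL by simp
  qed
  then have "rooted_sum D K x lam / fact (card D) = 1 / (2 * lam x * (lam x + lam j)) / fact (card D - 4)"
    using sum_distinct_lists_const[OF D(1) refl D(3), of "1 / (2 * lam x * (lam x + lam j))"] by simp
  moreover have "card K = 2" using K by simp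
  ultimately show ?thesis using D by (simp add: rooted_Z_def D_def)
qed

section \<open>Homogeneous polynomials in squares\<close>

text \<open>Polynomials are represented as functions, built up monomial by monomial;
  \<open>M\<close> is the degree in the squares of the variables. Linear claims then only have to be
  checked on monomials.\<close>

inductive hpoly :: "'b set \<Rightarrow> nat \<Rightarrow> (('b \<Rightarrow> real) \<Rightarrow> real) \<Rightarrow> bool" for K M where
  zero: "hpoly K M (\<lambda>_. 0)"
| step: "hpoly K M f \<Longrightarrow> (\<Sum>i\<in>K. d i) = M \<Longrightarrow> hpoly K M (\<lambda>\<mu>. f \<mu> + c * (\<Prod>i\<in>K. \<mu> i ^ (2 * d i)))"

lemma hpoly_cong: "hpoly K M f \<Longrightarrow> (\<And>\<mu>. f \<mu> = g \<mu>) \<Longrightarrow> hpoly K M g"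
  by (metis ext)

lemma hpoly_monom: "(\<Sum>i\<in>K. d i) = M \<Longrightarrow> hpoly K M (\<lambda>\<mu>. c * (\<Prod>i\<in>K. \<mu> i ^ (2 * d i)))"
  using hpoly.step[OF hpoly.zero, of d K M c] by simp

lemma hpoly_add:
  assumes "hpoly K M f" "hpoly K M g"
  shows "hpoly K M (\<lambda>\<mu>. f \<mu> + g \<mu>)"
  using assms(2)
proof induction
  case zero then show ?case using assms(1) by simp
next
  case (step g d c)
  then show ?case using hpoly.step[OF step.IH step.hyps(2), where c = c] by (simp add: add.assoc)
qed

lemma hpoly_scale: "hpoly K M f \<Longrightarrow> hpoly K M (\<lambda>\<mu>. a * f \<mu>)"
proof (induction rule: hpoly.induct)
  case zero then show ?case using hpoly.zero by simp
next
  case (step g d c)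
  then show ?case using hpoly.step[OF step.IH step.hyps(2), where c = "a * c"] by (simp add: distrib_left mult.assoc)
qed

lemma hpoly_diff: "hpoly K M f \<Longrightarrow> hpoly K M g \<Longrightarrow> hpoly K M (\<lambda>\<mu>. f \<mu> - g \<mu>)"
  using hpoly_add[of K M f "\<lambda>\<mu>. (-1) * g \<mu>"] hpoly_scale[of K M g "-1"] by simp

lemma hpoly_sum: "(\<And>a. a \<in> A \<Longrightarrow> hpoly K M (f a)) \<Longrightarrow> hpoly K M (\<lambda>\<mu>. \<Sum>a\<in>A. f a \<mu>)"
  by (induction A rule: infinite_finite_induct) (auto intro: hpoly.zero hpoly_add)

lemma hpoly_mult:
  assumes fin: "finite K1" "finite K2" "K1 \<inter> K2 = {}" and f: "hpoly K1 M1 f" and g: "hpoly K2 M2 g"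
  shows "hpoly (K1 \<union> K2) (M1 + M2) (\<lambda>\<mu>. f \<mu> * g \<mu>)"
  using f
proof induction
  case zero then show ?case using hpoly.zero by simp
next
  case (step f d c)
  have m: "hpoly (K1 \<union> K2) (M1 + M2) (\<lambda>\<mu>. (c * (\<Prod>i\<in>K1. \<mu> i ^ (2 * d i))) * g \<mu>)"
    using g
  proof induction
    case zero then show ?case using hpoly.zero by simp
  next
    case (step g e b)
    define h where "h i = (if i \<in> K1 then d i else e i)" for i
    have "(\<Sum>i\<in>K1 \<union> K2. h i) = (\<Sum>i\<in>K1. h i) + (\<Sum>i\<in>K2. h i)" using fin by (simp add: sum.union_disjoint)
    also have "(\<Sum>i\<in>K1. h i) = M1" using \<open>(\<Sum>i\<in>K1. d i) = M1\<close> by (simp add: h_def)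
    also have "(\<Sum>i\<in>K2. h i) = (\<Sum>i\<in>K2. e i)" by (rule sum.cong) (use fin in \<open>auto simp: h_def\<close>)
    finally have s: "(\<Sum>i\<in>K1 \<union> K2. h i) = M1 + M2" using step.hyps(2) by simp
    have p: "(\<Prod>i\<in>K1 \<union> K2. \<mu> i ^ (2 * h i)) = (\<Prod>i\<in>K1. \<mu> i ^ (2 * d i)) * (\<Prod>i\<in>K2. \<mu> i ^ (2 * e i))" for \<mu> :: "_ \<Rightarrow> real"
    proof -
      have "(\<Prod>i\<in>K1. \<mu> i ^ (2 * h i)) = (\<Prod>i\<in>K1. \<mu> i ^ (2 * d i))" by (simp add: h_def)
      moreover have "(\<Prod>i\<in>K2. \<mu> i ^ (2 * h i)) = (\<Prod>i\<in>K2. \<mu> i ^ (2 * e i))"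
        by (rule prod.cong) (use fin in \<open>auto simp: h_def\<close>)
      ultimately show ?thesis using fin by (simp add: prod.union_disjoint)
    qed
    show ?case
      by (rule hpoly_cong[OF hpoly.step[OF step.IH s, where c = "c * b"]]) (unfold p, simp add: algebra_simps)
  qed
  show ?case
    by (rule hpoly_cong[OF hpoly_add[OF step.IH m]]) (simp add: algebra_simps)
qed

lemma hpoly_single: "hpoly {x} d (\<lambda>\<mu>. \<mu> x ^ (2 * d))"
  using hpoly_monom[of "\<lambda>_. d" "{x}" d 1] by simp

text \<open>If the degree is smaller than the number of variables, every monomial omits a variable;
  so the polynomial is an alternating sum of its restrictions to coordinate hyperplanes.\<close>

lemma hpoly_incl_excl:
  assumes K: "finite K" "M < card K" and Q: "hpoly K M Q"
  shows "(\<Sum>A\<in>Pow K. (-1) ^ card A * Q (\<lambda>i. if i \<in> A then 0 else \<mu> i)) = 0"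
  using Q
proof induction
  case zero then show ?case by simp
next
  case (step f d c)
  have "\<exists>i\<in>K. d i = 0"
  proof (rule ccontr)
    assume "\<not> ?thesis"
    then have "(\<Sum>i\<in>K. 1) \<le> (\<Sum>i\<in>K. d i)" by (intro sum_mono) auto
    then show False using step.hyps(2) K by simp
  qed
  then obtain i0 where i0: "i0 \<in> K" "d i0 = 0" by blast
  let ?m = "\<lambda>A. (\<Prod>i\<in>K. (if i \<in> A then 0 else \<mu> i) ^ (2 * d i))"
  have m: "(-1) ^ card A * ?m A = (\<Prod>i\<in>A. - (0 ^ (2 * d i))) * (\<Prod>i\<in>K - A. \<mu> i ^ (2 * d i))" if A: "A \<in> Pow K" for A
  proof -
    have "?m A = (\<Prod>i\<in>K - A. (if i \<in> A then 0 else \<mu> i) ^ (2 * d i)) * (\<Prod>i\<in>A. (if i \<in> A then 0 else \<mu> i) ^ (2 * d i))"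
      using A K by (intro prod.subset_diff) auto
    also have "(\<Prod>i\<in>K - A. (if i \<in> A then 0 else \<mu> i) ^ (2 * d i)) = (\<Prod>i\<in>K - A. \<mu> i ^ (2 * d i))"
      by (rule prod.cong) auto
    also have "(\<Prod>i\<in>A. (if i \<in> A then 0 else \<mu> i) ^ (2 * d i)) = (\<Prod>i\<in>A. 0 ^ (2 * d i))"
      by (rule prod.cong) auto
    also have "(-1) ^ card A * ((\<Prod>i\<in>K - A. \<mu> i ^ (2 * d i)) * (\<Prod>i\<in>A. 0 ^ (2 * d i))) =
        (\<Prod>i\<in>A. - (0 ^ (2 * d i))) * (\<Prod>i\<in>K - A. \<mu> i ^ (2 * d i))"
      by (simp add: prod_uminus)
    finally show ?thesis .
  qed
  have "(\<Sum>A\<in>Pow K. (-1) ^ card A * ?m A) = (\<Sum>A\<in>Pow K. (\<Prod>i\<in>A. - (0 ^ (2 * d i))) * (\<Prod>i\<in>K - A. \<mu> i ^ (2 * d i)))"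
    by (rule sum.cong[OF refl m])
  \<comment> \<open>The alternating sum factors over the variables, and as \<open>0 ^ 0 = 1\<close>
    the omitted variable \<open>i0\<close> has the factor \<open>-1 + 1\<close>.\<close>
  also have "\<dots> = (\<Prod>i\<in>K. - (0 ^ (2 * d i)) + \<mu> i ^ (2 * d i))"
    by (rule prod_add[OF K(1), symmetric])
  also have "\<dots> = 0" using K(1) i0 by (auto intro!: prod_zero bexI[of _ i0])
  finally have "(\<Sum>A\<in>Pow K. c * ((-1) ^ card A * ?m A)) = 0" by (simp add: sum_distrib_left[symmetric])
  then show ?case using step.IH by (simp add: algebra_simps sum.distrib)
qed

lemma hpoly_continuous:
  assumes "hpoly K M Q" and "\<And>i. i \<in> K \<Longrightarrow> ((\<lambda>s. \<mu> s i) \<longlongrightarrow> \<nu> i) F"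
  shows "((\<lambda>s. Q (\<mu> s)) \<longlongrightarrow> Q \<nu>) F"
  using assms(1)
proof induction
  case (step f d c)
  show ?case
    by (intro tendsto_add tendsto_mult tendsto_const tendsto_prod tendsto_power step.IH assms(2))
qed simp

lemma hpoly_depends: "hpoly K M Q \<Longrightarrow> (\<And>i. i \<in> K \<Longrightarrow> \<mu> i = \<nu> i) \<Longrightarrow> Q \<mu> = Q \<nu>"
  by (induction rule: hpoly.induct) simp_all

text \<open>In the alternating sum every term except the one of the empty set is a restriction to
  coordinate hyperplanes.\<close>

lemma hpoly_vanish:
  assumes K: "finite K" "M < card K" and Q: "hpoly K M Q"
    and zero: "\<And>\<mu> x. x \<in> K \<Longrightarrow> (\<And>i. i \<in> K - {x} \<Longrightarrow> \<mu> i > 0) \<Longrightarrow> \<mu> x = 0 \<Longrightarrow> Q \<mu> = 0"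
    and \<mu>: "\<And>i. i \<in> K \<Longrightarrow> \<mu> i > 0"
  shows "Q \<mu> = 0"
proof -
  have z: "Q (\<lambda>i. if i \<in> A then 0 else \<mu> i) = 0" if A: "A \<in> Pow K - {{}}" for A
  proof -
    obtain x where x: "x \<in> A" "x \<in> K" using A by auto
    \<comment> \<open>The assumption \<open>zero\<close> lets only one coordinate vanish. If several
      do, all but \<open>x\<close> are moved into the positive range by \<open>e\<close>, and
      continuity yields the value at \<open>e = 0\<close>.\<close>
    define \<nu> where "\<nu> e i = (if i = x then 0 else (if i \<in> A then 0 else \<mu> i) + e)" for e :: real and i
    have "((\<lambda>e. Q (\<nu> e)) \<longlongrightarrow> Q (\<nu> 0)) (at_right 0)"
      by (rule hpoly_continuous[OF Q]) (auto simp: \<nu>_def intro!: tendsto_eq_intros)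
    moreover
    have "eventually (\<lambda>e. Q (\<nu> e) = 0) (at_right 0)"
      using eventually_at_right_less[of 0]
    proof eventually_elim
      case (elim e)
      then show ?case using \<mu> x by (intro zero[of x]) (auto simp: \<nu>_def add_pos_pos)
    qed
    then have "((\<lambda>e. Q (\<nu> e)) \<longlongrightarrow> 0) (at_right 0)" by (rule tendsto_eventually)
    ultimately have "Q (\<nu> 0) = 0" by (rule tendsto_unique[OF trivial_limit_at_right_real])
    moreover have "\<nu> 0 = (\<lambda>i. if i \<in> A then 0 else \<mu> i)" using x by (auto simp: \<nu>_def)
    ultimately show ?thesis by simp
  qed
  have "0 = (\<Sum>A\<in>Pow K. (-1) ^ card A * Q (\<lambda>i. if i \<in> A then 0 else \<mu> i))"
    using hpoly_incl_excl[OF K Q] by simp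
  also have "\<dots> = Q \<mu> + (\<Sum>A\<in>Pow K - {{}}. (-1) ^ card A * Q (\<lambda>i. if i \<in> A then 0 else \<mu> i))"
    using K by (subst sum.remove[of _ "{}"]) auto
  also have "(\<Sum>A\<in>Pow K - {{}}. (-1) ^ card A * Q (\<lambda>i. if i \<in> A then 0 else \<mu> i)) = 0"
    by (rule sum.neutral) (use z in auto)
  finally show ?thesis by simp
qed

text \<open>In \<open>\<mu> x = 1 / t\<close> the antiderivative divides the coefficient of a
  monomial by \<open>2 * d x + 1\<close>. The type of polynomial is preserved, and monomials without
  the variable \<open>x\<close> keep their coefficient, so the restriction to
  \<open>\<mu> x = 0\<close> does not change.\<close>

lemma hpoly_integrate:
  assumes "hpoly K M Q" "finite K" "x \<in> K"
  shows "\<exists>R. hpoly K M R \<and> (\<forall>\<mu>. \<mu> x = 0 \<longrightarrow> R \<mu> = Q \<mu>) \<and>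
    (\<forall>\<mu> t. t > 0 \<longrightarrow> ((\<lambda>t. 1 / t * R (\<mu>(x := 1 / t))) has_real_derivative - ((1 / t)\<^sup>2 * Q (\<mu>(x := 1 / t)))) (at t))"
  using assms(1)
proof induction
  case zero
  show ?case by (rule exI[of _ "\<lambda>_. 0"]) (auto intro: hpoly.zero)
next
  case (step f d c)
  then obtain R where R: "hpoly K M R" "\<And>\<mu>. \<mu> x = 0 \<Longrightarrow> R \<mu> = f \<mu>"
    "\<And>\<mu> t. t > 0 \<Longrightarrow> ((\<lambda>t. 1 / t * R (\<mu>(x := 1 / t))) has_real_derivative - ((1 / t)\<^sup>2 * f (\<mu>(x := 1 / t)))) (at t)"
    by blast
  let ?c = "c / (2 * real (d x) + 1)"
  let ?m = "\<lambda>\<mu> :: _ \<Rightarrow> real. \<Prod>i\<in>K. \<mu> i ^ (2 * d i)"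
  have m: "?m (\<mu>(x := y)) = y ^ (2 * d x) * (\<Prod>i\<in>K - {x}. \<mu> i ^ (2 * d i))" for \<mu> :: "_ \<Rightarrow> real" and y
    using assms(2,3) by (simp add: prod.remove)
  show ?case
  proof (intro exI[of _ "\<lambda>\<mu>. R \<mu> + ?c * ?m \<mu>"] conjI allI impI)
    show "hpoly K M (\<lambda>\<mu>. R \<mu> + ?c * ?m \<mu>)" by (rule hpoly.step[OF R(1) step.hyps(2)])
  next
    fix \<mu> :: "_ \<Rightarrow> real" assume \<mu>: "\<mu> x = 0"
    show "R \<mu> + ?c * ?m \<mu> = f \<mu> + c * ?m \<mu>"
    proof (cases "d x = 0")
      case False
      then have "?m \<mu> = 0" using m[of \<mu> 0] \<mu> by (simp add: fun_upd_idem)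
      then show ?thesis using R(2)[of \<mu>, OF \<mu>] by simp
    qed (use R(2)[of \<mu>, OF \<mu>] in simp)
  next
    fix \<mu> :: "_ \<Rightarrow> real" and t :: real assume t: "t > 0"
    define p where "p = (\<Prod>i\<in>K - {x}. \<mu> i ^ (2 * d i))"
    have "((\<lambda>t. 1 / t) has_real_derivative - 1 / t\<^sup>2) (at t)"
      using t by (auto intro!: derivative_eq_intros simp: power2_eq_square)
    from DERIV_power[OF this, of "2 * d x + 1"]
    have "((\<lambda>t. (1 / t) ^ (2 * d x + 1)) has_real_derivative real (2 * d x + 1) * (1 / t) ^ (2 * d x) * (- 1 / t\<^sup>2)) (at t)"
      by (simp add: mult_ac)
    then have "((\<lambda>t. ?c * p * (1 / t) ^ (2 * d x + 1)) has_real_derivative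
        ?c * p * (real (2 * d x + 1) * (1 / t) ^ (2 * d x) * (- 1 / t\<^sup>2))) (at t)"
      by (rule DERIV_cmult)
    from DERIV_add[OF R(3)[of t \<mu>, OF t] this]
    show "((\<lambda>t. 1 / t * (R (\<mu>(x := 1 / t)) + ?c * ?m (\<mu>(x := 1 / t)))) has_real_derivative
        - ((1 / t)\<^sup>2 * (f (\<mu>(x := 1 / t)) + c * ?m (\<mu>(x := 1 / t))))) (at t)"
    proof (rule DERIV_cong_ev[THEN iffD1, rotated -1, OF _ refl always_eventually])
      show "\<forall>t. 1 / t * R (\<mu>(x := 1 / t)) + ?c * p * (1 / t) ^ (2 * d x + 1) =
          1 / t * (R (\<mu>(x := 1 / t)) + ?c * ?m (\<mu>(x := 1 / t)))"
        unfolding m p_def by (simp add: algebra_simps)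
      have "?c * p * (real (2 * d x + 1) * (1 / t) ^ (2 * d x) * (- 1 / t\<^sup>2)) = - ((1 / t)\<^sup>2 * (c * ((1 / t) ^ (2 * d x) * p)))"
      proof -
        have mult_swap: "u * v * (w * y * z) = (u * w) * (v * y * z)" for u v w y z :: real by (simp only: mult_ac)
        have "2 * real (d x) + 1 \<noteq> 0" by linarith
        then have cq: "?c * real (2 * d x + 1) = c" by (simp add: add.commute)
        have "?c * p * (real (2 * d x + 1) * (1 / t) ^ (2 * d x) * (- 1 / t\<^sup>2)) =
            c * (p * (1 / t) ^ (2 * d x) * (- 1 / t\<^sup>2))"
          unfolding mult_swap[of ?c p "real (2 * d x + 1)"] cq ..
        then show ?thesis by (simp add: power_divide mult_ac)
      qed
      then show "- ((1 / t)\<^sup>2 * f (\<mu>(x := 1 / t))) + ?c * p * (real (2 * d x + 1) * (1 / t) ^ (2 * d x) * (- 1 / t\<^sup>2)) =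
         - ((1 / t)\<^sup>2 * (f (\<mu>(x := 1 / t)) + c * ?m (\<mu>(x := 1 / t))))"
        unfolding m p_def[symmetric] by (simp add: algebra_simps)
    qed
  qed
qed

section \<open>Evaluation of the sums\<close>

definition closed_Z :: "'b set \<Rightarrow> ('b \<Rightarrow> real) \<Rightarrow> real" where
  "closed_Z K lam = closed_sum {..<6 * card K - 12} K lam / fact (6 * card K - 12)"

section \<open>Derivative and decay in a single variable\<close>

lemma edge_eq_fibre:
  assumes C: "cubic D U \<sigma> \<alpha>" and e: "e \<in> (\<lambda>d. {d, \<alpha> d}) ` D"
  shows "{d. d \<in> D \<and> {d, \<alpha> d} = e} = e"
  using e cubicD(3)[OF C] cubic_in(1)[OF C] by (auto simp: doubleton_eq_iff)

lemma sum_edges: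
  assumes C: "cubic D U \<sigma> \<alpha>"
  shows "(\<Sum>d\<in>D. h d) = (\<Sum>e\<in>(\<lambda>d. {d, \<alpha> d}) ` D. \<Sum>d\<in>e. h d)"
  using sum.image_gen[OF cubicD(1)[OF C], of h "\<lambda>d. {d, \<alpha> d}"] edge_eq_fibre[OF C] by simp

lemma edge_sum:
  assumes C: "cubic D U \<sigma> \<alpha>" and e: "e \<in> (\<lambda>d. {d, \<alpha> d}) ` D" and d: "d \<in> e"
  shows "(\<Sum>d\<in>e. v d) = v d + v (\<alpha> d)" "d \<in> D"
proof -
  have *: "d \<in> D" "e = {d, \<alpha> d}" using e d cubicD(3)[OF C] cubic_in(1)[OF C] by auto
  then show "(\<Sum>d\<in>e. v d) = v d + v (\<alpha> d)" "d \<in> D" using cubicD(4)[OF C, of d] by auto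
qed

lemma edge_sum_pos:
  fixes v :: "'a \<Rightarrow> real"
  assumes C: "cubic D U \<sigma> \<alpha>" and e: "e \<in> (\<lambda>d. {d, \<alpha> d}) ` D" and v: "\<And>d. d \<in> D \<Longrightarrow> v d > 0"
  shows "(\<Sum>d\<in>e. v d) > 0"
proof -
  obtain d where d: "d \<in> D" "e = {d, \<alpha> d}" using e by auto
  have "(\<Sum>d\<in>e. v d) = v d + v (\<alpha> d)" by (rule edge_sum(1)[OF C e]) (use d in simp)
  then show ?thesis using v[of d] v[of "\<alpha> d"] d cubic_in(1)[OF C] by simp
qed

text \<open>Logarithmic differentiation of the product. An edge with \<open>x\<close> on both sides
  has derivative 2 in its denominator and correspondingly two darts in the sum over
  \<open>k\<close>.\<close>

lemma edge_wt_deriv: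
  assumes C: "cubic D U \<sigma> \<alpha>" and lab: "lab ` D \<subseteq> K" and pos: "\<And>i. i \<in> K - {x} \<Longrightarrow> lam i > 0" and t: "t > 0"
  shows "((\<lambda>t. edge_wt D \<alpha> (\<lambda>d. (lam(x := t)) (lab d))) has_real_derivative
     - (edge_wt D \<alpha> (\<lambda>d. (lam(x := t)) (lab d)) *
        (\<Sum>k\<in>{k\<in>D. lab k = x}. 1 / ((lam(x := t)) x + (lam(x := t)) (lab (\<alpha> k)))))) (at t)"
proof -
  define v where "v = (\<lambda>t d. (lam(x := t)) (lab d))"
  let ?E = "(\<lambda>d. {d, \<alpha> d}) ` D"
  define n where "n e = (\<Sum>d\<in>e. if lab d = x then 1 else (0::real))" for e
  have vpos: "v t d > 0" if "d \<in> D" for d using that lab pos t by (auto simp: v_def)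
  have sp: "(\<Sum>d\<in>e. v t d) > 0" if "e \<in> ?E" for e by (rule edge_sum_pos[OF C that vpos])
  have ds: "((\<lambda>t. \<Sum>d\<in>e. v t d) has_real_derivative n e) (at t)" for e
    unfolding n_def v_def by (rule DERIV_sum) (auto intro!: derivative_eq_intros)
  have "((\<lambda>t. \<Prod>e\<in>?E. 1 / (\<Sum>d\<in>e. v t d)) has_real_derivative
      (\<Prod>e\<in>?E. 1 / (\<Sum>d\<in>e. v t d)) * (\<Sum>e\<in>?E. (- n e / (\<Sum>d\<in>e. v t d)\<^sup>2) / (1 / (\<Sum>d\<in>e. v t d)))) (at t)"
  proof (rule has_field_derivative_prod')
    fix e assume e: "e \<in> ?E"
    show "1 / (\<Sum>d\<in>e. v t d) \<noteq> 0" using sp[OF e] by simp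
    show "((\<lambda>t. 1 / (\<Sum>d\<in>e. v t d)) has_real_derivative - n e / (\<Sum>d\<in>e. v t d)\<^sup>2) (at t)"
      using DERIV_inverse_fun[OF ds[of e]] sp[OF e] by (simp add: divide_inverse power2_eq_square)
  qed
  also have "(\<Sum>e\<in>?E. (- n e / (\<Sum>d\<in>e. v t d)\<^sup>2) / (1 / (\<Sum>d\<in>e. v t d))) = - (\<Sum>e\<in>?E. n e / (\<Sum>d\<in>e. v t d))"
    unfolding sum_negf[symmetric] by (rule sum.cong) (simp_all add: power2_eq_square)
  also have "(\<Sum>e\<in>?E. n e / (\<Sum>d\<in>e. v t d)) = (\<Sum>e\<in>?E. \<Sum>d\<in>e. if lab d = x then 1 / (v t d + v t (\<alpha> d)) else 0)"
  proof (rule sum.cong[OF refl])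
    fix e assume e: "e \<in> ?E"
    show "n e / (\<Sum>d\<in>e. v t d) = (\<Sum>d\<in>e. if lab d = x then 1 / (v t d + v t (\<alpha> d)) else 0)"
      unfolding n_def sum_divide_distrib by (rule sum.cong[OF refl]) (simp add: edge_sum[OF C e])
  qed
  also have "\<dots> = (\<Sum>d\<in>D. if lab d = x then 1 / (v t d + v t (\<alpha> d)) else 0)"
    by (rule sum_edges[OF C, symmetric])
  also have "\<dots> = (\<Sum>k\<in>{k\<in>D. lab k = x}. 1 / (v t k + v t (\<alpha> k)))"
    using cubicD(1)[OF C] by (simp add: sum.inter_filter)
  also have "\<dots> = (\<Sum>k\<in>{k\<in>D. lab k = x}. 1 / ((lam(x := t)) x + (lam(x := t)) (lab (\<alpha> k))))"
    by (rule sum.cong) (auto simp: v_def)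
  finally show ?thesis unfolding edge_wt_def v_def by simp
qed

lemma closed_Z_deriv:
  assumes pos: "\<And>i. i \<in> K - {x} \<Longrightarrow> lam i > 0" and t: "t > 0"
  shows "((\<lambda>t. closed_Z K (lam(x := t))) has_real_derivative - marked_Z K x (lam(x := t))) (at t)"
proof -
  let ?D = "{..<6 * card K - 12} :: nat set"
  have "((\<lambda>t. \<Sum>m\<in>closed_maps ?D K. edge_wt ?D (fst (snd m)) (\<lambda>d. (lam(x := t)) (snd (snd m) d))) has_real_derivative
     (\<Sum>m\<in>closed_maps ?D K. - (edge_wt ?D (fst (snd m)) (\<lambda>d. (lam(x := t)) (snd (snd m) d)) *
        (\<Sum>k\<in>{k\<in>?D. snd (snd m) k = x}. 1 / ((lam(x := t)) x + (lam(x := t)) (snd (snd m) (fst (snd m) k))))))) (at t)"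
  proof (rule DERIV_sum)
    fix m assume m: "m \<in> closed_maps ?D K"
    obtain \<sigma> \<alpha> lab where m': "m = (\<sigma>, \<alpha>, lab)" by (cases m)
    have C: "cubic ?D {} \<sigma> \<alpha>" and lab: "lab ` ?D \<subseteq> K"
      using m face_labD(3) cubic_map_cubic unfolding m' closed_maps_def by fastforce+
    show "((\<lambda>t. edge_wt ?D (fst (snd m)) (\<lambda>d. (lam(x := t)) (snd (snd m) d))) has_real_derivative
      - (edge_wt ?D (fst (snd m)) (\<lambda>d. (lam(x := t)) (snd (snd m) d)) *
        (\<Sum>k\<in>{k\<in>?D. snd (snd m) k = x}. 1 / ((lam(x := t)) x + (lam(x := t)) (snd (snd m) (fst (snd m) k)))))) (at t)"
      unfolding m' fst_conv snd_conv by (rule edge_wt_deriv[OF C lab pos t])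
  qed
  from DERIV_cdivide[OF this, of "fact (6 * card K - 12)"]
  show ?thesis
    unfolding closed_Z_def marked_Z_def closed_sum_def marked_sum_def case_prod_unfold sum_negf by simp
qed

lemma edge_wt_tendsto_0:
  assumes C: "cubic D U \<sigma> \<alpha>" and lab: "lab ` D \<subseteq> K" and pos: "\<And>i. i \<in> K - {x} \<Longrightarrow> lam i > 0"
    and k: "k \<in> D" "lab k = x"
  shows "((\<lambda>t. edge_wt D \<alpha> (\<lambda>d. (lam(x := t)) (lab d))) \<longlongrightarrow> 0) at_top"
proof -
  define v where "v = (\<lambda>t d. (lam(x := t)) (lab d))"
  let ?E = "(\<lambda>d. {d, \<alpha> d}) ` D"
  define l where "l e = (if \<exists>d\<in>e. lab d = x then 0 else 1 / (\<Sum>d\<in>e. v 1 d))" for e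
  have vpos: "v t d > 0" if "d \<in> D" "t > 0" for d t using that lab pos by (auto simp: v_def)
  have "((\<lambda>t. \<Prod>e\<in>?E. 1 / (\<Sum>d\<in>e. v t d)) \<longlongrightarrow> (\<Prod>e\<in>?E. l e)) at_top"
  proof (rule tendsto_prod)
    fix e assume e: "e \<in> ?E"
    show "((\<lambda>t. 1 / (\<Sum>d\<in>e. v t d)) \<longlongrightarrow> l e) at_top"
    proof (cases "\<exists>d\<in>e. lab d = x")
      case True
      then obtain d where d: "d \<in> e" "lab d = x" by blast
      have "((\<lambda>t. 1 / (\<Sum>d\<in>e. v t d)) \<longlongrightarrow> 0) at_top"
      proof (rule tendsto_sandwich[of "\<lambda>_. 0" _ _ "\<lambda>t. inverse t"])
        show "eventually (\<lambda>t. 0 \<le> 1 / (\<Sum>d\<in>e. v t d)) at_top"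
          using eventually_gt_at_top[of 0] by eventually_elim (use edge_sum_pos[OF C e] vpos in \<open>simp add: less_imp_le\<close>)
        show "eventually (\<lambda>t. 1 / (\<Sum>d\<in>e. v t d) \<le> inverse t) at_top"
          using eventually_gt_at_top[of 0]
        proof eventually_elim
          case (elim t)
          have "v t (\<alpha> d) > 0" using vpos elim edge_sum(2)[OF C e d(1)] cubic_in(1)[OF C] by blast
          moreover have "(\<Sum>d\<in>e. v t d) = t + v t (\<alpha> d)" unfolding edge_sum(1)[OF C e d(1)] using d(2) by (simp add: v_def)
          ultimately show ?case using elim by (simp add: field_simps)
        qed
        show "((\<lambda>t::real. inverse t) \<longlongrightarrow> 0) at_top" by (rule tendsto_inverse_0_at_top[OF filterlim_ident])
      qed simp
      then show ?thesis using True by (simp add: l_def)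
    next
      case False
      then have "(\<Sum>d\<in>e. v t d) = (\<Sum>d\<in>e. v 1 d)" for t by (intro sum.cong) (auto simp: v_def)
      moreover have "l e = 1 / (\<Sum>d\<in>e. v 1 d)" using False by (simp add: l_def)
      ultimately have "1 / (\<Sum>d\<in>e. v t d) = l e" for t by metis
      then show ?thesis by simp
    qed
  qed
  moreover have "(\<Prod>e\<in>?E. l e) = 0"
    using k cubicD(1)[OF C] by (intro prod_zero bexI[of _ "{k, \<alpha> k}"]) (auto simp: l_def)
  ultimately show ?thesis unfolding edge_wt_def v_def by simp
qed

lemma closed_Z_tendsto_0:
  assumes pos: "\<And>i. i \<in> K - {x} \<Longrightarrow> lam i > 0" and x: "x \<in> K"
  shows "((\<lambda>t. closed_Z K (lam(x := t))) \<longlongrightarrow> 0) at_top"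
proof -
  let ?D = "{..<6 * card K - 12} :: nat set"
  have "((\<lambda>t. \<Sum>m\<in>closed_maps ?D K. edge_wt ?D (fst (snd m)) (\<lambda>d. (lam(x := t)) (snd (snd m) d))) \<longlongrightarrow>
     (\<Sum>m\<in>closed_maps ?D K. 0)) at_top"
  proof (rule tendsto_sum)
    fix m assume m: "m \<in> closed_maps ?D K"
    obtain \<sigma> \<alpha> lab where m': "m = (\<sigma>, \<alpha>, lab)" by (cases m)
    have C: "cubic ?D {} \<sigma> \<alpha>" and lab: "lab ` ?D = K"
      using m face_labD(3) cubic_map_cubic unfolding m' closed_maps_def by fastforce+
    \<comment> \<open>Every label occurs in every map, so each summand has an edge along
      \<open>x\<close>, whose factor tends to 0.\<close>
    have "x \<in> lab ` ?D" using lab x by simp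
    then obtain k where k: "k \<in> ?D" "lab k = x" by blast
    show "((\<lambda>t. edge_wt ?D (fst (snd m)) (\<lambda>d. (lam(x := t)) (snd (snd m) d))) \<longlongrightarrow> 0) at_top"
      unfolding m' fst_conv snd_conv by (rule edge_wt_tendsto_0[OF C eq_refl[OF lab] pos k])
  qed
  from tendsto_divide[OF this tendsto_const[of "fact (6 * card K - 12)"]]
  show ?thesis
    unfolding closed_Z_def closed_sum_def case_prod_unfold by simp
qed

text \<open>The expansion of \<open>(1 - 4 * y^2 * X) ^ (-1/2)\<close>. The central binomial
  coefficients come from the Laplace transform of \<open>P ^ (2 * d) / (fact d)^2\<close>, which is
  \<open>(2 * d choose d) / lam ^ (2 * d + 1)\<close>.\<close>

definition psi_series :: "real \<Rightarrow> real fps" where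
  "psi_series y = Abs_fps (\<lambda>d. real (2 * d choose d) * y ^ (2 * d))"

definition psi_poly :: "'b set \<Rightarrow> nat \<Rightarrow> ('b \<Rightarrow> real) \<Rightarrow> real" where
  "psi_poly K M \<mu> = (\<Prod>i\<in>K. psi_series (\<mu> i)) $ M"

text \<open>The prefactor \<open>1 / (M! * 2 ^ (2 * M + 1))\<close> of the volume times
  \<open>(M!)^2\<close>: expanding \<open>(\<Sum> P_i^2 \<psi>_i) ^ M\<close> yields the multinomial
  coefficient \<open>M! / \<Prod> d_i!\<close>, and the genus 0 intersection number of the monomial
  is the same multinomial coefficient.\<close>

definition kappa :: "nat \<Rightarrow> real" where
  "kappa M = fact M / 2 ^ (2 * M + 1)"

lemma psi_poly_insert:
  assumes "finite K" "x \<notin> K"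
  shows "psi_poly (insert x K) M \<mu> = (\<Sum>d=0..M. real (2 * d choose d) * \<mu> x ^ (2 * d) * psi_poly K (M - d) \<mu>)"
  using assms by (simp add: psi_poly_def fps_mult_nth psi_series_def)

lemma psi_poly_remove:
  assumes "finite K" "x \<in> K"
  shows "psi_poly K M \<mu> = (\<Sum>d=0..M. real (2 * d choose d) * \<mu> x ^ (2 * d) * psi_poly (K - {x}) (M - d) \<mu>)"
  using psi_poly_insert[of "K - {x}" x M \<mu>] assms by (simp add: insert_absorb)

lemma psi_poly_zero:
  assumes "finite K" "x \<in> K" "\<mu> x = 0"
  shows "psi_poly K M \<mu> = psi_poly (K - {x}) M \<mu>"
proof -
  have "psi_poly K M \<mu> = (\<Sum>d=0..M. if d = 0 then psi_poly (K - {x}) M \<mu> else 0)"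
    unfolding psi_poly_remove[OF assms(1,2)] by (rule sum.cong) (use assms(3) in auto)
  then show ?thesis by simp
qed

lemma hpoly_psi_poly: "finite K \<Longrightarrow> hpoly K M (psi_poly K M)"
proof (induction K arbitrary: M rule: finite_induct)
  case empty
  have "hpoly {} M (\<lambda>\<mu>. if M = 0 then 1 else 0)"
    using hpoly_monom[of "\<lambda>_. 0" "{}" 0 1] hpoly.zero[of "{}" M] by (cases "M = 0") auto
  then show ?case by (rule hpoly_cong) (simp add: psi_poly_def)
next
  case (insert x K)
  have "hpoly (insert x K) M (\<lambda>\<mu>. \<Sum>d=0..M. real (2 * d choose d) * (\<mu> x ^ (2 * d) * psi_poly K (M - d) \<mu>))"
  proof (intro hpoly_sum hpoly_scale)
    fix d assume d: "d \<in> {0..M}"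
    have "hpoly ({x} \<union> K) (d + (M - d)) (\<lambda>\<mu>. \<mu> x ^ (2 * d) * psi_poly K (M - d) \<mu>)"
      by (rule hpoly_mult) (use insert hpoly_single in auto)
    then show "hpoly (insert x K) M (\<lambda>\<mu>. \<mu> x ^ (2 * d) * psi_poly K (M - d) \<mu>)" using d by simp
  qed
  then show ?case
    by (rule hpoly_cong) (simp add: psi_poly_insert[OF insert.hyps] mult.assoc)
qed

lemma fps_deriv_prod:
  fixes f :: "'b \<Rightarrow> real fps"
  assumes "finite S"
  shows "fps_deriv (\<Prod>i\<in>S. f i) = (\<Sum>j\<in>S. fps_deriv (f j) * (\<Prod>i\<in>S - {j}. f i))"
  using assms
proof (induction S rule: finite_induct)
  case (insert x S)
  have "(\<Sum>j\<in>S. fps_deriv (f j) * (\<Prod>i\<in>insert x S - {j}. f i)) = (\<Sum>j\<in>S. f x * (fps_deriv (f j) * (\<Prod>i\<in>S - {j}. f i)))"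
  proof (rule sum.cong[OF refl])
    fix j assume j: "j \<in> S"
    then have "insert x S - {j} = insert x (S - {j})" using insert by auto
    then show "fps_deriv (f j) * (\<Prod>i\<in>insert x S - {j}. f i) = f x * (fps_deriv (f j) * (\<Prod>i\<in>S - {j}. f i))"
      using insert j by (simp add: mult_ac)
  qed
  then show ?case using insert by (simp add: sum_distrib_left mult.commute add.commute)
qed simp

lemma central_binomial_Suc: "real (Suc d) * real (2 * Suc d choose Suc d) = 2 * (2 * real d + 1) * real (2 * d choose d)"
proof -
  have "Suc d * (2 * Suc d choose Suc d) = (2 * Suc d) * (Suc (2 * d) choose d)"
    using Suc_times_binomial_eq[of "Suc (2 * d)" d] by simp
  moreover have "Suc (2 * d) * (2 * d choose d) = (Suc (2 * d) choose d) * (Suc (2 * d) - d)"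
    using binomial_absorb_comp[of "Suc (2 * d)" d] by (simp add: mult.commute)
  moreover have "Suc (2 * d) - d = Suc d" by simp
  ultimately have "Suc d * (2 * Suc d choose Suc d) = 2 * (Suc (2 * d) * (2 * d choose d))"
    by (metis mult.assoc mult.commute)
  then have "real (Suc d * (2 * Suc d choose Suc d)) = real (2 * (Suc (2 * d) * (2 * d choose d)))" by presburger
  then show ?thesis unfolding of_nat_mult by (simp del: binomial_Suc_Suc mult_Suc_right add: add.commute)
qed

text \<open>Up to normalisation, this is the string equation for intersection numbers of psi classes.\<close>

lemma psi_poly_string:
  assumes S: "finite S" and M: "M \<ge> 1"
  shows "(\<Sum>j\<in>S. \<Sum>d=0..M - 1. 2 * (2 * real d + 1) * real (2 * d choose d) * \<mu> j ^ (2 * (d + 1)) * psi_poly (S - {j}) (M - 1 - d) \<mu>) =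
    real M * psi_poly S M \<mu>"
proof -
  have d: "fps_deriv (psi_series y) $ d = 2 * (2 * real d + 1) * real (2 * d choose d) * y ^ (2 * (d + 1))" for y d
    using central_binomial_Suc[of d] by (simp add: psi_series_def mult.assoc[symmetric] del: binomial_Suc_Suc mult_Suc_right)
  have "real M * psi_poly S M \<mu> = fps_deriv (\<Prod>i\<in>S. psi_series (\<mu> i)) $ (M - 1)"
    using M by (simp add: psi_poly_def)
  also have "\<dots> = (\<Sum>j\<in>S. (fps_deriv (psi_series (\<mu> j)) * (\<Prod>i\<in>S - {j}. psi_series (\<mu> i))) $ (M - 1))"
    by (simp add: fps_deriv_prod[OF S] fps_sum_nth)
  also have "\<dots> = (\<Sum>j\<in>S. \<Sum>d=0..M - 1. 2 * (2 * real d + 1) * real (2 * d choose d) * \<mu> j ^ (2 * (d + 1)) * psi_poly (S - {j}) (M - 1 - d) \<mu>)"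
    by (simp only: fps_mult_nth d psi_poly_def)
  finally show ?thesis by simp
qed

section \<open>Induction on the number of faces\<close>

definition closed_form :: "'b set \<Rightarrow> bool" where
  "closed_form K \<longleftrightarrow> (\<forall>lam. (\<forall>i\<in>K. lam i > 0) \<longrightarrow>
     closed_Z K lam = (\<Prod>i\<in>K. 1 / lam i) * (kappa (card K - 3) * psi_poly K (card K - 3) (\<lambda>i. 1 / lam i)))"

text \<open>The derivative of \<open>(1 / t) ^ (2 * d + 1)\<close> gives the factor
  \<open>2 * d + 1\<close> and two more powers; the division by \<open>2 * lam x\<close> in
  \<open>rooted_Z_marked_Z\<close> gives the third power and the factor
  \<open>1 / 2\<close>.\<close>

lemma rooted_Z_closed_form:
  assumes cf: "closed_form K" and K: "card K \<ge> 3" "x \<in> K" and pos: "\<And>i. i \<in> K \<Longrightarrow> lam i > 0"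
  shows "rooted_Z K x lam = (\<Prod>i\<in>K - {x}. 1 / lam i) *
     (\<Sum>d=0..card K - 3. kappa (card K - 3) * (2 * real d + 1) / 2 * real (2 * d choose d) * (1 / lam x) ^ (2 * d + 3) *
        psi_poly (K - {x}) (card K - 3 - d) (\<lambda>i. 1 / lam i))"
proof -
  define M where "M = card K - 3"
  define P where "P = (\<Prod>i\<in>K - {x}. 1 / lam i)"
  define V where "V d = psi_poly (K - {x}) (M - d) (\<lambda>i. 1 / lam i)" for d
  have fK: "finite K" using K by (metis card.infinite not_numeral_le_zero)
  have eq: "closed_Z K (lam(x := t)) = (\<Sum>d=0..M. P * kappa M * real (2 * d choose d) * V d * (1 / t) ^ (2 * d + 1))" if t: "t > 0" for t
  proof -
    have "(\<Prod>i\<in>K. 1 / (lam(x := t)) i) = 1 / t * P"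
      unfolding P_def using fK K by (subst prod.remove[of _ x]) auto
    moreover have "psi_poly (K - {x}) (M - d) (\<lambda>i. 1 / (lam(x := t)) i) = V d" for d
      unfolding V_def by (rule hpoly_depends[OF hpoly_psi_poly]) (use fK in auto)
    moreover have "closed_Z K (lam(x := t)) = (\<Prod>i\<in>K. 1 / (lam(x := t)) i) * (kappa M * psi_poly K M (\<lambda>i. 1 / (lam(x := t)) i))"
      using cf pos t unfolding closed_form_def M_def by simp
    ultimately show ?thesis
      unfolding psi_poly_remove[OF fK K(2)] by (simp add: sum_distrib_left mult_ac)
  qed
  have l: "lam x > 0" using pos K by simp
  have "((\<lambda>t. \<Sum>d=0..M. P * kappa M * real (2 * d choose d) * V d * (1 / t) ^ (2 * d + 1)) has_real_derivative
     (\<Sum>d=0..M. P * kappa M * real (2 * d choose d) * V d * (real (2 * d + 1) * (1 / lam x) ^ (2 * d) * (- 1 / (lam x)\<^sup>2)))) (at (lam x))"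
  proof (rule DERIV_sum, rule DERIV_cmult)
    fix d
    have "((\<lambda>t. 1 / t) has_real_derivative - 1 / (lam x)\<^sup>2) (at (lam x))"
      using l by (auto intro!: derivative_eq_intros simp: power2_eq_square)
    from DERIV_power[OF this, of "2 * d + 1"]
    show "((\<lambda>t. (1 / t) ^ (2 * d + 1)) has_real_derivative real (2 * d + 1) * (1 / lam x) ^ (2 * d) * (- 1 / (lam x)\<^sup>2)) (at (lam x))"
      by (simp add: mult_ac)
  qed
  moreover have "((\<lambda>t. \<Sum>d=0..M. P * kappa M * real (2 * d choose d) * V d * (1 / t) ^ (2 * d + 1)) has_real_derivative
      - marked_Z K x (lam(x := lam x))) (at (lam x))"
  proof (rule has_field_derivative_transform_within_open[of _ _ _ "{0<..}"])
    show "((\<lambda>t. closed_Z K (lam(x := t))) has_real_derivative - marked_Z K x (lam(x := lam x))) (at (lam x))"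
      by (rule closed_Z_deriv) (use pos l in auto)
  qed (use l eq in auto)
  ultimately have "marked_Z K x lam = - (\<Sum>d=0..M. P * kappa M * real (2 * d choose d) * V d * (real (2 * d + 1) * (1 / lam x) ^ (2 * d) * (- 1 / (lam x)\<^sup>2)))"
    using DERIV_unique by fastforce
  also have "\<dots> = 2 * lam x * (P * (\<Sum>d=0..M. kappa M * (2 * real d + 1) / 2 * real (2 * d choose d) * (1 / lam x) ^ (2 * d + 3) * V d))"
    unfolding sum_distrib_left sum_negf[symmetric]
    by (rule sum.cong[OF refl]) (use l in \<open>simp add: power_add power3_eq_cube power2_eq_square field_simps\<close>)
  finally have "2 * lam x * rooted_Z K x lam = \<dots>"
    using rooted_Z_marked_Z[of K x lam, OF K] pos by simp
  then show ?thesis using l unfolding P_def V_def M_def by simp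
qed

text \<open>The condition \<open>lam j \<noteq> lam x\<close> only avoids the vanishing denominators of the loop equation.\<close>

definition poly_form :: "'b set \<Rightarrow> 'b \<Rightarrow> bool" where
  "poly_form K x \<longleftrightarrow> (\<exists>Q. hpoly K (card K - 3) Q \<and>
     (\<forall>\<mu>. \<mu> x = 0 \<longrightarrow> Q \<mu> = kappa (card K - 3) * psi_poly (K - {x}) (card K - 3) \<mu>) \<and>
     (\<forall>lam. (\<forall>i\<in>K. lam i > 0) \<longrightarrow> (\<forall>j\<in>K - {x}. lam j \<noteq> lam x) \<longrightarrow>
        marked_Z K x lam = (1 / lam x)\<^sup>2 * (\<Prod>i\<in>K - {x}. 1 / lam i) * Q (\<lambda>i. 1 / lam i)))"

text \<open>For three faces the polynomial is the constant \<open>1 / 2\<close>, and the loop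
  equation involves only the maps with two faces, which are explicit.\<close>

lemma poly_form_three:
  assumes K: "card K = 3" "x \<in> K"
  shows "poly_form K x"
proof -
  have fK: "finite K" using K by (metis card.infinite zero_neq_numeral)
  have "card (K - {x}) = 2" using K fK by simp
  then obtain j l where jl: "K - {x} = {j, l}" "j \<noteq> l" by (auto simp: card_2_iff)
  then have Kx: "K = {x, j, l}" "x \<noteq> j" "x \<noteq> l" using K by auto
  have "hpoly K 0 (\<lambda>\<mu>. 1 / 2)" using hpoly_monom[of "\<lambda>_. 0" K 0 "1 / 2"] by simp
  moreover have "kappa 0 * psi_poly (K - {x}) 0 \<mu> = 1 / 2" for \<mu>
    using jl by (simp add: kappa_def psi_poly_def psi_series_def)
  moreover have "marked_Z K x lam = (1 / lam x)\<^sup>2 * (\<Prod>i\<in>K - {x}. 1 / lam i) * (1 / 2)"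
    if pos: "\<forall>i\<in>K. lam i > 0" and ne: "\<forall>j\<in>K - {x}. lam j \<noteq> lam x" for lam
  proof -
    have p: "lam x > 0" "lam j > 0" "lam l > 0" "lam j \<noteq> lam x" "lam l \<noteq> lam x" using pos ne Kx by auto
    have sets: "{K1. K1 \<subseteq> K \<and> x \<in> K1} = {{x}, {x, j}, {x, l}, K}" unfolding Kx by auto
    have dist: "{x} \<noteq> {x, j}" "{x} \<noteq> {x, l}" "{x} \<noteq> K" "{x, j} \<noteq> {x, l}" "{x, j} \<noteq> K" "{x, l} \<noteq> K" using Kx jl by auto
    have c: "insert x (K - {x}) = K" "insert x (K - {x, j}) = {x, l}" "insert x (K - {x, l}) = {x, j}" "insert x (K - K) = {x}"
      using Kx jl by auto
    have pair: "rooted_Z {x, j} x lam = 1 / (2 * lam x * (lam x + lam j))" "rooted_Z {x, l} x lam = 1 / (2 * lam x * (lam x + lam l))"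
      "rooted_Z {x, l} x (lam(x := lam j)) = 1 / (2 * lam j * (lam j + lam l))"
      "rooted_Z {x, j} x (lam(x := lam l)) = 1 / (2 * lam l * (lam l + lam j))"
      using rooted_Z_pair[of "{x, j}" x j lam] rooted_Z_pair[of "{x, l}" x l lam] rooted_Z_pair[of "{x, l}" x l "lam(x := lam j)"]
        rooted_Z_pair[of "{x, j}" x j "lam(x := lam l)"] p Kx by auto
    have "marked_Z K x lam = 2 * lam x * rooted_Z K x lam"
      using rooted_Z_marked_Z[of K x lam] K pos by simp
    also have "\<dots> = (\<Sum>K1\<in>{K1. K1 \<subseteq> K \<and> x \<in> K1}. rooted_Z K1 x lam * rooted_Z (insert x (K - K1)) x lam) +
      (\<Sum>j\<in>K - {x}. (rooted_Z (K - {j}) x lam - rooted_Z (K - {j}) x (lam(x := lam j))) / ((lam j)\<^sup>2 - (lam x)\<^sup>2))"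
      by (rule loop_equation) (use K pos ne in auto)
    also have "(\<Sum>K1\<in>{K1. K1 \<subseteq> K \<and> x \<in> K1}. rooted_Z K1 x lam * rooted_Z (insert x (K - K1)) x lam) =
        2 * (rooted_Z {x, j} x lam * rooted_Z {x, l} x lam)"
      unfolding sets using dist by (simp add: c rooted_Z_singleton)
    also have "(\<Sum>j\<in>K - {x}. (rooted_Z (K - {j}) x lam - rooted_Z (K - {j}) x (lam(x := lam j))) / ((lam j)\<^sup>2 - (lam x)\<^sup>2)) =
       (rooted_Z {x, l} x lam - rooted_Z {x, l} x (lam(x := lam j))) / ((lam j)\<^sup>2 - (lam x)\<^sup>2) +
       (rooted_Z {x, j} x lam - rooted_Z {x, j} x (lam(x := lam l))) / ((lam l)\<^sup>2 - (lam x)\<^sup>2)"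
    proof -
      have "K - {j} = {x, l}" "K - {l} = {x, j}" using Kx jl by auto
      then show ?thesis unfolding jl using jl(2) by simp
    qed
    finally have "marked_Z K x lam = 2 * (1 / (2 * lam x * (lam x + lam j)) * (1 / (2 * lam x * (lam x + lam l)))) +
       ((1 / (2 * lam x * (lam x + lam l)) - 1 / (2 * lam j * (lam j + lam l))) / ((lam j)\<^sup>2 - (lam x)\<^sup>2) +
       (1 / (2 * lam x * (lam x + lam j)) - 1 / (2 * lam l * (lam l + lam j))) / ((lam l)\<^sup>2 - (lam x)\<^sup>2))" unfolding pair .
    also have "\<dots> = (1 / lam x)\<^sup>2 * (1 / lam j * (1 / lam l)) * (1 / 2)"
    proof -
      \<comment> \<open>The numerator is divisible by \<open>b - a\<close>, so the divided
        difference has no pole at equal arguments.\<close>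
      have div: "(1 / (2 * a * (a + c)) - 1 / (2 * b * (b + c))) / (b\<^sup>2 - a\<^sup>2) = (a + b + c) / (2 * a * b * (a + c) * (b + c) * (a + b))"
        if "a > 0" "b > 0" "c > 0" "b \<noteq> a" for a b c :: real
      proof -
        have "1 / (2 * a * (a + c)) - 1 / (2 * b * (b + c)) = (b - a) * (a + b + c) / (2 * a * b * (a + c) * (b + c))"
          using that by (simp add: divide_simps add_pos_pos[THEN less_imp_neq, symmetric]) (simp add: algebra_simps)
        moreover have "b\<^sup>2 - a\<^sup>2 = (b - a) * (a + b)" by (simp add: power2_eq_square algebra_simps)
        ultimately show ?thesis using that by simp
      qed
      have s: "lam x + lam j \<noteq> 0" "lam x + lam l \<noteq> 0" "lam j + lam l \<noteq> 0" "lam l + lam j \<noteq> 0" using p by auto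
      show ?thesis
        unfolding div[OF p(1,2,3,4)] div[OF p(1,3,2,5)]
        using p s by (simp add: divide_simps) (simp add: algebra_simps power2_eq_square)
    qed
    finally show ?thesis using jl by simp
  qed
  ultimately show ?thesis unfolding poly_form_def K by (intro exI[of _ "\<lambda>_. 1 / 2"]) auto
qed

text \<open>With \<open>X = 1 / lam x\<close> and \<open>Y = 1 / lam j\<close>, the product with the
  two-face sum and the divided difference of odd powers both have a pole at \<open>X = - Y\<close>.
  The pole cancels in the sum: over the common denominator \<open>X^2 - Y^2\<close> the numerators
  combine to \<open>X ^ (2 * d + 4) - Y ^ (2 * d + 4)\<close>, a difference of powers of
  squares.\<close>

lemma divided_difference_odd:
  fixes X Y :: real
  assumes "X > 0" "Y > 0" "X \<noteq> Y"
  shows "X ^ (2 * d + 3) / (1 / X * (1 / X + 1 / Y)) + (X ^ (2 * d + 3) - Y ^ (2 * d + 3)) / ((1 / Y)\<^sup>2 - (1 / X)\<^sup>2) =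
    X\<^sup>2 * Y * (\<Sum>a<d + 2. Y ^ (2 * (d + 1 - a)) * X ^ (2 * a))"
proof -
  have XY: "X + Y \<noteq> 0" "X - Y \<noteq> 0" "X\<^sup>2 - Y\<^sup>2 \<noteq> 0" using assms by (auto simp: power2_eq_iff)
  have 1: "1 / X * (1 / X + 1 / Y) = (X + Y) / (X\<^sup>2 * Y)" "(1 / Y)\<^sup>2 - (1 / X)\<^sup>2 = (X\<^sup>2 - Y\<^sup>2) / (X\<^sup>2 * Y\<^sup>2)"
    using assms by (auto simp: field_simps power2_eq_square)
  have "X ^ (2 * d + 3) / (1 / X * (1 / X + 1 / Y)) = X\<^sup>2 * Y * (X ^ (2 * d + 3) * (X - Y)) / (X\<^sup>2 - Y\<^sup>2)"
  proof -
    have e: "X\<^sup>2 - Y\<^sup>2 = (X + Y) * (X - Y)" by (simp add: power2_eq_square algebra_simps)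
    have "X\<^sup>2 * Y * (X ^ (2 * d + 3) * (X - Y)) / ((X + Y) * (X - Y)) = X\<^sup>2 * Y * X ^ (2 * d + 3) / (X + Y)"
      by (simp only: mult.assoc[symmetric] nonzero_mult_divide_mult_cancel_right[OF XY(2)])
    then show ?thesis unfolding 1 e by (simp add: mult_ac)
  qed
  moreover have "(X ^ (2 * d + 3) - Y ^ (2 * d + 3)) / ((1 / Y)\<^sup>2 - (1 / X)\<^sup>2) = X\<^sup>2 * Y * ((X ^ (2 * d + 3) - Y ^ (2 * d + 3)) * Y) / (X\<^sup>2 - Y\<^sup>2)"
    unfolding 1 by (simp add: power2_eq_square mult_ac)
  moreover have "X ^ (2 * d + 3) * (X - Y) + (X ^ (2 * d + 3) - Y ^ (2 * d + 3)) * Y = (X\<^sup>2) ^ (d + 2) - (Y\<^sup>2) ^ (d + 2)"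
  proof -
    have "(Z\<^sup>2) ^ (d + 2) = Z ^ (2 * d + 3) * Z" for Z :: real by (simp add: power_mult[symmetric] power_add power3_eq_cube power4_eq_xxxx algebra_simps)
    then show ?thesis by (simp add: algebra_simps)
  qed
  moreover have "(X\<^sup>2) ^ (d + 2) - (Y\<^sup>2) ^ (d + 2) = (X\<^sup>2 - Y\<^sup>2) * (\<Sum>a<d + 2. Y ^ (2 * (d + 1 - a)) * X ^ (2 * a))"
    unfolding power_diff_sumr2[of "X\<^sup>2" "d + 2"] by (simp add: power_mult)
  ultimately have "X ^ (2 * d + 3) / (1 / X * (1 / X + 1 / Y)) + (X ^ (2 * d + 3) - Y ^ (2 * d + 3)) / ((1 / Y)\<^sup>2 - (1 / X)\<^sup>2) =
    X\<^sup>2 * Y * ((X\<^sup>2 - Y\<^sup>2) * (\<Sum>a<d + 2. Y ^ (2 * (d + 1 - a)) * X ^ (2 * a))) / (X\<^sup>2 - Y\<^sup>2)"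
    by (metis (no_types, lifting) add_divide_distrib distrib_left)
  then show ?thesis using XY by simp
qed

text \<open>Splittings with a part of two labels occur twice by symmetry. They are set apart because
  the two-face sum is not of the polynomial form and has to be combined with the divided
  differences.\<close>

lemma sum_root_subsets:
  assumes fK: "finite K" and x: "x \<in> K" and card: "card K \<ge> 4"
    and small: "\<And>K1. card K1 = 1 \<Longrightarrow> g K1 = (0::real)"
  shows "(\<Sum>K1\<in>{K1. K1 \<subseteq> K \<and> x \<in> K1}. g K1 * g (insert x (K - K1))) =
    (\<Sum>K1\<in>{K1. K1 \<subseteq> K \<and> x \<in> K1 \<and> card K1 \<ge> 3 \<and> card (insert x (K - K1)) \<ge> 3}. g K1 * g (insert x (K - K1))) +
    2 * (\<Sum>j\<in>K - {x}. g {x, j} * g (K - {j}))"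
proof -
  let ?A = "{K1. K1 \<subseteq> K \<and> x \<in> K1}" and ?c = "\<lambda>K1. insert x (K - K1)"
  let ?B = "{K1. K1 \<subseteq> K \<and> x \<in> K1 \<and> card K1 \<ge> 3 \<and> card (?c K1) \<ge> 3}"
  define C1 where "C1 = (\<lambda>j. {x, j}) ` (K - {x})"
  define C2 where "C2 = (\<lambda>j. K - {j}) ` (K - {x})"
  have fA: "finite ?A" using fK by simp
  have cc: "card K1 + card (?c K1) = card K + 1" "finite K1" "card K1 \<ge> 1" "card (?c K1) \<ge> 1" if "K1 \<in> ?A" for K1
  proof -
    have K1: "K1 \<subseteq> K" "x \<in> K1" "finite K1" using that fK by (auto intro: finite_subset)
    have "card (?c K1) = card (K - K1) + 1" using K1 fK by simp
    moreover have "card (K - K1) = card K - card K1" using K1 by (simp add: card_Diff_subset)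
    moreover have "card K1 \<le> card K" using K1 fK by (simp add: card_mono)
    ultimately show "card K1 + card (?c K1) = card K + 1" by simp
    show "finite K1" by fact
    show "card K1 \<ge> 1" "card (?c K1) \<ge> 1" using K1 fK by (auto simp: Suc_le_eq card_gt_0_iff)
  qed
  have C1: "C1 = {K1 \<in> ?A. card K1 = 2}"
  proof
    show "C1 \<subseteq> {K1 \<in> ?A. card K1 = 2}" using x by (auto simp: C1_def)
    show "{K1 \<in> ?A. card K1 = 2} \<subseteq> C1"
    proof
      fix K1 assume K1: "K1 \<in> {K1 \<in> ?A. card K1 = 2}"
      then have "card (K1 - {x}) = 1" using cc(2)[of K1] by simp
      then obtain j where "K1 - {x} = {j}" by (auto simp: card_1_singleton_iff)
      then have "K1 = {x, j}" "j \<in> K - {x}" using K1 by auto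
      then show "K1 \<in> C1" by (auto simp: C1_def)
    qed
  qed
  have C2: "C2 = {K1 \<in> ?A. card (?c K1) = 2}"
  proof
    have "?c (K - {j}) = {x, j}" if "j \<in> K - {x}" for j using that by auto
    then show "C2 \<subseteq> {K1 \<in> ?A. card (?c K1) = 2}" using x by (auto simp: C2_def)
    show "{K1 \<in> ?A. card (?c K1) = 2} \<subseteq> C2"
    proof
      fix K1 assume K1: "K1 \<in> {K1 \<in> ?A. card (?c K1) = 2}"
      then have "x \<notin> K - K1" by auto
      then have "card (K - K1) = 1" using K1 fK by simp
      then obtain j where j: "K - K1 = {j}" by (auto simp: card_1_singleton_iff)
      then have "K1 = K - {j}" "j \<in> K - {x}" using K1 by auto
      then show "K1 \<in> C2" by (auto simp: C2_def)
    qed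
  qed
  have zero: "g K1 * g (?c K1) = 0" if "K1 \<in> ?A - (?B \<union> C1 \<union> C2)" for K1
  proof -
    have "card K1 = 1 \<or> card (?c K1) = 1"
      using that cc(3,4)[of K1] unfolding C1 C2 by auto
    then show ?thesis using small by auto
  qed
  have d1: "?B \<inter> C1 = {}" "(?B \<union> C1) \<inter> C2 = {}" 
  proof -
    show "?B \<inter> C1 = {}" unfolding C1 by auto
    \<comment> \<open>If both parts had two labels, \<open>K\<close> would have three, contrary to
      \<open>card K \<ge> 4\<close>.\<close>
    have "K1 \<notin> C2" if K1: "K1 \<in> C1" for K1
    proof
      assume "K1 \<in> C2"
      then have "card K1 = 2" "card (?c K1) = 2" "K1 \<in> ?A" using K1 unfolding C1 C2 by blast+
      then show False using cc(1)[of K1] card by linarith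
    qed
    moreover have "?B \<inter> C2 = {}" unfolding C2 by auto
    ultimately show "(?B \<union> C1) \<inter> C2 = {}" by blast
  qed
  have f: "finite ?B" "finite C1" "finite C2" using fK by (auto simp: C1_def C2_def)
  have "(\<Sum>K1\<in>?A. g K1 * g (?c K1)) = (\<Sum>K1\<in>?B \<union> C1 \<union> C2. g K1 * g (?c K1))"
    by (rule sum.mono_neutral_right[OF fA]) (use zero C1 C2 in auto)
  also have "\<dots> = (\<Sum>K1\<in>?B. g K1 * g (?c K1)) + (\<Sum>K1\<in>C1. g K1 * g (?c K1)) + (\<Sum>K1\<in>C2. g K1 * g (?c K1))"
    using d1 f by (simp add: sum.union_disjoint)
  also have "(\<Sum>K1\<in>C1. g K1 * g (?c K1)) = (\<Sum>j\<in>K - {x}. g {x, j} * g (K - {j}))"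
  proof -
    have i: "inj_on (\<lambda>j. {x, j}) (K - {x})" by (auto simp: inj_on_def doubleton_eq_iff)
    have "?c {x, j} = K - {j}" if "j \<in> K - {x}" for j using that x by auto
    then show ?thesis unfolding C1_def sum.reindex[OF i] by (intro sum.cong) auto
  qed
  also have "(\<Sum>K1\<in>C2. g K1 * g (?c K1)) = (\<Sum>j\<in>K - {x}. g {x, j} * g (K - {j}))"
  proof -
    have i: "inj_on (\<lambda>j. K - {j}) (K - {x})" by (auto simp: inj_on_def)
    have "?c (K - {j}) = {x, j}" if "j \<in> K - {x}" for j using that by auto
    then show ?thesis unfolding C2_def sum.reindex[OF i] by (intro sum.cong) (auto simp: mult.commute)
  qed
  finally show ?thesis by simp
qed

text \<open>\<open>Q1\<close> comes from the splittings into parts with at least three labels, and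
  \<open>Q2\<close> from all other terms of the loop equation. Every term of \<open>Q1\<close>
  contains \<open>\<mu> x\<close>, so on \<open>\<mu> x = 0\<close> only the terms
  \<open>a = 0\<close> of \<open>Q2\<close> remain, and these form the left side of the string
  equation.\<close>

lemma poly_form_step:
  fixes K :: "'b set"
  assumes K: "card K \<ge> 4" "x \<in> K"
    and IH: "\<And>K' :: 'b set. card K' < card K \<Longrightarrow> card K' \<ge> 3 \<Longrightarrow> closed_form K'"
  shows "poly_form K x"
proof -
  have fK: "finite K" using K by (metis card.infinite not_numeral_le_zero)
  define S where "S = K - {x}"
  define M where "M = card K - 3"
  define c where "c K1 = insert x (K - K1)" for K1
  define big where "big = {K1. K1 \<subseteq> K \<and> x \<in> K1 \<and> card K1 \<ge> 3 \<and> card (c K1) \<ge> 3}"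
  define g where "g m d = kappa m * (2 * real d + 1) / 2 * real (2 * d choose d)" for m d
  define V where "V K1 d \<mu> = psi_poly (K1 - {x}) (card K1 - 3 - d) \<mu>" for K1 d and \<mu> :: "'b \<Rightarrow> real"
  define Q1 where "Q1 \<mu> = (\<Sum>K1\<in>big. \<Sum>d1=0..card K1 - 3. \<Sum>d2=0..card (c K1) - 3.
     g (card K1 - 3) d1 * g (card (c K1) - 3) d2 * (\<mu> x ^ (2 * (d1 + d2 + 2)) * (V K1 d1 \<mu> * V (c K1) d2 \<mu>)))" for \<mu> :: "'b \<Rightarrow> real"
  define Q2 where "Q2 \<mu> = (\<Sum>j\<in>S. \<Sum>d=0..M - 1. \<Sum>a<d + 2.
     g (M - 1) d * (\<mu> x ^ (2 * a) * (\<mu> j ^ (2 * (d + 1 - a)) * psi_poly (S - {j}) (M - 1 - d) \<mu>)))" for \<mu> :: "'b \<Rightarrow> real"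
  have M1: "M \<ge> 1" using K by (simp add: M_def)
  have fS: "finite S" "x \<notin> S" "K = insert x S" using fK K by (auto simp: S_def)
  have cS: "card S = M + 2" using fK K by (simp add: S_def M_def)
  have big: "finite K1" "card K1 + card (c K1) = card K + 1" "(K1 - {x}) \<inter> (c K1 - {x}) = {}"
      "(K1 - {x}) \<union> (c K1 - {x}) = S" "card K1 < card K" "card (c K1) < card K" "card K1 \<ge> 3" "card (c K1) \<ge> 3" "x \<in> K1" "x \<in> c K1" "K1 \<subseteq> K" "c K1 \<subseteq> K"
    if "K1 \<in> big" for K1
  proof -
    have K1: "K1 \<subseteq> K" "x \<in> K1" "finite K1" "card K1 \<ge> 3" "card (c K1) \<ge> 3" using that fK by (auto simp: big_def intro: finite_subset)
    have "card (c K1) = card (K - K1) + 1" using K1 fK by (simp add: c_def)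
    moreover have "card (K - K1) = card K - card K1" using K1 by (simp add: card_Diff_subset)
    moreover have "card K1 \<le> card K" using K1 fK by (simp add: card_mono)
    ultimately show cc: "card K1 + card (c K1) = card K + 1" by simp
    show "finite K1" "card K1 \<ge> 3" "card (c K1) \<ge> 3" "x \<in> K1" "K1 \<subseteq> K" by fact+
    show "card K1 < card K" "card (c K1) < card K" using cc K1 by auto
    show "(K1 - {x}) \<inter> (c K1 - {x}) = {}" "(K1 - {x}) \<union> (c K1 - {x}) = S" "x \<in> c K1" "c K1 \<subseteq> K" using K1 K by (auto simp: c_def S_def)
  qed
  have h1: "hpoly K M Q1" unfolding Q1_def
  proof (intro hpoly_sum hpoly_scale)
    fix K1 d1 d2 assume K1: "K1 \<in> big" and d: "d1 \<in> {0..card K1 - 3}" "d2 \<in> {0..card (c K1) - 3}"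
    note b = big[OF K1]
    have f: "finite (K1 - {x})" "finite (c K1 - {x})" using b fK by (auto intro: finite_subset)
    have "hpoly ({x} \<union> ((K1 - {x}) \<union> (c K1 - {x}))) ((d1 + d2 + 2) + ((card K1 - 3 - d1) + (card (c K1) - 3 - d2)))
       (\<lambda>\<mu>. \<mu> x ^ (2 * (d1 + d2 + 2)) * (V K1 d1 \<mu> * V (c K1) d2 \<mu>))"
      unfolding V_def
      by (intro hpoly_mult hpoly_single hpoly_psi_poly) (use f b in auto)
    moreover have "{x} \<union> ((K1 - {x}) \<union> (c K1 - {x})) = K" using b(4) fS by auto
    \<comment> \<open>Since \<open>card K1 + card (c K1) = card K + 1\<close>, subtracting 3 for
      each part and adding 2 gives \<open>card K - 3\<close>.\<close>
    moreover have "(d1 + d2 + 2) + ((card K1 - 3 - d1) + (card (c K1) - 3 - d2)) = M"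
      using d b(2,7,8) by (auto simp: M_def)
    ultimately show "hpoly K M (\<lambda>\<mu>. \<mu> x ^ (2 * (d1 + d2 + 2)) * (V K1 d1 \<mu> * V (c K1) d2 \<mu>))" by simp
  qed
  have h2: "hpoly K M Q2" unfolding Q2_def
  proof (intro hpoly_sum hpoly_scale)
    fix j d a assume j: "j \<in> S" and d: "d \<in> {0..M - 1}" and a: "a \<in> {..<d + 2}"
    have "hpoly ({x} \<union> ({j} \<union> (S - {j}))) (a + ((d + 1 - a) + (M - 1 - d)))
       (\<lambda>\<mu>. \<mu> x ^ (2 * a) * (\<mu> j ^ (2 * (d + 1 - a)) * psi_poly (S - {j}) (M - 1 - d) \<mu>))"
      by (intro hpoly_mult hpoly_single hpoly_psi_poly) (use fS j in auto)
    moreover have "{x} \<union> ({j} \<union> (S - {j})) = K" using fS j by auto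
    moreover have "a + ((d + 1 - a) + (M - 1 - d)) = M" using d a M1 by auto
    ultimately show "hpoly K M (\<lambda>\<mu>. \<mu> x ^ (2 * a) * (\<mu> j ^ (2 * (d + 1 - a)) * psi_poly (S - {j}) (M - 1 - d) \<mu>))" by simp
  qed
  have z: "Q1 \<mu> + Q2 \<mu> = kappa M * psi_poly S M \<mu>" if \<mu>: "\<mu> x = 0" for \<mu>
  proof -
    have q1: "Q1 \<mu> = 0" unfolding Q1_def using \<mu> by (intro sum.neutral ballI) simp
    have "Q2 \<mu> = (\<Sum>j\<in>S. \<Sum>d=0..M - 1. g (M - 1) d * (\<mu> j ^ (2 * (d + 1)) * psi_poly (S - {j}) (M - 1 - d) \<mu>))"
      unfolding Q2_def
    proof (intro sum.cong refl)
      fix j d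
      have "(\<Sum>a<d + 2. g (M - 1) d * (\<mu> x ^ (2 * a) * (\<mu> j ^ (2 * (d + 1 - a)) * psi_poly (S - {j}) (M - 1 - d) \<mu>))) =
        (\<Sum>a<d + 2. if a = 0 then g (M - 1) d * (\<mu> j ^ (2 * (d + 1)) * psi_poly (S - {j}) (M - 1 - d) \<mu>) else 0)"
        by (rule sum.cong) (use \<mu> in auto)
      then show "(\<Sum>a<d + 2. g (M - 1) d * (\<mu> x ^ (2 * a) * (\<mu> j ^ (2 * (d + 1 - a)) * psi_poly (S - {j}) (M - 1 - d) \<mu>))) =
        g (M - 1) d * (\<mu> j ^ (2 * (d + 1)) * psi_poly (S - {j}) (M - 1 - d) \<mu>)" by (subst (asm) sum.delta) auto
    qed
    also have "\<dots> = kappa (M - 1) / 4 * (\<Sum>j\<in>S. \<Sum>d=0..M - 1. 2 * (2 * real d + 1) * real (2 * d choose d) * \<mu> j ^ (2 * (d + 1)) * psi_poly (S - {j}) (M - 1 - d) \<mu>)"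
      unfolding sum_distrib_left by (intro sum.cong refl) (simp add: g_def)
    also have "\<dots> = kappa (M - 1) / 4 * (real M * psi_poly S M \<mu>)"
      unfolding psi_poly_string[OF fS(1) M1] ..
    \<comment> \<open>The recursion \<open>kappa M = M / 4 * kappa (M - 1)\<close> is what forces
      the factor \<open>fact M / 2 ^ (2 * M)\<close> in \<open>kappa\<close>.\<close>
    also have "\<dots> = kappa M * psi_poly S M \<mu>"
    proof -
      obtain m where "M = Suc m" using M1 by (cases M) auto
      then show ?thesis by (simp add: kappa_def)
    qed
    finally show ?thesis using q1 by simp
  qed
  have main: "marked_Z K x lam = (1 / lam x)\<^sup>2 * (\<Prod>i\<in>S. 1 / lam i) * (Q1 (\<lambda>i. 1 / lam i) + Q2 (\<lambda>i. 1 / lam i))"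
    if pos: "\<forall>i\<in>K. lam i > 0" and ne: "\<forall>j\<in>S. lam j \<noteq> lam x" for lam
  proof -
    define \<mu> where "\<mu> = (\<lambda>i. 1 / lam i)"
    define X where "X = \<mu> x"
    define P where "P A = (\<Prod>i\<in>A. \<mu> i)" for A
    have Xp: "X > 0" using pos K by (simp add: X_def \<mu>_def)
    have rZ: "rooted_Z K1 x lm = (\<Prod>i\<in>K1 - {x}. 1 / lm i) * (\<Sum>d=0..card K1 - 3. g (card K1 - 3) d * (1 / lm x) ^ (2 * d + 3) * V K1 d (\<lambda>i. 1 / lm i))"
      if "K1 \<subseteq> K" "x \<in> K1" "3 \<le> card K1" "card K1 < card K" "\<And>i. i \<in> K1 \<Longrightarrow> lm i > 0" for K1 lm
      unfolding g_def V_def by (rule rooted_Z_closed_form[OF IH]) (use that in auto)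
    have "marked_Z K x lam = 2 * lam x * rooted_Z K x lam"
      using rooted_Z_marked_Z[of K x lam] K pos by simp
    also have "\<dots> = (\<Sum>K1\<in>{K1. K1 \<subseteq> K \<and> x \<in> K1}. rooted_Z K1 x lam * rooted_Z (c K1) x lam) +
      (\<Sum>j\<in>S. (rooted_Z (K - {j}) x lam - rooted_Z (K - {j}) x (lam(x := lam j))) / ((lam j)\<^sup>2 - (lam x)\<^sup>2))"
      unfolding S_def c_def by (rule loop_equation) (use K pos ne in \<open>auto simp: S_def\<close>)
    also have "(\<Sum>K1\<in>{K1. K1 \<subseteq> K \<and> x \<in> K1}. rooted_Z K1 x lam * rooted_Z (c K1) x lam) =
       (\<Sum>K1\<in>big. rooted_Z K1 x lam * rooted_Z (c K1) x lam) + 2 * (\<Sum>j\<in>S. rooted_Z {x, j} x lam * rooted_Z (K - {j}) x lam)"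
      unfolding c_def big_def S_def
      by (rule sum_root_subsets[where g = "\<lambda>K1. rooted_Z K1 x lam", OF fK K(2,1) rooted_Z_singleton])
    finally have e: "marked_Z K x lam = (\<Sum>K1\<in>big. rooted_Z K1 x lam * rooted_Z (c K1) x lam) +
       (\<Sum>j\<in>S. 2 * (rooted_Z {x, j} x lam * rooted_Z (K - {j}) x lam) +
          (rooted_Z (K - {j}) x lam - rooted_Z (K - {j}) x (lam(x := lam j))) / ((lam j)\<^sup>2 - (lam x)\<^sup>2))"
      by (simp add: sum.distrib sum_distrib_left fun_upd_def)
    have "(\<Sum>K1\<in>big. rooted_Z K1 x lam * rooted_Z (c K1) x lam) = X\<^sup>2 * P S * Q1 \<mu>"
      unfolding Q1_def sum_distrib_left
    proof (rule sum.cong[OF refl])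
      fix K1 assume K1: "K1 \<in> big"
      note b = big[OF K1]
      have PS: "P S = P (K1 - {x}) * P (c K1 - {x})"
        unfolding P_def b(4)[symmetric] using b(1,3,12) fK by (intro prod.union_disjoint) (auto intro: finite_subset)
      have r1: "rooted_Z K1 x lam = P (K1 - {x}) * (\<Sum>d=0..card K1 - 3. g (card K1 - 3) d * X ^ (2 * d + 3) * V K1 d \<mu>)"
        using rZ[of K1 lam] b pos by (auto simp: P_def \<mu>_def X_def)
      have r2: "rooted_Z (c K1) x lam = P (c K1 - {x}) * (\<Sum>d=0..card (c K1) - 3. g (card (c K1) - 3) d * X ^ (2 * d + 3) * V (c K1) d \<mu>)"
        using rZ[of "c K1" lam] b pos by (auto simp: P_def \<mu>_def X_def)
      \<comment> \<open>The odd powers of two rooted sums multiply to an even one, of which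
        \<open>X\<^sup>2\<close> is the prefactor of \<open>marked_Z\<close>.\<close>
      have pw: "X ^ (2 * d1 + 3) * X ^ (2 * d2 + 3) = X\<^sup>2 * X ^ (2 * (d1 + d2 + 2))" for d1 d2
        unfolding power_add[symmetric] by (rule arg_cong[of _ _ "\<lambda>n. X ^ n"]) simp
      have "rooted_Z K1 x lam * rooted_Z (c K1) x lam = P S * (\<Sum>d1=0..card K1 - 3. \<Sum>d2=0..card (c K1) - 3.
         (g (card K1 - 3) d1 * X ^ (2 * d1 + 3) * V K1 d1 \<mu>) * (g (card (c K1) - 3) d2 * X ^ (2 * d2 + 3) * V (c K1) d2 \<mu>))"
        unfolding r1 r2 PS sum_product[symmetric] by (simp only: mult_ac)
      also have "\<dots> = (\<Sum>d1=0..card K1 - 3. \<Sum>d2=0..card (c K1) - 3. X\<^sup>2 * P S *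
          (g (card K1 - 3) d1 * g (card (c K1) - 3) d2 * (\<mu> x ^ (2 * (d1 + d2 + 2)) * (V K1 d1 \<mu> * V (c K1) d2 \<mu>))))"
        unfolding sum_distrib_left
      proof (intro sum.cong refl)
        fix d1 d2
        have "P S * ((g (card K1 - 3) d1 * X ^ (2 * d1 + 3) * V K1 d1 \<mu>) * (g (card (c K1) - 3) d2 * X ^ (2 * d2 + 3) * V (c K1) d2 \<mu>)) =
           (X ^ (2 * d1 + 3) * X ^ (2 * d2 + 3)) * P S * (g (card K1 - 3) d1 * g (card (c K1) - 3) d2 * (V K1 d1 \<mu> * V (c K1) d2 \<mu>))"
          by (simp only: mult_ac)
        also have "\<dots> = X\<^sup>2 * P S * (g (card K1 - 3) d1 * g (card (c K1) - 3) d2 * (\<mu> x ^ (2 * (d1 + d2 + 2)) * (V K1 d1 \<mu> * V (c K1) d2 \<mu>)))"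
          unfolding pw X_def[symmetric] by (simp only: mult_ac)
        finally show "P S * ((g (card K1 - 3) d1 * X ^ (2 * d1 + 3) * V K1 d1 \<mu>) * (g (card (c K1) - 3) d2 * X ^ (2 * d2 + 3) * V (c K1) d2 \<mu>)) =
          X\<^sup>2 * P S * (g (card K1 - 3) d1 * g (card (c K1) - 3) d2 * (\<mu> x ^ (2 * (d1 + d2 + 2)) * (V K1 d1 \<mu> * V (c K1) d2 \<mu>)))" .
      qed
      finally show "rooted_Z K1 x lam * rooted_Z (c K1) x lam = (\<Sum>d1=0..card K1 - 3. \<Sum>d2=0..card (c K1) - 3. X\<^sup>2 * P S *
          (g (card K1 - 3) d1 * g (card (c K1) - 3) d2 * (\<mu> x ^ (2 * (d1 + d2 + 2)) * (V K1 d1 \<mu> * V (c K1) d2 \<mu>))))" .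
    qed
    \<comment> \<open>For each \<open>j\<close> the two-face product and the divided difference are
      summed before anything else, so that \<open>divided_difference_odd\<close> applies to each
      power.\<close>
    moreover have "(\<Sum>j\<in>S. 2 * (rooted_Z {x, j} x lam * rooted_Z (K - {j}) x lam) +
          (rooted_Z (K - {j}) x lam - rooted_Z (K - {j}) x (lam(x := lam j))) / ((lam j)\<^sup>2 - (lam x)\<^sup>2)) = X\<^sup>2 * P S * Q2 \<mu>"
      unfolding Q2_def sum_distrib_left[of "X\<^sup>2 * P S" _ S]
    proof (rule sum.cong[OF refl])
      fix j assume j: "j \<in> S"
      define Y where "Y = \<mu> j"
      have jx: "j \<in> K" "j \<noteq> x" "lam j > 0" "lam x > 0" using j fS pos by auto
      have Y: "Y > 0" "X \<noteq> Y" using jx ne j by (auto simp: Y_def X_def \<mu>_def)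
      have l: "lam x = 1 / X" "lam j = 1 / Y" by (auto simp: X_def Y_def \<mu>_def)
      have cj: "card (K - {j}) = M + 2" using jx fK K by (simp add: M_def)
      have Kj: "K - {j} - {x} = S - {j}" by (auto simp: S_def)
      have PS: "P S = Y * P (S - {j})" unfolding P_def Y_def using fS j by (simp add: prod.remove)
      define W where "W d = g (M - 1) d * psi_poly (S - {j}) (M - 1 - d) \<mu>" for d
      have Vj: "V (K - {j}) d \<mu>' = psi_poly (S - {j}) (M - 1 - d) \<mu>'" for d \<mu>'
        unfolding V_def Kj cj using M1 by simp
      have Vj': "psi_poly (S - {j}) (M - 1 - d) (\<lambda>i. 1 / (lam(x := lam j)) i) = psi_poly (S - {j}) (M - 1 - d) \<mu>" for d
        by (rule hpoly_depends[OF hpoly_psi_poly]) (use fS in \<open>auto simp: \<mu>_def\<close>)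
      have r1: "rooted_Z (K - {j}) x lam = P (S - {j}) * (\<Sum>d=0..M - 1. W d * X ^ (2 * d + 3))"
        using rZ[of "K - {j}" lam] jx fS cj K M1 pos unfolding Vj Kj cj
        by (auto simp: P_def W_def \<mu>_def X_def M_def mult_ac)
      have pm: "(\<Prod>i\<in>S - {j}. 1 / (lam(x := lam j)) i) = P (S - {j})"
        unfolding P_def \<mu>_def by (rule prod.cong) (use fS in auto)
      have "rooted_Z (K - {j}) x (lam(x := lam j)) = (\<Prod>i\<in>S - {j}. 1 / (lam(x := lam j)) i) *
          (\<Sum>d=0..M + 2 - 3. g (M + 2 - 3) d * (1 / (lam(x := lam j)) x) ^ (2 * d + 3) * psi_poly (S - {j}) (M - 1 - d) (\<lambda>i. 1 / (lam(x := lam j)) i))"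
      proof (rule rZ[of "K - {j}" "lam(x := lam j)", unfolded Vj Kj cj])
        show "K - {j} \<subseteq> K" "x \<in> K - {j}" "3 \<le> M + 2" "M + 2 < card K" using jx fS cS M1 by auto
        show "\<And>i. i \<in> K - {j} \<Longrightarrow> (lam(x := lam j)) i > 0" using jx pos by auto
      qed
      also have "\<dots> = P (S - {j}) * (\<Sum>d=0..M - 1. W d * Y ^ (2 * d + 3))"
      proof -
        have "M + 2 - 3 = M - 1" by simp
        then show ?thesis unfolding pm Vj' by (simp add: W_def Y_def \<mu>_def mult_ac)
      qed
      finally have r2: "rooted_Z (K - {j}) x (lam(x := lam j)) = P (S - {j}) * (\<Sum>d=0..M - 1. W d * Y ^ (2 * d + 3))" .
      have pr: "2 * rooted_Z {x, j} x lam = 1 / (1 / X * (1 / X + 1 / Y))"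
        using rooted_Z_pair[of "{x, j}" x j lam] jx unfolding l[symmetric] by simp
      have "2 * (rooted_Z {x, j} x lam * rooted_Z (K - {j}) x lam) +
          (rooted_Z (K - {j}) x lam - rooted_Z (K - {j}) x (lam(x := lam j))) / ((lam j)\<^sup>2 - (lam x)\<^sup>2) =
        P (S - {j}) * (\<Sum>d=0..M - 1. W d * (X ^ (2 * d + 3) / (1 / X * (1 / X + 1 / Y)) + (X ^ (2 * d + 3) - Y ^ (2 * d + 3)) / ((1 / Y)\<^sup>2 - (1 / X)\<^sup>2)))"
      proof -
        define A where "A = 1 / (1 / X * (1 / X + 1 / Y))"
        define B where "B = (1 / Y)\<^sup>2 - (1 / X)\<^sup>2"
        have dA: "y / (1 / X * (1 / X + 1 / Y)) = A * y" for y by (simp add: A_def)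
        have "(\<Sum>d=0..M - 1. W d * (A * X ^ (2 * d + 3) + (X ^ (2 * d + 3) - Y ^ (2 * d + 3)) / B)) =
          (\<Sum>d=0..M - 1. A * (W d * X ^ (2 * d + 3)) + (W d * X ^ (2 * d + 3) / B - W d * Y ^ (2 * d + 3) / B))"
          by (rule sum.cong) (simp_all add: diff_divide_distrib distrib_left right_diff_distrib)
        also have "\<dots> = A * (\<Sum>d=0..M - 1. W d * X ^ (2 * d + 3)) + ((\<Sum>d=0..M - 1. W d * X ^ (2 * d + 3)) / B - (\<Sum>d=0..M - 1. W d * Y ^ (2 * d + 3)) / B)"
          by (simp add: sum.distrib sum_subtractf sum_distrib_left sum_divide_distrib)
        finally show ?thesis
          unfolding r1 r2 unfolding l dA B_def[symmetric] mult.assoc[symmetric] pr A_def[symmetric]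
          by (simp add: distrib_left right_diff_distrib diff_divide_distrib mult_ac)
      qed
      also have "\<dots> = X\<^sup>2 * P S * (\<Sum>d=0..M - 1. W d * (\<Sum>a<d + 2. Y ^ (2 * (d + 1 - a)) * X ^ (2 * a)))"
        unfolding divided_difference_odd[OF Xp Y] PS sum_distrib_left by (intro sum.cong refl) (simp only: mult_ac)
      also have "(\<Sum>d=0..M - 1. W d * (\<Sum>a<d + 2. Y ^ (2 * (d + 1 - a)) * X ^ (2 * a))) =
         (\<Sum>d=0..M - 1. \<Sum>a<d + 2. g (M - 1) d * (\<mu> x ^ (2 * a) * (\<mu> j ^ (2 * (d + 1 - a)) * psi_poly (S - {j}) (M - 1 - d) \<mu>)))"
        unfolding W_def sum_distrib_left X_def[symmetric] Y_def[symmetric] by (intro sum.cong refl) (simp only: mult_ac)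
      finally show "2 * (rooted_Z {x, j} x lam * rooted_Z (K - {j}) x lam) +
          (rooted_Z (K - {j}) x lam - rooted_Z (K - {j}) x (lam(x := lam j))) / ((lam j)\<^sup>2 - (lam x)\<^sup>2) =
          X\<^sup>2 * P S * (\<Sum>d=0..M - 1. \<Sum>a<d + 2. g (M - 1) d * (\<mu> x ^ (2 * a) * (\<mu> j ^ (2 * (d + 1 - a)) * psi_poly (S - {j}) (M - 1 - d) \<mu>)))" .
    qed
    ultimately have "marked_Z K x lam = X\<^sup>2 * P S * (Q1 \<mu> + Q2 \<mu>)" unfolding e by (simp add: distrib_left)
    then show ?thesis by (simp add: X_def P_def \<mu>_def)
  qed
  show ?thesis unfolding poly_form_def M_def[symmetric] S_def[symmetric]
    by (intro exI[of _ "\<lambda>\<mu>. Q1 \<mu> + Q2 \<mu>"] conjI hpoly_add h1 h2 allI impI z main)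
qed

text \<open>By \<open>closed_Z_deriv\<close> the sum over closed maps is an antiderivative of the marked one, without constant
  because it vanishes as \<open>lam x\<close> tends to infinity.\<close>

lemma closed_form_of_poly_form:
  assumes K: "card K \<ge> 3" and pf: "\<And>x. x \<in> K \<Longrightarrow> poly_form K x"
  shows "closed_form K"
proof -
  have fK: "finite K" using K by (metis card.infinite not_numeral_le_zero)
  define M where "M = card K - 3"
  have "\<exists>R. hpoly K M R \<and> (\<forall>\<mu>. \<mu> x = 0 \<longrightarrow> R \<mu> = kappa M * psi_poly K M \<mu>) \<and>
     (\<forall>lam. (\<forall>i\<in>K. lam i > 0) \<longrightarrow> closed_Z K lam = (\<Prod>i\<in>K. 1 / lam i) * R (\<lambda>i. 1 / lam i))"
    if x: "x \<in> K" for x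
  proof -
    obtain Q where Q: "hpoly K M Q" "\<And>\<mu>. \<mu> x = 0 \<Longrightarrow> Q \<mu> = kappa M * psi_poly (K - {x}) M \<mu>"
      "\<And>lam. (\<forall>i\<in>K. lam i > 0) \<Longrightarrow> (\<forall>j\<in>K - {x}. lam j \<noteq> lam x) \<Longrightarrow>
        marked_Z K x lam = (1 / lam x)\<^sup>2 * (\<Prod>i\<in>K - {x}. 1 / lam i) * Q (\<lambda>i. 1 / lam i)"
      using pf[OF x] unfolding poly_form_def M_def by blast
    obtain R where R: "hpoly K M R" "\<And>\<mu>. \<mu> x = 0 \<Longrightarrow> R \<mu> = Q \<mu>"
      "\<And>\<mu> t. t > 0 \<Longrightarrow> ((\<lambda>t. 1 / t * R (\<mu>(x := 1 / t))) has_real_derivative - ((1 / t)\<^sup>2 * Q (\<mu>(x := 1 / t)))) (at t)"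
      using hpoly_integrate[OF Q(1) fK x] by blast
    show ?thesis
    proof (intro exI[of _ R] conjI allI impI R(1))
      fix \<mu> :: "_ \<Rightarrow> real" assume \<mu>: "\<mu> x = 0"
      show "R \<mu> = kappa M * psi_poly K M \<mu>"
        using R(2)[of \<mu>, OF \<mu>] Q(2)[of \<mu>, OF \<mu>] psi_poly_zero[of K x \<mu> M] fK x \<mu> by simp
    next
      fix lam :: "_ \<Rightarrow> real" assume pos: "\<forall>i\<in>K. lam i > 0"
      define \<mu> where "\<mu> = (\<lambda>i. 1 / lam i)"
      define P where "P = (\<Prod>i\<in>K - {x}. 1 / lam i)"
      define f where "f t = closed_Z K (lam(x := t)) - P * (1 / t * R (\<mu>(x := 1 / t)))" for t
      have lx: "lam x > 0" using pos x by simp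
      have df: "(f has_real_derivative - marked_Z K x (lam(x := t)) - P * - ((1 / t)\<^sup>2 * Q (\<mu>(x := 1 / t)))) (at t)"
        if t: "t > 0" for t
        unfolding f_def by (intro DERIV_diff DERIV_cmult R(3)[of t \<mu>, OF t] closed_Z_deriv) (use pos t in auto)
      \<comment> \<open>The loop equation says nothing at the finitely many values
        \<open>t = lam j\<close>. There the continuity of \<open>f\<close> is enough, as the
        constancy argument below tolerates a finite exceptional set.\<close>
      have d0: "(f has_derivative (\<lambda>h. 0)) (at t within {0<..})" if t: "t \<in> {0<..} - lam ` (K - {x})" for t
      proof -
        have "marked_Z K x (lam(x := t)) = (1 / (lam(x := t)) x)\<^sup>2 * (\<Prod>i\<in>K - {x}. 1 / (lam(x := t)) i) * Q (\<lambda>i. 1 / (lam(x := t)) i)"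
          by (rule Q(3)) (use pos t in auto)
        also have "(\<Prod>i\<in>K - {x}. 1 / (lam(x := t)) i) = P" unfolding P_def by (rule prod.cong) auto
        also have "(\<lambda>i. 1 / (lam(x := t)) i) = \<mu>(x := 1 / t)" by (auto simp: \<mu>_def)
        finally have "- marked_Z K x (lam(x := t)) - P * - ((1 / t)\<^sup>2 * Q (\<mu>(x := 1 / t))) = 0" by (simp del: fun_upd_apply add: fun_upd_same)
        then have "(f has_real_derivative 0) (at t)" using df[of t] t by simp
        then have "(f has_derivative (\<lambda>h. h * 0)) (at t within {0<..})"
          by (metis has_field_derivative_def has_derivative_at_withinI mult_commute_abs)
        then show ?thesis by simp
      qed
      have cf: "continuous_on {0<..} f"
        by (rule DERIV_continuous_on[where D = "\<lambda>t. - marked_Z K x (lam(x := t)) - P * - ((1 / t)\<^sup>2 * Q (\<mu>(x := 1 / t)))"])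
           (use df has_field_derivative_at_within in fastforce)
      have const: "f t = f (lam x)" if "t \<in> {0<..}" for t
      proof (rule has_derivative_zero_unique_strong_convex[of "{0<..}" "lam ` (K - {x})" f "lam x"])
        show "convex {0::real<..}" by (rule convex_real_interval)
        show "finite (lam ` (K - {x}))" "lam x \<in> {0<..}" using fK lx by auto
      qed (use cf d0 that in auto)
      have l1: "((\<lambda>t. closed_Z K (lam(x := t))) \<longlongrightarrow> 0) at_top"
        by (rule closed_Z_tendsto_0) (use pos x in auto)
      have it: "((\<lambda>t::real. 1 / t) \<longlongrightarrow> 0) at_top"
        using tendsto_inverse_0_at_top[OF filterlim_ident] by (simp add: inverse_eq_divide)
      have "((\<lambda>t. R (\<mu>(x := 1 / t))) \<longlongrightarrow> R (\<mu>(x := 0))) at_top"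
        by (rule hpoly_continuous[OF R(1)]) (use it in auto)
      from tendsto_diff[OF l1 tendsto_mult[OF tendsto_const[of P] tendsto_mult[OF it this]]]
      have "(f \<longlongrightarrow> 0) at_top" unfolding f_def by simp
      moreover have "(f \<longlongrightarrow> f (lam x)) at_top"
        by (rule tendsto_eventually, rule eventually_mono[OF eventually_gt_at_top[of 0]]) (use const in auto)
      ultimately have "f (lam x) = 0" using tendsto_unique trivial_limit_at_top_linorder by blast
      moreover have "lam(x := lam x) = lam" "\<mu>(x := 1 / lam x) = \<mu>" by (auto simp: \<mu>_def)
      moreover have "(\<Prod>i\<in>K. 1 / lam i) = 1 / lam x * P" unfolding P_def using fK x by (simp add: prod.remove)
      ultimately show "closed_Z K lam = (\<Prod>i\<in>K. 1 / lam i) * R (\<lambda>i. 1 / lam i)"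
        unfolding f_def by (simp add: \<mu>_def)
    qed
  qed
  then obtain R where R: "\<And>x. x \<in> K \<Longrightarrow> hpoly K M (R x)"
    "\<And>x \<mu>. x \<in> K \<Longrightarrow> \<mu> x = 0 \<Longrightarrow> R x \<mu> = kappa M * psi_poly K M \<mu>"
    "\<And>x lam. x \<in> K \<Longrightarrow> (\<forall>i\<in>K. lam i > 0) \<Longrightarrow> closed_Z K lam = (\<Prod>i\<in>K. 1 / lam i) * R x (\<lambda>i. 1 / lam i)"
    by metis
  \<comment> \<open>Each \<open>R x\<close> is known only on its own hyperplane
    \<open>\<mu> x = 0\<close>, but all of them represent the same function at positive arguments.
    In the limit, any one of them has the prescribed values on every coordinate hyperplane.\<close>
  have agree: "R x \<mu> = R y \<mu>" if "x \<in> K" "y \<in> K" "\<forall>i\<in>K. \<mu> i > 0" for x y \<mu>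
  proof -
    have "(\<Prod>i\<in>K. 1 / (1 / \<mu> i)) * R x (\<lambda>i. 1 / (1 / \<mu> i)) = (\<Prod>i\<in>K. 1 / (1 / \<mu> i)) * R y (\<lambda>i. 1 / (1 / \<mu> i))"
      using R(3)[of x "\<lambda>i. 1 / \<mu> i"] R(3)[of y "\<lambda>i. 1 / \<mu> i"] that by (metis zero_less_divide_1_iff)
    moreover have "(\<Prod>i\<in>K. \<mu> i) \<noteq> 0" using that(3) fK by (auto simp: prod_zero_iff)
    ultimately show ?thesis by simp
  qed
  have "K \<noteq> {}" using K by auto
  then obtain x0 where x0: "x0 \<in> K" by auto
  have eq: "R x0 \<mu> - kappa M * psi_poly K M \<mu> = 0" if \<mu>: "\<And>i. i \<in> K \<Longrightarrow> \<mu> i > 0" for \<mu>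
  proof (rule hpoly_vanish[OF fK _ hpoly_diff[OF R(1)[OF x0] hpoly_scale[OF hpoly_psi_poly[OF fK]]] _ \<mu>])
    show "M < card K" using K by (simp add: M_def)
    fix \<nu> :: "_ \<Rightarrow> real" and x assume x: "x \<in> K" and pos: "\<And>i. i \<in> K - {x} \<Longrightarrow> \<nu> i > 0" and z: "\<nu> x = 0"
    have lim: "((\<lambda>s. R y (\<nu>(x := s))) \<longlongrightarrow> R y (\<nu>(x := 0))) (at_right 0)" if "y \<in> K" for y
      by (rule hpoly_continuous[OF R(1)[OF that]]) (auto intro!: tendsto_eq_intros)
    have "eventually (\<lambda>s. R x0 (\<nu>(x := s)) = R x (\<nu>(x := s))) (at_right 0)"
      using eventually_at_right_less[of 0]
      by eventually_elim (rule agree[OF x0 x], use pos in auto)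
    then have "((\<lambda>s. R x (\<nu>(x := s))) \<longlongrightarrow> R x0 (\<nu>(x := 0))) (at_right 0)"
      using lim[OF x0] by (rule Lim_transform_eventually[rotated])
    then have "R x0 (\<nu>(x := 0)) = R x (\<nu>(x := 0))"
      using lim[OF x] tendsto_unique trivial_limit_at_right_real by blast
    moreover have "\<nu>(x := 0) = \<nu>" using z by auto
    ultimately show "R x0 \<nu> - kappa M * psi_poly K M \<nu> = 0" using R(2)[OF x, of \<nu>] z by simp
  qed
  show ?thesis unfolding closed_form_def M_def[symmetric]
  proof (intro allI impI)
    fix lam :: "_ \<Rightarrow> real" assume pos: "\<forall>i\<in>K. lam i > 0"
    have "R x0 (\<lambda>i. 1 / lam i) = kappa M * psi_poly K M (\<lambda>i. 1 / lam i)"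
      using eq[of "\<lambda>i. 1 / lam i"] pos by simp
    then show "closed_Z K lam = (\<Prod>i\<in>K. 1 / lam i) * (kappa M * psi_poly K M (\<lambda>i. 1 / lam i))"
      using R(3)[OF x0 pos] by simp
  qed
qed

theorem closed_Z_eq: "card K \<ge> 3 \<Longrightarrow> closed_form K"
proof (induction "card K" arbitrary: K rule: less_induct)
  case less
  have "poly_form K x" if "x \<in> K" for x
  proof (cases "card K = 3")
    case True
    then show ?thesis by (rule poly_form_three[OF _ that])
  next
    case False
    then have "card K \<ge> 4" using less.prems by simp
    then show ?thesis by (rule poly_form_step[OF _ that less.hyps])
  qed
  then show ?case by (rule closed_form_of_poly_form[OF less.prems])
qed

section \<open>Strebel graphs as trivalent maps\<close>

lemma orbit_least: "f x \<in> A \<Longrightarrow> (\<And>y. y \<in> A \<Longrightarrow> f y \<in> A) \<Longrightarrow> orbit f x \<subseteq> A"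
proof
  fix z assume "f x \<in> A" "\<And>y. y \<in> A \<Longrightarrow> f y \<in> A" "z \<in> orbit f x"
  from this(3,1,2) show "z \<in> A" by (induction rule: orbit.induct) auto
qed

lemma orbit_involution:
  assumes "f (f x) = x" shows "orbit f x = {x, f x}"
proof
  show "orbit f x \<subseteq> {x, f x}" by (rule orbit_least) (use assms in auto)
  show "{x, f x} \<subseteq> orbit f x" using orbit.base[of f x] orbit.step[OF orbit.base[of f x]] assms by auto
qed

lemma orbit_order_three:
  assumes "f (f (f x)) = x" shows "orbit f x = {x, f x, f (f x)}"
proof
  show "orbit f x \<subseteq> {x, f x, f (f x)}" by (rule orbit_least) (use assms in auto)
  have "f x \<in> orbit f x" "f (f x) \<in> orbit f x" "f (f (f x)) \<in> orbit f x" by (intro orbit.intros)+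
  then show "{x, f x, f (f x)} \<subseteq> orbit f x" using assms by simp
qed

lemma card_orbit_two:
  assumes p: "f permutes D" "finite D" and c: "card (orbit f x) = 2"
  shows "f (f x) = x" "f x \<noteq> x"
proof -
  have self: "x \<in> orbit f x" by (rule permutation_self_in_orbit) (use p in \<open>auto simp: permutation_permutes\<close>)
  show ne: "f x \<noteq> x"
  proof
    assume "f x = x"
    then have "orbit f x = {x, x}" using orbit_involution[of f x] by simp
    then show False using c by simp
  qed
  have in2: "f x \<in> orbit f x" "f (f x) \<in> orbit f x" by (intro orbit.intros)+
  have fin: "finite (orbit f x)" using c card.infinite by fastforce
  have "{x, f x} = orbit f x" by (rule card_subset_eq[OF fin]) (use self in2 ne c in auto)
  then show "f (f x) = x" using in2 ne permutes_inj[OF p(1)] by (auto dest: injD)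
qed

lemma card_orbit_three:
  assumes p: "f permutes D" "finite D" and c: "card (orbit f x) = 3"
  shows "f (f (f x)) = x" "f x \<noteq> x"
proof -
  have self: "x \<in> orbit f x" by (rule permutation_self_in_orbit) (use p in \<open>auto simp: permutation_permutes\<close>)
  have inj: "f a = f b \<longleftrightarrow> a = b" for a b using permutes_inj[OF p(1)] by (auto dest: injD)
  have ne2: "f (f x) \<noteq> x"
  proof
    assume "f (f x) = x"
    then have "orbit f x = {x, f x}" by (rule orbit_involution)
    then have "card (orbit f x) \<le> 2" by (simp add: card_insert_if)
    then show False using c by simp
  qed
  show ne: "f x \<noteq> x" using ne2 by metis
  have in3: "f x \<in> orbit f x" "f (f x) \<in> orbit f x" "f (f (f x)) \<in> orbit f x" by (intro orbit.intros)+
  have fin: "finite (orbit f x)" using c card.infinite by fastforce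
  have "{x, f x, f (f x)} = orbit f x" by (rule card_subset_eq[OF fin]) (use self in3 ne ne2 c inj in auto)
  then show "f (f (f x)) = x" using in3 ne ne2 inj by auto
qed

lemma orbit_eq_iff:
  assumes "f permutes D" "finite D"
  shows "orbit f x = orbit f y \<longleftrightarrow> y \<in> orbit f x"
proof
  have pf: "permutation f" using assms by (auto simp: permutation_permutes)
  show "orbit f x = orbit f y \<Longrightarrow> y \<in> orbit f x" using permutation_self_in_orbit[OF pf, of y] by simp
  show "y \<in> orbit f x \<Longrightarrow> orbit f x = orbit f y"
    using orbit_cyclic_eq3[OF cyclic_on_orbit[OF assms]] by metis
qed

lemma card_cycles_of:
  assumes p: "f permutes D" "finite D" and c: "\<And>x. x \<in> D \<Longrightarrow> card (orbit f x) = k"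
  shows "k * card (cycles_of D f) = card D"
proof -
  have pf: "permutation f" using p by (auto simp: permutation_permutes)
  have sub: "orbit f x \<subseteq> D" if "x \<in> D" for x
    by (rule orbit_least) (use that permutes_in_image[OF p(1)] in auto)
  have "\<Union> (orbit f ` D) = D" using sub permutation_self_in_orbit[OF pf] by auto
  moreover have "k * card (orbit f ` D) = card (\<Union> (orbit f ` D))"
  proof (rule card_partition)
    show "finite (orbit f ` D)" "finite (\<Union> (orbit f ` D))" using p(2) sub by (auto intro: finite_subset)
    show "card c = k" if "c \<in> orbit f ` D" for c using that assms(3) by auto
    fix a b assume "a \<in> orbit f ` D" "b \<in> orbit f ` D" "a \<noteq> b"
    then show "a \<inter> b = {}" using orbit_eq_iff[OF p] by blast
  qed
  ultimately show ?thesis by (simp add: cycles_of_def)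
qed

lemma card_image_same_fibres:
  assumes "finite D" "\<And>x y. x \<in> D \<Longrightarrow> y \<in> D \<Longrightarrow> f x = f y \<longleftrightarrow> g x = g y"
  shows "card (f ` D) = card (g ` D)"
proof -
  have le: "card (f ` D) \<le> card (g ` D)"
    if e: "\<And>x y. x \<in> D \<Longrightarrow> y \<in> D \<Longrightarrow> g x = g y \<Longrightarrow> f x = f y" for f :: "_ \<Rightarrow> 'x" and g :: "_ \<Rightarrow> 'y"
  proof -
    have "f ` D \<subseteq> (\<lambda>z. f (inv_into D g z)) ` g ` D"
    proof
      fix z assume "z \<in> f ` D"
      then obtain x where x: "x \<in> D" "z = f x" by auto
      have "f (inv_into D g (g x)) = f x"
        by (rule e) (use x in \<open>auto intro: inv_into_into f_inv_into_f\<close>)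
      then show "z \<in> (\<lambda>z. f (inv_into D g z)) ` g ` D" using x by (auto simp: image_iff intro!: bexI[of _ x])
    qed
    then show ?thesis by (rule surj_card_le[rotated]) (use assms(1) in auto)
  qed
  show ?thesis by (rule antisym; rule le) (use assms(2) in auto)
qed

lemma planar_trivalent_map_imp_cubic_map:
  assumes "planar_trivalent_map D \<sigma> \<alpha>" shows "cubic_map D {} \<sigma> \<alpha>"
proof (rule cubic_mapI)
  note P = assms[unfolded planar_trivalent_map_def]
  have p: "finite D" "\<sigma> permutes D" "\<alpha> permutes D" using P by auto
  have a: "\<alpha> (\<alpha> d) = d" "\<alpha> d \<noteq> d" if "d \<in> D" for d
    using card_orbit_two[OF p(3,1), of d] P that unfolding cycles_of_def by auto
  have s: "\<sigma> (\<sigma> (\<sigma> d)) = d" "\<sigma> d \<noteq> d" if "d \<in> D" for d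
    using card_orbit_three[OF p(2,1), of d] P that unfolding cycles_of_def by auto
  show "finite D" "{} \<subseteq> D" using p by auto
  show "\<alpha> (\<alpha> d) = d" "\<alpha> d \<noteq> d \<longleftrightarrow> d \<in> D" "\<sigma> (\<sigma> (\<sigma> d)) = d" "\<sigma> d \<noteq> d \<longleftrightarrow> d \<in> D - {}" for d
    using a[of d] s[of d] permutes_not_in[OF p(2), of d] permutes_not_in[OF p(3), of d] by (cases "d \<in> D"; simp)+
  fix A assume A: "A \<subseteq> D" "A \<noteq> {}" "\<And>d. d \<in> A \<Longrightarrow> \<sigma> d \<in> A \<and> \<alpha> d \<in> A"
  then obtain d where d: "d \<in> A" by auto
  have "d' \<in> A" if "d' \<in> D" for d'
  proof -
    have "(d, d') \<in> (range (\<lambda>x. (x, \<sigma> x)) \<union> range (\<lambda>x. (x, \<alpha> x)))\<^sup>*" using P d A(1) that by auto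
    then show ?thesis by (induction rule: rtrancl_induct) (use d A(3) in auto)
  qed
  then show "A = D" using A(1) by auto
qed

lemma face_labelling_iff_face_lab:
  assumes C: "cubic D {} \<sigma> \<alpha>"
  shows "face_labelling D \<sigma> \<alpha> k lab \<longleftrightarrow> face_lab D (\<sigma> \<circ> \<alpha>) {1..k} lab"
proof -
  define \<phi> where "\<phi> = \<sigma> \<circ> \<alpha>"
  have p: "\<phi> permutes D" unfolding \<phi>_def by (intro permutes_compose cubic_permutes[OF C])
  have fD: "finite D" using cubicD(1)[OF C] .
  have self: "x \<in> orbit \<phi> x" for x
    by (rule permutation_self_in_orbit) (use p fD in \<open>auto simp: permutation_permutes\<close>)
  have sub: "orbit \<phi> x \<subseteq> D" if "x \<in> D" for x
    by (rule orbit_least) (use that permutes_in_image[OF p] in auto)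
  have "face_lab D \<phi> {1..k} lab" if "face_labelling D \<sigma> \<alpha> k lab"
  proof (rule face_labI)
    note F = that[unfolded face_labelling_def, folded \<phi>_def]
    show "lab \<in> extensional D" "lab ` D = {1..k}" using F by (auto simp: PiE_def)
    fix d assume d: "d \<in> D"
    have "lab d = lab (\<phi> d)" using F d permutes_in_image[OF p, of d] orbit.base[of \<phi> d] by blast
    then show "lab (\<phi> d) = lab d" by simp
  next
    note F = that[unfolded face_labelling_def, folded \<phi>_def]
    fix A d d' assume A: "A \<subseteq> D" "\<And>x. x \<in> A \<Longrightarrow> \<phi> x \<in> A" "d \<in> A" "d' \<in> D" "lab d' = lab d"
    then have "d' \<in> orbit \<phi> d" using F by force
    moreover have "orbit \<phi> d \<subseteq> A" by (rule orbit_least) (use A in auto)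
    ultimately show "d' \<in> A" by auto
  qed
  moreover have "face_labelling D \<sigma> \<alpha> k lab" if F: "face_lab D \<phi> {1..k} lab"
    unfolding face_labelling_def \<phi>_def[symmetric]
  proof (intro conjI ballI)
    show "lab \<in> D \<rightarrow>\<^sub>E {1..k}" "lab ` D = {1..k}" using face_labD[OF F] by auto
    fix d d' assume d: "d \<in> D" "d' \<in> D"
    have 1: "d' \<in> orbit \<phi> d" if "lab d = lab d'"
      by (rule face_labD(5)[OF F sub[OF d(1)] orbit.step self d(2)]) (use that in auto)
    have "lab y = lab d \<and> y \<in> D" if "y \<in> orbit \<phi> d" for y
      using that by (induction rule: orbit.induct) (use face_labD(4)[OF F] d permutes_in_image[OF p] in auto)
    then show "lab d = lab d' \<longleftrightarrow> d' \<in> orbit \<phi> d" using 1 by auto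
  qed
  ultimately show ?thesis unfolding \<phi>_def by blast
qed

lemma cycles_of_edges:
  assumes "cubic D U \<sigma> \<alpha>" shows "cycles_of D \<alpha> = (\<lambda>d. {d, \<alpha> d}) ` D"
  unfolding cycles_of_def by (rule image_cong[OF refl], rule orbit_involution) (rule cubicD(3)[OF assms])

text \<open>With \<open>6 * M + 6\<close> darts there are \<open>2 * M + 2\<close> vertices and
  \<open>3 * M + 3\<close> edges, and a labelling by \<open>M + 3\<close> labels fixes the number of
  faces. Euler's formula is thus automatic for the maps on the right.\<close>

theorem strebel_graphs_eq: "strebel_graphs M = closed_maps {..<6 * M + 6} {1..M + 3}"
proof -
  let ?D = "{..<6 * M + 6}"
  have "planar_trivalent_map ?D \<sigma> \<alpha> \<and> face_labelling ?D \<sigma> \<alpha> (M + 3) lab \<longleftrightarrow>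
     cubic_map ?D {} \<sigma> \<alpha> \<and> face_lab ?D (\<sigma> \<circ> \<alpha>) {1..M + 3} lab" (is "?l \<longleftrightarrow> ?r") for \<sigma> \<alpha> lab
  proof
    assume ?l
    then show ?r using planar_trivalent_map_imp_cubic_map face_labelling_iff_face_lab cubic_map_cubic by metis
  next
    assume r: ?r
    note C = cubic_map_cubic[OF conjunct1[OF r]]
    have F: "face_labelling ?D \<sigma> \<alpha> (M + 3) lab" using r face_labelling_iff_face_lab[OF C] by blast
    note pm = cubic_permutes[OF C]
    have oa: "card (orbit \<alpha> d) = 2" if "d \<in> ?D" for d
      using cubicD(4)[OF C, of d] that by (simp add: orbit_involution[of \<alpha> d, OF cubicD(3)[OF C]])
    have os: "card (orbit \<sigma> d) = 3" if "d \<in> ?D" for d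
    proof -
      have "\<sigma> d \<noteq> d" "\<sigma> (\<sigma> d) \<noteq> d" "\<sigma> (\<sigma> d) \<noteq> \<sigma> d"
        using cubicD(5,6)[OF C, of d] cubicD(5,6)[OF C, of "\<sigma> d"] that permutes_in_image[OF pm(1), of d] by auto
      then show ?thesis by (simp add: orbit_order_three[of \<sigma> d, OF cubicD(5)[OF C]])
    qed
    have "card (cycles_of ?D (\<sigma> \<circ> \<alpha>)) = card (lab ` ?D)" unfolding cycles_of_def
    proof (rule card_image_same_fibres)
      fix x y assume xy: "x \<in> ?D" "y \<in> ?D"
      have "orbit (\<sigma> \<circ> \<alpha>) x = orbit (\<sigma> \<circ> \<alpha>) y \<longleftrightarrow> y \<in> orbit (\<sigma> \<circ> \<alpha>) x"
        by (rule orbit_eq_iff[OF permutes_compose[OF pm(2,1)]]) simp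
      then show "orbit (\<sigma> \<circ> \<alpha>) x = orbit (\<sigma> \<circ> \<alpha>) y \<longleftrightarrow> lab x = lab y"
        using F xy unfolding face_labelling_def by simp
    qed simp
    then have f: "card (cycles_of ?D (\<sigma> \<circ> \<alpha>)) = M + 3" using F unfolding face_labelling_def by simp
    have v: "3 * card (cycles_of ?D \<sigma>) = 6 * M + 6" using card_cycles_of[OF pm(1) _ os] by simp
    have e: "2 * card (cycles_of ?D \<alpha>) = 6 * M + 6" using card_cycles_of[OF pm(2) _ oa] by simp
    have "planar_trivalent_map ?D \<sigma> \<alpha>" unfolding planar_trivalent_map_def
    proof (intro conjI ballI)
      show "\<sigma> permutes ?D" "\<alpha> permutes ?D" using pm .
      show "card c = 3" if "c \<in> cycles_of ?D \<sigma>" for c using that os by (auto simp: cycles_of_def)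
      show "card c = 2" if "c \<in> cycles_of ?D \<alpha>" for c using that oa by (auto simp: cycles_of_def)
      show "int (card (cycles_of ?D \<sigma>)) - int (card (cycles_of ?D \<alpha>)) + int (card (cycles_of ?D (\<sigma> \<circ> \<alpha>))) = 2"
        using f v e by linarith
      fix d d' assume d: "d \<in> ?D" "d' \<in> ?D"
      let ?R = "(range (\<lambda>x. (x, \<sigma> x)) \<union> range (\<lambda>x. (x, \<alpha> x)))\<^sup>*"
      have "{y \<in> ?D. (d, y) \<in> ?R} = ?D"
      proof (rule cubic_mapD(7)[OF conjunct1[OF r]])
        show "{y \<in> ?D. (d, y) \<in> ?R} \<noteq> {}" using d by auto
        fix y assume "y \<in> {y \<in> ?D. (d, y) \<in> ?R}"
        then show "\<sigma> y \<in> {y \<in> ?D. (d, y) \<in> ?R} \<and> \<alpha> y \<in> {y \<in> ?D. (d, y) \<in> ?R}"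
          using permutes_in_image[OF pm(1), of y] permutes_in_image[OF pm(2), of y]
          by (auto intro: rtrancl_into_rtrancl)
      qed auto
      then show "(d, d') \<in> ?R" using d(2) by blast
    qed simp
    then show ?l using F by blast
  qed
  then show ?thesis unfolding strebel_graphs_def closed_maps_def by simp
qed

theorem strebel_edge_sum:
  assumes "\<And>i. i \<in> {1..M + 3} \<Longrightarrow> lam i > 0"
  shows "(\<Sum>(\<sigma>, \<alpha>, lab)\<in>strebel_graphs M. edge_wt {..<6 * M + 6} \<alpha> (\<lambda>d. lam (lab d))) / fact (6 * M + 6) =
    (\<Prod>i\<in>{1..M + 3}. 1 / lam i) * (kappa M * psi_poly {1..M + 3} M (\<lambda>i. 1 / lam i))"
proof -
  have "closed_form {1..M + 3}" by (rule closed_Z_eq) simp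
  then have "closed_Z {1..M + 3} lam = (\<Prod>i\<in>{1..M + 3}. 1 / lam i) * (kappa M * psi_poly {1..M + 3} M (\<lambda>i. 1 / lam i))"
    using assms unfolding closed_form_def by simp
  moreover have "6 * card {1..M + 3} - 12 = 6 * M + 6" by simp
  ultimately show ?thesis unfolding closed_Z_def closed_sum_def strebel_graphs_eq by (simp only:)
qed

section \<open>Uniqueness of moments\<close>

text \<open>A finite family of signed densities \<open>g i\<close>, pushed forward to the unit
  interval by \<open>Z i\<close>. Several spaces are needed as each graph has its own space of edge
  lengths. The range of \<open>Z i\<close> is constrained only where \<open>g i\<close> does not
  vanish, because negative lengths belong to the space but not to the support.\<close>

definition moment_data :: "'i set \<Rightarrow> ('i \<Rightarrow> 'a measure) \<Rightarrow> ('i \<Rightarrow> 'a \<Rightarrow> real) \<Rightarrow> ('i \<Rightarrow> 'a \<Rightarrow> real) \<Rightarrow> bool" where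
  "moment_data I M Z g \<longleftrightarrow> finite I \<and> (\<forall>i\<in>I. integrable (M i) (g i) \<and> Z i \<in> borel_measurable (M i) \<and>
     (\<forall>x\<in>space (M i). g i x \<noteq> 0 \<longrightarrow> Z i x \<in> {0..1}))"

definition moment_functional ::
    "'i set \<Rightarrow> ('i \<Rightarrow> 'a measure) \<Rightarrow> ('i \<Rightarrow> 'a \<Rightarrow> real) \<Rightarrow> ('i \<Rightarrow> 'a \<Rightarrow> real) \<Rightarrow> (real \<Rightarrow> real) \<Rightarrow> real" where
  "moment_functional I M Z g h = (\<Sum>i\<in>I. \<integral>x. h (Z i x) * g i x \<partial>M i)"

lemma integrable_bounded_mult:
  fixes f g :: "'a \<Rightarrow> real"
  assumes g: "integrable M g" and f: "f \<in> borel_measurable M"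
    and C: "\<And>x. x \<in> space M \<Longrightarrow> g x \<noteq> 0 \<Longrightarrow> \<bar>f x\<bar> \<le> C"
  shows "integrable M (\<lambda>x. f x * g x)"
proof (rule Bochner_Integration.integrable_bound)
  show "integrable M (\<lambda>x. C * g x)" using g by simp
  show "(\<lambda>x. f x * g x) \<in> borel_measurable M" using f borel_measurable_integrable[OF g] by simp
  show "AE x in M. norm (f x * g x) \<le> norm (C * g x)"
  proof (rule AE_I2)
    fix x assume x: "x \<in> space M"
    show "norm (f x * g x) \<le> norm (C * g x)"
    proof (cases "g x = 0")
      case False
      then have "\<bar>f x\<bar> \<le> \<bar>C\<bar>" using C[OF x] by linarith
      then show ?thesis by (simp add: abs_mult mult_right_mono)
    qed simp
  qed
qed

lemma moment_functional_LIMSEQ: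
  assumes D: "moment_data I M Z g" and m: "\<And>m. h m \<in> borel_measurable borel" "h' \<in> borel_measurable borel"
    and C: "\<And>m z. z \<in> {0..1} \<Longrightarrow> \<bar>h m z\<bar> \<le> C"
    and lim: "\<And>z. z \<in> {0..1} \<Longrightarrow> (\<lambda>m. h m z) \<longlonglongrightarrow> h' z"
  shows "(\<lambda>m. moment_functional I M Z g (h m)) \<longlonglongrightarrow> moment_functional I M Z g h'"
  unfolding moment_functional_def
proof (rule tendsto_sum)
  fix i assume "i \<in> I"
  then have d: "integrable (M i) (g i)" "Z i \<in> borel_measurable (M i)"
    "\<And>x. x \<in> space (M i) \<Longrightarrow> g i x \<noteq> 0 \<Longrightarrow> Z i x \<in> {0..1}" using D by (auto simp: moment_data_def)
  note d(2) [measurable] m [measurable]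
  have gm[measurable]: "g i \<in> borel_measurable (M i)" using d(1) by simp
  show "(\<lambda>m. \<integral>x. h m (Z i x) * g i x \<partial>M i) \<longlonglongrightarrow> (\<integral>x. h' (Z i x) * g i x \<partial>M i)"
  proof (rule integral_dominated_convergence[where w = "\<lambda>x. C * \<bar>g i x\<bar>"])
    show "integrable (M i) (\<lambda>x. C * \<bar>g i x\<bar>)" using d(1) by simp
    show "AE x in M i. (\<lambda>m. h m (Z i x) * g i x) \<longlonglongrightarrow> h' (Z i x) * g i x"
    proof (rule AE_I2)
      fix x assume x: "x \<in> space (M i)"
      show "(\<lambda>m. h m (Z i x) * g i x) \<longlonglongrightarrow> h' (Z i x) * g i x"
        by (cases "g i x = 0") (use d(3)[OF x] in \<open>auto intro!: tendsto_mult_right lim\<close>)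
    qed
    show "AE x in M i. norm (h m (Z i x) * g i x) \<le> C * \<bar>g i x\<bar>" for m
    proof (rule AE_I2)
      fix x assume x: "x \<in> space (M i)"
      show "norm (h m (Z i x) * g i x) \<le> C * \<bar>g i x\<bar>"
        by (cases "g i x = 0") (use d(3)[OF x] in \<open>auto simp: abs_mult intro!: mult_right_mono C\<close>)
    qed
  qed simp_all
qed

lemma moment_functional_polynomial:
  assumes D: "moment_data I M Z g"
  shows "moment_functional I M Z g (\<lambda>z. \<Sum>k\<le>n. a k * z ^ k) = (\<Sum>k\<le>n. a k * moment_functional I M Z g (\<lambda>z. z ^ k))"
proof -
  have "(\<integral>x. (\<Sum>k\<le>n. a k * Z i x ^ k) * g i x \<partial>M i) = (\<Sum>k\<le>n. a k * (\<integral>x. Z i x ^ k * g i x \<partial>M i))" if "i \<in> I" for i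
  proof -
    have d: "integrable (M i) (g i)" "Z i \<in> borel_measurable (M i)"
      "\<And>x. x \<in> space (M i) \<Longrightarrow> g i x \<noteq> 0 \<Longrightarrow> Z i x \<in> {0..1}" using D that by (auto simp: moment_data_def)
    have int: "integrable (M i) (\<lambda>x. Z i x ^ k * g i x)" for k
      by (rule integrable_bounded_mult[where C = 1]) (use d in \<open>auto simp: power_le_one power_abs\<close>)
    have "(\<integral>x. (\<Sum>k\<le>n. a k * Z i x ^ k) * g i x \<partial>M i) = (\<integral>x. (\<Sum>k\<le>n. a k * (Z i x ^ k * g i x)) \<partial>M i)"
      by (simp add: sum_distrib_right mult.assoc)
    also have "\<dots> = (\<Sum>k\<le>n. a k * (\<integral>x. Z i x ^ k * g i x \<partial>M i))" using int by (simp add: Bochner_Integration.integral_sum)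
    finally show ?thesis .
  qed
  then have "moment_functional I M Z g (\<lambda>z. \<Sum>k\<le>n. a k * z ^ k) = (\<Sum>i\<in>I. \<Sum>k\<le>n. a k * (\<integral>x. Z i x ^ k * g i x \<partial>M i))"
    unfolding moment_functional_def by (intro sum.cong) auto
  also have "\<dots> = (\<Sum>k\<le>n. a k * moment_functional I M Z g (\<lambda>z. z ^ k))"
    unfolding moment_functional_def sum_distrib_left by (rule sum.swap)
  finally show ?thesis .
qed

text \<open>Equal moments give equal values on polynomials, and by Weierstrass these approximate
  \<open>h\<close> uniformly on the unit interval; dominated convergence passes to the
  limit.\<close>

lemma moment_functional_continuous_unique:
  assumes D: "moment_data I M Z g" "moment_data J N Y f"
    and eq: "\<And>n. moment_functional I M Z g (\<lambda>z. z ^ n) = moment_functional J N Y f (\<lambda>z. z ^ n)"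
    and h: "continuous_on UNIV (h :: real \<Rightarrow> real)"
  shows "moment_functional I M Z g h = moment_functional J N Y f h"
proof -
  have "\<exists>p. real_polynomial_function p \<and> (\<forall>z\<in>{0..1::real}. \<bar>h z - p z\<bar> < 1 / real (Suc m))" for m
    using Stone_Weierstrass_real_polynomial_function[of "{0..1::real}" h "1 / real (Suc m)"] continuous_on_subset[OF h]
    by (metis compact_Icc of_nat_0_less_iff subset_UNIV zero_less_Suc zero_less_divide_1_iff)
  then obtain p where p: "\<And>m. real_polynomial_function (p m)" "\<And>m z. z \<in> {0..1::real} \<Longrightarrow> \<bar>h z - p m z\<bar> < 1 / real (Suc m)"
    by metis
  obtain B where B: "\<And>z. z \<in> {0..1} \<Longrightarrow> \<bar>h z\<bar> \<le> B"
  proof -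
    have "compact (h ` {0..1})" by (intro compact_continuous_image continuous_on_subset[OF h]) auto
    then have "bounded (h ` {0..1})" by (rule compact_imp_bounded)
    then obtain c where "\<forall>x\<in>h ` {0..1}. norm x \<le> c" unfolding bounded_iff by blast
    then show ?thesis by (intro that[of c]) auto
  qed
  have peq: "moment_functional I M Z g (p m) = moment_functional J N Y f (p m)" for m
  proof -
    obtain a n where "p m = (\<lambda>z. \<Sum>k\<le>n. a k * z ^ k)" using p(1)[of m] unfolding real_polynomial_function_iff_sum by blast
    then show ?thesis using eq by (simp add: moment_functional_polynomial[OF D(1)] moment_functional_polynomial[OF D(2)])
  qed
  have bound: "\<bar>p m z\<bar> \<le> B + 1" if "z \<in> {0..1}" for m z
  proof -
    have "1 / real (Suc m) \<le> 1" by simp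
    then show ?thesis using p(2)[OF that, of m] B[OF that] by linarith
  qed
  have lim: "(\<lambda>m. p m z) \<longlonglongrightarrow> h z" if "z \<in> {0..1}" for z
  proof (rule LIM_zero_cancel, rule Lim_null_comparison)
    show "\<forall>\<^sub>F m in sequentially. norm (p m z - h z) \<le> 1 / real (Suc m)"
      using p(2)[OF that] by (intro always_eventually allI) (metis abs_minus_commute less_imp_le real_norm_def)
    show "(\<lambda>m. 1 / real (Suc m)) \<longlonglongrightarrow> 0"
      using LIMSEQ_inverse_real_of_nat by (simp add: inverse_eq_divide)
  qed
  have meas: "p m \<in> borel_measurable borel" for m
    using p(1) by (intro borel_measurable_continuous_onI) (simp add: continuous_on_polymonial_function real_polynomial_function_eq)
  have hm: "h \<in> borel_measurable borel" using h by (rule borel_measurable_continuous_onI)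
  have "(\<lambda>m. moment_functional I M Z g (p m)) \<longlonglongrightarrow> moment_functional I M Z g h"
    by (rule moment_functional_LIMSEQ[OF D(1) meas hm bound lim])
  moreover have "(\<lambda>m. moment_functional I M Z g (p m)) \<longlonglongrightarrow> moment_functional J N Y f h"
    unfolding peq by (rule moment_functional_LIMSEQ[OF D(2) meas hm bound lim])
  ultimately show ?thesis by (rule LIMSEQ_unique)
qed

text \<open>The factor \<open>1 / z\<close> cancels a weight \<open>exp (- p)\<close> when \<open>z = exp (- p)\<close>.\<close>

definition recip_box :: "real \<Rightarrow> real \<Rightarrow> real \<Rightarrow> real" where
  "recip_box a b z = (if a < z \<and> z < b then 1 / z else 0)"

lemma recip_box_measurable [measurable]: "recip_box a b \<in> borel_measurable borel"
  unfolding recip_box_def by measurable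

text \<open>Indicators of open intervals are bounded pointwise limits of continuous functions. The
  lower end \<open>a\<close> has to be positive to bound the factor \<open>1 / z\<close>.\<close>

lemma moment_functional_box_unique:
  assumes D: "moment_data I M Z g" "moment_data J N Y f"
    and eq: "\<And>n. moment_functional I M Z g (\<lambda>z. z ^ n) = moment_functional J N Y f (\<lambda>z. z ^ n)"
    and a: "0 < a"
  shows "moment_functional I M Z g (recip_box a b) = moment_functional J N Y f (recip_box a b)"
proof -
  \<comment> \<open>Trapezoids of increasing slope that vanish outside the interval. In the
    denominator \<open>max z a\<close> equals \<open>z\<close> inside the interval and keeps the
    function continuous on the whole line.\<close>
  define h where "h m z = min 1 (real m * max 0 (min (z - a) (b - z))) / max z a" for m z
  have cont: "continuous_on UNIV (h m)" for m
    unfolding h_def using a by (intro continuous_intros) (auto simp: max_def)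
  have bound: "\<bar>h m z\<bar> \<le> 1 / a" for m z
    unfolding h_def using a by (auto simp: abs_mult max_def min_def intro!: frac_le)
  have lim: "(\<lambda>m. h m z) \<longlonglongrightarrow> recip_box a b z" for z
  proof (cases "a < z \<and> z < b")
    case True
    define c where "c = min (z - a) (b - z)"
    have c: "c > 0" using True by (simp add: c_def)
    obtain m0 :: nat where m0: "1 / c < m0" using reals_Archimedean2 by blast
    have "\<forall>\<^sub>F m in sequentially. h m z = recip_box a b z"
      using eventually_ge_at_top[of m0]
    proof eventually_elim
      case (elim m)
      have "1 < real m0 * c" using m0 c by (simp add: field_simps)
      also have "\<dots> \<le> real m * c" using elim c by simp
      finally have "1 \<le> real m * c" by simp
      then have "min 1 (real m * max 0 c) = 1" using c by simp
      then show ?case using True unfolding h_def recip_box_def c_def by simp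
    qed
    then show ?thesis by (rule tendsto_eventually)
  next
    case False
    then have "h m z = 0" for m unfolding h_def by (auto simp: max_def min_def)
    moreover have "recip_box a b z = 0" using False by (auto simp: recip_box_def)
    ultimately show ?thesis by simp
  qed
  have meas: "h m \<in> borel_measurable borel" for m using cont by (rule borel_measurable_continuous_onI)
  note heq = moment_functional_continuous_unique[OF D eq cont]
  have "(\<lambda>m. moment_functional I M Z g (h m)) \<longlonglongrightarrow> moment_functional I M Z g (recip_box a b)"
    by (rule moment_functional_LIMSEQ[OF D(1) meas recip_box_measurable bound lim])
  moreover have "(\<lambda>m. moment_functional I M Z g (h m)) \<longlonglongrightarrow> moment_functional J N Y f (recip_box a b)"
    unfolding heq by (rule moment_functional_LIMSEQ[OF D(2) meas recip_box_measurable bound lim])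
  ultimately show ?thesis by (rule LIMSEQ_unique)
qed

text \<open>The Gamma integral, obtained from the Erlang density having total mass 1.\<close>

lemma has_bochner_integral_power_exp:
  fixes l :: real
  assumes l: "l > 0"
  shows "has_bochner_integral lborel (\<lambda>x. indicator {0<..} x * (x ^ k * exp (- l * x))) (fact k / l ^ Suc k)"
proof -
  have "has_bochner_integral lborel (erlang_density k l) 1"
    using nn_integral_erlang_ith_moment[OF l, of k 0] l by (intro has_bochner_integral_nn_integral) auto
  then have "has_bochner_integral lborel (\<lambda>x. fact k / l ^ Suc k * erlang_density k l x) (fact k / l ^ Suc k * 1)"
    by (rule has_bochner_integral_mult_right)
  moreover have "AE x in lborel. fact k / l ^ Suc k * erlang_density k l x = indicator {0<..} x * (x ^ k * exp (- l * x))"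
    using AE_lborel_singleton[of 0] by eventually_elim (use l in \<open>auto simp: erlang_density_def\<close>)
  ultimately show ?thesis
    by (subst has_bochner_integral_cong_AE[symmetric, where f = "\<lambda>x. fact k / l ^ Suc k * erlang_density k l x"]) auto
qed

section \<open>Laplace transforms of the volumes\<close>

lemma sum_weighted_perimeters:
  assumes C: "cubic D {} \<sigma> \<alpha>" and K: "finite K" "lab ` D \<subseteq> K"
  shows "(\<Sum>i\<in>K. lam i * perimeter D \<alpha> lab len i) = (\<Sum>e\<in>cycles_of D \<alpha>. (\<Sum>d\<in>e. lam (lab d)) * len e)"
proof -
  have fD: "finite D" using cubicD(1)[OF C] .
  have o: "orbit \<alpha> d = {d, \<alpha> d}" for d by (rule orbit_involution) (rule cubicD(3)[OF C])
  have "(\<Sum>i\<in>K. lam i * perimeter D \<alpha> lab len i) = (\<Sum>i\<in>K. \<Sum>d\<in>{d \<in> D. lab d = i}. lam (lab d) * len (orbit \<alpha> d))"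
    unfolding perimeter_def sum_distrib_left by (intro sum.cong) auto
  also have "\<dots> = (\<Sum>d\<in>D. lam (lab d) * len (orbit \<alpha> d))"
    by (rule sum.group[OF fD K])
  also have "\<dots> = (\<Sum>e\<in>(\<lambda>d. {d, \<alpha> d}) ` D. \<Sum>d\<in>e. lam (lab d) * len (orbit \<alpha> d))"
    by (rule sum_edges[OF C])
  also have "\<dots> = (\<Sum>e\<in>cycles_of D \<alpha>. (\<Sum>d\<in>e. lam (lab d)) * len e)"
    unfolding cycles_of_edges[OF C] sum_distrib_right
  proof (intro sum.cong refl)
    fix e d assume "e \<in> (\<lambda>d. {d, \<alpha> d}) ` D" "d \<in> e"
    then have "orbit \<alpha> d = e" unfolding o using cubicD(3)[OF C] by auto
    then show "lam (lab d) * len (orbit \<alpha> d) = lam (lab d) * len e" by simp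
  qed
  finally show ?thesis .
qed

definition edge_space :: "'a set \<Rightarrow> ('a \<Rightarrow> 'a) \<Rightarrow> ('a set \<Rightarrow> real) measure" where
  "edge_space D \<alpha> = Pi\<^sub>M (cycles_of D \<alpha>) (\<lambda>_. lborel)"

lemma perimeter_measurable [measurable]:
  "finite D \<Longrightarrow> (\<lambda>len. perimeter D \<alpha> lab len i) \<in> borel_measurable (edge_space D \<alpha>)"
  unfolding perimeter_def edge_space_def cycles_of_def by measurable

text \<open>Regrouped by edges, the exponent is linear in each edge length separately, so the
  integral is a product of exponential integrals over half-lines.\<close>

lemma laplace_perimeters:
  assumes C: "cubic D {} \<sigma> \<alpha>" and K: "finite K" "lab ` D \<subseteq> K" and lam: "\<And>i. i \<in> K \<Longrightarrow> lam i > 0"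
  shows "has_bochner_integral (edge_space D \<alpha>)
    (\<lambda>len. if \<forall>e\<in>cycles_of D \<alpha>. len e > 0 then exp (- (\<Sum>i\<in>K. lam i * perimeter D \<alpha> lab len i)) else 0)
    (edge_wt D \<alpha> (\<lambda>d. lam (lab d)))"
proof -
  interpret product_sigma_finite "\<lambda>_ :: 'a set. lborel :: real measure" by standard
  define E where "E = cycles_of D \<alpha>"
  define c where "c e = (\<Sum>d\<in>e. lam (lab d))" for e
  have fE: "finite E" unfolding E_def cycles_of_def using cubicD(1)[OF C] by simp
  have c: "c e > 0" if "e \<in> E" for e
    using that lam K cubic_in(1)[OF C] unfolding E_def c_def cycles_of_edges[OF C]
    by (intro sum_pos) auto
  have hb: "has_bochner_integral lborel (\<lambda>x. indicator {0<..} x * exp (- c e * x)) (1 / c e)" if "e \<in> E" for e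
    using has_bochner_integral_power_exp[OF c[OF that], of 0] by simp
  have "has_bochner_integral (Pi\<^sub>M E (\<lambda>_. lborel)) (\<lambda>len. \<Prod>e\<in>E. indicator {0<..} (len e) * exp (- c e * len e)) (\<Prod>e\<in>E. 1 / c e)"
    unfolding has_bochner_integral_iff
    using hb product_integrable_prod[OF fE, of "\<lambda>e x. indicator {0<..} x * exp (- c e * x)"]
      product_integral_prod[OF fE, of "\<lambda>e x. indicator {0<..} x * exp (- c e * x)"]
    by (simp add: has_bochner_integral_iff)
  moreover have "(\<Prod>e\<in>E. indicator {0<..} (len e) * exp (- c e * len e)) =
     (if \<forall>e\<in>E. len e > 0 then exp (- (\<Sum>i\<in>K. lam i * perimeter D \<alpha> lab len i)) else 0)" for len
  proof (cases "\<forall>e\<in>E. len e > 0")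
    case True
    then have "(\<Prod>e\<in>E. indicator {0<..} (len e) * exp (- c e * len e)) = (\<Prod>e\<in>E. exp (- (c e * len e)))"
      by (intro prod.cong) auto
    also have "\<dots> = exp (- (\<Sum>e\<in>E. c e * len e))" by (simp add: exp_sum[OF fE] sum_negf[symmetric])
    finally show ?thesis using True unfolding sum_weighted_perimeters[OF C K] c_def E_def by simp
  next
    case False
    then have "\<exists>e\<in>E. indicator {0<..} (len e) * exp (- c e * len e) = 0"
      unfolding not_less ball_simps by (auto simp: indicator_def not_less)
    then have "(\<Prod>e\<in>E. indicator {0<..} (len e) * exp (- c e * len e)) = 0" by (rule prod_zero[OF fE])
    then show ?thesis using False by simp
  qed
  moreover have "(\<Prod>e\<in>E. 1 / c e) = edge_wt D \<alpha> (\<lambda>d. lam (lab d))"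
    unfolding edge_wt_def E_def c_def cycles_of_edges[OF C] ..
  ultimately show ?thesis unfolding edge_space_def E_def by simp
qed

lemma recip_box_exp:
  "recip_box (exp (- (P + \<epsilon>))) (exp (- (P - \<epsilon>))) (exp (- p)) = (if \<bar>p - P\<bar> < \<epsilon> then exp p else 0)"
proof -
  have "1 / exp (- p) = exp p" by (simp add: exp_minus field_simps)
  then show ?thesis unfolding recip_box_def exp_less_cancel_iff by auto
qed

text \<open>The weight \<open>exp (- perimeter)\<close> makes the total mass finite, as the moment
  argument requires. The values \<open>exp p\<close> that \<open>recip_box\<close> takes inside the
  window remove it again.\<close>

lemma window_volume_eq_integral:
  assumes fD: "finite D"
  shows "window_volume D \<alpha> lab k P \<epsilon> =
    (\<integral>len. (\<Prod>i\<in>{1..k}. recip_box (exp (- (P i + \<epsilon>))) (exp (- (P i - \<epsilon>))) (exp (- perimeter D \<alpha> lab len i))) *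
      (if \<forall>e\<in>cycles_of D \<alpha>. len e > 0 then exp (- (\<Sum>i\<in>{1..k}. perimeter D \<alpha> lab len i)) else 0) \<partial>edge_space D \<alpha>)"
proof -
  define W where "W = {len \<in> space (edge_space D \<alpha>). (\<forall>e\<in>cycles_of D \<alpha>. len e > 0) \<and>
      (\<forall>i\<in>{1..k}. \<bar>perimeter D \<alpha> lab len i - P i\<bar> < \<epsilon>)}"
  have "window_volume D \<alpha> lab k P \<epsilon> = measure (edge_space D \<alpha>) W"
    unfolding window_volume_def Let_def W_def edge_space_def ..
  also have "\<dots> = measure (edge_space D \<alpha>) (W \<inter> space (edge_space D \<alpha>))"
    by (rule arg_cong[of _ _ "measure _"]) (auto simp: W_def)
  also have "\<dots> = (\<integral>len. indicator W len \<partial>edge_space D \<alpha>)" by simp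
  also have "\<dots> = (\<integral>len. (\<Prod>i\<in>{1..k}. recip_box (exp (- (P i + \<epsilon>))) (exp (- (P i - \<epsilon>))) (exp (- perimeter D \<alpha> lab len i))) *
      (if \<forall>e\<in>cycles_of D \<alpha>. len e > 0 then exp (- (\<Sum>i\<in>{1..k}. perimeter D \<alpha> lab len i)) else 0) \<partial>edge_space D \<alpha>)"
  proof (rule Bochner_Integration.integral_cong[OF refl])
    fix len assume len: "len \<in> space (edge_space D \<alpha>)"
    define p where "p i = perimeter D \<alpha> lab len i" for i
    show "indicator W len = (\<Prod>i\<in>{1..k}. recip_box (exp (- (P i + \<epsilon>))) (exp (- (P i - \<epsilon>))) (exp (- perimeter D \<alpha> lab len i))) *
      (if \<forall>e\<in>cycles_of D \<alpha>. len e > 0 then exp (- (\<Sum>i\<in>{1..k}. perimeter D \<alpha> lab len i)) else 0)"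
      unfolding p_def[symmetric] recip_box_exp
    proof (cases "\<forall>i\<in>{1..k}. \<bar>p i - P i\<bar> < \<epsilon>")
      case True
      then have "(\<Prod>i\<in>{1..k}. if \<bar>p i - P i\<bar> < \<epsilon> then exp (p i) else 0) = exp (\<Sum>i\<in>{1..k}. p i)"
        by (simp add: exp_sum)
      then show "indicator W len = (\<Prod>i\<in>{1..k}. if \<bar>p i - P i\<bar> < \<epsilon> then exp (p i) else 0) *
         (if \<forall>e\<in>cycles_of D \<alpha>. len e > 0 then exp (- (\<Sum>i\<in>{1..k}. p i)) else 0)"
        using True len by (auto simp: W_def p_def indicator_def exp_minus)
    next
      case False
      then have "(\<Prod>i\<in>{1..k}. if \<bar>p i - P i\<bar> < \<epsilon> then exp (p i) else 0) = 0" by (auto simp: prod_zero_iff)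
      then show "indicator W len = (\<Prod>i\<in>{1..k}. if \<bar>p i - P i\<bar> < \<epsilon> then exp (p i) else 0) *
         (if \<forall>e\<in>cycles_of D \<alpha>. len e > 0 then exp (- (\<Sum>i\<in>{1..k}. p i)) else 0)"
        using False by (auto simp: W_def p_def indicator_def)
    qed
  qed
  finally show ?thesis .
qed

text \<open>The contribution of one face to the expected volume density,
  \<open>p ^ (2 * m) / (fact m)^2\<close>, under the same exponential weight as on the side of the
  graphs.\<close>

definition perim_density :: "nat \<Rightarrow> real \<Rightarrow> real" where
  "perim_density m p = indicator {0<..} p * (p ^ (2 * m) * exp (- p)) / (fact m)\<^sup>2"

lemma perim_density_moment:
  "has_bochner_integral lborel (\<lambda>p. exp (- p) ^ n * perim_density m p)
     (1 / real (Suc n) * (real (2 * m choose m) * (1 / real (Suc n)) ^ (2 * m)))"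
proof -
  have "has_bochner_integral lborel (\<lambda>p. indicator {0<..} p * (p ^ (2 * m) * exp (- real (Suc n) * p)) / (fact m)\<^sup>2)
      (fact (2 * m) / real (Suc n) ^ Suc (2 * m) / (fact m)\<^sup>2)"
    by (intro has_bochner_integral_divide has_bochner_integral_power_exp) simp_all
  moreover have "indicator {0<..} p * (p ^ (2 * m) * exp (- real (Suc n) * p)) / (fact m)\<^sup>2 = exp (- p) ^ n * perim_density m p" for p :: real
  proof -
    have "exp (- real (Suc n) * p) = exp (- p) ^ n * exp (- p)"
      by (simp add: exp_of_nat_mult[symmetric] exp_add[symmetric] algebra_simps)
    then show ?thesis by (simp add: perim_density_def)
  qed
  moreover have b: "real (2 * m choose m) = fact (2 * m) / (fact m)\<^sup>2"
    using binomial_fact[of m "2 * m", where 'a = real] by (simp add: power2_eq_square mult_2)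
  have "fact (2 * m) / real (Suc n) ^ Suc (2 * m) / (fact m)\<^sup>2 = 1 / real (Suc n) * (real (2 * m choose m) * (1 / real (Suc n)) ^ (2 * m))"
    unfolding b by (simp add: power_one_over divide_simps)
  ultimately show ?thesis by simp
qed

lemma perim_density_window:
  assumes "0 < \<epsilon>" "\<epsilon> < P"
  shows "(\<integral>p. recip_box (exp (- (P + \<epsilon>))) (exp (- (P - \<epsilon>))) (exp (- p)) * perim_density m p \<partial>lborel) =
     (P + \<epsilon>) ^ Suc (2 * m) / (real (Suc (2 * m)) * (fact m)\<^sup>2) - (P - \<epsilon>) ^ Suc (2 * m) / (real (Suc (2 * m)) * (fact m)\<^sup>2)"
proof -
  define F where "F p = p ^ Suc (2 * m) / (real (Suc (2 * m)) * (fact m)\<^sup>2)" for p :: real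
  have dF: "(F has_real_derivative p ^ (2 * m) / (fact m)\<^sup>2) (at p)" for p
    unfolding F_def by (rule derivative_eq_intros refl | simp)+
  have "(\<integral>p. p ^ (2 * m) / (fact m)\<^sup>2 * indicator {P - \<epsilon> .. P + \<epsilon>} p \<partial>lborel) = F (P + \<epsilon>) - F (P - \<epsilon>)"
    by (rule integral_FTC_Icc_real) (use assms dF in \<open>auto intro!: continuous_intros\<close>)
  moreover have "(\<integral>p. recip_box (exp (- (P + \<epsilon>))) (exp (- (P - \<epsilon>))) (exp (- p)) * perim_density m p \<partial>lborel) =
     (\<integral>p. p ^ (2 * m) / (fact m)\<^sup>2 * indicator {P - \<epsilon> .. P + \<epsilon>} p \<partial>lborel)"
  proof (rule integral_cong_AE)
    \<comment> \<open>The open window of \<open>recip_box\<close> and the closed interval of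
      integration differ only in their two endpoints.\<close>
    show "AE p in lborel. recip_box (exp (- (P + \<epsilon>))) (exp (- (P - \<epsilon>))) (exp (- p)) * perim_density m p =
        p ^ (2 * m) / (fact m)\<^sup>2 * indicator {P - \<epsilon> .. P + \<epsilon>} p"
      using AE_lborel_singleton[of "P - \<epsilon>"] AE_lborel_singleton[of "P + \<epsilon>"]
    proof eventually_elim
      case (elim p)
      show ?case
      proof (cases "P - \<epsilon> < p \<and> p < P + \<epsilon>")
        case True
        then show ?thesis using assms unfolding recip_box_exp by (simp add: perim_density_def exp_minus abs_less_iff)
      next
        case False
        then have "p < P - \<epsilon> \<or> P + \<epsilon> < p" using elim by auto
        then show ?thesis unfolding recip_box_exp by auto
      qed
    qed
  qed (auto simp: perim_density_def)
  ultimately show ?thesis by (simp add: F_def)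
qed

section \<open>Comparing the volumes with the density one perimeter at a time\<close>

definition bounded_test :: "(real \<Rightarrow> real) \<Rightarrow> bool" where
  "bounded_test f \<longleftrightarrow> f \<in> borel_measurable borel \<and> (\<exists>C. \<forall>z\<in>{0..1}. \<bar>f z\<bar> \<le> C)"

lemma bounded_test_power: "bounded_test (\<lambda>z. z ^ n)"
  unfolding bounded_test_def by (auto intro!: exI[of _ 1] simp: power_abs power_le_one)

lemma bounded_test_recip_box: "0 < a \<Longrightarrow> bounded_test (recip_box a b)"
  unfolding bounded_test_def by (auto intro!: exI[of _ "1 / a"] simp: recip_box_def frac_le)

lemma abs_prod_le_prod:
  fixes f g :: "'a \<Rightarrow> real"
  shows "(\<And>i. i \<in> A \<Longrightarrow> \<bar>f i\<bar> \<le> g i) \<Longrightarrow> \<bar>prod f A\<bar> \<le> prod g A"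
  unfolding abs_prod by (rule prod_mono) auto

definition perim_weight :: "'a set \<Rightarrow> ('a \<Rightarrow> 'a) \<Rightarrow> ('a \<Rightarrow> nat) \<Rightarrow> nat \<Rightarrow> ('a set \<Rightarrow> real) \<Rightarrow> real" where
  "perim_weight D \<alpha> lab k len =
     (if \<forall>e\<in>cycles_of D \<alpha>. len e > 0 then exp (- (\<Sum>i\<in>{1..k}. perimeter D \<alpha> lab len i)) else 0)"

definition map_functional :: "nat \<Rightarrow> (nat \<Rightarrow> real \<Rightarrow> real) \<Rightarrow> real" where
  "map_functional M f = (\<Sum>\<Gamma>\<in>strebel_graphs M. \<integral>len.
     (\<Prod>i\<in>{1..M + 3}. f i (exp (- perimeter {..<6 * M + 6} (fst (snd \<Gamma>)) (snd (snd \<Gamma>)) len i))) *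
     perim_weight {..<6 * M + 6} (fst (snd \<Gamma>)) (snd (snd \<Gamma>)) (M + 3) len \<partial>edge_space {..<6 * M + 6} (fst (snd \<Gamma>)))"

text \<open>A multiset of size \<open>M\<close> encodes a monomial of degree \<open>M\<close>:
  \<open>count X i\<close> is the exponent belonging to face \<open>i\<close>.\<close>

definition density_functional :: "nat \<Rightarrow> (nat \<Rightarrow> real \<Rightarrow> real) \<Rightarrow> real" where
  "density_functional M f = (\<Sum>X\<in>multisets_of_size {1..M + 3} M. fact (6 * M + 6) * kappa M *
     (\<Prod>i\<in>{1..M + 3}. \<integral>p. f i (exp (- p)) * perim_density (count X i) p \<partial>lborel))"

lemma strebel_graphsD:
  assumes "\<Gamma> \<in> strebel_graphs M"
  shows "cubic {..<6 * M + 6} {} (fst \<Gamma>) (fst (snd \<Gamma>))" "snd (snd \<Gamma>) ` {..<6 * M + 6} = {1..M + 3}"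
  using assms cubic_map_cubic face_labD(3) unfolding strebel_graphs_eq closed_maps_def by fastforce+

text \<open>With \<open>z = exp (- P i)\<close> the power \<open>z ^ n i\<close> raises the Laplace
  variable from 1 to \<open>n i + 1\<close>. The joint moments are therefore Laplace transforms at
  positive integers, where the edge sum over all graphs is known.\<close>

lemma functionals_eq_power:
  "map_functional M (\<lambda>i z. z ^ n i) = density_functional M (\<lambda>i z. z ^ n i)"
proof -
  let ?D = "{..<6 * M + 6}" and ?K = "{1..M + 3}"
  define lam where "lam i = real (Suc (n i))" for i
  have lam: "lam i > 0" for i by (simp add: lam_def)
  have "map_functional M (\<lambda>i z. z ^ n i) = (\<Sum>\<Gamma>\<in>strebel_graphs M. edge_wt ?D (fst (snd \<Gamma>)) (\<lambda>d. lam (snd (snd \<Gamma>) d)))"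
    unfolding map_functional_def
  proof (rule sum.cong[OF refl])
    fix \<Gamma> assume G: "\<Gamma> \<in> strebel_graphs M"
    obtain \<sigma> \<alpha> lab where [simp]: "\<Gamma> = (\<sigma>, \<alpha>, lab)" by (cases \<Gamma>)
    have C: "cubic ?D {} \<sigma> \<alpha>" "lab ` ?D \<subseteq> ?K" using strebel_graphsD[OF G] by auto
    have "(\<Prod>i\<in>?K. exp (- perimeter ?D \<alpha> lab len i) ^ n i) * perim_weight ?D \<alpha> lab (M + 3) len =
       (if \<forall>e\<in>cycles_of ?D \<alpha>. len e > 0 then exp (- (\<Sum>i\<in>?K. lam i * perimeter ?D \<alpha> lab len i)) else 0)" for len
    proof -
      have "(\<Prod>i\<in>?K. exp (- perimeter ?D \<alpha> lab len i) ^ n i) * exp (- (\<Sum>i\<in>?K. perimeter ?D \<alpha> lab len i)) =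
         (\<Prod>i\<in>?K. exp (- perimeter ?D \<alpha> lab len i) ^ n i * exp (- perimeter ?D \<alpha> lab len i))"
        by (simp only: prod.distrib sum_negf[symmetric] exp_sum[OF finite_atLeastAtMost])
      also have "\<dots> = (\<Prod>i\<in>?K. exp (- (lam i * perimeter ?D \<alpha> lab len i)))"
        by (intro prod.cong refl) (simp add: lam_def exp_of_nat_mult[symmetric] exp_add[symmetric] algebra_simps)
      also have "\<dots> = exp (- (\<Sum>i\<in>?K. lam i * perimeter ?D \<alpha> lab len i))"
        by (simp only: sum_negf[symmetric] exp_sum[OF finite_atLeastAtMost])
      finally show ?thesis by (simp add: perim_weight_def)
    qed
    then show "(\<integral>len. (\<Prod>i\<in>?K. exp (- perimeter ?D (fst (snd \<Gamma>)) (snd (snd \<Gamma>)) len i) ^ n i) *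
       perim_weight ?D (fst (snd \<Gamma>)) (snd (snd \<Gamma>)) (M + 3) len \<partial>edge_space ?D (fst (snd \<Gamma>))) =
       edge_wt ?D (fst (snd \<Gamma>)) (\<lambda>d. lam (snd (snd \<Gamma>) d))"
      using laplace_perimeters[OF C(1) _ C(2) lam] by (simp add: has_bochner_integral_iff)
  qed
  also have "\<dots> = fact (6 * M + 6) * ((\<Prod>i\<in>?K. 1 / lam i) * (kappa M * psi_poly ?K M (\<lambda>i. 1 / lam i)))"
    using strebel_edge_sum[of M lam, OF lam] by (simp add: case_prod_unfold field_simps)
  also have "\<dots> = density_functional M (\<lambda>i z. z ^ n i)"
  proof -
    have "psi_poly ?K M (\<lambda>i. 1 / lam i) = (\<Sum>X\<in>multisets_of_size ?K M. \<Prod>i\<in>?K. real (2 * count X i choose count X i) * (1 / lam i) ^ (2 * count X i))"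
      unfolding psi_poly_def by (simp add: fps_prod_nth' psi_series_def)
    moreover have "(\<integral>p. exp (- p) ^ n i * perim_density m p \<partial>lborel) = 1 / lam i * (real (2 * m choose m) * (1 / lam i) ^ (2 * m))" for i m
      using perim_density_moment[of "n i" m] unfolding lam_def has_bochner_integral_iff by blast
    ultimately show ?thesis unfolding density_functional_def
      by (simp only: prod.distrib sum_distrib_left mult_ac)
  qed
  finally show ?thesis .
qed

text \<open>When the test functions of the other faces are frozen, both sides are moment functionals
  in the single variable \<open>exp (- P x)\<close>. So the problem on the cube reduces to the
  uniqueness of moments on an interval.\<close>

lemma functionals_eq_step:
  assumes x: "x \<in> {1..M + 3}" and f: "\<And>i. i \<in> {1..M + 3} - {x} \<Longrightarrow> bounded_test (f i)"
    and eq: "\<And>n. map_functional M (f(x := \<lambda>z. z ^ n)) = density_functional M (f(x := \<lambda>z. z ^ n))"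
    and a: "0 < a"
  shows "map_functional M (f(x := recip_box a b)) = density_functional M (f(x := recip_box a b))"
proof -
  let ?D = "{..<6 * M + 6}" and ?K = "{1..M + 3}"
  define Ms :: "(nat \<Rightarrow> nat) \<times> (nat \<Rightarrow> nat) \<times> (nat \<Rightarrow> nat) \<Rightarrow> _" where "Ms \<Gamma> = edge_space ?D (fst (snd \<Gamma>))" for \<Gamma>
  define p where "p \<Gamma> len i = perimeter ?D (fst (snd \<Gamma>)) (snd (snd \<Gamma>)) len i"
    for \<Gamma> :: "(nat \<Rightarrow> nat) \<times> (nat \<Rightarrow> nat) \<times> (nat \<Rightarrow> nat)" and len i
  define w where "w \<Gamma> = perim_weight ?D (fst (snd \<Gamma>)) (snd (snd \<Gamma>)) (M + 3)"
    for \<Gamma> :: "(nat \<Rightarrow> nat) \<times> (nat \<Rightarrow> nat) \<times> (nat \<Rightarrow> nat)"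
  define Z where "Z \<Gamma> len = exp (- p \<Gamma> len x)" for \<Gamma> len
  define g where "g \<Gamma> len = (\<Prod>i\<in>?K - {x}. f i (exp (- p \<Gamma> len i))) * w \<Gamma> len" for \<Gamma> len
  define q where "q X y = fact (6 * M + 6) * kappa M * (\<Prod>i\<in>?K - {x}. \<integral>p. f i (exp (- p)) * perim_density (count X i) p \<partial>lborel) *
      perim_density (count X x) y" for X :: "nat multiset" and y
  have e1: "map_functional M (f(x := h)) = moment_functional (strebel_graphs M) Ms Z g h" for h
    unfolding map_functional_def moment_functional_def Ms_def[symmetric] p_def[symmetric] w_def[symmetric]
  proof (intro sum.cong refl Bochner_Integration.integral_cong)
    fix \<Gamma> len
    have "(\<Prod>i\<in>?K. (f(x := h)) i (exp (- p \<Gamma> len i))) = h (Z \<Gamma> len) * (\<Prod>i\<in>?K - {x}. f i (exp (- p \<Gamma> len i)))"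
      using x by (subst prod.remove[of _ x]) (auto simp: Z_def intro!: prod.cong)
    then show "(\<Prod>i\<in>?K. (f(x := h)) i (exp (- p \<Gamma> len i))) * w \<Gamma> len = h (Z \<Gamma> len) * g \<Gamma> len"
      by (simp add: g_def)
  qed
  have e2: "density_functional M (f(x := h)) = moment_functional (multisets_of_size ?K M) (\<lambda>_. lborel) (\<lambda>_ y. exp (- y)) q h" for h
    unfolding density_functional_def moment_functional_def
  proof (intro sum.cong refl)
    fix X
    have "(\<Prod>i\<in>?K. \<integral>p. (f(x := h)) i (exp (- p)) * perim_density (count X i) p \<partial>lborel) =
       (\<integral>p. h (exp (- p)) * perim_density (count X x) p \<partial>lborel) * (\<Prod>i\<in>?K - {x}. \<integral>p. f i (exp (- p)) * perim_density (count X i) p \<partial>lborel)"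
      using x by (subst prod.remove[of _ x]) (auto intro!: prod.cong)
    moreover define c where "c = fact (6 * M + 6) * kappa M * (\<Prod>i\<in>?K - {x}. \<integral>p. f i (exp (- p)) * perim_density (count X i) p \<partial>lborel)"
    moreover have "(\<integral>y. h (exp (- y)) * q X y \<partial>lborel) = (\<integral>y. c * (h (exp (- y)) * perim_density (count X x) y) \<partial>lborel)"
      unfolding q_def c_def[symmetric] by (simp only: mult_ac)
    ultimately show "fact (6 * M + 6) * kappa M * (\<Prod>i\<in>?K. \<integral>p. (f(x := h)) i (exp (- p)) * perim_density (count X i) p \<partial>lborel) =
       (\<integral>y. h (exp (- y)) * q X y \<partial>lborel)"
      by simp
  qed
  have "finite (strebel_graphs M)" unfolding strebel_graphs_eq by (rule finite_closed_maps) auto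
  then have d1: "moment_data (strebel_graphs M) Ms Z g" unfolding moment_data_def
  proof (intro conjI ballI impI)
    fix \<Gamma> assume G: "\<Gamma> \<in> strebel_graphs M"
    have C: "cubic ?D {} (fst \<Gamma>) (fst (snd \<Gamma>))" "snd (snd \<Gamma>) ` ?D \<subseteq> ?K" using strebel_graphsD[OF G] by auto
    have pm[measurable]: "(\<lambda>len. p \<Gamma> len i) \<in> borel_measurable (Ms \<Gamma>)" for i unfolding p_def Ms_def by measurable
    show "Z \<Gamma> \<in> borel_measurable (Ms \<Gamma>)" unfolding Z_def by measurable
    \<comment> \<open>Where the weight does not vanish all edges have positive length; the
      perimeters are then nonnegative and their exponentials lie in the unit interval.\<close>
    have pos: "p \<Gamma> len i \<ge> 0" if "w \<Gamma> len \<noteq> 0" for len i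
    proof -
      have "\<forall>e\<in>cycles_of ?D (fst (snd \<Gamma>)). len e > 0" using that unfolding w_def perim_weight_def by metis
      then show ?thesis unfolding p_def perimeter_def cycles_of_def by (intro sum_nonneg) (auto intro: less_imp_le)
    qed
    show "Z \<Gamma> len \<in> {0..1}" if "g \<Gamma> len \<noteq> 0" for len
      using pos[of len x] that by (auto simp: Z_def g_def)
    have iw: "integrable (Ms \<Gamma>) (w \<Gamma>)"
      using laplace_perimeters[OF C(1) _ C(2), of "\<lambda>_. 1"] unfolding mult_1_left Ms_def w_def perim_weight_def[abs_def] has_bochner_integral_iff
      by simp
    obtain B where B: "\<And>i z. i \<in> ?K - {x} \<Longrightarrow> z \<in> {0..1} \<Longrightarrow> \<bar>f i z\<bar> \<le> B i"
      using f unfolding bounded_test_def by metis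
    show "integrable (Ms \<Gamma>) (g \<Gamma>)" unfolding g_def
    proof (rule integrable_bounded_mult[OF iw, where C = "\<Prod>i\<in>?K - {x}. B i"])
      have fm: "f i \<in> borel_measurable borel" if "i \<in> ?K - {x}" for i using f[OF that] by (simp add: bounded_test_def)
      have "(\<lambda>len. f i (exp (- p \<Gamma> len i))) \<in> borel_measurable (Ms \<Gamma>)" if "i \<in> ?K - {x}" for i
        by (rule measurable_compose[OF _ fm[OF that]]) measurable
      then show "(\<lambda>len. \<Prod>i\<in>?K - {x}. f i (exp (- p \<Gamma> len i))) \<in> borel_measurable (Ms \<Gamma>)"
        by (rule borel_measurable_prod)
      show "\<bar>\<Prod>i\<in>?K - {x}. f i (exp (- p \<Gamma> len i))\<bar> \<le> (\<Prod>i\<in>?K - {x}. B i)" if "w \<Gamma> len \<noteq> 0" for len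
        by (rule abs_prod_le_prod, rule B) (use pos[OF that] in auto)
    qed
  qed
  have d2: "moment_data (multisets_of_size ?K M) (\<lambda>_. lborel) (\<lambda>_ y. exp (- y)) q" unfolding moment_data_def
  proof (intro conjI ballI impI)
    show "finite (multisets_of_size ?K M)" by (rule finite_multisets_of_size) simp
    fix X
    have "integrable lborel (perim_density m)" for m
      using perim_density_moment[of 0 m] by (simp add: has_bochner_integral_iff)
    then show "integrable lborel (q X)" unfolding q_def by simp
    show "exp (- y) \<in> {0..1}" if "q X y \<noteq> 0" for y :: real
      using that by (auto simp: q_def perim_density_def indicator_def split: if_splits)
  qed simp
  show ?thesis unfolding e1 e2
    by (rule moment_functional_box_unique[OF d1 d2 _ a]) (use eq in \<open>simp only: e1 e2\<close>)
qed

text \<open>Induction over the faces whose power has already been exchanged for a box; the case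
  without any box is the equality of moments.\<close>

lemma functionals_eq:
  assumes "finite J" "J \<subseteq> {1..M + 3}" "\<And>i. i \<in> J \<Longrightarrow> \<exists>a b. 0 < a \<and> f i = recip_box a b"
    "\<And>i. i \<notin> J \<Longrightarrow> \<exists>n. f i = (\<lambda>z. z ^ n)"
  shows "map_functional M f = density_functional M f"
  using assms
proof (induction J arbitrary: f rule: finite_induct)
  case empty
  then obtain n where "\<And>i. f i = (\<lambda>z. z ^ n i)" by (metis empty_iff)
  then have "f = (\<lambda>i z. z ^ n i)" by auto
  then show ?case using functionals_eq_power by simp
next
  case (insert x J)
  obtain a b where ab: "0 < a" "f x = recip_box a b" using insert.prems(2)[of x] by auto
  have t: "bounded_test (f i)" for i
  proof (cases "i \<in> insert x J")
    case True
    then obtain a b where "0 < a" "f i = recip_box a b" using insert.prems(2) by blast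
    then show ?thesis using bounded_test_recip_box by simp
  next
    case False
    then obtain n where "f i = (\<lambda>z. z ^ n)" using insert.prems(3) by blast
    then show ?thesis using bounded_test_power by simp
  qed
  have "map_functional M (f(x := \<lambda>z. z ^ n)) = density_functional M (f(x := \<lambda>z. z ^ n))" for n
  proof (rule insert.IH)
    show "J \<subseteq> {1..M + 3}" using insert.prems(1) by simp
    show "\<exists>a b. 0 < a \<and> (f(x := \<lambda>z. z ^ n)) i = recip_box a b" if "i \<in> J" for i
      using insert.prems(2)[of i] insert.hyps(2) that by auto
    show "\<exists>m. (f(x := \<lambda>z. z ^ n)) i = (\<lambda>z. z ^ m)" if "i \<notin> J" for i
      using insert.prems(3)[of i] that by auto
  qed
  from functionals_eq_step[OF _ t this ab(1)] insert.prems(1)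
  have "map_functional M (f(x := recip_box a b)) = density_functional M (f(x := recip_box a b))" by simp
  moreover have "f(x := recip_box a b) = f" using ab by auto
  ultimately show ?case by simp
qed

lemma window_sum:
  assumes "0 < \<epsilon>" "\<And>i. i \<in> {1..M + 3} \<Longrightarrow> \<epsilon> < P i"
  shows "(\<Sum>(\<sigma>, \<alpha>, lab)\<in>strebel_graphs M. window_volume {..<6 * M + 6} \<alpha> lab (M + 3) P \<epsilon>) =
    (\<Sum>X\<in>multisets_of_size {1..M + 3} M. fact (6 * M + 6) * kappa M *
     (\<Prod>i\<in>{1..M + 3}. (P i + \<epsilon>) ^ Suc (2 * count X i) / (real (Suc (2 * count X i)) * (fact (count X i))\<^sup>2) -
        (P i - \<epsilon>) ^ Suc (2 * count X i) / (real (Suc (2 * count X i)) * (fact (count X i))\<^sup>2)))"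
proof -
  define f where "f i = (if i \<in> {1..M + 3} then recip_box (exp (- (P i + \<epsilon>))) (exp (- (P i - \<epsilon>))) else (\<lambda>z. z ^ 0))" for i
  have "(\<Sum>(\<sigma>, \<alpha>, lab)\<in>strebel_graphs M. window_volume {..<6 * M + 6} \<alpha> lab (M + 3) P \<epsilon>) = map_functional M f"
    unfolding map_functional_def case_prod_unfold
    by (intro sum.cong refl) (simp add: window_volume_eq_integral perim_weight_def f_def)
  also have "\<dots> = density_functional M f"
    by (rule functionals_eq[of "{1..M + 3}"]) (auto simp: f_def simp del: exp_minus intro!: exI[of _ "exp _"] exI[of _ "0 :: nat"])
  also have "\<dots> = (\<Sum>X\<in>multisets_of_size {1..M + 3} M. fact (6 * M + 6) * kappa M *
     (\<Prod>i\<in>{1..M + 3}. (P i + \<epsilon>) ^ Suc (2 * count X i) / (real (Suc (2 * count X i)) * (fact (count X i))\<^sup>2) -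
        (P i - \<epsilon>) ^ Suc (2 * count X i) / (real (Suc (2 * count X i)) * (fact (count X i))\<^sup>2)))"
    unfolding density_functional_def
  proof (intro sum.cong refl arg_cong2[of _ _ _ _ "(*)"] prod.cong)
    fix X i assume i: "i \<in> {1..M + 3}"
    have f: "f i = recip_box (exp (- (P i + \<epsilon>))) (exp (- (P i - \<epsilon>)))" using i unfolding f_def by (rule if_P)
    show "(\<integral>p. f i (exp (- p)) * perim_density (count X i) p \<partial>lborel) =
      (P i + \<epsilon>) ^ Suc (2 * count X i) / (real (Suc (2 * count X i)) * (fact (count X i))\<^sup>2) -
      (P i - \<epsilon>) ^ Suc (2 * count X i) / (real (Suc (2 * count X i)) * (fact (count X i))\<^sup>2)"
      unfolding f by (rule perim_density_window) (use assms i in auto)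
  qed
  finally show ?thesis .
qed

text \<open>The windows are centred at the prescribed perimeters and have width
  \<open>2 * \<epsilon>\<close>, so the normalised window sums lead to symmetric difference
  quotients.\<close>

lemma symmetric_quotient:
  assumes "(F has_real_derivative D) (at x)"
  shows "((\<lambda>h. (F (x + h) - F (x - h)) / (2 * h)) \<longlongrightarrow> D) (at_right 0)"
proof -
  have 1: "((\<lambda>h. (F (x + h) - F x) / h) \<longlongrightarrow> D) (at 0)" using assms by (simp add: DERIV_def)
  have "filterlim uminus (at 0) (at (0::real))"
    by (auto simp: filterlim_at eventually_at_filter intro!: tendsto_eq_intros)
  from filterlim_compose[OF 1 this]
  have 2: "((\<lambda>h. (F (x + - h) - F x) / - h) \<longlongrightarrow> D) (at 0)" .
  have "((\<lambda>h. ((F (x + h) - F x) / h + (F (x + - h) - F x) / - h) / 2) \<longlongrightarrow> (D + D) / 2) (at 0)"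
    by (intro tendsto_divide tendsto_add 1 2 tendsto_const) simp
  then have lim: "((\<lambda>h. ((F (x + h) - F x) / h + (F (x + - h) - F x) / - h) / 2) \<longlongrightarrow> (D + D) / 2) (at_right 0)"
    by (rule tendsto_within_subset) simp
  have e: "((F (x + h) - F x) / h + (F (x + - h) - F x) / - h) / 2 = (F (x + h) - F (x - h)) / (2 * h)" for h
    by (cases "h = 0") (simp_all add: divide_simps)
  show ?thesis using lim unfolding e by simp
qed

text \<open>The Bessel function \<open>I_0(2 * P * sqrt X)\<close> as a series in
  \<open>X\<close>.\<close>

definition volume_series :: "real \<Rightarrow> real fps" where
  "volume_series P = Abs_fps (\<lambda>m. P ^ (2 * m) / (fact m)\<^sup>2)"

theorem strebel_volume_eq:
  assumes P: "\<And>i. i \<in> {1..M + 3} \<Longrightarrow> P i > 0"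
  shows "strebel_volume M P = kappa M * (\<Prod>i\<in>{1..M + 3}. volume_series (P i)) $ M"
proof -
  let ?K = "{1..M + 3}"
  define F where "F m p = p ^ Suc (2 * m) / (real (Suc (2 * m)) * (fact m)\<^sup>2)" for m and p :: real
  have dF: "(F m has_real_derivative p ^ (2 * m) / (fact m)\<^sup>2) (at p)" for m p
    unfolding F_def by (rule derivative_eq_intros refl | simp)+
  define V where "V \<epsilon> = (\<Sum>(\<sigma>, \<alpha>, lab)\<in>strebel_graphs M. window_volume {..<6 * M + 6} \<alpha> lab (M + 3) P \<epsilon>)
         / fact (6 * M + 6) / (2 * \<epsilon>) ^ (M + 3)" for \<epsilon>
  have "((\<lambda>\<epsilon>. \<Sum>X\<in>multisets_of_size ?K M. kappa M * (\<Prod>i\<in>?K. (F (count X i) (P i + \<epsilon>) - F (count X i) (P i - \<epsilon>)) / (2 * \<epsilon>))) \<longlongrightarrow>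
     (\<Sum>X\<in>multisets_of_size ?K M. kappa M * (\<Prod>i\<in>?K. P i ^ (2 * count X i) / (fact (count X i))\<^sup>2))) (at_right 0)"
    by (intro tendsto_sum tendsto_mult tendsto_prod tendsto_const symmetric_quotient dF)
  moreover have "\<forall>\<^sub>F \<epsilon> in at_right 0. (\<Sum>X\<in>multisets_of_size ?K M. kappa M * (\<Prod>i\<in>?K. (F (count X i) (P i + \<epsilon>) - F (count X i) (P i - \<epsilon>)) / (2 * \<epsilon>))) = V \<epsilon>"
  proof -
    \<comment> \<open>For positive perimeters, small windows stay inside the half-line on which the
      density is the weighted monomial.\<close>
    have "\<forall>\<^sub>F \<epsilon> in at_right 0. \<forall>i\<in>?K. \<epsilon> < P i"
      by (intro eventually_ball_finite ballI order_tendstoD(2)[OF tendsto_ident_at] P) auto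
    with eventually_at_right_less[of 0] show ?thesis
    proof eventually_elim
      case (elim \<epsilon>)
      have "V \<epsilon> = (\<Sum>X\<in>multisets_of_size ?K M. fact (6 * M + 6) * kappa M * (\<Prod>i\<in>?K. F (count X i) (P i + \<epsilon>) - F (count X i) (P i - \<epsilon>)))
         / fact (6 * M + 6) / (2 * \<epsilon>) ^ (M + 3)"
        unfolding V_def F_def using elim by (subst window_sum) auto
      also have "\<dots> = (\<Sum>X\<in>multisets_of_size ?K M. kappa M * ((\<Prod>i\<in>?K. F (count X i) (P i + \<epsilon>) - F (count X i) (P i - \<epsilon>)) / (2 * \<epsilon>) ^ (M + 3)))"
        unfolding sum_divide_distrib by (intro sum.cong refl) simp
      finally show ?case by (simp add: prod_dividef add.commute)
    qed
  qed
  ultimately have lim: "(V \<longlongrightarrow> (\<Sum>X\<in>multisets_of_size ?K M. kappa M * (\<Prod>i\<in>?K. P i ^ (2 * count X i) / (fact (count X i))\<^sup>2))) (at_right 0)"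
    by (rule Lim_transform_eventually)
  have "strebel_volume M P = Lim (at_right 0) V" unfolding strebel_volume_def V_def ..
  also have "\<dots> = (\<Sum>X\<in>multisets_of_size ?K M. kappa M * (\<Prod>i\<in>?K. P i ^ (2 * count X i) / (fact (count X i))\<^sup>2))"
    by (rule tendsto_Lim[OF trivial_limit_at_right_real lim])
  also have "\<dots> = kappa M * (\<Prod>i\<in>?K. volume_series (P i)) $ M"
    by (simp add: fps_prod_nth' volume_series_def sum_distrib_left)
  finally show ?thesis .
qed

section \<open>Lagrange inversion and Bessel series\<close>

text \<open>Splitting \<open>f\<close> into its constant term and a multiple of \<open>fps_X\<close> shows that both sides satisfy the same
  recursion in \<open>m\<close>.\<close>

lemma lagrange_inversion:
  fixes \<phi> w f :: "'a::field_char_0 fps"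
  assumes w: "w = fps_X * (\<phi> oo w)" "w $ 0 = 0"
  shows "((f oo w) * inverse (1 - fps_X * (fps_deriv \<phi> oo w))) $ m = (f * \<phi> ^ m) $ m"
proof (induction m arbitrary: f)
  case 0
  then show ?case by simp
next
  case (Suc m)
  define i where "i = inverse (1 - fps_X * (fps_deriv \<phi> oo w))"
  have "i * (1 - fps_X * (fps_deriv \<phi> oo w)) = 1" unfolding i_def by (rule inverse_mult_eq_1) simp
  then have i: "i = 1 + fps_X * ((fps_deriv \<phi> oo w) * i)" by (simp add: algebra_simps)
  have "i $ Suc m = ((fps_deriv \<phi> oo w) * i) $ m" by (subst i) simp
  also have "\<dots> = (fps_deriv \<phi> * \<phi> ^ m) $ m" unfolding i_def by (rule Suc.IH)
  finally have i1: "i $ Suc m = (fps_deriv \<phi> * \<phi> ^ m) $ m" .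
  \<comment> \<open>This treats the constant part of \<open>f\<close>: the coefficient of
    \<open>\<phi> ^ Suc m\<close> at \<open>Suc m\<close> is read off from its derivative, where the
    factor \<open>Suc m\<close> cancels.\<close>
  have "of_nat (Suc m) * (\<phi> ^ Suc m) $ Suc m = fps_deriv (\<phi> ^ Suc m) $ m"
    by (simp only: fps_deriv_nth Suc_eq_plus1)
  also have "\<dots> = of_nat (Suc m) * (fps_deriv \<phi> * \<phi> ^ m) $ m"
    by (simp only: fps_deriv_power diff_Suc_1 mult.assoc fps_mult_left_const_nth)
  finally have p: "(\<phi> ^ Suc m) $ Suc m = (fps_deriv \<phi> * \<phi> ^ m) $ m" by (simp del: of_nat_Suc power_Suc)
  have f: "f = fps_const (f $ 0) + fps_X * fps_shift 1 f"
  proof (rule fps_ext)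
    show "f $ k = (fps_const (f $ 0) + fps_X * fps_shift 1 f) $ k" for k by (cases k) auto
  qed
  have "(f oo w) * i = fps_const (f $ 0) * i + fps_X * (((\<phi> * fps_shift 1 f) oo w) * i)"
  proof -
    have "f oo w = fps_const (f $ 0) + w * (fps_shift 1 f oo w)"
      by (subst f) (simp add: fps_compose_add_distrib fps_compose_mult_distrib[OF w(2)] w(2))
    also have "\<dots> = fps_const (f $ 0) + fps_X * ((\<phi> * fps_shift 1 f) oo w)"
      by (subst (1) w(1)) (simp add: fps_compose_mult_distrib[OF w(2)] mult.assoc)
    finally show ?thesis by (simp add: algebra_simps)
  qed
  then have "((f oo w) * i) $ Suc m = f $ 0 * i $ Suc m + (((\<phi> * fps_shift 1 f) oo w) * i) $ m" by simp
  also have "\<dots> = f $ 0 * (\<phi> ^ Suc m) $ Suc m + (\<phi> * fps_shift 1 f * \<phi> ^ m) $ m"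
    unfolding i1 p using Suc.IH[of "\<phi> * fps_shift 1 f"] by (simp add: i_def)
  also have "\<dots> = ((fps_const (f $ 0) + fps_X * fps_shift 1 f) * \<phi> ^ Suc m) $ Suc m"
  proof -
    have "\<phi> * fps_shift 1 f * \<phi> ^ m = fps_shift 1 f * \<phi> ^ Suc m" by (simp add: mult_ac)
    then show ?thesis unfolding distrib_right by (simp only: mult.assoc fps_add_nth fps_mult_left_const_nth fps_X_mult_nth) simp
  qed
  finally show ?case unfolding f[symmetric] i_def .
qed

section \<open>Bessel series in the variable \<open>u^2\<close>\<close>

lemma fps_at_sqrt_compose [simp]: "fps_at_sqrt (F oo fps_X ^ 2) = F"
  by (rule fps_ext) (simp add: fps_at_sqrt_def fps_nth_compose_X_power)

abbreviation bessel_sqrt :: "real fps" where "bessel_sqrt \<equiv> fps_at_sqrt (bessel_I 0)"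

lemma bessel_sqrt_nth: "bessel_sqrt $ j = (1 / 4) ^ j / (fact j)\<^sup>2"
  by (simp add: fps_at_sqrt_def bessel_I_def power_mult power2_eq_square)

lemma bessel_0_eq: "bessel_I 0 = bessel_sqrt oo fps_X ^ 2"
  by (rule fps_ext) (auto simp: fps_nth_compose_X_power fps_at_sqrt_def bessel_I_def)

text \<open>This is \<open>I_1 = I_0'\<close> in disguise: if \<open>I_0(u) = B(u^2)\<close>, then
  \<open>u * I_1(u) = 2 * u^2 * B'(u^2)\<close>.\<close>

lemma X_bessel_1_eq: "fps_X * bessel_I 1 = (2 * fps_X * fps_deriv bessel_sqrt) oo fps_X ^ 2"
proof (rule fps_ext)
  fix m :: nat
  show "(fps_X * bessel_I 1) $ m = ((2 * fps_X * fps_deriv bessel_sqrt) oo fps_X ^ 2) $ m"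
  proof (cases "even m \<and> m > 0")
    case True
    then obtain j where m: "m = 2 * Suc j" by (metis dvdE gr0_conv_Suc mult_0_right not_gr0)
    have four: "(4 :: real) ^ j = 2 ^ j * 2 ^ j" by (simp add: power_mult_distrib[symmetric])
    have "((2 * fps_X * fps_deriv bessel_sqrt) oo fps_X ^ 2) $ m = 2 * (real (Suc j) * bessel_sqrt $ Suc j)"
      unfolding m by (simp add: fps_nth_compose_X_power mult.assoc numeral_fps_const)
    also have "\<dots> = (1 / 2) ^ (2 * j + 1) / (fact j * fact (j + 1))"
      unfolding bessel_sqrt_nth four
      by (simp add: power_mult power2_eq_square four divide_simps)
    also have "\<dots> = (fps_X * bessel_I 1) $ m" unfolding m by (simp add: bessel_I_def)
    finally show ?thesis ..
  next
    case False
    then show ?thesis by (auto simp: fps_nth_compose_X_power bessel_I_def numeral_fps_const mult.assoc)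
  qed
qed

lemma bessel_scaled_eq: "bessel_I 0 oo (fps_const c * fps_X) = (bessel_sqrt oo (fps_const (c\<^sup>2) * fps_X)) oo fps_X ^ 2"
  by (rule fps_ext) (auto simp: fps_nth_compose_X_power fps_compose_linear fps_at_sqrt_def bessel_I_def power_mult elim!: evenE)

definition bessel_product :: "nat \<Rightarrow> real \<Rightarrow> (nat \<Rightarrow> real) \<Rightarrow> real fps" where
  "bessel_product n L Ls = (\<Prod>i = 1..n. bessel_sqrt oo (fps_const ((Ls i / L)\<^sup>2) * fps_X))"

lemma bracket_numerator_at_sqrt:
  "fps_at_sqrt (bracket_numerator n L Ls) =
     bessel_sqrt ^ 4 * inverse (2 * (bessel_sqrt - fps_X * fps_deriv bessel_sqrt)) * bessel_product n L Ls"
proof -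
  let ?B = bessel_sqrt
  have X2: "(fps_X ^ 2 :: real fps) $ 0 = 0" by simp
  have B0: "?B $ 0 = 1" by (simp add: bessel_sqrt_nth)
  have d: "2 * bessel_I 0 - fps_X * bessel_I 1 = (2 * (?B - fps_X * fps_deriv ?B)) oo fps_X ^ 2"
    unfolding X_bessel_1_eq bessel_0_eq[symmetric]
    by (subst bessel_0_eq) (simp add: fps_compose_sub_distrib fps_compose_mult_distrib[OF X2] right_diff_distrib mult.assoc numeral_fps_const)
  have nz: "(2 * (?B - fps_X * fps_deriv ?B)) $ 0 \<noteq> 0" using B0 by (simp add: numeral_fps_const)
  have nz': "(2 * bessel_I 0 - fps_X * bessel_I 1) $ 0 \<noteq> 0" unfolding d using nz by simp
  define D where "D = 2 * (?B - fps_X * fps_deriv ?B)"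
  have b4: "bessel_I 0 ^ 4 = ?B ^ 4 oo fps_X ^ 2"
    by (subst bessel_0_eq) (rule fps_compose_power[OF X2])
  have "bracket_numerator n L Ls = (?B ^ 4 * inverse D * bessel_product n L Ls) oo fps_X ^ 2"
    unfolding bracket_numerator_def fps_divide_unit[OF nz']
    unfolding bessel_scaled_eq bessel_product_def fps_compose_mult_distrib[OF X2]
      fps_compose_prod_distrib[OF X2] fps_inverse_compose[OF X2 nz[folded D_def]] b4 d[folded D_def] ..
  then have "bracket_numerator n L Ls = (?B ^ 4 * inverse (2 * (?B - fps_X * fps_deriv ?B)) * bessel_product n L Ls) oo fps_X ^ 2"
    unfolding D_def .
  then show ?thesis by simp
qed

lemma u_squared: "u_squared $ 0 = 0" "u_squared = fps_X * (bessel_sqrt oo u_squared)"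
  using theI'[OF u_squared_unique] unfolding u_squared_def[symmetric] by auto

text \<open>Let \<open>B\<close> be \<open>bessel_sqrt\<close>, so that
  \<open>\<beta> = B(w)\<close> and \<open>w = X * \<beta>\<close>. The denominator
  \<open>2 * I_0 - u * I_1\<close> becomes \<open>2 * \<beta> * (1 - X * B'(w))\<close>, which
  contains exactly the factor of Lagrange inversion; its \<open>\<beta>\<close> lowers
  \<open>\<beta> ^ 4\<close> to \<open>\<beta> ^ 3\<close>. Dividing by
  \<open>w ^ n = X ^ n * \<beta> ^ n\<close> moves the coefficient from \<open>N\<close> to
  \<open>N + n\<close>.\<close>

lemma bracket_nth:
  "fls_nth (bracket n L Ls) (int N) = (bessel_sqrt ^ (N + 3) * bessel_product n L Ls) $ (N + n) / 2"
proof -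
  let ?B = bessel_sqrt and ?w = u_squared
  define \<beta> where "\<beta> = ?B oo ?w"
  define i where "i = inverse (1 - fps_X * (fps_deriv ?B oo ?w))"
  \<comment> \<open>The factor \<open>inverse ?B ^ n\<close> stems from the division by
    \<open>w ^ n\<close>; it turns the power \<open>N + n\<close> supplied by Lagrange inversion
    into \<open>N\<close>, and \<open>?B ^ 3\<close> completes it to \<open>N + 3\<close>.\<close>
  define F where "F = ?B ^ 3 * bessel_product n L Ls * inverse ?B ^ n"
  note w = u_squared
  have B0: "?B $ 0 = 1" by (simp add: bessel_sqrt_nth)
  have \<beta>0: "\<beta> $ 0 = 1" using B0 by (simp add: \<beta>_def)
  have inv\<beta>: "inverse \<beta> = inverse ?B oo ?w" unfolding \<beta>_def by (rule fps_inverse_compose[symmetric]) (use w B0 in auto)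
  have \<beta>1: "inverse \<beta> * \<beta> = 1" by (rule inverse_mult_eq_1) (simp add: \<beta>0)
  have den: "(2 * (?B - fps_X * fps_deriv ?B)) oo ?w = fps_const 2 * (\<beta> * (1 - fps_X * (fps_deriv ?B oo ?w)))"
  proof -
    have "(2 * (?B - fps_X * fps_deriv ?B)) oo ?w = fps_const 2 * (\<beta> - ?w * (fps_deriv ?B oo ?w))"
      by (simp add: fps_compose_sub_distrib fps_compose_mult_distrib[OF w(1)] \<beta>_def numeral_fps_const w(1))
    also have "?w * (fps_deriv ?B oo ?w) = fps_X * \<beta> * (fps_deriv ?B oo ?w)" by (subst (1) w(2)) (simp add: \<beta>_def)
    finally show ?thesis by (simp add: algebra_simps)
  qed
  have "inverse (2 * (?B - fps_X * fps_deriv ?B)) oo ?w = inverse (fps_const 2 * (\<beta> * (1 - fps_X * (fps_deriv ?B oo ?w))))"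
    unfolding den[symmetric] by (rule fps_inverse_compose) (use w B0 in \<open>auto simp: numeral_fps_const\<close>)
  also have "\<dots> = fps_const (1 / 2) * (inverse \<beta> * i)"
    by (simp add: fps_inverse_mult i_def fps_const_inverse inverse_eq_divide)
  finally have "fps_at_sqrt (bracket_numerator n L Ls) oo ?w = \<beta> ^ 4 * (fps_const (1 / 2) * (inverse \<beta> * i)) * (bessel_product n L Ls oo ?w)"
    unfolding bracket_numerator_at_sqrt fps_compose_mult_distrib[OF w(1)] fps_compose_power[OF w(1), symmetric]
    by (simp add: \<beta>_def)
  also have "\<dots> = (inverse \<beta> * \<beta>) * (fps_const (1 / 2) * (\<beta> ^ 3 * (bessel_product n L Ls oo ?w) * i))"
    by (simp add: power4_eq_xxxx power3_eq_cube mult_ac)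
  finally have num: "fps_at_sqrt (bracket_numerator n L Ls) oo ?w = fps_const (1 / 2) * (\<beta> ^ 3 * (bessel_product n L Ls oo ?w) * i)"
    unfolding \<beta>1 by simp
  have "(F oo ?w) * \<beta> ^ n = (inverse \<beta> * \<beta>) ^ n * (\<beta> ^ 3 * (bessel_product n L Ls oo ?w))"
    unfolding F_def fps_compose_mult_distrib[OF w(1)] fps_compose_power[OF w(1), symmetric] inv\<beta>[symmetric] \<beta>_def[symmetric]
    by (simp add: power_mult_distrib mult_ac)
  then have "fps_at_sqrt (bracket_numerator n L Ls) oo ?w = fps_const (1 / 2) * ((F oo ?w) * i) * \<beta> ^ n"
    unfolding num \<beta>1 by (simp add: mult_ac)
  moreover have "?w ^ n = fps_X ^ n * \<beta> ^ n" by (subst w(2)) (simp add: power_mult_distrib \<beta>_def)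
  ultimately have "bracket n L Ls = fps_to_fls (fps_const (1 / 2) * ((F oo ?w) * i)) * fps_to_fls (\<beta> ^ n) / (fls_X ^ n * fps_to_fls (\<beta> ^ n))"
    unfolding bracket_def fps_to_fls_power[symmetric] by (simp only: fls_times_fps_to_fls fps_to_fls_power fps_X_to_fls)
  also have "\<dots> = fps_to_fls (fps_const (1 / 2) * ((F oo ?w) * i)) / fls_X ^ n"
  proof -
    have "\<beta> ^ n \<noteq> 0" using \<beta>0 by auto
    then show ?thesis by simp
  qed
  also have "\<dots> = fls_shift (int n) (fps_to_fls (fps_const (1 / 2) * ((F oo ?w) * i)))"
    by (simp add: nonzero_divide_eq_eq fls_X_power_times_conv_shift)
  finally have "fls_nth (bracket n L Ls) (int N) = (fps_const (1 / 2) * ((F oo ?w) * i)) $ (N + n)"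
    by (simp add: nat_add_distrib)
  also have "\<dots> = (F * ?B ^ (N + n)) $ (N + n) / 2"
    using lagrange_inversion[OF w(2,1), of F "N + n"] by (simp add: i_def)
  also have "F * ?B ^ (N + n) = (inverse ?B * ?B) ^ n * (?B ^ (N + 3) * bessel_product n L Ls)"
    by (simp add: F_def power_add power_mult_distrib mult_ac)
  also have "inverse ?B * ?B = 1" by (rule inverse_mult_eq_1) (simp add: B0)
  finally show ?thesis by simp
qed

text \<open>Derivatives and iterated antiderivatives multiply coefficients by the same quotient of
  factorials. The condition \<open>m + n \<ge> 3\<close> expresses the zero integration constants
  for \<open>n < 3\<close> and always holds for larger \<open>n\<close>.\<close>

lemma fps_deriv_int_nth:
  "fps_deriv_int (int n - 3) f $ m = (if m + n \<ge> 3 then fact (m + n - 3) / fact m * f $ (m + n - 3) else 0)"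
proof -
  have d: "(fps_deriv ^^ k) f $ m = fact (m + k) / fact m * f $ (m + k)" for k m and f :: "real fps"
  proof (induction k arbitrary: m)
    case (Suc k)
    have "(fps_deriv ^^ Suc k) f $ m = real (m + 1) * (fps_deriv ^^ k) f $ (m + 1)" by simp
    moreover have "fact (m + 1) = real (m + 1) * fact m" "m + 1 + k = m + Suc k" by simp_all
    ultimately show ?case unfolding Suc.IH by (simp add: field_simps del: fact_Suc of_nat_Suc of_nat_add)
  qed simp
  have s: "((\<lambda>g. fps_integral0 g) ^^ k) f $ m = (if m \<ge> k then fact (m - k) / fact m * f $ (m - k) else 0)"
    for k m and f :: "real fps"
  proof (induction k arbitrary: m)
    case (Suc k)
    show ?case
    proof (cases m)
      case (Suc m')
      have "((\<lambda>g. fps_integral0 g) ^^ Suc k) f $ m = ((\<lambda>g. fps_integral0 g) ^^ k) f $ m' / real (Suc m')"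
        unfolding Suc by (simp add: fps_integral_def field_simps)
      moreover have "fact (Suc m') = real (Suc m') * fact m'" by simp
      ultimately show ?thesis unfolding Suc.IH unfolding Suc
        by (cases "k \<le> m'") (simp_all add: field_simps del: fact_Suc of_nat_Suc funpow.simps)
    qed (simp add: fps_integral_def)
  qed simp
  show ?thesis
  proof (cases "n \<ge> 3")
    case True
    then have "nat (int n - 3) = n - 3" by linarith
    then show ?thesis using True unfolding fps_deriv_int_def by (simp add: d)
  next
    case False
    then have "nat (- (int n - 3)) = 3 - n" "m - (3 - n) = m + n - 3" "3 - n \<le> m \<longleftrightarrow> 3 \<le> m + n" by linarith+
    then show ?thesis using False unfolding fps_deriv_int_def by (simp add: s)
  qed
qed

lemma volume_series_eq: "volume_series P = bessel_sqrt oo (fps_const (4 * P\<^sup>2) * fps_X)"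
  by (rule fps_ext) (simp add: volume_series_def fps_compose_linear bessel_sqrt_nth power_mult power_mult_distrib power_one_over)

text \<open>Rescaling the series variable by \<open>4 * L^2\<close> turns each face of perimeter
  \<open>L\<close> into one factor \<open>bessel_sqrt\<close> and the others into the factors of
  \<open>bessel_product\<close>. The power of 4 extracted in this way cancels the power of 2 in
  \<open>kappa\<close> up to the factor \<open>1 / 2\<close>.\<close>

lemma strebel_Z_eq:
  assumes L: "L > 0" and Ls: "\<And>i. i \<in> {1..n} \<Longrightarrow> Ls i > 0"
  shows "strebel_Z N n L Ls =
    fact (N + n) / 2 * L ^ (2 * (N + n)) * (bessel_sqrt ^ (N + 3) * bessel_product n L Ls) $ (N + n)"
proof -
  define P where "P i = (if i \<le> N + 3 then L else Ls (i - (N + 3)))" for i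
  define c where "c = fps_const (4 * L\<^sup>2) * (fps_X :: real fps)"
  have c0: "c $ 0 = 0" by (simp add: c_def)
  have v: "volume_series p = (bessel_sqrt oo (fps_const ((p / L)\<^sup>2) * fps_X)) oo c" for p
  proof (rule fps_ext)
    have "4 * p\<^sup>2 = 4 * L\<^sup>2 * (p / L)\<^sup>2" using L by (simp add: power_divide)
    then have "(4 * p\<^sup>2) ^ k = (4 * L\<^sup>2) ^ k * ((p / L)\<^sup>2) ^ k" for k by (metis power_mult_distrib)
    then show "volume_series p $ k = ((bessel_sqrt oo (fps_const ((p / L)\<^sup>2) * fps_X)) oo c) $ k" for k
      unfolding volume_series_eq c_def by (simp only: fps_compose_linear fps_nth_Abs_fps mult.assoc)
  qed
  have "strebel_Z N n L Ls = kappa (N + n) * (\<Prod>i\<in>{1..N + n + 3}. volume_series (P i)) $ (N + n)"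
    unfolding strebel_Z_def P_def[symmetric]
  proof (rule strebel_volume_eq)
    show "P i > 0" if "i \<in> {1..N + n + 3}" for i
    proof (cases "i \<le> N + 3")
      case False
      then have "i - (N + 3) \<in> {1..n}" using that by auto
      then show ?thesis using Ls False by (simp add: P_def)
    qed (use L in \<open>simp add: P_def\<close>)
  qed
  also have "(\<Prod>i\<in>{1..N + n + 3}. volume_series (P i)) = (\<Prod>i\<in>{1..N + 3}. volume_series (P i)) * (\<Prod>i\<in>{1 + (N + 3)..n + (N + 3)}. volume_series (P i))"
    by (subst prod.union_disjoint[symmetric]) (auto intro!: prod.cong)
  also have "(\<Prod>i\<in>{1..N + 3}. volume_series (P i)) = volume_series L ^ (N + 3)"
    by (simp add: P_def add.commute)
  also have "volume_series L = bessel_sqrt oo c" unfolding volume_series_eq c_def ..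
  also have "(\<Prod>i\<in>{1 + (N + 3)..n + (N + 3)}. volume_series (P i)) = (\<Prod>i\<in>{1..n}. volume_series (P (i + (N + 3))))"
    by (rule prod.shift_bounds_cl_nat_ivl)
  also have "\<dots> = (\<Prod>i\<in>{1..n}. volume_series (Ls i))" by (intro prod.cong) (auto simp: P_def)
  also have "\<dots> = bessel_product n L Ls oo c"
    unfolding bessel_product_def fps_compose_prod_distrib[OF c0] v ..
  also have "(bessel_sqrt oo c) ^ (N + 3) * (bessel_product n L Ls oo c) = (bessel_sqrt ^ (N + 3) * bessel_product n L Ls) oo c"
    by (simp add: fps_compose_mult_distrib[OF c0] fps_compose_power[OF c0])
  also have "(\<dots>) $ (N + n) = (4 * L\<^sup>2) ^ (N + n) * (bessel_sqrt ^ (N + 3) * bessel_product n L Ls) $ (N + n)"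
    unfolding c_def fps_compose_linear by simp
  also have "kappa (N + n) * \<dots> = fact (N + n) / 2 * L ^ (2 * (N + n)) * (bessel_sqrt ^ (N + 3) * bessel_product n L Ls) $ (N + n)"
  proof -
    have "(4 * L\<^sup>2) ^ k = 2 ^ (2 * k) * L ^ (2 * k)" for k by (simp add: power_mult power_mult_distrib)
    then show ?thesis by (simp add: kappa_def del: distrib_left_numeral)
  qed
  finally show ?thesis .
qed

theorem mainTheorem3:
  fixes n :: nat and L :: real and Ls :: "nat \<Rightarrow> real"
  assumes "n \<ge> 1" and "L > 0" and "\<And>i. i \<in> {1..n} \<Longrightarrow> Ls i > 0"
  shows "strebel_Z_hat n L Ls =
    fps_deriv_int (int n - 3)
      (fps_X ^ n * fps_const (L ^ (2 * n)) *
        (fls_regpart (bracket n L Ls) oo (fps_const (L\<^sup>2) * fps_X)))"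
proof (rule fps_ext)
  fix m
  define f where "f = fps_X ^ n * fps_const (L ^ (2 * n)) *
        (fls_regpart (bracket n L Ls) oo (fps_const (L\<^sup>2) * fps_X))"
  \<comment> \<open>Truncated subtraction in \<open>k - n\<close> is harmless: the factor
    \<open>fps_X ^ n\<close> annihilates the coefficients with \<open>k < n\<close>, and for the
    others \<open>k - n\<close> is a nonnegative index, where \<open>fls_regpart\<close> keeps the
    coefficient of the bracket.\<close>
  have f: "f $ k = (if k < n then 0 else L ^ (2 * k) * fls_nth (bracket n L Ls) (int (k - n)))" for k
  proof -
    have "f $ k = (if k < n then 0 else L ^ (2 * n) * ((L\<^sup>2) ^ (k - n) * fls_nth (bracket n L Ls) (int (k - n))))"
      unfolding f_def mult.assoc by (simp add: fps_X_power_mult_nth fps_compose_linear)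
    moreover have "L ^ (2 * n) * (L\<^sup>2) ^ (k - n) = L ^ (2 * k)" if "\<not> k < n"
      unfolding power_mult[symmetric] power_add[symmetric] by (rule arg_cong[of _ _ "\<lambda>j. L ^ j"]) (use that in auto)
    ultimately show ?thesis by (simp add: mult.assoc[symmetric])
  qed
  have "strebel_Z_hat n L Ls $ m = fps_deriv_int (int n - 3) f $ m"
  proof (cases "m < 3")
    \<comment> \<open>For \<open>m < 3\<close> the index \<open>m + n - 3\<close> is below
      \<open>n\<close>, where \<open>f\<close> has no coefficients; this matches the start of the
      generating series at the third power.\<close>
    case True
    then show ?thesis by (simp add: strebel_Z_hat_def fps_deriv_int_nth f)
  next
    case False
    \<comment> \<open>At order \<open>m = N + 3\<close> the right side involves the coefficient of
      \<open>f\<close> at \<open>N + n\<close>, that is, the coefficient of the bracket at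
      \<open>N\<close>.\<close>
    then obtain N where m: "m = N + 3" by (metis add.commute le_Suc_ex not_less)
    have Z: "strebel_Z N n L Ls =
        fact (N + n) / 2 * L ^ (2 * (N + n)) * (bessel_sqrt ^ (N + 3) * bessel_product n L Ls) $ (N + n)"
      by (rule strebel_Z_eq) (use assms in auto)
    have "strebel_Z_hat n L Ls $ m = strebel_Z N n L Ls / fact (N + 3)" by (simp add: strebel_Z_hat_def m)
    also have "\<dots> = fact (N + n) / fact (N + 3) * (L ^ (2 * (N + n)) * fls_nth (bracket n L Ls) (int N))"
      unfolding Z bracket_nth by simp
    also have "\<dots> = fps_deriv_int (int n - 3) f $ m" unfolding fps_deriv_int_nth f m by simp
    finally show ?thesis .
  qed
  then show "strebel_Z_hat n L Ls $ m = fps_deriv_int (int n - 3)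
      (fps_X ^ n * fps_const (L ^ (2 * n)) *
        (fls_regpart (bracket n L Ls) oo (fps_const (L\<^sup>2) * fps_X))) $ m"
    unfolding f_def .
qed

end
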